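(* Let $A$ and $M$ be compact smooth manifolds, possibly with boundary, let $\rho\colon A\to M$ be a smooth map, let $\Lambda$ be a proper subring of $\mathbb{R}$, and let $k\ge 1$. Then the following sequence is exact: $$0\to\Omega^{k-1}_\Lambda M/\widetilde{\Omega}^{k-1}M\xrightarrow{\ \phi\ }\widehat{H}^k_0(\rho)\xrightarrow{\ J\ }\check{H}^k(\rho)\to0.$$
   Context: $C_kM$, $Z_kM$ denote the groups of smooth $k$-chains and $k$-cycles of $M$, $\Omega^kM$ the smooth differential $k$-forms, and $\Omega^k_\Lambda M$ the subgroup of $k$-forms with $\Lambda$-periods, i.e. whose integrals over all smooth $k$-cycles lie in $\Lambda$; similarly for $A$. Groups in negative degree are zero. Relative chains: $C_k(\rho)=C_kM\times C_{k-1}A$ with differential $\partial(\sigma,\tau)=(\partial\sigma+\rho_*\tau,-\partial\tau)$; its $k$-cycles are denoted $Z_k(\rho)$. Relative cochains: for an abelian group $G$, $C^k(\rho;G)=\operatorname{Hom}(C_k(\rho),G)$, with $\delta(h,e)=(\delta h,\rho^*h-\delta e)$. Relative forms: $\Omega^k(\rho)=\Omega^kM\times\Omega^{k-1}A$. A pair $(\omega,\theta)\in\Omega^k(\rho)$ is regarded as a cochain by $(\omega,\theta)(\sigma,\tau)=\int_\sigma\omega+\int_\tau\theta$ for $(\sigma,\tau)\in C_k(\rho)$. Via integration followed by reduction modulo $\Lambda$, $\Omega^k(\rho)$ is viewed as a subgroup of $C^k(\rho;\mathbb{R}/\Lambda)$. $\Omega^k_\Lambda(\rho)\subset\Omega^k(\rho)$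 is the subgroup of pairs with relative $\Lambda$-periods, i.e. taking values in $\Lambda$ on $Z_k(\rho)$. Put $\widetilde{\Omega}^kM=\{\omega\in\Omega^kM\mid(\omega,0)\in\Omega^k_\Lambda(\rho)\}\subset\Omega^k_\Lambda M$. Relative Cheeger-Simons differential characters of degree $k$: $\widehat{H}^k(\rho)=\{f\in\operatorname{Hom}(Z_{k-1}(\rho),\mathbb{R}/\Lambda)\mid f\circ\partial\in\Omega^k(\rho)\}$. The subgroup $\widehat{H}^k_0(\rho)\subset\widehat{H}^k(\rho)$ consists of those $f$ with $f|_{Z_{k-1}A}=0$, i.e. $f(\rho_*\tau,0)=0$ for all $\tau\in Z_{k-1}A$; writing $f\circ\partial=(\omega,\theta)$, this is equivalent to $\theta$ having $\Lambda$-periods. The relative Hopkins-Singer group $\check{H}^k(\rho)$ is by definition the $k$-th homology of the complex $\check{C}^*(M)\times\check{C}^{*-1}(A)$ with differential $(S,T)\mapsto(\Delta S,\rho^*S-\Delta T)$, where $\check{C}^k(X)=C^k(X;\Lambda)\times C^{k-1}(X;\mathbb{R})\times\Omega^k_\Lambda X$ with $\Delta(c,h,\omega)=(\delta c,\omega-c-\delta h,0)$. By changing the sign of $e$ below, this complex is isomorphic to $$\check{C}^k(\rho)=C^k(\rho;\Lambda)\times C^{k-1}(\rho;\mathbb{R})\times\Omega^k_\Lambda M\times\Omega^{k-1}_\Lambda A,$$ $$\Delta((c,b),(h,e),(\omega,\theta))=(\delta(c,b),\ (\omega,\theta)-(c,b)-\delta(h,e),\ (0,\rho^*\omega)),$$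 so that $\check{H}^k(\rho)\cong H_k(\check{C}^*(\rho))$. The map $\phi$ is induced by sending $\nu\in\Omega^{k-1}_\Lambda M$ to $\phi(\nu)\in\widehat{H}^k_0(\rho)$ given by $\phi(\nu)(\sigma,\tau)=\int_\sigma\nu \bmod\Lambda$ for $(\sigma,\tau)\in Z_{k-1}(\rho)$. The map $J$: for $f\in\widehat{H}^k_0(\rho)$ choose $(h,e)\in C^{k-1}(\rho;\mathbb{R})$ whose mod $\Lambda$ reduction restricts to $f$ on $Z_{k-1}(\rho)$; then $\delta(h,e)=(\omega,\theta)-(c,b)$ for some $(\omega,\theta)\in\Omega^k_\Lambda(\rho)$ and $(c,b)\in C^k(\rho;\Lambda)$ with $\delta(c,b)=0$; $((c,b),(h,e),(\omega,\theta))$ is a cocycle in $\check{C}^k(\rho)$, and $J(f)=[((c,b),(h,e),(\omega,\theta))]\in\check{H}^k(\rho)$.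
   Formalization: For k = 1 it is additionally assumed that ρ* maps the locally constant Λ-valued functions on M onto those on A; without this J is not well defined and the claim fails (M a point, A two points, Λ = Z, k = 1). *)

theory Defs
  imports
    "HOL-Analysis.Analysis"
    "HOL-Algebra.Algebraic_Closure_Type"
    "HOL-Homology.Homology"
begin

section \<open>Calculus on subsets of R^n\<close>

text \<open>
  R^n is \<^term>\<open>topspace (Euclidean_space n)\<close>, i.e. the functions \<open>x :: nat \<Rightarrow> real\<close>
  with \<open>x i = 0\<close> for \<open>i \<ge> n\<close>; its topology is the one induced from \<open>nat \<Rightarrow> real\<close>.
  In this way the dimension is an ordinary natural number, and 0 is allowed.
\<close>

abbreviation Rn :: "nat \<Rightarrow> (nat \<Rightarrow> real) set" where
  "Rn n \<equiv> topspace (Euclidean_space n)"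

text \<open>
  Partial derivatives are taken within \<open>S\<close>: they are one-sided at boundary points of a half-space
  and two-sided at interior points of \<open>S\<close>.
\<close>

definition partial :: "(nat \<Rightarrow> real) set \<Rightarrow> nat \<Rightarrow> ((nat \<Rightarrow> real) \<Rightarrow> real) \<Rightarrow> (nat \<Rightarrow> real) \<Rightarrow> real" where
  "partial S i f x = vector_derivative (\<lambda>t. f (x(i := t))) (at (x i) within {t. x(i := t) \<in> S})"

primrec C_diff :: "nat \<Rightarrow> nat \<Rightarrow> (nat \<Rightarrow> real) set \<Rightarrow> ((nat \<Rightarrow> real) \<Rightarrow> real) \<Rightarrow> bool" where
  "C_diff n 0 V f \<longleftrightarrow> continuous_on V f"
| "C_diff n (Suc r) V f \<longleftrightarrow> continuous_on V f \<and>
     (\<forall>i<n. (\<forall>x\<in>V. (\<lambda>t. f (x(i := t))) differentiable (at (x i))) \<and> C_diff n r V (partial V i f))"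

text \<open>A function on an arbitrary subset of R^n is smooth if locally it has smooth extensions to
  open subsets of R^n.\<close>

definition smooth_fun_on :: "nat \<Rightarrow> (nat \<Rightarrow> real) set \<Rightarrow> ((nat \<Rightarrow> real) \<Rightarrow> real) \<Rightarrow> bool" where
  "smooth_fun_on n S f \<longleftrightarrow>
     (\<forall>x\<in>S. \<exists>V g. openin (Euclidean_space n) V \<and> x \<in> V \<and> (\<forall>r. C_diff n r V g) \<and>
                  (\<forall>y\<in>V \<inter> S. g y = f y))"

definition smooth_on :: "nat \<Rightarrow> nat \<Rightarrow> (nat \<Rightarrow> real) set \<Rightarrow> ((nat \<Rightarrow> real) \<Rightarrow> nat \<Rightarrow> real) \<Rightarrow> bool" where
  "smooth_on n m S F \<longleftrightarrow> F ` S \<subseteq> Rn m \<and> (\<forall>j<m. smooth_fun_on n S (\<lambda>x. F x j))"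

definition differential ::
  "nat \<Rightarrow> (nat \<Rightarrow> real) set \<Rightarrow> ((nat \<Rightarrow> real) \<Rightarrow> nat \<Rightarrow> real) \<Rightarrow> (nat \<Rightarrow> real) \<Rightarrow> (nat \<Rightarrow> real) \<Rightarrow> nat \<Rightarrow> real" where
  "differential n S F x v = (\<lambda>j. \<Sum>i<n. partial S i (\<lambda>y. F y j) x * v i)"

definition unit_vec :: "nat \<Rightarrow> nat \<Rightarrow> real" where
  "unit_vec i = (\<lambda>j. if j = i then 1 else 0)"


section \<open>Smooth manifolds with boundary\<close>

text \<open>The model half-space is \<open>{x \<in> R^n. x 0 \<ge> 0}\<close>, which for \<open>n = 0\<close> is the point R^0.
  Charts around interior points are charts whose image misses \<open>x 0 = 0\<close>.\<close>

definition half_space :: "nat \<Rightarrow> (nat \<Rightarrow> real) topology" where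
  "half_space n = subtopology (Euclidean_space n) {x. 0 \<le> x 0}"

type_synonym 'a chart = "'a set \<times> ('a \<Rightarrow> nat \<Rightarrow> real)"

abbreviation chart_dom :: "'a chart \<Rightarrow> 'a set" where "chart_dom c \<equiv> fst c"
abbreviation chart_map :: "'a chart \<Rightarrow> 'a \<Rightarrow> nat \<Rightarrow> real" where "chart_map c \<equiv> snd c"
abbreviation chart_img :: "'a chart \<Rightarrow> (nat \<Rightarrow> real) set" where "chart_img c \<equiv> chart_map c ` chart_dom c"
abbreviation chart_inv :: "'a chart \<Rightarrow> (nat \<Rightarrow> real) \<Rightarrow> 'a" where
  "chart_inv c \<equiv> inv_into (chart_dom c) (chart_map c)"

record 'a mfd =
  mtop :: "'a topology"
  mdim :: nat
  atlas :: "'a chart set"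

definition smooth_map :: "'a mfd \<Rightarrow> 'b mfd \<Rightarrow> ('a \<Rightarrow> 'b) \<Rightarrow> bool" where
  "smooth_map A M \<rho> \<longleftrightarrow> continuous_map (mtop A) (mtop M) \<rho> \<and>
     (\<forall>c\<in>atlas A. \<forall>d\<in>atlas M.
        smooth_on (mdim A) (mdim M) (chart_map c ` {p \<in> chart_dom c. \<rho> p \<in> chart_dom d})
          (chart_map d \<circ> \<rho> \<circ> chart_inv c))"

text \<open>The last conjunct says that all transition maps of the atlas are smooth.\<close>

definition smooth_manifold :: "'a mfd \<Rightarrow> bool" where
  "smooth_manifold M \<longleftrightarrow>
     Hausdorff_space (mtop M) \<and> second_countable (mtop M) \<and>
     topspace (mtop M) = (\<Union>c\<in>atlas M. chart_dom c) \<and>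
     (\<forall>c\<in>atlas M. openin (mtop M) (chart_dom c) \<and> openin (half_space (mdim M)) (chart_img c) \<and>
        homeomorphic_map (subtopology (mtop M) (chart_dom c))
                         (subtopology (half_space (mdim M)) (chart_img c)) (chart_map c)) \<and>
     smooth_map M M id"

definition compact_manifold :: "'a mfd \<Rightarrow> bool" where
  "compact_manifold M \<longleftrightarrow> smooth_manifold M \<and> compact_space (mtop M)"


section \<open>Differential forms\<close>

text \<open>
  A \<open>k\<close>-form is given by its coordinate expressions: \<open>\<omega> c x [v\<^sub>1, \<dots>, v\<^sub>k]\<close> is the value at
  \<open>x \<in> chart_img c\<close> on the vectors \<open>v\<^sub>i \<in> R^n\<close>. Coordinate expressions are extended by 0 to all
  other arguments, so that equality of forms is equality in the logic.
\<close>

type_synonym 'a form = "'a chart \<Rightarrow> (nat \<Rightarrow> real) \<Rightarrow> (nat \<Rightarrow> real) list \<Rightarrow> real"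

definition alternating :: "nat \<Rightarrow> nat \<Rightarrow> ((nat \<Rightarrow> real) list \<Rightarrow> real) \<Rightarrow> bool" where
  "alternating n k \<alpha> \<longleftrightarrow>
     (\<forall>vs. \<not> (length vs = k \<and> set vs \<subseteq> Rn n) \<longrightarrow> \<alpha> vs = 0) \<and>
     (\<forall>vs i a. \<forall>u\<in>Rn n. \<forall>w\<in>Rn n. length vs = k \<and> set vs \<subseteq> Rn n \<and> i < k \<longrightarrow>
        \<alpha> (vs[i := (\<lambda>j. a * u j + w j)]) = a * \<alpha> (vs[i := u]) + \<alpha> (vs[i := w])) \<and>
     (\<forall>vs i j. i < j \<and> j < length vs \<and> vs ! i = vs ! j \<longrightarrow> \<alpha> vs = 0)"

definition differential_form :: "'a mfd \<Rightarrow> nat \<Rightarrow> 'a form \<Rightarrow> bool" where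
  "differential_form M k \<omega> \<longleftrightarrow>
     (\<forall>c x vs. \<not> (c \<in> atlas M \<and> x \<in> chart_img c) \<longrightarrow> \<omega> c x vs = 0) \<and>
     (\<forall>c\<in>atlas M. \<forall>x\<in>chart_img c. alternating (mdim M) k (\<omega> c x)) \<and>
     (\<forall>c\<in>atlas M. \<forall>js. length js = k \<and> set js \<subseteq> {..<mdim M} \<longrightarrow>
        smooth_fun_on (mdim M) (chart_img c) (\<lambda>x. \<omega> c x (map unit_vec js))) \<and>
     (\<forall>c\<in>atlas M. \<forall>d\<in>atlas M. \<forall>p\<in>chart_dom c \<inter> chart_dom d. \<forall>vs.
        length vs = k \<and> set vs \<subseteq> Rn (mdim M) \<longrightarrow>
        \<omega> c (chart_map c p) vs =
        \<omega> d (chart_map d p)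
          (map (differential (mdim M) (chart_map c ` (chart_dom c \<inter> chart_dom d))
                  (chart_map d \<circ> chart_inv c) (chart_map c p)) vs))"

definition zero_form :: "'a form" where
  "zero_form = (\<lambda>c x vs. 0)"

definition form_group :: "'a mfd \<Rightarrow> int \<Rightarrow> 'a form monoid" where
  "form_group M k =
     \<lparr>carrier = (if k < 0 then {zero_form} else {\<omega>. differential_form M (nat k) \<omega>}),
      monoid.mult = (\<lambda>\<omega> \<eta> c x vs. \<omega> c x vs + \<eta> c x vs), one = zero_form\<rparr>"

text \<open>The value of \<open>g\<^sup>*\<omega>\<close> at \<open>x \<in> S \<subseteq> R^n\<close> on the vectors \<open>vs\<close>, for \<open>g : S \<rightarrow> M\<close>. By the
  compatibility of the coordinate expressions of \<open>\<omega>\<close> the chart around \<open>g x\<close> is immaterial.\<close>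

definition chart_at :: "'a mfd \<Rightarrow> 'a \<Rightarrow> 'a chart" where
  "chart_at M p = (SOME c. c \<in> atlas M \<and> p \<in> chart_dom c)"

definition pull_at ::
  "'a mfd \<Rightarrow> nat \<Rightarrow> (nat \<Rightarrow> real) set \<Rightarrow> ((nat \<Rightarrow> real) \<Rightarrow> 'a) \<Rightarrow> 'a form \<Rightarrow> (nat \<Rightarrow> real) \<Rightarrow> (nat \<Rightarrow> real) list \<Rightarrow> real" where
  "pull_at M n S g \<omega> x vs =
     (let d = chart_at M (g x)
      in \<omega> d (chart_map d (g x))
           (map (differential n {y \<in> S. g y \<in> chart_dom d} (chart_map d \<circ> g) x) vs))"

definition pull_form :: "'a mfd \<Rightarrow> 'b mfd \<Rightarrow> ('a \<Rightarrow> 'b) \<Rightarrow> 'b form \<Rightarrow> 'a form" where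
  "pull_form A M \<rho> \<omega> = (\<lambda>c x vs.
     if c \<in> atlas A \<and> x \<in> chart_img c \<and> set vs \<subseteq> Rn (mdim A)
     then pull_at M (mdim A) (chart_img c) (\<rho> \<circ> chart_inv c) \<omega> x vs else 0)"


section \<open>Smooth chains and integration\<close>

definition smooth_simplex :: "nat \<Rightarrow> 'a mfd \<Rightarrow> ((nat \<Rightarrow> real) \<Rightarrow> 'a) \<Rightarrow> bool" where
  "smooth_simplex k M \<sigma> \<longleftrightarrow> singular_simplex k (mtop M) \<sigma> \<and>
     (\<forall>c\<in>atlas M. smooth_on (Suc k) (mdim M) {t \<in> standard_simplex k. \<sigma> t \<in> chart_dom c}
                    (chart_map c \<circ> \<sigma>))"

definition smooth_chains :: "'a mfd \<Rightarrow> int \<Rightarrow> 'a chain monoid" where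
  "smooth_chains M k = free_Abelian_group {\<sigma>. 0 \<le> k \<and> smooth_simplex (nat k) M \<sigma>}"

definition smooth_cycles :: "'a mfd \<Rightarrow> int \<Rightarrow> 'a chain set" where
  "smooth_cycles M k = {z \<in> carrier (smooth_chains M k). chain_boundary (nat k) z = 0}"

text \<open>
  The open simplex in R^k is mapped to the interior of the standard simplex in R^(k+1) by
  \<open>(x\<^sub>1, \<dots>, x\<^sub>k) \<mapsto> (1 - \<Sum>\<^sub>i x\<^sub>i, x\<^sub>1, \<dots>, x\<^sub>k)\<close>. Integrating over the open simplex omits a null set
  only; for \<open>k = 0\<close> the integral is the value at the point.
\<close>

definition open_simplex :: "nat \<Rightarrow> (nat \<Rightarrow> real) set" where
  "open_simplex k = {x \<in> Rn k. (\<forall>i<k. 0 < x i) \<and> (\<Sum>i<k. x i) < 1}"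

definition simplex_param :: "nat \<Rightarrow> (nat \<Rightarrow> real) \<Rightarrow> nat \<Rightarrow> real" where
  "simplex_param k x = (\<lambda>i. if i = 0 then 1 - (\<Sum>j<k. x j) else x (i - 1))"

text \<open>Points of the product measure space are \<open>undefined\<close> at \<open>i \<ge> k\<close>, points of R^k are 0 there.\<close>

definition integral_Rn :: "nat \<Rightarrow> (nat \<Rightarrow> real) set \<Rightarrow> ((nat \<Rightarrow> real) \<Rightarrow> real) \<Rightarrow> real" where
  "integral_Rn k S f =
     (LINT x|Pi\<^sub>M {..<k} (\<lambda>_. lborel).
        (let y = (\<lambda>i. if i < k then x i else 0) in indicator S y * f y))"

definition simplex_integral :: "'a mfd \<Rightarrow> nat \<Rightarrow> ((nat \<Rightarrow> real) \<Rightarrow> 'a) \<Rightarrow> 'a form \<Rightarrow> real" where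
  "simplex_integral M k \<sigma> \<omega> =
     integral_Rn k (open_simplex k)
       (\<lambda>x. pull_at M k (open_simplex k) (\<sigma> \<circ> simplex_param k) \<omega> x (map unit_vec [0..<k]))"

definition chain_integral :: "'a mfd \<Rightarrow> int \<Rightarrow> 'a chain \<Rightarrow> 'a form \<Rightarrow> real" where
  "chain_integral M k z \<omega> =
     (\<Sum>\<sigma>\<in>Poly_Mapping.keys z. of_int (Poly_Mapping.lookup z \<sigma>) * simplex_integral M (nat k) \<sigma> \<omega>)"

definition period_forms :: "real set \<Rightarrow> 'a mfd \<Rightarrow> int \<Rightarrow> 'a form monoid" where
  "period_forms \<Lambda> M k = (form_group M k)
     \<lparr>carrier := {\<omega> \<in> carrier (form_group M k). \<forall>z\<in>smooth_cycles M k. chain_integral M k z \<omega> \<in> \<Lambda>}\<rparr>"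


section \<open>Coefficient groups and cochains\<close>

abbreviation real_ring :: "real ring" where
  "real_ring \<equiv> ring_of_type_algebra"

abbreviation real_group :: "real monoid" where
  "real_group \<equiv> add_monoid real_ring"

definition coeff_group :: "real set \<Rightarrow> real monoid" where
  "coeff_group \<Lambda> = real_group\<lparr>carrier := \<Lambda>\<rparr>"

definition RmodL :: "real set \<Rightarrow> real set monoid" where
  "RmodL \<Lambda> = real_group Mod \<Lambda>"

definition reduce :: "real set \<Rightarrow> real \<Rightarrow> real set" where
  "reduce \<Lambda> x = \<Lambda> #>\<^bsub>real_group\<^esub> x"

definition hom_group :: "('a, 'x) monoid_scheme \<Rightarrow> ('b, 'y) monoid_scheme \<Rightarrow> ('a \<Rightarrow> 'b) monoid" where
  "hom_group G H =
     \<lparr>carrier = hom G H \<inter> extensional (carrier G),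
      monoid.mult = (\<lambda>f g. \<lambda>x\<in>carrier G. f x \<otimes>\<^bsub>H\<^esub> g x),
      one = (\<lambda>x\<in>carrier G. \<one>\<^bsub>H\<^esub>)\<rparr>"


section \<open>Relative chains, forms and differential characters\<close>

definition rel_chains :: "'a mfd \<Rightarrow> 'b mfd \<Rightarrow> int \<Rightarrow> ('b chain \<times> 'a chain) monoid" where
  "rel_chains A M k = smooth_chains M k \<times>\<times> smooth_chains A (k - 1)"

definition rel_boundary :: "('a \<Rightarrow> 'b) \<Rightarrow> int \<Rightarrow> 'b chain \<times> 'a chain \<Rightarrow> 'b chain \<times> 'a chain" where
  "rel_boundary \<rho> k = (\<lambda>(\<sigma>, \<tau>).
     (chain_boundary (nat k) \<sigma> + chain_map (nat (k - 1)) \<rho> \<tau>, - chain_boundary (nat (k - 1)) \<tau>))"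

definition rel_cycles :: "'a mfd \<Rightarrow> 'b mfd \<Rightarrow> ('a \<Rightarrow> 'b) \<Rightarrow> int \<Rightarrow> ('b chain \<times> 'a chain) monoid" where
  "rel_cycles A M \<rho> k = (rel_chains A M k)
     \<lparr>carrier := {z \<in> carrier (rel_chains A M k). rel_boundary \<rho> k z = (0, 0)}\<rparr>"

definition rel_forms :: "'a mfd \<Rightarrow> 'b mfd \<Rightarrow> int \<Rightarrow> ('b form \<times> 'a form) monoid" where
  "rel_forms A M k = form_group M k \<times>\<times> form_group A (k - 1)"

definition rel_integral ::
  "'a mfd \<Rightarrow> 'b mfd \<Rightarrow> int \<Rightarrow> 'b form \<times> 'a form \<Rightarrow> 'b chain \<times> 'a chain \<Rightarrow> real" where
  "rel_integral A M k = (\<lambda>(\<omega>, \<theta>) (\<sigma>, \<tau>). chain_integral M k \<sigma> \<omega> + chain_integral A (k - 1) \<tau> \<theta>)"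

definition rel_period_forms :: "real set \<Rightarrow> 'a mfd \<Rightarrow> 'b mfd \<Rightarrow> ('a \<Rightarrow> 'b) \<Rightarrow> int \<Rightarrow> ('b form \<times> 'a form) set" where
  "rel_period_forms \<Lambda> A M \<rho> k =
     {w \<in> carrier (rel_forms A M k). \<forall>z\<in>carrier (rel_cycles A M \<rho> k). rel_integral A M k w z \<in> \<Lambda>}"

text \<open>The group written \<open>\<Omega>\<close> with a tilde.\<close>

definition tilde_forms :: "real set \<Rightarrow> 'a mfd \<Rightarrow> 'b mfd \<Rightarrow> ('a \<Rightarrow> 'b) \<Rightarrow> int \<Rightarrow> 'b form set" where
  "tilde_forms \<Lambda> A M \<rho> k =
     {\<omega> \<in> carrier (form_group M k). (\<omega>, zero_form) \<in> rel_period_forms \<Lambda> A M \<rho> k}"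

definition rel_characters ::
  "real set \<Rightarrow> 'a mfd \<Rightarrow> 'b mfd \<Rightarrow> ('a \<Rightarrow> 'b) \<Rightarrow> int \<Rightarrow> ('b chain \<times> 'a chain \<Rightarrow> real set) monoid" where
  "rel_characters \<Lambda> A M \<rho> k = (hom_group (rel_cycles A M \<rho> (k - 1)) (RmodL \<Lambda>))
     \<lparr>carrier := {f \<in> carrier (hom_group (rel_cycles A M \<rho> (k - 1)) (RmodL \<Lambda>)).
        \<exists>w\<in>carrier (rel_forms A M k). \<forall>z\<in>carrier (rel_chains A M k).
          f (rel_boundary \<rho> k z) = reduce \<Lambda> (rel_integral A M k w z)}\<rparr>"

definition rel_characters0 ::
  "real set \<Rightarrow> 'a mfd \<Rightarrow> 'b mfd \<Rightarrow> ('a \<Rightarrow> 'b) \<Rightarrow> int \<Rightarrow> ('b chain \<times> 'a chain \<Rightarrow> real set) monoid" where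
  "rel_characters0 \<Lambda> A M \<rho> k = (rel_characters \<Lambda> A M \<rho> k)
     \<lparr>carrier := {f \<in> carrier (rel_characters \<Lambda> A M \<rho> k).
        \<forall>\<tau>\<in>smooth_cycles A (k - 1). f (chain_map (nat (k - 1)) \<rho> \<tau>, 0) = \<one>\<^bsub>RmodL \<Lambda>\<^esub>}\<rparr>"


section \<open>Hopkins-Singer groups\<close>

type_synonym 'a hs_cochain = "('a chain \<Rightarrow> real) \<times> ('a chain \<Rightarrow> real) \<times> 'a form"

definition hs_group :: "real set \<Rightarrow> 'a mfd \<Rightarrow> int \<Rightarrow> 'a hs_cochain monoid" where
  "hs_group \<Lambda> N k =
     hom_group (smooth_chains N k) (coeff_group \<Lambda>) \<times>\<times>
     (hom_group (smooth_chains N (k - 1)) real_group \<times>\<times> period_forms \<Lambda> N k)"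

definition hs_diff :: "'a mfd \<Rightarrow> int \<Rightarrow> 'a hs_cochain \<Rightarrow> 'a hs_cochain" where
  "hs_diff N k = (\<lambda>(c, h, \<omega>).
     (\<lambda>z\<in>carrier (smooth_chains N (k + 1)). c (chain_boundary (nat (k + 1)) z),
      \<lambda>z\<in>carrier (smooth_chains N k). chain_integral N k z \<omega> - c z - h (chain_boundary (nat k) z),
      zero_form))"

definition hs_pull :: "'a mfd \<Rightarrow> 'b mfd \<Rightarrow> ('a \<Rightarrow> 'b) \<Rightarrow> int \<Rightarrow> 'b hs_cochain \<Rightarrow> 'a hs_cochain" where
  "hs_pull A M \<rho> k = (\<lambda>(c, h, \<omega>).
     (\<lambda>z\<in>carrier (smooth_chains A k). c (chain_map (nat k) \<rho> z),
      \<lambda>z\<in>carrier (smooth_chains A (k - 1)). h (chain_map (nat (k - 1)) \<rho> z),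
      pull_form A M \<rho> \<omega>))"

definition rel_hs_group :: "real set \<Rightarrow> 'a mfd \<Rightarrow> 'b mfd \<Rightarrow> int \<Rightarrow> ('b hs_cochain \<times> 'a hs_cochain) monoid" where
  "rel_hs_group \<Lambda> A M k = hs_group \<Lambda> M k \<times>\<times> hs_group \<Lambda> A (k - 1)"

definition rel_hs_diff ::
  "real set \<Rightarrow> 'a mfd \<Rightarrow> 'b mfd \<Rightarrow> ('a \<Rightarrow> 'b) \<Rightarrow> int \<Rightarrow>
   'b hs_cochain \<times> 'a hs_cochain \<Rightarrow> 'b hs_cochain \<times> 'a hs_cochain" where
  "rel_hs_diff \<Lambda> A M \<rho> k = (\<lambda>(S, T).
     (hs_diff M k S,
      hs_pull A M \<rho> k S \<otimes>\<^bsub>hs_group \<Lambda> A k\<^esub> inv\<^bsub>hs_group \<Lambda> A k\<^esub> (hs_diff A (k - 1) T)))"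

definition rel_hs_cocycles ::
  "real set \<Rightarrow> 'a mfd \<Rightarrow> 'b mfd \<Rightarrow> ('a \<Rightarrow> 'b) \<Rightarrow> int \<Rightarrow> ('b hs_cochain \<times> 'a hs_cochain) monoid" where
  "rel_hs_cocycles \<Lambda> A M \<rho> k = (rel_hs_group \<Lambda> A M k)
     \<lparr>carrier := kernel (rel_hs_group \<Lambda> A M k) (rel_hs_group \<Lambda> A M (k + 1)) (rel_hs_diff \<Lambda> A M \<rho> k)\<rparr>"

definition rel_hs_coboundaries ::
  "real set \<Rightarrow> 'a mfd \<Rightarrow> 'b mfd \<Rightarrow> ('a \<Rightarrow> 'b) \<Rightarrow> int \<Rightarrow> ('b hs_cochain \<times> 'a hs_cochain) set" where
  "rel_hs_coboundaries \<Lambda> A M \<rho> k =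
     rel_hs_diff \<Lambda> A M \<rho> (k - 1) ` carrier (rel_hs_group \<Lambda> A M (k - 1))"

definition rel_hopkins_singer ::
  "real set \<Rightarrow> 'a mfd \<Rightarrow> 'b mfd \<Rightarrow> ('a \<Rightarrow> 'b) \<Rightarrow> int \<Rightarrow> ('b hs_cochain \<times> 'a hs_cochain) set monoid" where
  "rel_hopkins_singer \<Lambda> A M \<rho> k = rel_hs_cocycles \<Lambda> A M \<rho> k Mod rel_hs_coboundaries \<Lambda> A M \<rho> k"


section \<open>The maps \<open>\<phi>\<close> and \<open>J\<close>\<close>

definition phi0 ::
  "real set \<Rightarrow> 'a mfd \<Rightarrow> 'b mfd \<Rightarrow> ('a \<Rightarrow> 'b) \<Rightarrow> int \<Rightarrow> 'b form \<Rightarrow> 'b chain \<times> 'a chain \<Rightarrow> real set" where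
  "phi0 \<Lambda> A M \<rho> k \<nu> =
     (\<lambda>z\<in>carrier (rel_cycles A M \<rho> (k - 1)). reduce \<Lambda> (chain_integral M (k - 1) (fst z) \<nu>))"

text \<open>\<open>the_elem\<close> yields the common value of \<open>phi0\<close> on the elements of a coset.\<close>

definition phi ::
  "real set \<Rightarrow> 'a mfd \<Rightarrow> 'b mfd \<Rightarrow> ('a \<Rightarrow> 'b) \<Rightarrow> int \<Rightarrow> 'b form set \<Rightarrow> 'b chain \<times> 'a chain \<Rightarrow> real set" where
  "phi \<Lambda> A M \<rho> k N = the_elem (phi0 \<Lambda> A M \<rho> k ` N)"

text \<open>
  A relative cochain \<open>u\<close> is a homomorphism on relative chains; the corresponding pair consists of
  \<open>\<sigma> \<mapsto> u (\<sigma>, 0)\<close> and \<open>\<tau> \<mapsto> u (0, \<tau>)\<close>. \<open>hs_element\<close> is the isomorphism from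
  \<open>C\<^sup>k(\<rho>;\<Lambda>) \<times> C\<^sup>k\<^sup>-\<^sup>1(\<rho>;R) \<times> \<Omega>\<^sup>k\<^sub>\<Lambda>M \<times> \<Omega>\<^sup>k\<^sup>-\<^sup>1\<^sub>\<Lambda>A\<close> to the complex defining \<open>rel_hopkins_singer\<close>:
  \<open>((c, b), (h, e), (\<omega>, \<theta>))\<close> goes to \<open>((c, h, \<omega>), (b, -e, \<theta>))\<close>.
\<close>

definition hs_element ::
  "'a mfd \<Rightarrow> 'b mfd \<Rightarrow> int \<Rightarrow> ('b chain \<times> 'a chain \<Rightarrow> real) \<Rightarrow> ('b chain \<times> 'a chain \<Rightarrow> real) \<Rightarrow>
   'b form \<times> 'a form \<Rightarrow> 'b hs_cochain \<times> 'a hs_cochain" where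
  "hs_element A M k u v = (\<lambda>(\<omega>, \<theta>).
     ((\<lambda>\<sigma>\<in>carrier (smooth_chains M k). u (\<sigma>, 0),
       \<lambda>\<sigma>\<in>carrier (smooth_chains M (k - 1)). v (\<sigma>, 0), \<omega>),
      (\<lambda>\<tau>\<in>carrier (smooth_chains A (k - 1)). u (0, \<tau>),
       \<lambda>\<tau>\<in>carrier (smooth_chains A (k - 2)). - v (0, \<tau>), \<theta>)))"

text \<open>The possible choices in the definition of \<open>J f\<close>: \<open>u = (c, b)\<close>, \<open>v = (h, e)\<close> and
  \<open>w = (\<omega>, \<theta>)\<close>.\<close>

definition J_choice ::
  "real set \<Rightarrow> 'a mfd \<Rightarrow> 'b mfd \<Rightarrow> ('a \<Rightarrow> 'b) \<Rightarrow> int \<Rightarrow> ('b chain \<times> 'a chain \<Rightarrow> real set) \<Rightarrow>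
   ('b chain \<times> 'a chain \<Rightarrow> real) \<Rightarrow> ('b chain \<times> 'a chain \<Rightarrow> real) \<Rightarrow> 'b form \<times> 'a form \<Rightarrow> bool" where
  "J_choice \<Lambda> A M \<rho> k f u v w \<longleftrightarrow>
     v \<in> carrier (hom_group (rel_chains A M (k - 1)) real_group) \<and>
     (\<forall>z\<in>carrier (rel_cycles A M \<rho> (k - 1)). f z = reduce \<Lambda> (v z)) \<and>
     w \<in> rel_period_forms \<Lambda> A M \<rho> k \<and>
     u \<in> carrier (hom_group (rel_chains A M k) (coeff_group \<Lambda>)) \<and>
     (\<forall>z\<in>carrier (rel_chains A M k). v (rel_boundary \<rho> k z) = rel_integral A M k w z - u z) \<and>
     (\<forall>z\<in>carrier (rel_chains A M (k + 1)). u (rel_boundary \<rho> (k + 1) z) = 0)"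

definition J_map ::
  "real set \<Rightarrow> 'a mfd \<Rightarrow> 'b mfd \<Rightarrow> ('a \<Rightarrow> 'b) \<Rightarrow> int \<Rightarrow> ('b chain \<times> 'a chain \<Rightarrow> real set) \<Rightarrow>
   ('b hs_cochain \<times> 'a hs_cochain) set" where
  "J_map \<Lambda> A M \<rho> k f =
     the_elem {rel_hs_coboundaries \<Lambda> A M \<rho> k #>\<^bsub>rel_hs_cocycles \<Lambda> A M \<rho> k\<^esub> hs_element A M k u v w
               | u v w. J_choice \<Lambda> A M \<rho> k f u v w}"


section \<open>Short exact sequences\<close>

text \<open>Unlike \<open>exact_seq\<close> of HOL-Algebra, this allows groups over three different types.\<close>

definition short_exact ::
  "('a, 'x) monoid_scheme \<Rightarrow> ('a \<Rightarrow> 'b) \<Rightarrow> ('b, 'y) monoid_scheme \<Rightarrow> ('b \<Rightarrow> 'c) \<Rightarrow>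
   ('c, 'z) monoid_scheme \<Rightarrow> bool" where
  "short_exact G \<alpha> H \<beta> K \<longleftrightarrow>
     comm_group G \<and> comm_group H \<and> comm_group K \<and>
     \<alpha> \<in> mon G H \<and> \<alpha> ` carrier G = kernel H K \<beta> \<and> \<beta> \<in> epi H K"

end

theory Submission
  imports Defs
begin

text \<open>
  A proper subring \<open>\<Lambda>\<close> of the reals contains no interval, so a quantity that depends continuously
  on a parameter and stays in \<open>\<Lambda>\<close> is constant. Applied to the integral over a simplex contracting to
  a point, this shows that a form of positive degree whose integrals over all smooth simplices lie in
  \<open>\<Lambda>\<close> vanishes; applied to the boundary of a contracting simplex, it shows that a form with
  \<open>\<Lambda>\<close>-periods integrates to zero over every boundary. These two facts replace Stokes' theorem and
  exterior derivatives.

  The rest is algebra. Boundaries of relative chains form a subgroup of a free abelian group, so the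
  relative cycles are the image of a retraction. With it a character extends to all relative chains
  and lifts to a real cochain, giving \<open>J\<close>. If the character is trivial, the retraction splits the
  lift into a \<open>\<Lambda>\<close>-valued cochain and one that vanishes on cycles; the latter factors through the
  boundary and, \<open>R\<close> being divisible, is a coboundary. For \<open>k = 1\<close> the remaining form on \<open>A\<close> is only
  known to have \<open>\<Lambda>\<close>-periods, which is where the assumption on pullbacks of functions enters.
\<close>

section \<open>Smooth functions on subsets of R^n\<close>

text \<open>\<open>\<Lambda>\<close> may be dense in the reals, so no discreteness is available; all
  that is left is that a continuous path inside \<open>\<Lambda>\<close> is constant. Two obstacles
  shape the proof. Continuity of an integral in a parameter needs integrands that are bounded
  uniformly up to the boundary of the simplex, where partial derivatives within the simplex make no
  sense. Hence integrands live on the open simplex, families of simplices on the compact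
  \<open>prism\<close>, and the bound comes from local smooth extensions. Second, a form of degree 0
  with values in \<open>\<Lambda>\<close> is locally constant but need not vanish. For k = 1 this
  concerns the form \<open>\<theta>\<close> on A that comes with a lift of the trivial character:
  the form component of a coboundary over A is a pull-back from M, so the cocycle bounds only if
  \<open>\<theta>\<close> is one. J is first treated as a multiplicative relation between characters
  and cocycles; it descends to classes because everything related to the trivial character is a
  coboundary.\<close>

lemma Rn_iff: "x \<in> Rn n \<longleftrightarrow> (\<forall>i\<ge>n. x i = 0)"
  by (simp add: topspace_Euclidean_space)

lemma Rn_upd [simp]: "x \<in> Rn n \<Longrightarrow> i < n \<Longrightarrow> x(i := t) \<in> Rn n"
  by (simp add: Rn_iff)

section \<open>Open subsets of R^n\<close>

lemma openin_Rn_iff: "openin (Euclidean_space n) V \<longleftrightarrow> (\<exists>T. open T \<and> V = T \<inter> Rn n)"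
  by (simp add: Euclidean_space_def euclidean_product_topology openin_subtopology
      topspace_Euclidean_space)

lemma openin_Rn_subset: "openin (Euclidean_space n) V \<Longrightarrow> V \<subseteq> Rn n"
  by (rule openin_subset)

lemma open_coordinate_box: "open {y :: nat \<Rightarrow> real. \<forall>i<n. \<bar>y i - x i\<bar> < e}"
proof -
  have "{y :: nat \<Rightarrow> real. \<forall>i<n. \<bar>y i - x i\<bar> < e} = (\<Inter>i\<in>{..<n}. {y. \<bar>y i - x i\<bar> < e})"
    by auto
  moreover have "open {y :: nat \<Rightarrow> real. \<bar>y i - x i\<bar> < e}" for i
    by (intro open_Collect_less continuous_intros) auto
  ultimately show ?thesis
    by auto
qed

text \<open>Points of R^n differ only in their first n coordinates, so only finitely many factors of
  a basic open set of the product topology matter, and a single radius serves them all.\<close>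

lemma openin_Rn_box:
  "openin (Euclidean_space n) V \<longleftrightarrow>
     V \<subseteq> Rn n \<and> (\<forall>x\<in>V. \<exists>e>0. \<forall>y\<in>Rn n. (\<forall>i<n. \<bar>y i - x i\<bar> < e) \<longrightarrow> y \<in> V)"
proof (intro iffI conjI ballI)
  assume V: "openin (Euclidean_space n) V"
  then show "V \<subseteq> Rn n" by (rule openin_Rn_subset)
  fix x assume x: "x \<in> V"
  obtain T where T: "open T" "V = T \<inter> Rn n"
    using V by (auto simp: openin_Rn_iff)
  then obtain B where B: "x \<in> PiE UNIV B" "\<And>i. open (B i)" "PiE UNIV B \<subseteq> T"
    using x product_topology_open_contains_basis[where T="\<lambda>_::nat. euclideanreal" and I=UNIV and U=T and x=x]
    by (auto simp: euclidean_product_topology)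
  have "\<forall>i. \<exists>e>0. \<forall>t. \<bar>t - x i\<bar> < e \<longrightarrow> t \<in> B i"
  proof
    fix i have "x i \<in> B i" using B(1) by auto
    then show "\<exists>e>0. \<forall>t. \<bar>t - x i\<bar> < e \<longrightarrow> t \<in> B i"
      using B(2)[of i] unfolding open_dist by (auto simp: dist_real_def)
  qed
  then obtain d where d: "\<And>i. d i > 0" "\<And>i t. \<bar>t - x i\<bar> < d i \<Longrightarrow> t \<in> B i"
    by metis
  \<comment> \<open>The inserted 1 keeps the minimum defined when n = 0.\<close>
  define e where "e = Min (insert 1 (d ` {..<n}))"
  have "e > 0" using d(1) by (auto simp: e_def)
  moreover have "y \<in> V" if y: "y \<in> Rn n" "\<forall>i<n. \<bar>y i - x i\<bar> < e" for y
  proof -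
    have "y i \<in> B i" for i
    proof (cases "i < n")
      case True
      then have "e \<le> d i" by (auto simp: e_def)
      then show ?thesis using y(2) True d(2) by (meson less_le_trans)
    next
      case False
      then have "y i = x i" using y(1) x T(2) by (auto simp: Rn_iff)
      then show ?thesis using B(1) by auto
    qed
    then show ?thesis using B(3) T(2) y(1) by auto
  qed
  ultimately show "\<exists>e>0. \<forall>y\<in>Rn n. (\<forall>i<n. \<bar>y i - x i\<bar> < e) \<longrightarrow> y \<in> V"
    by blast
next
  assume A: "V \<subseteq> Rn n \<and> (\<forall>x\<in>V. \<exists>e>0. \<forall>y\<in>Rn n. (\<forall>i<n. \<bar>y i - x i\<bar> < e) \<longrightarrow> y \<in> V)"
  then obtain e where e: "\<And>x. x \<in> V \<Longrightarrow> e x > 0"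
    "\<And>x y. x \<in> V \<Longrightarrow> y \<in> Rn n \<Longrightarrow> (\<forall>i<n. \<bar>y i - x i\<bar> < e x) \<Longrightarrow> y \<in> V"
    by metis
  define T where "T = (\<Union>x\<in>V. {y :: nat \<Rightarrow> real. \<forall>i<n. \<bar>y i - x i\<bar> < e x})"
  have "open T" unfolding T_def by (intro open_UN ballI open_coordinate_box)
  moreover have "V = T \<inter> Rn n"
  proof (intro equalityI subsetI)
    fix x assume "x \<in> V"
    then show "x \<in> T \<inter> Rn n"
      using e(1) A by (force simp: T_def)
  next
    fix y assume "y \<in> T \<inter> Rn n"
    then obtain x where "x \<in> V" "\<forall>i<n. \<bar>y i - x i\<bar> < e x" "y \<in> Rn n"
      by (auto simp: T_def)
    then show "y \<in> V" using e(2) by blast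
  qed
  ultimately show "openin (Euclidean_space n) V"
    by (auto simp: openin_Rn_iff)
qed

lemma openin_Rn_preimage:
  assumes "openin (Euclidean_space n) V" "continuous_on V g" "open S"
  shows "openin (Euclidean_space n) {x \<in> V. g x \<in> S}"
proof -
  obtain T where T: "open T" "V = T \<inter> Rn n"
    using assms(1) by (auto simp: openin_Rn_iff)
  obtain U where U: "open U" "U \<inter> V = g -` S \<inter> V"
    using assms(2,3) unfolding continuous_on_open_invariant by blast
  have "{x \<in> V. g x \<in> S} = (U \<inter> T) \<inter> Rn n"
    using T(2) U(2) by blast
  then show ?thesis using U T by (auto simp: openin_Rn_iff)
qed

lemma openin_Rn_Collect_all:
  fixes m :: nat
  assumes "openin (Euclidean_space n) V"
    "\<And>j. j < m \<Longrightarrow> openin (Euclidean_space n) {x \<in> V. P j x}"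
  shows "openin (Euclidean_space n) {x \<in> V. \<forall>j<m. P j x}"
  using assms(2)
proof (induct m)
  case (Suc m)
  have "{x \<in> V. \<forall>j<Suc m. P j x} = {x \<in> V. \<forall>j<m. P j x} \<inter> {x \<in> V. P m x}"
    by (auto simp: less_Suc_eq)
  then show ?case using Suc by (simp add: openin_Int)
qed (use assms(1) in auto)

lemma eventually_upd_mem:
  assumes "openin (Euclidean_space n) V" "x \<in> V" "i < n"
  shows "eventually (\<lambda>t. x(i := t) \<in> V) (nhds (x i))"
proof -
  obtain e where e: "e > 0" "\<And>y. y \<in> Rn n \<Longrightarrow> (\<forall>i<n. \<bar>y i - x i\<bar> < e) \<Longrightarrow> y \<in> V"
    using assms by (meson openin_Rn_box)
  have x: "x \<in> Rn n" using assms openin_Rn_subset by blast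
  show ?thesis
    unfolding eventually_nhds_metric
    by (rule exI[of _ e]) (use e x assms(3) in \<open>auto simp: dist_real_def intro!: e(2)\<close>)
qed

text \<open>The condition under which a derivative along a coordinate line within S is unique, so
  that \<open>partial S\<close> has a meaning. Open sets and relatively open subsets of the
  half-space satisfy it. The standard simplex does not: a coordinate line meets it in a single
  point, because the coordinates sum to 1.\<close>

definition line_perfect :: "nat \<Rightarrow> (nat \<Rightarrow> real) set \<Rightarrow> bool" where
  "line_perfect n S \<longleftrightarrow>
     S \<subseteq> Rn n \<and> (\<forall>x\<in>S. \<forall>i<n. at (x i) within {t. x(i := t) \<in> S} \<noteq> bot)"

lemma at_within_Int_openin:
  assumes "openin (Euclidean_space n) V" "x \<in> V" "i < n"
  shows "at (x i) within {t. x(i := t) \<in> S \<inter> V} = at (x i) within {t. x(i := t) \<in> S}"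
proof -
  obtain U where "open U" "x i \<in> U" "\<And>t. t \<in> U \<Longrightarrow> x(i := t) \<in> V"
    using eventually_upd_mem[OF assms] unfolding eventually_nhds by blast
  then show ?thesis by (intro at_within_nhd[of _ U]) auto
qed

lemma at_within_openin:
  assumes "openin (Euclidean_space n) V" "x \<in> V" "i < n"
  shows "at (x i) within {t. x(i := t) \<in> V} = at (x i)"
  using at_within_Int_openin[OF assms, of UNIV] by simp

lemma line_perfect_openin: "openin (Euclidean_space n) V \<Longrightarrow> line_perfect n V"
  unfolding line_perfect_def
  by (simp add: openin_Rn_subset at_within_openin)

lemma line_perfect_Int:
  assumes "line_perfect n S" "openin (Euclidean_space n) V"
  shows "line_perfect n (S \<inter> V)"
  unfolding line_perfect_def
proof (intro conjI ballI allI impI)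
  show "S \<inter> V \<subseteq> Rn n" using assms(1) by (auto simp: line_perfect_def)
  fix x i assume x: "x \<in> S \<inter> V" "i < n"
  then have "at (x i) within {t. x(i := t) \<in> S \<inter> V} = at (x i) within {t. x(i := t) \<in> S}"
    by (intro at_within_Int_openin[OF assms(2)]) auto
  then show "at (x i) within {t. x(i := t) \<in> S \<inter> V} \<noteq> bot"
    using assms(1) x unfolding line_perfect_def by simp
qed

lemma partial_eqI:
  assumes "line_perfect n S" "x \<in> S" "i < n"
    and "((\<lambda>t. f (x(i := t))) has_real_derivative D) (at (x i) within {t. x(i := t) \<in> S})"
  shows "partial S i f x = D"
  unfolding partial_def
proof (rule vector_derivative_within)
  show "at (x i) within {t. x(i := t) \<in> S} \<noteq> bot"
    using assms(1-3) unfolding line_perfect_def by blast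
qed (use assms(4) in \<open>simp add: has_real_derivative_iff_has_vector_derivative\<close>)

lemma partial_cong:
  assumes "x \<in> S" "\<And>y. y \<in> S \<Longrightarrow> f y = g y"
  shows "partial S i f x = partial S i g x"
proof -
  define T where "T = {t. x(i := t) \<in> S}"
  have T: "x i \<in> T" "\<And>t. t \<in> T \<Longrightarrow> f (x(i := t)) = g (x(i := t))"
    using assms by (auto simp: T_def)
  \<comment> \<open>\<open>vector_derivative\<close> is a choice operator. It agrees for two
    functions as soon as the same values D qualify, even where no derivative exists.\<close>
  have "((\<lambda>t. f (x(i := t))) has_vector_derivative D) (at (x i) within T) \<longleftrightarrow>
        ((\<lambda>t. g (x(i := t))) has_vector_derivative D) (at (x i) within T)" for D
    by (rule iffI; erule has_vector_derivative_transform[OF T(1), rotated]) (simp_all add: T(2))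
  then show ?thesis
    by (simp add: partial_def vector_derivative_def T_def)
qed

lemma partial_Int:
  assumes "openin (Euclidean_space n) V" "x \<in> V" "i < n"
  shows "partial (S \<inter> V) i f x = partial S i f x"
  using at_within_Int_openin[OF assms] by (simp add: partial_def)

lemma partial_openin:
  assumes "openin (Euclidean_space n) V" "x \<in> V" "i < n"
    and "((\<lambda>t. f (x(i := t))) has_real_derivative D) (at (x i))"
  shows "partial V i f x = D"
  using assms by (intro partial_eqI[of n]) (auto simp: line_perfect_openin at_within_openin)

subsection \<open>Closure properties of C^r functions\<close>

lemma C_diff_continuous: "C_diff n r V f \<Longrightarrow> continuous_on V f"
  by (cases r) auto

lemma C_diff_DERIV:
  assumes "openin (Euclidean_space n) V" "C_diff n (Suc r) V f" "x \<in> V" "i < n"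
  shows "((\<lambda>t. f (x(i := t))) has_real_derivative partial V i f x) (at (x i))"
proof -
  obtain D where "((\<lambda>t. f (x(i := t))) has_real_derivative D) (at (x i))"
    using assms by (auto simp: real_differentiable_def)
  with partial_openin[OF assms(1,3,4) this] show ?thesis by simp
qed

lemma C_diff_cong:
  assumes "openin (Euclidean_space n) V"
  shows "C_diff n r V f \<Longrightarrow> (\<And>x. x \<in> V \<Longrightarrow> f x = g x) \<Longrightarrow> C_diff n r V g"
proof (induction r arbitrary: f g)
  case 0
  then show ?case by (auto cong: continuous_on_cong)
next
  case (Suc r)
  have "continuous_on V g"
    using Suc.prems by (auto cong: continuous_on_cong)
  moreover have "C_diff n r V (partial V i g)" if "i < n" for i
    by (rule Suc.IH[of "partial V i f"]) (use Suc.prems that in \<open>auto intro: partial_cong\<close>)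
  moreover have "(\<lambda>t. g (x(i := t))) differentiable (at (x i))" if "i < n" "x \<in> V" for i x
  proof -
    have "\<forall>\<^sub>F t in nhds (x i). f (x(i := t)) = g (x(i := t))"
      using eventually_upd_mem[OF assms that(2,1)] by eventually_elim (use Suc.prems in auto)
    from iffD1[OF DERIV_cong_ev[OF refl this refl] C_diff_DERIV[OF assms Suc.prems(1) that(2,1)]]
    show ?thesis by (auto simp: real_differentiable_def)
  qed
  ultimately show ?case by simp
qed

text \<open>Lets the partial derivatives be given by an explicit formula p, instead of by the choice
  operator inside \<open>partial\<close>; the closure properties below are all proved in this
  way.\<close>

lemma C_diff_SucI:
  assumes "openin (Euclidean_space n) V" "continuous_on V f"
    and "\<And>i x. i < n \<Longrightarrow> x \<in> V \<Longrightarrow> ((\<lambda>t. f (x(i := t))) has_real_derivative p i x) (at (x i))"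
    and "\<And>i. i < n \<Longrightarrow> C_diff n r V (p i)"
  shows "C_diff n (Suc r) V f"
proof -
  have "C_diff n r V (partial V i f)" if "i < n" for i
    by (rule C_diff_cong[OF assms(1) assms(4)[OF that]])
      (use partial_openin[OF assms(1) _ that assms(3)[OF that], symmetric] in blast)
  then show ?thesis
    using assms(2,3) by (auto simp: real_differentiable_def)
qed

lemma C_diff_mono: "openin (Euclidean_space n) V \<Longrightarrow> C_diff n (Suc r) V f \<Longrightarrow> C_diff n r V f"
  by (induction r arbitrary: f) auto

lemma C_diff_subset:
  assumes "openin (Euclidean_space n) V" "openin (Euclidean_space n) W" "W \<subseteq> V"
  shows "C_diff n r V f \<Longrightarrow> C_diff n r W f"
proof (induction r arbitrary: f)
  case 0
  then show ?case using assms(3) by (auto intro: continuous_on_subset)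
next
  case (Suc r)
  show ?case
    by (rule C_diff_SucI[OF assms(2), where p="\<lambda>i. partial V i f"])
       (use assms(3) C_diff_DERIV[OF assms(1) Suc.prems] Suc in \<open>auto intro: continuous_on_subset\<close>)
qed

lemma C_diff_const: "openin (Euclidean_space n) V \<Longrightarrow> C_diff n r V (\<lambda>x. c)"
proof (induction r arbitrary: c)
  case (Suc r)
  show ?case
    by (rule C_diff_SucI[OF Suc.prems, where p="\<lambda>_ _. 0"]) (use Suc in auto)
qed auto

lemma C_diff_proj: "openin (Euclidean_space n) V \<Longrightarrow> C_diff n r V (\<lambda>x. x j)"
proof (cases r)
  case (Suc q)
  assume V: "openin (Euclidean_space n) V"
  have "((\<lambda>t. (x(i := t)) j) has_real_derivative (if i = j then 1 else 0)) (at (x i))" for i x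
    by (cases "i = j") (auto intro!: derivative_eq_intros)
  then show ?thesis
    unfolding Suc by (intro C_diff_SucI[OF V, where p="\<lambda>i _. if i = j then 1 else 0"] C_diff_const[OF V])
      (auto intro: continuous_on_product_coordinates continuous_on_subset)
qed (auto intro: continuous_on_product_coordinates continuous_on_subset)

lemma C_diff_add:
  assumes V: "openin (Euclidean_space n) V"
  shows "C_diff n r V f \<Longrightarrow> C_diff n r V g \<Longrightarrow> C_diff n r V (\<lambda>x. f x + g x)"
proof (induction r arbitrary: f g)
  case (Suc r)
  show ?case
    by (rule C_diff_SucI[OF V, where p="\<lambda>i x. partial V i f x + partial V i g x"])
       (use Suc C_diff_DERIV[OF V Suc.prems(1)] C_diff_DERIV[OF V Suc.prems(2)]
         in \<open>auto intro!: continuous_intros DERIV_add\<close>)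
qed (auto intro: continuous_intros)

lemma C_diff_mult:
  assumes V: "openin (Euclidean_space n) V"
  shows "C_diff n r V f \<Longrightarrow> C_diff n r V g \<Longrightarrow> C_diff n r V (\<lambda>x. f x * g x)"
proof (induction r arbitrary: f g)
  case (Suc r)
  show ?case
  proof (rule C_diff_SucI[OF V, where p="\<lambda>i x. partial V i f x * g x + partial V i g x * f x"])
    show "C_diff n r V (\<lambda>x. partial V i f x * g x + partial V i g x * f x)" if "i < n" for i
      using that Suc.prems C_diff_mono[OF V Suc.prems(1)] C_diff_mono[OF V Suc.prems(2)]
      by (intro C_diff_add[OF V] Suc.IH) auto
    show "((\<lambda>t. f (x(i := t)) * g (x(i := t))) has_real_derivative
           partial V i f x * g x + partial V i g x * f x) (at (x i))" if "i < n" "x \<in> V" for i x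
      using DERIV_mult[OF C_diff_DERIV[OF V Suc.prems(1) that(2,1)] C_diff_DERIV[OF V Suc.prems(2) that(2,1)]]
      by (simp only: fun_upd_triv)
  qed (use Suc.prems in \<open>auto intro!: continuous_intros\<close>)
qed (auto intro: continuous_intros)

lemma C_diff_sum:
  assumes V: "openin (Euclidean_space n) V" and "\<And>j. j \<in> J \<Longrightarrow> C_diff n r V (f j)"
  shows "C_diff n r V (\<lambda>x. \<Sum>j\<in>J. f j x)"
  using assms(2)
  by (induction J rule: infinite_finite_induct) (auto intro: C_diff_const[OF V] C_diff_add[OF V])

text \<open>Continuous partial derivatives imply Frechet differentiability: pass from \<open>x\<close> to \<open>y\<close> one
  coordinate at a time and apply the mean value inequality in each step.\<close>

lemma frechet_estimate:
  assumes W: "openin (Euclidean_space n) W" "x \<in> W"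
    and p: "\<And>j y. j < n \<Longrightarrow> y \<in> W \<Longrightarrow> ((\<lambda>t. f (y(j := t))) has_real_derivative p j y) (at (y j))"
    and c: "\<And>j. j < n \<Longrightarrow> continuous_on W (p j)" and e: "e > 0"
  shows "\<exists>d>0. \<forall>y\<in>Rn n. (\<forall>j<n. \<bar>y j - x j\<bar> < d) \<longrightarrow>
     \<bar>f y - f x - (\<Sum>j<n. p j x * (y j - x j))\<bar> \<le> e * (\<Sum>j<n. \<bar>y j - x j\<bar>)"
proof -
  define W' where "W' = {z \<in> W. \<forall>j<n. p j z \<in> ball (p j x) e}"
  have "openin (Euclidean_space n) W'"
    unfolding W'_def using W c by (intro openin_Rn_Collect_all openin_Rn_preimage) auto
  moreover have "x \<in> W'" using W e by (auto simp: W'_def)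
  ultimately obtain d where d: "d > 0" "\<And>y. y \<in> Rn n \<Longrightarrow> (\<forall>j<n. \<bar>y j - x j\<bar> < d) \<Longrightarrow> y \<in> W'"
    by (meson openin_Rn_box)
  have x: "x \<in> Rn n" using W openin_Rn_subset by blast
  show ?thesis
  proof (intro exI[of _ d] conjI ballI impI)
    fix y assume y: "y \<in> Rn n" "\<forall>j<n. \<bar>y j - x j\<bar> < d"
    define z where "z m = (\<lambda>i. if i < m then y i else x i)" for m :: nat
    have "m \<le> n \<Longrightarrow> \<bar>f (z m) - f x - (\<Sum>j<m. p j x * (y j - x j))\<bar> \<le> e * (\<Sum>j<m. \<bar>y j - x j\<bar>)" for m
    proof (induction m)
      case 0
      then show ?case by (simp add: z_def)
    next
      case (Suc m)
      \<comment> \<open>With the linear term removed, the derivative of \<open>\<phi>\<close> is the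
        variation of the partial derivative, which is at most e on \<open>W'\<close>.\<close>
      define \<phi> where "\<phi> t = f ((z m)(m := t)) - p m x * t" for t
      have zW: "(z m)(m := t) \<in> W'" if "\<bar>t - x m\<bar> < d" for t
        by (rule d(2)) (use that x y Suc.prems d(1) in \<open>auto simp: z_def Rn_iff\<close>)
      have "norm (\<phi> (y m) - \<phi> (x m)) \<le> e * norm (y m - x m)"
      proof (rule field_differentiable_bound[where S="ball (x m) d" and f'="\<lambda>t. p m ((z m)(m := t)) - p m x"])
        fix t assume "t \<in> ball (x m) d"
        then have t: "(z m)(m := t) \<in> W'" using zW by (auto simp: dist_real_def abs_minus_commute)
        have "((\<lambda>s. f ((z m)(m := s))) has_real_derivative p m ((z m)(m := t))) (at t)"
          using p[of m "(z m)(m := t)"] t Suc.prems by (auto simp: W'_def)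
        then show "(\<phi> has_real_derivative p m ((z m)(m := t)) - p m x) (at t within ball (x m) d)"
          unfolding \<phi>_def by (auto intro!: derivative_eq_intros intro: has_field_derivative_at_within)
        show "norm (p m ((z m)(m := t)) - p m x) \<le> e"
          using t Suc.prems by (auto simp: W'_def dist_real_def less_imp_le abs_minus_commute)
      qed (use d(1) y(2) Suc.prems in \<open>auto simp: dist_real_def abs_minus_commute\<close>)
      moreover have "(z m)(m := y m) = z (Suc m)" "(z m)(m := x m) = z m"
        by (auto simp: z_def)
      ultimately have "\<bar>f (z (Suc m)) - f (z m) - p m x * (y m - x m)\<bar> \<le> e * \<bar>y m - x m\<bar>"
        by (simp add: \<phi>_def algebra_simps)
      with Suc show ?case by (simp add: algebra_simps)
    qed
    from this[of n] show "\<bar>f y - f x - (\<Sum>j<n. p j x * (y j - x j))\<bar> \<le> e * (\<Sum>j<n. \<bar>y j - x j\<bar>)"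
    proof -
      have "z n = y" using x y by (auto simp: z_def Rn_iff)
      then show ?thesis using \<open>n \<le> n \<Longrightarrow> _\<close> by simp
    qed
  qed (rule d(1))
qed

text \<open>By \<open>frechet_estimate\<close> the difference quotient of f along the curve differs
  from the expected linear combination of the quotients \<open>q j\<close> by at most a small
  multiple of the sum of their absolute values, and that sum stays bounded because each quotient
  converges.\<close>

lemma chain_rule_curve:
  assumes W: "openin (Euclidean_space n) W"
    and p: "\<And>j y. j < n \<Longrightarrow> y \<in> W \<Longrightarrow> ((\<lambda>t. f (y(j := t))) has_real_derivative p j y) (at (y j))"
    and c: "\<And>j. j < n \<Longrightarrow> continuous_on W (p j)"
    and \<gamma>: "\<gamma> t0 \<in> W" "eventually (\<lambda>t. \<gamma> t \<in> Rn n) (at t0 within T)"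
    and D: "\<And>j. j < n \<Longrightarrow> ((\<lambda>t. \<gamma> t j) has_real_derivative D j) (at t0 within T)"
  shows "((\<lambda>t. f (\<gamma> t)) has_real_derivative (\<Sum>j<n. p j (\<gamma> t0) * D j)) (at t0 within T)"
proof -
  define x where "x = \<gamma> t0"
  define q where "q j t = (\<gamma> t j - x j) / (t - t0)" for j t
  have q: "(q j \<longlongrightarrow> D j) (at t0 within T)" if "j < n" for j
    using D[OF that] unfolding has_field_derivative_iff q_def[abs_def] x_def .
  have cont: "((\<lambda>t. \<gamma> t j) \<longlongrightarrow> x j) (at t0 within T)" if "j < n" for j
    using DERIV_isCont D[OF that]
    by (metis DERIV_continuous continuous_within x_def)
  \<comment> \<open>The summand 1 makes B positive and lifts it strictly above the limit of the sum
    of the quotients, so that B bounds that sum near \<open>t0\<close>.\<close>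
  define B where "B = (\<Sum>j<n. \<bar>D j\<bar>) + 1"
  have B: "B > 0" by (simp add: B_def sum_nonneg add_nonneg_pos)
  have lin: "((\<lambda>t. (\<Sum>j<n. p j x * q j t)) \<longlongrightarrow> (\<Sum>j<n. p j x * D j)) (at t0 within T)"
    using q by (intro tendsto_intros) auto
  have "((\<lambda>t. (\<Sum>j<n. \<bar>q j t\<bar>)) \<longlongrightarrow> (\<Sum>j<n. \<bar>D j\<bar>)) (at t0 within T)"
    using q by (intro tendsto_intros) auto
  then have evB: "eventually (\<lambda>t. (\<Sum>j<n. \<bar>q j t\<bar>) < B) (at t0 within T)"
    by (rule order_tendstoD) (simp add: B_def)
  have "((\<lambda>t. (f (\<gamma> t) - f x) / (t - t0) - (\<Sum>j<n. p j x * q j t)) \<longlongrightarrow> 0) (at t0 within T)"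
  proof (rule tendstoI)
    fix e :: real assume e: "e > 0"
    \<comment> \<open>The factor 2 turns the weak estimate by \<open>e' * B\<close> into a strict
      one by e.\<close>
    define e' where "e' = e / (2 * B)"
    have e': "e' > 0" "e' * B < e" using e B by (auto simp: e'_def)
    obtain d where d: "d > 0" "\<And>y. y \<in> Rn n \<Longrightarrow> (\<forall>j<n. \<bar>y j - x j\<bar> < d) \<Longrightarrow>
      \<bar>f y - f x - (\<Sum>j<n. p j x * (y j - x j))\<bar> \<le> e' * (\<Sum>j<n. \<bar>y j - x j\<bar>)"
      using frechet_estimate[OF W _ p c e'(1), of x] \<gamma>(1) unfolding x_def by blast
    have "eventually (\<lambda>t. \<forall>j\<in>{..<n}. \<bar>\<gamma> t j - x j\<bar> < d) (at t0 within T)"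
    proof (rule eventually_ball_finite)
      show "\<forall>j\<in>{..<n}. eventually (\<lambda>t. \<bar>\<gamma> t j - x j\<bar> < d) (at t0 within T)"
        using tendstoD[OF cont d(1)] by (auto simp: dist_real_def)
    qed auto
    moreover have "eventually (\<lambda>t. t \<noteq> t0) (at t0 within T)"
      by (simp add: eventually_at_filter)
    ultimately show "eventually (\<lambda>t. dist ((f (\<gamma> t) - f x) / (t - t0) - (\<Sum>j<n. p j x * q j t)) 0 < e) (at t0 within T)"
      using \<gamma>(2) evB
    proof eventually_elim
      case (elim t)
      have *: "(\<Sum>j<n. p j x * q j t) = (\<Sum>j<n. p j x * (\<gamma> t j - x j)) / (t - t0)"
        by (simp add: q_def sum_divide_distrib)
      have **: "(\<Sum>j<n. \<bar>q j t\<bar>) = (\<Sum>j<n. \<bar>\<gamma> t j - x j\<bar>) / \<bar>t - t0\<bar>"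
        by (simp add: q_def sum_divide_distrib abs_divide)
      have "\<bar>(f (\<gamma> t) - f x) / (t - t0) - (\<Sum>j<n. p j x * q j t)\<bar> =
         \<bar>f (\<gamma> t) - f x - (\<Sum>j<n. p j x * (\<gamma> t j - x j))\<bar> / \<bar>t - t0\<bar>"
        unfolding * by (simp add: diff_divide_distrib[symmetric] abs_divide)
      also have "\<dots> \<le> e' * (\<Sum>j<n. \<bar>\<gamma> t j - x j\<bar>) / \<bar>t - t0\<bar>"
        using d(2)[of "\<gamma> t"] elim by (intro divide_right_mono) auto
      also have "\<dots> = e' * (\<Sum>j<n. \<bar>q j t\<bar>)" by (simp add: **)
      also have "\<dots> \<le> e' * B" using elim e' by (intro mult_left_mono) auto
      finally show ?case using e' by (simp add: dist_real_def)
    qed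
  qed
  from tendsto_add[OF this lin] show ?thesis
    by (simp add: has_field_derivative_iff x_def)
qed

lemma continuous_on_Rn:
  assumes "G ` V \<subseteq> Rn m" "\<And>j. j < m \<Longrightarrow> continuous_on V (\<lambda>x. G x j)"
  shows "continuous_on V G"
proof (rule continuous_on_coordinatewise_then_product)
  show "continuous_on V (\<lambda>x. G x j)" for j
  proof (cases "j < m")
    case False
    then have "G x j = 0" if "x \<in> V" for x
      using assms(1) that Rn_iff[of "G x" m] by auto
    then show ?thesis by (simp cong: continuous_on_cong)
  qed (use assms(2) in auto)
qed

text \<open>Induction on r for all f at once: the partial derivatives of f, taken along G, are
  composites of lower order, and those of G enter only as factors, so closure under sums and
  products finishes the step.\<close>

lemma C_diff_compose:
  assumes V: "openin (Euclidean_space n) V" and W: "openin (Euclidean_space m) W"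
    and G: "G ` V \<subseteq> W"
  shows "C_diff m r W f \<Longrightarrow> (\<And>j. j < m \<Longrightarrow> C_diff n r V (\<lambda>x. G x j)) \<Longrightarrow> C_diff n r V (\<lambda>x. f (G x))"
proof (induction r arbitrary: f)
  case 0
  have "continuous_on V G"
    using 0 G openin_Rn_subset[OF W] by (intro continuous_on_Rn[of G V m]) auto
  then show ?case using 0 G continuous_on_compose2[of W f V G] by simp
next
  case (Suc r)
  have D: "((\<lambda>t. f (G (x(i := t)))) has_real_derivative
        (\<Sum>j<m. partial W j f (G x) * partial V i (\<lambda>x. G x j) x)) (at (x i))" if "i < n" "x \<in> V" for i x
  proof -
    have "((\<lambda>t. f (G (x(i := t)))) has_real_derivative
        (\<Sum>j<m. partial W j f (G (x(i := x i))) * partial V i (\<lambda>x. G x j) x)) (at (x i))"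
    proof (rule chain_rule_curve[OF W])
      show "((\<lambda>t. f (y(j := t))) has_real_derivative partial W j f y) (at (y j))" if "j < m" "y \<in> W" for j y
        by (rule C_diff_DERIV[OF W Suc.prems(1) that(2,1)])
      show "continuous_on W (partial W j f)" if "j < m" for j
        using Suc.prems(1) that by (auto intro: C_diff_continuous)
      have "\<forall>\<^sub>F t in at (x i). x(i := t) \<in> V"
        using eventually_upd_mem[OF V that(2,1)] by (simp add: eventually_at_filter eventually_mono)
      then show "\<forall>\<^sub>F t in at (x i). G (x(i := t)) \<in> Rn m"
        by eventually_elim (use G openin_Rn_subset[OF W] in auto)
      show "((\<lambda>t. G (x(i := t)) j) has_real_derivative partial V i (\<lambda>x. G x j) x) (at (x i))" if "j < m" for j
        using C_diff_DERIV[OF V Suc.prems(2)[OF that] \<open>x \<in> V\<close> \<open>i < n\<close>] .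
    qed (use G that in auto)
    then show ?thesis by simp
  qed
  show ?case
  proof (rule C_diff_SucI[OF V _ D])
    have "continuous_on V G"
      using Suc.prems(2) G openin_Rn_subset[OF W] by (intro continuous_on_Rn[of G V m]) auto
    then show "continuous_on V (\<lambda>x. f (G x))"
      using Suc.prems(1) G continuous_on_compose2[of W f V G] by simp
    show "C_diff n r V (\<lambda>x. \<Sum>j<m. partial W j f (G x) * partial V i (\<lambda>x. G x j) x)" if "i < n" for i
    proof (rule C_diff_sum[OF V], rule C_diff_mult[OF V])
      fix j assume "j \<in> {..<m}"
      then have j: "j < m" by simp
      show "C_diff n r V (\<lambda>x. partial W j f (G x))"
        by (rule Suc.IH) (use Suc.prems(1) j C_diff_mono[OF V Suc.prems(2)] in simp_all)
      show "C_diff n r V (partial V i (\<lambda>x. G x j))"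
        using Suc.prems(2)[OF j] that by simp
    qed
  qed
qed

section \<open>Smooth functions on arbitrary subsets\<close>

lemma smooth_fun_onE:
  assumes "smooth_fun_on n S f" "x \<in> S"
  obtains V g where "openin (Euclidean_space n) V" "x \<in> V" "\<And>r. C_diff n r V g"
    "\<And>y. y \<in> V \<Longrightarrow> y \<in> S \<Longrightarrow> g y = f y"
proof -
  from bspec[OF assms(1)[unfolded smooth_fun_on_def] assms(2)]
  obtain V g where "openin (Euclidean_space n) V" "x \<in> V" "\<forall>r. C_diff n r V g"
    "\<forall>y\<in>V \<inter> S. g y = f y"
    by (elim exE conjE)
  then show ?thesis by (intro that[of V g]) simp_all
qed

lemma smooth_fun_onI:
  assumes "\<And>x. x \<in> S \<Longrightarrow> \<exists>V g. openin (Euclidean_space n) V \<and> x \<in> V \<and> (\<forall>r. C_diff n r V g) \<and>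
    (\<forall>y\<in>V \<inter> S. g y = f y)"
  shows "smooth_fun_on n S f"
  unfolding smooth_fun_on_def by (rule ballI, rule assms)

lemma smooth_fun_on_Rn:
  assumes "smooth_fun_on n S f" shows "S \<subseteq> Rn n"
proof
  fix x assume "x \<in> S"
  then obtain V where "openin (Euclidean_space n) V" "x \<in> V"
    using smooth_fun_onE[OF assms] by metis
  then show "x \<in> Rn n" using openin_Rn_subset by blast
qed

lemma smooth_fun_on_subset_cong:
  assumes "smooth_fun_on n S f" "T \<subseteq> S" "\<And>x. x \<in> T \<Longrightarrow> f x = g x"
  shows "smooth_fun_on n T g"
proof (rule smooth_fun_onI)
  fix x assume "x \<in> T"
  then have "x \<in> S" using assms(2) by blast
  then obtain V h where V: "openin (Euclidean_space n) V" "x \<in> V" "\<And>r. C_diff n r V h"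
    "\<And>y. y \<in> V \<Longrightarrow> y \<in> S \<Longrightarrow> h y = f y"
    using smooth_fun_onE[OF assms(1)] by metis
  then have "\<forall>y\<in>V \<inter> T. h y = g y" using assms(2,3) by auto
  then show "\<exists>V h. openin (Euclidean_space n) V \<and> x \<in> V \<and> (\<forall>r. C_diff n r V h) \<and>
    (\<forall>y\<in>V \<inter> T. h y = g y)"
    using V(1-3) by (intro exI[of _ V] exI[of _ h]) simp
qed

lemma smooth_fun_on_subset: "smooth_fun_on n S f \<Longrightarrow> T \<subseteq> S \<Longrightarrow> smooth_fun_on n T f"
  by (rule smooth_fun_on_subset_cong[of n S f T f]) simp_all

lemma smooth_fun_on_cong:
  assumes "smooth_fun_on n S f" "\<And>x. x \<in> S \<Longrightarrow> f x = g x"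
  shows "smooth_fun_on n S g"
  using assms by (intro smooth_fun_on_subset_cong[of n S f S g]) auto

lemma smooth_fun_on_local:
  assumes "\<And>x. x \<in> S \<Longrightarrow> \<exists>V. openin (Euclidean_space n) V \<and> x \<in> V \<and> smooth_fun_on n (S \<inter> V) f"
  shows "smooth_fun_on n S f"
proof (rule smooth_fun_onI)
  fix x assume x: "x \<in> S"
  then obtain V where V: "openin (Euclidean_space n) V" "x \<in> V" "smooth_fun_on n (S \<inter> V) f"
    using assms by blast
  then obtain U g where U: "openin (Euclidean_space n) U" "x \<in> U" "\<And>r. C_diff n r U g"
    "\<And>y. y \<in> U \<Longrightarrow> y \<in> S \<inter> V \<Longrightarrow> g y = f y"
    using smooth_fun_onE[OF V(3), of x] x by (metis IntI)
  have "openin (Euclidean_space n) (U \<inter> V)" using U V by blast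
  moreover have "\<forall>r. C_diff n r (U \<inter> V) g"
    using C_diff_subset[OF U(1) calculation] U(3) by blast
  ultimately show "\<exists>V g. openin (Euclidean_space n) V \<and> x \<in> V \<and> (\<forall>r. C_diff n r V g) \<and>
    (\<forall>y\<in>V \<inter> S. g y = f y)"
    using U V by (intro exI[of _ "U \<inter> V"] exI[of _ g]) auto
qed

lemma smooth_fun_on_const: "S \<subseteq> Rn n \<Longrightarrow> smooth_fun_on n S (\<lambda>x. c)"
  by (rule smooth_fun_onI, rule exI[of _ "Rn n"], rule exI[of _ "\<lambda>x. c"])
     (auto simp: C_diff_const)

lemma smooth_fun_on_proj: "S \<subseteq> Rn n \<Longrightarrow> smooth_fun_on n S (\<lambda>x. x j)"
  by (rule smooth_fun_onI, rule exI[of _ "Rn n"], rule exI[of _ "\<lambda>x. x j"])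
     (auto simp: C_diff_proj)

lemma smooth_fun_on_combine:
  assumes f: "smooth_fun_on n S f" and g: "smooth_fun_on n S g"
    and C: "\<And>V r f g. openin (Euclidean_space n) V \<Longrightarrow> C_diff n r V f \<Longrightarrow> C_diff n r V g \<Longrightarrow>
      C_diff n r V (\<lambda>x. h (f x) (g x))"
  shows "smooth_fun_on n S (\<lambda>x. h (f x) (g x))"
proof (rule smooth_fun_onI)
  fix x assume x: "x \<in> S"
  obtain V f' where V: "openin (Euclidean_space n) V" "x \<in> V" "\<And>r. C_diff n r V f'"
    "\<And>y. y \<in> V \<Longrightarrow> y \<in> S \<Longrightarrow> f' y = f y"
    using smooth_fun_onE[OF f x] by blast
  obtain U g' where U: "openin (Euclidean_space n) U" "x \<in> U" "\<And>r. C_diff n r U g'"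
    "\<And>y. y \<in> U \<Longrightarrow> y \<in> S \<Longrightarrow> g' y = g y"
    using smooth_fun_onE[OF g x] by blast
  have UV: "openin (Euclidean_space n) (U \<inter> V)" using U V by blast
  have "C_diff n r (U \<inter> V) (\<lambda>x. h (f' x) (g' x))" for r
    by (rule C[OF UV C_diff_subset[OF V(1) UV _ V(3)] C_diff_subset[OF U(1) UV _ U(3)]]) auto
  then show "\<exists>V k. openin (Euclidean_space n) V \<and> x \<in> V \<and> (\<forall>r. C_diff n r V k) \<and>
    (\<forall>y\<in>V \<inter> S. k y = h (f y) (g y))"
    using U V UV by (intro exI[of _ "U \<inter> V"] exI[of _ "\<lambda>x. h (f' x) (g' x)"]) auto
qed

lemma smooth_fun_on_add:
  "smooth_fun_on n S f \<Longrightarrow> smooth_fun_on n S g \<Longrightarrow> smooth_fun_on n S (\<lambda>x. f x + g x)"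
  by (rule smooth_fun_on_combine) (auto intro: C_diff_add)

lemma smooth_fun_on_mult:
  "smooth_fun_on n S f \<Longrightarrow> smooth_fun_on n S g \<Longrightarrow> smooth_fun_on n S (\<lambda>x. f x * g x)"
  by (rule smooth_fun_on_combine) (auto intro: C_diff_mult)

lemma smooth_fun_on_sum:
  assumes "S \<subseteq> Rn n" "\<And>j. j \<in> J \<Longrightarrow> smooth_fun_on n S (f j)"
  shows "smooth_fun_on n S (\<lambda>x. \<Sum>j\<in>J. f j x)"
  using assms(2)
  by (induct J rule: infinite_finite_induct)
     (simp_all add: smooth_fun_on_const[OF assms(1)] smooth_fun_on_add)

lemma smooth_fun_on_continuous:
  assumes "smooth_fun_on n S f" shows "continuous_on S f"
proof (subst continuous_on_open_gen[where T=UNIV])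
  show "\<forall>U. openin (top_of_set UNIV) U \<longrightarrow> openin (top_of_set S) (S \<inter> f -` U)"
  proof (intro allI impI)
    fix U :: "real set" assume "openin (top_of_set UNIV) U"
    then have U: "open U" by simp
    show "openin (top_of_set S) (S \<inter> f -` U)"
    proof (subst openin_subopen, intro ballI)
      fix x assume x: "x \<in> S \<inter> f -` U"
      then obtain V g where V: "openin (Euclidean_space n) V" "x \<in> V" "\<And>r. C_diff n r V g"
        "\<And>y. y \<in> V \<Longrightarrow> y \<in> S \<Longrightarrow> g y = f y"
        using smooth_fun_onE[OF assms, of x] by blast
      have "openin (Euclidean_space n) {y \<in> V. g y \<in> U}"
        by (rule openin_Rn_preimage[OF V(1) C_diff_continuous[OF V(3)] U])
      then obtain T where T: "open T" "{y \<in> V. g y \<in> U} = T \<inter> Rn n"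
        unfolding openin_Rn_iff by blast
      have S: "S \<subseteq> Rn n" using assms by (rule smooth_fun_on_Rn)
      have "S \<inter> T \<subseteq> S \<inter> f -` U"
      proof
        fix y assume y: "y \<in> S \<inter> T"
        then have "y \<in> {y \<in> V. g y \<in> U}" using T(2) S by blast
        then show "y \<in> S \<inter> f -` U" using V(4)[of y] y by auto
      qed
      moreover have "x \<in> S \<inter> T"
        using T(2) x V by auto
      ultimately show "\<exists>T. openin (top_of_set S) T \<and> x \<in> T \<and> T \<subseteq> S \<inter> f -` U"
        using T(1) by (intro exI[of _ "S \<inter> T"]) (auto intro: openin_open_Int)
    qed
  qed
qed auto

lemma smooth_on_component: "smooth_on n m S G \<Longrightarrow> j < m \<Longrightarrow> smooth_fun_on n S (\<lambda>x. G x j)"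
  by (simp add: smooth_on_def)

lemma smooth_on_Rn: "smooth_on n m S G \<Longrightarrow> x \<in> S \<Longrightarrow> G x \<in> Rn m"
  by (auto simp: smooth_on_def)

lemma smooth_on_subset: "smooth_on n m S G \<Longrightarrow> T \<subseteq> S \<Longrightarrow> smooth_on n m T G"
  unfolding smooth_on_def using smooth_fun_on_subset by (metis image_mono order_trans)

lemma smooth_on_cong:
  assumes "smooth_on n m S G" "\<And>x. x \<in> S \<Longrightarrow> G x = H x"
  shows "smooth_on n m S H"
  unfolding smooth_on_def
proof (intro conjI allI impI)
  show "H ` S \<subseteq> Rn m" using assms by (force simp: smooth_on_def)
  show "smooth_fun_on n S (\<lambda>x. H x j)" if "j < m" for j
    by (rule smooth_fun_on_cong[OF smooth_on_component[OF assms(1) that]]) (simp add: assms(2))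
qed

lemma smooth_on_continuous: "smooth_on n m S G \<Longrightarrow> continuous_on S G"
  by (rule continuous_on_Rn[of G S m])
     (auto simp: smooth_on_def intro: smooth_fun_on_continuous)

text \<open>The components extend to different neighbourhoods. There are finitely many, so these can
  be intersected, and then shrunk until the extension lands in W; without the last step it could not
  be composed with an extension living on W.\<close>

lemma smooth_on_extend:
  assumes G: "smooth_on n m S G" and x: "x \<in> S" and W: "openin (Euclidean_space m) W" "G x \<in> W"
    and S: "S \<subseteq> Rn n"
  obtains V G' where "openin (Euclidean_space n) V" "x \<in> V" "\<And>r j. j < m \<Longrightarrow> C_diff n r V (\<lambda>y. G' y j)"
    "G' ` V \<subseteq> W" "\<And>y. y \<in> V \<Longrightarrow> y \<in> S \<Longrightarrow> G' y = G y"
proof -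
  have "\<forall>j. \<exists>V g. j < m \<longrightarrow> openin (Euclidean_space n) V \<and> x \<in> V \<and> (\<forall>r. C_diff n r V g) \<and>
    (\<forall>y\<in>V \<inter> S. g y = G y j)"
    using G x unfolding smooth_on_def smooth_fun_on_def by blast
  then obtain V g where Vg: "\<And>j. j < m \<Longrightarrow> openin (Euclidean_space n) (V j)" "\<And>j. j < m \<Longrightarrow> x \<in> V j"
    "\<And>j r. j < m \<Longrightarrow> C_diff n r (V j) (g j)" "\<And>j y. j < m \<Longrightarrow> y \<in> V j \<Longrightarrow> y \<in> S \<Longrightarrow> g j y = G y j"
    by (metis IntI)
  define V0 where "V0 = {y \<in> Rn n. \<forall>j<m. y \<in> V j}"
  have V0: "openin (Euclidean_space n) V0"
    unfolding V0_def
  proof (rule openin_Rn_Collect_all)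
    fix j assume j: "j < m"
    then have "{y \<in> Rn n. y \<in> V j} = V j" using openin_Rn_subset[OF Vg(1)] by blast
    then show "openin (Euclidean_space n) {y \<in> Rn n. y \<in> V j}" using Vg(1)[OF j] by simp
  qed simp
  define G' where "G' y = (\<lambda>j. if j < m then g j y else 0)" for y
  have C0: "C_diff n r V0 (\<lambda>y. G' y j)" if "j < m" for r j
    using C_diff_subset[OF Vg(1)[OF that] V0 _ Vg(3)[OF that]] that
    by (simp add: G'_def V0_def subset_iff)
  have G'R: "G' y \<in> Rn m" for y by (simp add: G'_def Rn_iff)
  have cont: "continuous_on V0 G'"
    using C0 G'R by (intro continuous_on_Rn[of G' V0 m]) (auto intro: C_diff_continuous)
  obtain T where T: "open T" "W = T \<inter> Rn m" using W(1) unfolding openin_Rn_iff by blast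
  define V1 where "V1 = {y \<in> V0. G' y \<in> T}"
  have V1: "openin (Euclidean_space n) V1"
    unfolding V1_def by (rule openin_Rn_preimage[OF V0 cont T(1)])
  have eq: "G' y = G y" if "y \<in> V0" "y \<in> S" for y
  proof
    fix j show "G' y j = G y j"
      using Vg(4)[of j y] that smooth_on_Rn[OF G that(2)] by (auto simp: G'_def V0_def Rn_iff)
  qed
  show ?thesis
  proof (rule that[OF V1])
    show "x \<in> V1" using x S Vg(2) eq[of x] W(2) T(2) by (auto simp: V1_def V0_def)
    show "C_diff n r V1 (\<lambda>y. G' y j)" if "j < m" for r j
      by (rule C_diff_subset[OF V0 V1 _ C0[OF that]]) (auto simp: V1_def)
    show "G' ` V1 \<subseteq> W" using T(2) G'R by (auto simp: V1_def)
    show "G' y = G y" if "y \<in> V1" "y \<in> S" for y using eq that by (auto simp: V1_def)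
  qed
qed

lemma smooth_fun_on_compose:
  assumes f: "smooth_fun_on m T f" and G: "smooth_on n m S G" "G ` S \<subseteq> T" and S: "S \<subseteq> Rn n"
  shows "smooth_fun_on n S (\<lambda>x. f (G x))"
proof (rule smooth_fun_onI)
  fix x assume x: "x \<in> S"
  obtain W f' where W: "openin (Euclidean_space m) W" "G x \<in> W" "\<And>r. C_diff m r W f'"
    "\<And>y. y \<in> W \<Longrightarrow> y \<in> T \<Longrightarrow> f' y = f y"
    using smooth_fun_onE[OF f, of "G x"] G(2) x by blast
  obtain V G' where V: "openin (Euclidean_space n) V" "x \<in> V" "\<And>r j. j < m \<Longrightarrow> C_diff n r V (\<lambda>y. G' y j)"
    "G' ` V \<subseteq> W" "\<And>y. y \<in> V \<Longrightarrow> y \<in> S \<Longrightarrow> G' y = G y"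
    using smooth_on_extend[OF G(1) x W(1,2) S] by blast
  have "C_diff n r V (\<lambda>x. f' (G' x))" for r
    by (rule C_diff_compose[OF V(1) W(1) V(4) W(3) V(3)])
  moreover have "f' (G' y) = f (G y)" if "y \<in> V \<inter> S" for y
    using that V(4,5) W(4) G(2) by (metis Int_iff image_subset_iff)
  ultimately show "\<exists>V k. openin (Euclidean_space n) V \<and> x \<in> V \<and> (\<forall>r. C_diff n r V k) \<and>
    (\<forall>y\<in>V \<inter> S. k y = f (G y))"
    using V by (intro exI[of _ V] exI[of _ "\<lambda>x. f' (G' x)"]) auto
qed

lemma smooth_on_compose:
  assumes F: "smooth_on m l T F" and G: "smooth_on n m S G" "G ` S \<subseteq> T" and S: "S \<subseteq> Rn n"
  shows "smooth_on n l S (\<lambda>x. F (G x))"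
  unfolding smooth_on_def
proof (intro conjI allI impI)
  show "(\<lambda>x. F (G x)) ` S \<subseteq> Rn l" using F G by (auto simp: smooth_on_def)
  show "smooth_fun_on n S (\<lambda>x. F (G x) j)" if "j < l" for j
    by (rule smooth_fun_on_compose[OF smooth_on_component[OF F that] G S])
qed

text \<open>On a line-perfect set the values on S determine the derivative within S, hence every
  smooth extension computes it. This carries the calculus on open sets over to chart images with
  boundary.\<close>

lemma partial_eq_extension:
  assumes S: "line_perfect n S" and V: "openin (Euclidean_space n) V" "C_diff n (Suc r) V g"
    "\<And>y. y \<in> V \<Longrightarrow> y \<in> S \<Longrightarrow> g y = f y" and x: "x \<in> V" "x \<in> S" "i < n"
  shows "partial S i f x = partial V i g x"
proof (rule partial_eqI[OF S x(2,3)])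
  have "((\<lambda>t. g (x(i := t))) has_real_derivative partial V i g x) (at (x i) within {t. x(i := t) \<in> S \<inter> V})"
    using C_diff_DERIV[OF V(1,2) x(1,3)] by (rule has_field_derivative_at_within)
  then have "((\<lambda>t. f (x(i := t))) has_real_derivative partial V i g x) (at (x i) within {t. x(i := t) \<in> S \<inter> V})"
    by (rule has_field_derivative_transform_within[where d=1]) (use V(3) x in auto)
  then show "((\<lambda>t. f (x(i := t))) has_real_derivative partial V i g x) (at (x i) within {t. x(i := t) \<in> S})"
    using at_within_Int_openin[OF V(1) x(1,3)] by simp
qed

lemma smooth_fun_on_partial:
  assumes S: "line_perfect n S" and f: "smooth_fun_on n S f" and i: "i < n"
  shows "smooth_fun_on n S (partial S i f)"
proof (rule smooth_fun_onI)
  fix x assume x: "x \<in> S"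
  obtain V g where V: "openin (Euclidean_space n) V" "x \<in> V" "\<And>r. C_diff n r V g"
    "\<And>y. y \<in> V \<Longrightarrow> y \<in> S \<Longrightarrow> g y = f y"
    using smooth_fun_onE[OF f x] by blast
  have "C_diff n r V (partial V i g)" for r
    using V(3)[of "Suc r"] i by simp
  moreover have "partial V i g y = partial S i f y" if "y \<in> V \<inter> S" for y
    using partial_eq_extension[OF S V(1) V(3)[of "Suc 0"] V(4) _ _ i, of y] that by auto
  ultimately show "\<exists>V g. openin (Euclidean_space n) V \<and> x \<in> V \<and> (\<forall>r. C_diff n r V g) \<and>
    (\<forall>y\<in>V \<inter> S. g y = partial S i f y)"
    using V by (intro exI[of _ V] exI[of _ "partial V i g"]) auto
qed

lemma partial_compose:
  assumes f: "smooth_fun_on m T f" and G: "smooth_on n m S G" "G ` S \<subseteq> T"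
    and S: "line_perfect n S" and T: "line_perfect m T" and x: "x \<in> S" "i < n"
  shows "partial S i (\<lambda>x. f (G x)) x = (\<Sum>j<m. partial T j f (G x) * partial S i (\<lambda>x. G x j) x)"
proof -
  have SR: "S \<subseteq> Rn n" using S by (simp add: line_perfect_def)
  obtain W f' where W: "openin (Euclidean_space m) W" "G x \<in> W" "\<And>r. C_diff m r W f'"
    "\<And>y. y \<in> W \<Longrightarrow> y \<in> T \<Longrightarrow> f' y = f y"
    using smooth_fun_onE[OF f, of "G x"] G(2) x by blast
  obtain V G' where V: "openin (Euclidean_space n) V" "x \<in> V" "\<And>r j. j < m \<Longrightarrow> C_diff n r V (\<lambda>y. G' y j)"
    "G' ` V \<subseteq> W" "\<And>y. y \<in> V \<Longrightarrow> y \<in> S \<Longrightarrow> G' y = G y"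
    using smooth_on_extend[OF G(1) x(1) W(1,2) SR] by blast
  have eq: "f' (G' y) = f (G y)" if "y \<in> V" "y \<in> S" for y
    using that V(4,5) W(4) G(2) by (metis image_subset_iff)
  have "((\<lambda>t. f' (G' (x(i := t)))) has_real_derivative
        (\<Sum>j<m. partial W j f' (G' (x(i := x i))) * partial V i (\<lambda>x. G' x j) x)) (at (x i))"
  proof (rule chain_rule_curve[OF W(1)])
    show "((\<lambda>t. f' (y(j := t))) has_real_derivative partial W j f' y) (at (y j))" if "j < m" "y \<in> W" for j y
      by (rule C_diff_DERIV[OF W(1,3) that(2,1)])
    show "continuous_on W (partial W j f')" if "j < m" for j
      using W(3)[of "Suc 0"] that by simp
    show "G' (x(i := x i)) \<in> W" using V by auto
    have "\<forall>\<^sub>F t in at (x i). x(i := t) \<in> V"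
      using eventually_upd_mem[OF V(1,2) x(2)] by (simp add: eventually_at_filter eventually_mono)
    then show "\<forall>\<^sub>F t in at (x i). G' (x(i := t)) \<in> Rn m"
      by eventually_elim (use V(4) openin_Rn_subset[OF W(1)] in auto)
    show "((\<lambda>t. G' (x(i := t)) j) has_real_derivative partial V i (\<lambda>x. G' x j) x) (at (x i))" if "j < m" for j
      by (rule C_diff_DERIV[OF V(1) V(3)[OF that] V(2) x(2)])
  qed
  then have "partial V i (\<lambda>y. f' (G' y)) x = (\<Sum>j<m. partial W j f' (G x) * partial V i (\<lambda>x. G' x j) x)"
    using partial_openin[OF V(1,2) x(2)] V(5)[OF V(2) x(1)] by simp
  moreover have "partial S i (\<lambda>y. f (G y)) x = partial V i (\<lambda>y. f' (G' y)) x"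
    by (rule partial_eq_extension[OF S V(1) C_diff_compose[OF V(1) W(1) V(4) W(3) V(3)] eq V(2) x])
  moreover have "partial W j f' (G x) = partial T j f (G x)" if "j < m" for j
    by (rule partial_eq_extension[OF T W(1) W(3) W(4) W(2) _ that, symmetric]) (use G(2) x in auto)
  moreover have "partial V i (\<lambda>x. G' x j) x = partial S i (\<lambda>x. G x j) x" if "j < m" for j
    by (rule partial_eq_extension[OF S V(1) V(3)[OF that] _ V(2) x, symmetric]) (simp add: V(5))
  ultimately show ?thesis by simp
qed

lemma partial_zero:
  assumes "line_perfect n S" "x \<in> S" "i < n" "\<And>y. y \<in> S \<Longrightarrow> f y = c"
  shows "partial S i f x = 0"
proof -
  have "partial S i f x = partial S i (\<lambda>_. c) x" by (rule partial_cong) (use assms in auto)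
  also have "\<dots> = 0" by (rule partial_eqI[OF assms(1-3)]) simp
  finally show ?thesis .
qed

lemma partial_affine:
  assumes "line_perfect n S" "x \<in> S" "i < n" "\<And>y. y \<in> S \<Longrightarrow> f y = a + (\<Sum>j<n. b j * y j)"
  shows "partial S i f x = b i"
proof -
  have *: "a + (\<Sum>j<n. b j * (x(i := t)) j) = a + (\<Sum>j\<in>{..<n} - {i}. b j * x j) + b i * t" for t
    using assms(3) by (simp add: sum.remove[of _ i])
  have "partial S i f x = partial S i (\<lambda>y. a + (\<Sum>j<n. b j * y j)) x"
    by (rule partial_cong) (use assms in auto)
  also have "\<dots> = b i"
    by (rule partial_eqI[OF assms(1-3)], subst *) (auto intro!: derivative_eq_intros)
  finally show ?thesis .
qed

subsection \<open>Differentials\<close>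

lemma differential_Int:
  assumes "openin (Euclidean_space n) V" "x \<in> V"
  shows "differential n (S \<inter> V) F x = differential n S F x"
  using partial_Int[OF assms] by (simp add: differential_def fun_eq_iff)

lemma differential_cong:
  assumes "x \<in> S" "\<And>y. y \<in> S \<Longrightarrow> F y = G y"
  shows "differential n S F x = differential n S G x"
proof -
  have "partial S i (\<lambda>y. F y j) x = partial S i (\<lambda>y. G y j) x" for i j
    by (rule partial_cong) (use assms in auto)
  then show ?thesis by (simp add: differential_def fun_eq_iff)
qed

lemma differential_eq_0:
  assumes "line_perfect n S" "x \<in> S" "\<And>y. y \<in> S \<Longrightarrow> F y j = c"
  shows "differential n S F x v j = 0"
  using partial_zero[OF assms(1,2), of _ "\<lambda>y. F y j" c] assms(3) by (simp add: differential_def)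

lemma differential_Rn:
  assumes "line_perfect n S" "x \<in> S" "F ` S \<subseteq> Rn m"
  shows "differential n S F x v \<in> Rn m"
  unfolding Rn_iff
proof (intro allI impI)
  fix j assume "j \<ge> m"
  then show "differential n S F x v j = 0"
    by (intro differential_eq_0[OF assms(1,2), where c=0]) (use assms(3) in \<open>auto simp: Rn_iff\<close>)
qed

lemma differential_compose:
  assumes F: "smooth_on m l T F" and G: "smooth_on n m S G" "G ` S \<subseteq> T"
    and S: "line_perfect n S" and T: "line_perfect m T" and x: "x \<in> S"
  shows "differential n S (\<lambda>x. F (G x)) x v = differential m T F (G x) (differential n S G x v)"
proof
  fix j
  show "differential n S (\<lambda>x. F (G x)) x v j = differential m T F (G x) (differential n S G x v) j"
  proof (cases "j < l")
    case True
    have "(\<Sum>i<n. partial S i (\<lambda>x. F (G x) j) x * v i) =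
      (\<Sum>i<n. (\<Sum>q<m. partial T q (\<lambda>y. F y j) (G x) * partial S i (\<lambda>x. G x q) x) * v i)"
      using partial_compose[OF smooth_on_component[OF F True] G S T x] by (intro sum.cong) auto
    also have "\<dots> = (\<Sum>i<n. \<Sum>q<m. partial T q (\<lambda>y. F y j) (G x) * (partial S i (\<lambda>x. G x q) x * v i))"
      by (simp add: sum_distrib_right mult.assoc)
    also have "\<dots> = (\<Sum>q<m. \<Sum>i<n. partial T q (\<lambda>y. F y j) (G x) * (partial S i (\<lambda>x. G x q) x * v i))"
      by (rule sum.swap)
    also have "\<dots> = (\<Sum>q<m. partial T q (\<lambda>y. F y j) (G x) * (\<Sum>i<n. partial S i (\<lambda>x. G x q) x * v i))"
      by (simp add: sum_distrib_left)
    finally show ?thesis by (simp add: differential_def)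
  next
    \<comment> \<open>From index l on, \<open>smooth_on\<close> asserts no smoothness but places the
      values in R^l, so both sides are derivatives of the constant 0.\<close>
    case False
    have z: "F y j = 0" if "y \<in> T" for y
      using smooth_on_Rn[OF F that] False by (simp add: Rn_iff)
    have "differential n S (\<lambda>x. F (G x)) x v j = 0"
      by (rule differential_eq_0[OF S x, where c=0]) (use z G(2) in auto)
    moreover have "differential m T F (G x) (differential n S G x v) j = 0"
      by (rule differential_eq_0[OF T, where c=0]) (use z G(2) x in auto)
    ultimately show ?thesis by simp
  qed
qed

lemma differential_unit_vec:
  assumes "i < n" shows "differential n S F x (unit_vec i) j = partial S i (\<lambda>y. F y j) x"
proof -
  have "(\<Sum>q<n. partial S q (\<lambda>y. F y j) x * unit_vec i q) = (\<Sum>q\<in>{i}. partial S q (\<lambda>y. F y j) x * unit_vec i q)"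
    by (rule sum.mono_neutral_right) (use assms in \<open>auto simp: unit_vec_def\<close>)
  then show ?thesis by (simp add: differential_def unit_vec_def)
qed

section \<open>Charts and smooth maps into manifolds\<close>

lemma openin_half_space_iff:
  "openin (half_space n) S \<longleftrightarrow> (\<exists>V. openin (Euclidean_space n) V \<and> S = V \<inter> {x. 0 \<le> x 0})"
  by (auto simp: half_space_def openin_subtopology)

lemma line_perfect_half_space:
  assumes "openin (half_space n) S" shows "line_perfect n S"
proof -
  obtain V where V: "openin (Euclidean_space n) V" "S = V \<inter> {x. 0 \<le> x 0}"
    using assms unfolding openin_half_space_iff by blast
  have "line_perfect n (Rn n \<inter> {x. 0 \<le> x 0})"
    unfolding line_perfect_def
  proof (intro conjI ballI allI impI)
    fix x i assume x: "x \<in> Rn n \<inter> {x. 0 \<le> x 0}" "i < n"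
    \<comment> \<open>Increasing a coordinate never leaves the half-space, so each line through x
      contains a right half-neighbourhood of x.\<close>
    have sub: "{x i<..} \<subseteq> {t. x(i := t) \<in> Rn n \<inter> {x. 0 \<le> x 0}}"
      using x by auto
    show "at (x i) within {t. x(i := t) \<in> Rn n \<inter> {x. 0 \<le> x 0}} \<noteq> bot"
    proof
      assume "at (x i) within {t. x(i := t) \<in> Rn n \<inter> {x. 0 \<le> x 0}} = bot"
      then have "at_right (x i) \<le> bot" using at_le[OF sub] by metis
      then show False by (simp add: bot_unique)
    qed
  qed auto
  moreover have "S = (Rn n \<inter> {x. 0 \<le> x 0}) \<inter> V"
    using V openin_Rn_subset[OF V(1)] by blast
  ultimately show ?thesis using line_perfect_Int V(1) by metis
qed

context
  fixes M :: "'a mfd"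
  assumes M: "smooth_manifold M"
begin

lemma chart_dom_openin: "c \<in> atlas M \<Longrightarrow> openin (mtop M) (chart_dom c)"
  and chart_img_openin: "c \<in> atlas M \<Longrightarrow> openin (half_space (mdim M)) (chart_img c)"
  and chart_homeomorphic: "c \<in> atlas M \<Longrightarrow> homeomorphic_map (subtopology (mtop M) (chart_dom c))
                         (subtopology (half_space (mdim M)) (chart_img c)) (chart_map c)"
  and topspace_mtop: "topspace (mtop M) = (\<Union>c\<in>atlas M. chart_dom c)"
  using M by (simp_all add: smooth_manifold_def)

lemma chart_img_Rn: "c \<in> atlas M \<Longrightarrow> chart_img c \<subseteq> Rn (mdim M)"
  using line_perfect_half_space[OF chart_img_openin] by (auto simp: line_perfect_def)

lemma chart_inj: "c \<in> atlas M \<Longrightarrow> inj_on (chart_map c) (chart_dom c)"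
  using homeomorphic_imp_injective_map[OF chart_homeomorphic, of c]
    openin_subset[OF chart_dom_openin, of c]
  by (simp add: Int_absorb1)

lemma chart_inv_map: "c \<in> atlas M \<Longrightarrow> p \<in> chart_dom c \<Longrightarrow> chart_inv c (chart_map c p) = p"
  by (rule inv_into_f_f[OF chart_inj])

lemma chart_image_openin:
  assumes c: "c \<in> atlas M" and U: "openin (mtop M) U" "U \<subseteq> chart_dom c"
  shows "openin (half_space (mdim M)) (chart_map c ` U)"
proof -
  have "openin (subtopology (mtop M) (chart_dom c)) U"
    using U openin_open_subtopology[OF chart_dom_openin[OF c]] by blast
  then have "openin (subtopology (half_space (mdim M)) (chart_img c)) (chart_map c ` U)"
    using homeomorphic_map_openness_eq[OF chart_homeomorphic[OF c]] by blast
  then show ?thesis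
    using openin_open_subtopology[OF chart_img_openin[OF c]] by blast
qed

lemma transition_smooth:
  assumes "c \<in> atlas M" "d \<in> atlas M"
  shows "smooth_on (mdim M) (mdim M) (chart_map c ` (chart_dom c \<inter> chart_dom d))
    (\<lambda>x. chart_map d (chart_inv c x))"
proof -
  have "smooth_on (mdim M) (mdim M) (chart_map c ` {p \<in> chart_dom c. id p \<in> chart_dom d})
          (chart_map d \<circ> id \<circ> chart_inv c)"
    using M assms unfolding smooth_manifold_def smooth_map_def by blast
  moreover have "{p \<in> chart_dom c. id p \<in> chart_dom d} = chart_dom c \<inter> chart_dom d" by auto
  ultimately show ?thesis by (simp add: comp_def)
qed

lemma chart_at: 
  assumes "p \<in> topspace (mtop M)"
  shows "chart_at M p \<in> atlas M" "p \<in> chart_dom (chart_at M p)"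
proof -
  have "\<exists>c. c \<in> atlas M \<and> p \<in> chart_dom c" using assms topspace_mtop by auto
  from someI_ex[OF this] show "chart_at M p \<in> atlas M" "p \<in> chart_dom (chart_at M p)"
    unfolding chart_at_def by auto
qed

end

lemma chart_inv_mem: "x \<in> chart_img c \<Longrightarrow> chart_inv c x \<in> chart_dom c"
  by (rule inv_into_into)

lemma chart_map_inv: "x \<in> chart_img c \<Longrightarrow> chart_map c (chart_inv c x) = x"
  by (rule f_inv_into_f)

text \<open>One notion for simplices, prisms of simplices, slices of prisms and inverse charts,
  closed under composition on both sides. Unlike \<open>smooth_simplex\<close> it does not constrain
  the values outside S.\<close>

definition smooth_into :: "nat \<Rightarrow> (nat \<Rightarrow> real) set \<Rightarrow> 'a mfd \<Rightarrow> ((nat \<Rightarrow> real) \<Rightarrow> 'a) \<Rightarrow> bool" where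
  "smooth_into n S M g \<longleftrightarrow> S \<subseteq> Rn n \<and> continuous_map (top_of_set S) (mtop M) g \<and>
     (\<forall>c\<in>atlas M. smooth_on n (mdim M) {y \<in> S. g y \<in> chart_dom c} (\<lambda>y. chart_map c (g y)))"

lemma smooth_into_Rn: "smooth_into n S M g \<Longrightarrow> S \<subseteq> Rn n"
  by (simp add: smooth_into_def)

lemma smooth_into_smooth_on:
  "smooth_into n S M g \<Longrightarrow> c \<in> atlas M \<Longrightarrow>
    smooth_on n (mdim M) {y \<in> S. g y \<in> chart_dom c} (\<lambda>y. chart_map c (g y))"
  by (simp add: smooth_into_def)

lemma smooth_into_topspace: "smooth_into n S M g \<Longrightarrow> x \<in> S \<Longrightarrow> g x \<in> topspace (mtop M)"
  by (auto simp: smooth_into_def continuous_map_def)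

lemma openin_top_of_set_Rn:
  assumes "openin (top_of_set S) P" "S \<subseteq> Rn n"
  obtains V where "openin (Euclidean_space n) V" "P = S \<inter> V"
proof -
  obtain T where "open T" "P = S \<inter> T" using assms(1) by (auto simp: openin_open)
  then show ?thesis
    using assms(2) by (intro that[of "T \<inter> Rn n"]) (auto simp: openin_Rn_iff)
qed

lemma smooth_into_preimage:
  assumes "smooth_into n S M g" "openin (mtop M) U"
  obtains V where "openin (Euclidean_space n) V" "{y \<in> S. g y \<in> U} = S \<inter> V"
proof -
  have "openin (top_of_set S) {y \<in> S. g y \<in> U}"
    using assms unfolding smooth_into_def continuous_map_def by auto
  then show ?thesis
    using openin_top_of_set_Rn[OF _ smooth_into_Rn[OF assms(1)]] that by blast
qed

lemma line_perfect_preimage: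
  assumes "smooth_into n S M g" "openin (mtop M) U" "line_perfect n S"
  shows "line_perfect n {y \<in> S. g y \<in> U}"
  using smooth_into_preimage[OF assms(1,2)] line_perfect_Int[OF assms(3)] by metis

lemma smooth_on_local:
  assumes "\<And>x. x \<in> S \<Longrightarrow> \<exists>V. openin (Euclidean_space n) V \<and> x \<in> V \<and> smooth_on n m (S \<inter> V) F"
  shows "smooth_on n m S F"
  unfolding smooth_on_def
proof (intro conjI allI impI)
  show "F ` S \<subseteq> Rn m"
    using assms smooth_on_Rn by (metis IntI image_subsetI)
  show "smooth_fun_on n S (\<lambda>x. F x j)" if "j < m" for j
  proof (rule smooth_fun_on_local)
    fix x assume "x \<in> S"
    then obtain V where "openin (Euclidean_space n) V" "x \<in> V" "smooth_on n m (S \<inter> V) F"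
      using assms by metis
    then show "\<exists>V. openin (Euclidean_space n) V \<and> x \<in> V \<and> smooth_fun_on n (S \<inter> V) (\<lambda>x. F x j)"
      using smooth_on_component[OF _ that] by blast
  qed
qed

lemma smooth_into_cong:
  assumes g: "smooth_into n S M g" "\<And>x. x \<in> S \<Longrightarrow> g x = h x"
  shows "smooth_into n S M h"
  unfolding smooth_into_def
proof (intro conjI ballI)
  show "S \<subseteq> Rn n" using g(1) by (rule smooth_into_Rn)
  show "continuous_map (top_of_set S) (mtop M) h"
    by (rule continuous_map_eq[of _ _ g]) (use g in \<open>auto simp: smooth_into_def\<close>)
  fix c assume c: "c \<in> atlas M"
  have eq: "{y \<in> S. h y \<in> chart_dom c} = {y \<in> S. g y \<in> chart_dom c}" using g(2) by auto
  show "smooth_on n (mdim M) {y \<in> S. h y \<in> chart_dom c} (\<lambda>y. chart_map c (h y))"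
    unfolding eq by (rule smooth_on_cong[OF smooth_into_smooth_on[OF g(1) c]]) (simp add: g(2))
qed

lemma smooth_into_compose:
  assumes g: "smooth_into m T M g" and \<phi>: "smooth_on n m S \<phi>" "\<phi> ` S \<subseteq> T" and S: "S \<subseteq> Rn n"
  shows "smooth_into n S M (\<lambda>x. g (\<phi> x))"
  unfolding smooth_into_def
proof (intro conjI ballI)
  have "continuous_map (top_of_set S) (top_of_set T) \<phi>"
    using smooth_on_continuous[OF \<phi>(1)] \<phi>(2)
    by (auto simp: continuous_map_in_subtopology)
  from continuous_map_compose[OF this, of "mtop M" g]
  show "continuous_map (top_of_set S) (mtop M) (\<lambda>x. g (\<phi> x))"
    using g by (simp add: comp_def smooth_into_def)
  fix c assume c: "c \<in> atlas M"
  show "smooth_on n (mdim M) {y \<in> S. g (\<phi> y) \<in> chart_dom c} (\<lambda>y. chart_map c (g (\<phi> y)))"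
    by (rule smooth_on_compose[OF smooth_into_smooth_on[OF g c]])
       (use smooth_on_subset[OF \<phi>(1)] \<phi>(2) S in auto)
qed (rule S)

text \<open>With inverse charts as parametrizations, a pull-back along a map of manifolds becomes a
  pull-back along a map from a subset of R^n, and a simplex inside a chart can be written down in
  coordinates.\<close>

lemma smooth_into_chart_inv:
  assumes M: "smooth_manifold M" and c: "c \<in> atlas M"
  shows "smooth_into (mdim M) (chart_img c) M (chart_inv c)"
  unfolding smooth_into_def
proof (intro conjI ballI)
  show "chart_img c \<subseteq> Rn (mdim M)" by (rule chart_img_Rn[OF M c])
  obtain V0 where V0: "chart_img c = V0 \<inter> {x. 0 \<le> x 0}" 
    using chart_img_openin[OF M c] unfolding openin_half_space_iff by blast
  show "continuous_map (top_of_set (chart_img c)) (mtop M) (chart_inv c)"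
    unfolding continuous_map_def
  proof (intro conjI allI impI)
    show "chart_inv c \<in> topspace (top_of_set (chart_img c)) \<rightarrow> topspace (mtop M)"
      using chart_inv_mem[of _ c] openin_subset[OF chart_dom_openin[OF M c]] by auto
    fix U assume U: "openin (mtop M) U"
    have "{x \<in> topspace (top_of_set (chart_img c)). chart_inv c x \<in> U} = chart_map c ` (U \<inter> chart_dom c)"
    proof (intro equalityI subsetI)
      fix x assume "x \<in> {x \<in> topspace (top_of_set (chart_img c)). chart_inv c x \<in> U}"
      then have "x \<in> chart_img c" "chart_inv c x \<in> U" by auto
      then have "chart_map c (chart_inv c x) \<in> chart_map c ` (U \<inter> chart_dom c)"
        by (intro imageI IntI chart_inv_mem)
      then show "x \<in> chart_map c ` (U \<inter> chart_dom c)"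
        by (simp only: chart_map_inv[OF \<open>x \<in> chart_img c\<close>])
    qed (auto simp: chart_inv_map[OF M c])
    moreover have "openin (half_space (mdim M)) (chart_map c ` (U \<inter> chart_dom c))"
      by (rule chart_image_openin[OF M c]) (use U chart_dom_openin[OF M c] in auto)
    then obtain V where V: "openin (Euclidean_space (mdim M)) V"
      "chart_map c ` (U \<inter> chart_dom c) = V \<inter> {x. 0 \<le> x 0}"
      unfolding openin_half_space_iff by blast
    then obtain T where T: "open T" "V = T \<inter> Rn (mdim M)" unfolding openin_Rn_iff by blast
    have "chart_map c ` (U \<inter> chart_dom c) \<subseteq> chart_img c" by auto
    then have "chart_map c ` (U \<inter> chart_dom c) = chart_img c \<inter> T"
      using V(2) T(2) V0 chart_img_Rn[OF M c] by blast
    ultimately show "openin (top_of_set (chart_img c))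
       {x \<in> topspace (top_of_set (chart_img c)). chart_inv c x \<in> U}"
      using T(1) by (simp add: openin_open_Int)
  qed
  fix d assume d: "d \<in> atlas M"
  have "{y \<in> chart_img c. chart_inv c y \<in> chart_dom d} = chart_map c ` (chart_dom c \<inter> chart_dom d)"
  proof (intro equalityI subsetI)
    fix x assume "x \<in> {y \<in> chart_img c. chart_inv c y \<in> chart_dom d}"
    then have x: "x \<in> chart_img c" "chart_inv c x \<in> chart_dom d" by simp_all
    then have "chart_map c (chart_inv c x) \<in> chart_map c ` (chart_dom c \<inter> chart_dom d)"
      by (intro imageI IntI chart_inv_mem)
    then show "x \<in> chart_map c ` (chart_dom c \<inter> chart_dom d)"
      by (simp only: chart_map_inv[OF x(1)])
  qed (auto simp: chart_inv_map[OF M c])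
  then show "smooth_on (mdim M) (mdim M) {y \<in> chart_img c. chart_inv c y \<in> chart_dom d}
     (\<lambda>y. chart_map d (chart_inv c y))"
    using transition_smooth[OF M c d] by simp
qed

text \<open>Near a point of S the composite is the coordinate expression of \<open>\<rho>\<close>
  after that of g. Smoothness is local, so the chart of A may depend on the point.\<close>

lemma smooth_into_map:
  assumes A: "smooth_manifold A" and M: "smooth_manifold M" and \<rho>: "smooth_map A M \<rho>"
    and g: "smooth_into n S A g"
  shows "smooth_into n S M (\<lambda>x. \<rho> (g x))"
  unfolding smooth_into_def
proof (intro conjI ballI)
  show S: "S \<subseteq> Rn n" using g by (rule smooth_into_Rn)
  have "continuous_map (top_of_set S) (mtop A) g" "continuous_map (mtop A) (mtop M) \<rho>"
    using g \<rho> by (simp_all add: smooth_into_def smooth_map_def)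
  from continuous_map_compose[OF this] show "continuous_map (top_of_set S) (mtop M) (\<lambda>x. \<rho> (g x))"
    by (simp add: comp_def)
  fix d assume d: "d \<in> atlas M"
  show "smooth_on n (mdim M) {y \<in> S. \<rho> (g y) \<in> chart_dom d} (\<lambda>y. chart_map d (\<rho> (g y)))"
  proof (rule smooth_on_local)
    fix x assume x: "x \<in> {y \<in> S. \<rho> (g y) \<in> chart_dom d}"
    then have "g x \<in> topspace (mtop A)" using smooth_into_topspace[OF g] by auto
    then obtain c where c: "c \<in> atlas A" "g x \<in> chart_dom c" using topspace_mtop[OF A] by auto
    obtain V where V: "openin (Euclidean_space n) V" "{y \<in> S. g y \<in> chart_dom c} = S \<inter> V"
      using smooth_into_preimage[OF g chart_dom_openin[OF A c(1)]] by metis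
    have R: "smooth_on (mdim A) (mdim M) (chart_map c ` {p \<in> chart_dom c. \<rho> p \<in> chart_dom d})
          (chart_map d \<circ> \<rho> \<circ> chart_inv c)"
      using \<rho> c(1) d unfolding smooth_map_def by blast
    let ?S' = "{y \<in> S. \<rho> (g y) \<in> chart_dom d} \<inter> V"
    have S': "y \<in> S" "g y \<in> chart_dom c" "\<rho> (g y) \<in> chart_dom d" if "y \<in> ?S'" for y
      using that V(2) by blast+
    have "smooth_on n (mdim M) ?S' (\<lambda>y. (chart_map d \<circ> \<rho> \<circ> chart_inv c) (chart_map c (g y)))"
    proof (rule smooth_on_compose[OF R])
      show "smooth_on n (mdim A) ?S' (\<lambda>y. chart_map c (g y))"
        by (rule smooth_on_subset[OF smooth_into_smooth_on[OF g c(1)]]) (use S' in blast)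
      show "(\<lambda>y. chart_map c (g y)) ` ?S' \<subseteq> chart_map c ` {p \<in> chart_dom c. \<rho> p \<in> chart_dom d}"
        using S'(2,3) by blast
      show "?S' \<subseteq> Rn n" using S'(1) S by blast
    qed
    then have "smooth_on n (mdim M) ?S' (\<lambda>y. chart_map d (\<rho> (g y)))"
    proof (rule smooth_on_cong)
      fix y assume "y \<in> ?S'"
      then show "(chart_map d \<circ> \<rho> \<circ> chart_inv c) (chart_map c (g y)) = chart_map d (\<rho> (g y))"
        by (simp only: comp_apply chart_inv_map[OF A c(1) S'(2)])
    qed
    then show "\<exists>V. openin (Euclidean_space n) V \<and> x \<in> V \<and>
       smooth_on n (mdim M) ({y \<in> S. \<rho> (g y) \<in> chart_dom d} \<inter> V) (\<lambda>y. chart_map d (\<rho> (g y)))"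
      using V x c(2) by (intro exI[of _ V]) auto
  qed
qed

section \<open>Alternating forms\<close>

lemma unit_vec_Rn: "j < m \<Longrightarrow> unit_vec j \<in> Rn m"
  by (simp add: unit_vec_def Rn_iff)

lemma alternating_wrong: "alternating m k \<alpha> \<Longrightarrow> \<not> (length vs = k \<and> set vs \<subseteq> Rn m) \<Longrightarrow> \<alpha> vs = 0"
  by (simp add: alternating_def)

lemma alternating_linear:
  assumes \<alpha>: "alternating m k \<alpha>" and len: "length us + Suc (length ws) = k"
    and R: "set us \<subseteq> Rn m" "set ws \<subseteq> Rn m" "u \<in> Rn m" "w \<in> Rn m"
  shows "\<alpha> (us @ (\<lambda>j. a * u j + w j) # ws) = a * \<alpha> (us @ u # ws) + \<alpha> (us @ w # ws)"
proof -
  have "\<forall>vs i a. \<forall>u\<in>Rn m. \<forall>w\<in>Rn m. length vs = k \<and> set vs \<subseteq> Rn m \<and> i < k \<longrightarrow>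
        \<alpha> (vs[i := (\<lambda>j. a * u j + w j)]) = a * \<alpha> (vs[i := u]) + \<alpha> (vs[i := w])"
    using \<alpha> unfolding alternating_def by blast
  from this[rule_format, OF R(3,4), of "us @ w # ws" "length us" a]
  show ?thesis using len R by auto
qed

lemma alternating_zero:
  assumes \<alpha>: "alternating m k \<alpha>" and len: "length us + Suc (length ws) = k"
    and R: "set us \<subseteq> Rn m" "set ws \<subseteq> Rn m"
  shows "\<alpha> (us @ (\<lambda>_. 0) # ws) = 0"
  using alternating_linear[OF \<alpha> len R, of "\<lambda>_. 0" "\<lambda>_. 0" 1] by (simp add: Rn_iff)

lemma alternating_expand:
  assumes \<alpha>: "alternating m k \<alpha>" and len: "length us + Suc (length ws) = k"
    and R: "set us \<subseteq> Rn m" "set ws \<subseteq> Rn m" "w \<in> Rn m"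
  shows "\<alpha> (us @ w # ws) = (\<Sum>j<m. w j * \<alpha> (us @ unit_vec j # ws))"
proof -
  \<comment> \<open>The vector is truncated after its first p coordinates; each step of the
    induction adds one coordinate by linearity.\<close>
  have "p \<le> m \<Longrightarrow> \<alpha> (us @ (\<lambda>j. if j < p then w j else 0) # ws) = (\<Sum>j<p. w j * \<alpha> (us @ unit_vec j # ws))" for p
  proof (induct p)
    case 0
    then show ?case using alternating_zero[OF \<alpha> len R(1,2)] by simp
  next
    case (Suc p)
    have "(\<lambda>j. if j < Suc p then w j else 0) = (\<lambda>j. w p * unit_vec p j + (if j < p then w j else 0))"
      by (auto simp: unit_vec_def fun_eq_iff less_Suc_eq)
    moreover have "(\<lambda>j. if j < p then w j else 0) \<in> Rn m" using Suc by (auto simp: Rn_iff)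
    ultimately show ?case
      using Suc alternating_linear[OF \<alpha> len R(1,2) unit_vec_Rn[of p m], of "\<lambda>j. if j < p then w j else 0" "w p"]
      by simp
  qed
  from this[of m] have "\<alpha> (us @ (\<lambda>j. if j < m then w j else 0) # ws) = (\<Sum>j<m. w j * \<alpha> (us @ unit_vec j # ws))"
    by simp
  moreover have "(\<lambda>j. if j < m then w j else 0) = w" using R(3) by (auto simp: Rn_iff fun_eq_iff)
  ultimately show ?thesis by simp
qed

text \<open>Instantiated with smoothness and with continuity for \<open>P\<close>.\<close>

lemma alternating_closed_class:
  fixes P :: "('x \<Rightarrow> real) \<Rightarrow> bool"
  assumes cong: "\<And>f g. P f \<Longrightarrow> (\<And>x. x \<in> D \<Longrightarrow> f x = g x) \<Longrightarrow> P g"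
    and zero: "P (\<lambda>_. 0)" and add: "\<And>f g. P f \<Longrightarrow> P g \<Longrightarrow> P (\<lambda>x. f x + g x)"
    and mult: "\<And>f g. P f \<Longrightarrow> P g \<Longrightarrow> P (\<lambda>x. f x * g x)"
    and alt: "\<And>x. x \<in> D \<Longrightarrow> alternating m k (\<alpha> x)"
    and coeff: "\<And>js. length js = k \<Longrightarrow> set js \<subseteq> {..<m} \<Longrightarrow> P (\<lambda>x. \<alpha> x (map unit_vec js))"
    and ps: "length ps + length vs = k" "set ps \<subseteq> {..<m}"
    and vs: "\<And>v x. v \<in> set vs \<Longrightarrow> x \<in> D \<Longrightarrow> v x \<in> Rn m" "\<And>v j. v \<in> set vs \<Longrightarrow> j < m \<Longrightarrow> P (\<lambda>x. v x j)"
  shows "P (\<lambda>x. \<alpha> x (map unit_vec ps @ map (\<lambda>v. v x) vs))"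
  using ps vs
proof (induct vs arbitrary: ps)
  case Nil
  then show ?case using coeff[of ps] by simp
next
  case (Cons v vs)
  have psum: "P (\<lambda>x. \<Sum>j<q. h j x)" if "\<And>j. j < q \<Longrightarrow> P (h j)" for h and q :: nat
    using that by (induct q) (simp_all add: zero add)
  \<comment> \<open>The variable arguments are expanded one after the other in unit vectors, whose
    indices move into \<open>ps\<close>; in the end only the coefficient functions of the form
    remain.\<close>
  have "P (\<lambda>x. \<Sum>j<m. v x j * \<alpha> x (map unit_vec (ps @ [j]) @ map (\<lambda>v. v x) vs))"
  proof (rule psum, rule mult)
    fix j assume j: "j < m"
    show "P (\<lambda>x. v x j)" by (rule Cons.prems(4)) (use j in auto)
    show "P (\<lambda>x. \<alpha> x (map unit_vec (ps @ [j]) @ map (\<lambda>v. v x) vs))"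
    proof (rule Cons.hyps)
      show "length (ps @ [j]) + length vs = k" using Cons.prems(1) by simp
      show "set (ps @ [j]) \<subseteq> {..<m}" using Cons.prems(2) j by simp
    qed (use Cons.prems(3,4) in auto)
  qed
  then show ?case
  proof (rule cong)
    fix x assume x: "x \<in> D"
    have "\<alpha> x (map unit_vec ps @ v x # map (\<lambda>v. v x) vs) =
      (\<Sum>j<m. v x j * \<alpha> x (map unit_vec ps @ unit_vec j # map (\<lambda>v. v x) vs))"
    proof (rule alternating_expand[OF alt[OF x]])
      show "set (map unit_vec ps) \<subseteq> Rn m" using Cons.prems(2) by (auto intro: unit_vec_Rn)
    qed (use Cons.prems x in auto)
    then show "(\<Sum>j<m. v x j * \<alpha> x (map unit_vec (ps @ [j]) @ map (\<lambda>v. v x) vs)) =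
      \<alpha> x (map unit_vec ps @ map (\<lambda>v. v x) (v # vs))" by simp
  qed
qed

lemma alternating_ext:
  assumes \<alpha>: "alternating m k \<alpha>" and \<beta>: "alternating m k \<beta>"
    and eq: "\<And>js. length js = k \<Longrightarrow> set js \<subseteq> {..<m} \<Longrightarrow> \<alpha> (map unit_vec js) = \<beta> (map unit_vec js)"
  shows "\<alpha> vs = \<beta> vs"
proof (cases "length vs = k \<and> set vs \<subseteq> Rn m")
  case True
  have "length ps + length vs = k \<Longrightarrow> set ps \<subseteq> {..<m} \<Longrightarrow> set vs \<subseteq> Rn m \<Longrightarrow>
    \<alpha> (map unit_vec ps @ vs) = \<beta> (map unit_vec ps @ vs)" for ps
  proof (induct vs arbitrary: ps)
    case (Cons v vs)
    have ps: "set (map unit_vec ps) \<subseteq> Rn m" using Cons.prems(2) by (auto intro: unit_vec_Rn)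
    have "\<alpha> (map unit_vec (ps @ [j]) @ vs) = \<beta> (map unit_vec (ps @ [j]) @ vs)" if "j < m" for j
      by (rule Cons.hyps) (use that Cons.prems in auto)
    then show ?case
      using alternating_expand[OF \<alpha> _ ps, of vs v] alternating_expand[OF \<beta> _ ps, of vs v] Cons.prems
      by simp
  qed (use eq in simp)
  from this[of "[]"] True show ?thesis by simp
next
  case False
  then show ?thesis using alternating_wrong[OF \<alpha>] alternating_wrong[OF \<beta>] by simp
qed

section \<open>Pull-back of forms\<close>

lemma pull_at_eq:
  "pull_at M n S g \<omega> x vs =
    \<omega> (chart_at M (g x)) (chart_map (chart_at M (g x)) (g x))
      (map (differential n {y \<in> S. g y \<in> chart_dom (chart_at M (g x))}
         (\<lambda>y. chart_map (chart_at M (g x)) (g y)) x) vs)"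
  by (simp add: pull_at_def Let_def comp_def)

lemma form_alternating:
  "differential_form M k \<omega> \<Longrightarrow> c \<in> atlas M \<Longrightarrow> x \<in> chart_img c \<Longrightarrow> alternating (mdim M) k (\<omega> c x)"
  unfolding differential_form_def by blast

lemma form_smooth:
  "differential_form M k \<omega> \<Longrightarrow> c \<in> atlas M \<Longrightarrow> length js = k \<Longrightarrow> set js \<subseteq> {..<mdim M} \<Longrightarrow>
     smooth_fun_on (mdim M) (chart_img c) (\<lambda>x. \<omega> c x (map unit_vec js))"
  by (simp add: differential_form_def)

lemma form_transition:
  assumes "differential_form M k \<omega>" "c \<in> atlas M" "d \<in> atlas M" "p \<in> chart_dom c" "p \<in> chart_dom d"
    "length vs = k" "set vs \<subseteq> Rn (mdim M)"
  shows "\<omega> c (chart_map c p) vs =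
        \<omega> d (chart_map d p)
          (map (differential (mdim M) (chart_map c ` (chart_dom c \<inter> chart_dom d))
                  (\<lambda>x. chart_map d (chart_inv c x)) (chart_map c p)) vs)"
proof -
  have "\<forall>c\<in>atlas M. \<forall>d\<in>atlas M. \<forall>p\<in>chart_dom c \<inter> chart_dom d. \<forall>vs.
        length vs = k \<and> set vs \<subseteq> Rn (mdim M) \<longrightarrow>
        \<omega> c (chart_map c p) vs =
        \<omega> d (chart_map d p)
          (map (differential (mdim M) (chart_map c ` (chart_dom c \<inter> chart_dom d))
                  (chart_map d \<circ> chart_inv c) (chart_map c p)) vs)"
    using assms(1) unfolding differential_form_def by (elim conjE)
  from this[rule_format, OF assms(2,3) IntI[OF assms(4,5)] conjI[OF assms(6,7)]]
  show ?thesis by (simp add: comp_def)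
qed

lemma pull_at_Int:
  assumes "openin (Euclidean_space n) V" "x \<in> V"
  shows "pull_at M n (S \<inter> V) g \<omega> x vs = pull_at M n S g \<omega> x vs"
proof -
  have "{y \<in> S \<inter> V. g y \<in> D} = {y \<in> S. g y \<in> D} \<inter> V" for D by auto
  then show ?thesis by (simp add: pull_at_eq differential_Int[OF assms])
qed

lemma pull_at_cong:
  assumes M: "smooth_manifold M" and x: "x \<in> S" "g x \<in> topspace (mtop M)"
    and eq: "\<And>y. y \<in> S \<Longrightarrow> g y = h y"
  shows "pull_at M n S g \<omega> x vs = pull_at M n S h \<omega> x vs"
proof -
  define d where "d = chart_at M (g x)"
  have d: "g x \<in> chart_dom d" using chart_at[OF M x(2)] by (simp add: d_def)
  have S: "{y \<in> S. g y \<in> chart_dom d} = {y \<in> S. h y \<in> chart_dom d}" using eq by auto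
  have "differential n {y \<in> S. g y \<in> chart_dom d} (\<lambda>y. chart_map d (g y)) x =
    differential n {y \<in> S. g y \<in> chart_dom d} (\<lambda>y. chart_map d (h y)) x"
    by (rule differential_cong) (use x d eq in auto)
  moreover have "h x = g x" using eq x by simp
  ultimately show ?thesis
    unfolding pull_at_eq by (simp add: d_def[symmetric] S)
qed

text \<open>\<open>pull_at\<close> selects the chart by choice at each point, so nothing can be said
  about its dependence on the point directly. The transition law of forms and the chain rule allow
  any chart around \<open>g x\<close> instead, which can then be kept fixed on a
  neighbourhood.\<close>

lemma pull_at_chart:
  assumes M: "smooth_manifold M" and \<omega>: "differential_form M k \<omega>" and g: "smooth_into n S M g"
    and S: "line_perfect n S" and x: "x \<in> S" and d: "d \<in> atlas M" "g x \<in> chart_dom d"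
  shows "pull_at M n S g \<omega> x vs =
    \<omega> d (chart_map d (g x))
      (map (differential n {y \<in> S. g y \<in> chart_dom d} (\<lambda>y. chart_map d (g y)) x) vs)"
proof -
  define e where "e = chart_at M (g x)"
  have e: "e \<in> atlas M" "g x \<in> chart_dom e"
    using chart_at[OF M smooth_into_topspace[OF g x]] by (simp_all add: e_def)
  define Se where "Se = {y \<in> S. g y \<in> chart_dom e}"
  define Sd where "Sd = {y \<in> S. g y \<in> chart_dom d}"
  define De where "De = differential n Se (\<lambda>y. chart_map e (g y)) x"
  define Dd where "Dd = differential n Sd (\<lambda>y. chart_map d (g y)) x"
  have L: "pull_at M n S g \<omega> x vs = \<omega> e (chart_map e (g x)) (map De vs)"
    by (simp add: pull_at_eq e_def De_def Se_def)
  show ?thesis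
  proof (cases "length vs = k")
    \<comment> \<open>The transition law speaks only of lists of length k; for other lengths both
      sides are the default value 0.\<close>
    case False
    have "\<omega> e (chart_map e (g x)) (map De vs) = 0" "\<omega> d (chart_map d (g x)) (map Dd vs) = 0"
      using False e d by (auto intro!: alternating_wrong[OF form_alternating[OF \<omega>]])
    then show ?thesis using L by (simp add: Dd_def Sd_def)
  next
    case True
    obtain Ve where Ve: "openin (Euclidean_space n) Ve" "Se = S \<inter> Ve"
      using smooth_into_preimage[OF g chart_dom_openin[OF M e(1)]] unfolding Se_def by metis
    obtain Vd where Vd: "openin (Euclidean_space n) Vd" "Sd = S \<inter> Vd"
      using smooth_into_preimage[OF g chart_dom_openin[OF M d(1)]] unfolding Sd_def by metis
    have xS: "x \<in> Se" "x \<in> Sd" using x e d by (auto simp: Se_def Sd_def)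
    have lp: "line_perfect n Se" "line_perfect n (Se \<inter> Vd)"
      using line_perfect_Int S Ve Vd by metis+
    have De: "De v \<in> Rn (mdim M)" for v
      unfolding De_def
      by (rule differential_Rn[OF lp(1) xS(1)])
        (use smooth_into_smooth_on[OF g e(1)] in \<open>auto simp: smooth_on_def Se_def\<close>)
    let ?T = "chart_map e ` (chart_dom e \<inter> chart_dom d)"
    \<comment> \<open>The two coordinate expressions are compared on the part of S that g sends into
      both chart domains. It is relatively open in S, so restricting to it does not change the
      differentials.\<close>
    have "differential (mdim M) ?T (\<lambda>x. chart_map d (chart_inv e x)) (chart_map e (g x)) (De v) = Dd v" for v
    proof -
      have mem: "y \<in> Se" "y \<in> Sd" if "y \<in> Se \<inter> Vd" for y using that Ve(2) Vd(2) by auto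
      have "differential n (Se \<inter> Vd) (\<lambda>y. chart_map d (chart_inv e (chart_map e (g y)))) x v =
        differential (mdim M) ?T (\<lambda>x. chart_map d (chart_inv e x)) (chart_map e (g x))
          (differential n (Se \<inter> Vd) (\<lambda>y. chart_map e (g y)) x v)"
      proof (rule differential_compose[OF transition_smooth[OF M e(1) d(1)]])
        show "smooth_on n (mdim M) (Se \<inter> Vd) (\<lambda>y. chart_map e (g y))"
          by (rule smooth_on_subset[OF smooth_into_smooth_on[OF g e(1)]]) (auto simp: Se_def)
        show "(\<lambda>y. chart_map e (g y)) ` (Se \<inter> Vd) \<subseteq> ?T"
        proof
          fix z assume "z \<in> (\<lambda>y. chart_map e (g y)) ` (Se \<inter> Vd)"
          then obtain y where y: "y \<in> Se \<inter> Vd" "z = chart_map e (g y)" by blast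
          have "g y \<in> chart_dom e" "g y \<in> chart_dom d"
            using mem[OF y(1)] by (simp_all add: Se_def Sd_def)
          then show "z \<in> ?T" using y(2) by blast
        qed
        show "line_perfect (mdim M) ?T"
          by (rule line_perfect_half_space[OF chart_image_openin[OF M e(1)]])
            (intro openin_Int chart_dom_openin[OF M] e d Int_lower1)+
      qed (use lp xS Vd in auto)
      also have "differential n (Se \<inter> Vd) (\<lambda>y. chart_map e (g y)) x v = De v"
        using xS Vd by (subst differential_Int[OF Vd(1)]) (auto simp: De_def)
      finally have "differential (mdim M) ?T (\<lambda>x. chart_map d (chart_inv e x)) (chart_map e (g x)) (De v) =
        differential n (Se \<inter> Vd) (\<lambda>y. chart_map d (chart_inv e (chart_map e (g y)))) x v" by simp
      also have "\<dots> = differential n (Se \<inter> Vd) (\<lambda>y. chart_map d (g y)) x v"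
      proof -
        have "differential n (Se \<inter> Vd) (\<lambda>y. chart_map d (chart_inv e (chart_map e (g y)))) x =
          differential n (Se \<inter> Vd) (\<lambda>y. chart_map d (g y)) x"
        proof (rule differential_cong)
          fix y assume "y \<in> Se \<inter> Vd"
          then have "g y \<in> chart_dom e" by (simp add: Se_def)
          then show "chart_map d (chart_inv e (chart_map e (g y))) = chart_map d (g y)"
            by (simp add: chart_inv_map[OF M e(1)])
        qed (use xS Vd in auto)
        then show ?thesis by simp
      qed
      also have "Se \<inter> Vd = Sd \<inter> Ve" using Ve(2) Vd(2) by auto
      also have "differential n (Sd \<inter> Ve) (\<lambda>y. chart_map d (g y)) x v = Dd v"
        using xS Ve by (subst differential_Int[OF Ve(1)]) (auto simp: Dd_def)
      finally show ?thesis .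
    qed
    then have "map (differential (mdim M) ?T (\<lambda>x. chart_map d (chart_inv e x)) (chart_map e (g x)))
       (map De vs) = map Dd vs" by simp
    moreover have "\<omega> e (chart_map e (g x)) (map De vs) = \<omega> d (chart_map d (g x))
      (map (differential (mdim M) ?T (\<lambda>x. chart_map d (chart_inv e x)) (chart_map e (g x))) (map De vs))"
      by (rule form_transition[OF \<omega> e(1) d(1) e(2) d(2)]) (use True De in auto)
    ultimately show ?thesis unfolding L Dd_def Sd_def by (simp only:)
  qed
qed

text \<open>The chart chosen by \<open>pull_at\<close> depends only on the image point, which is the
  same on both sides; what remains is the chain rule in that chart.\<close>

lemma pull_at_compose:
  assumes M: "smooth_manifold M" and g: "smooth_into m T M g" and \<phi>: "smooth_on n m S \<phi>" "\<phi> ` S \<subseteq> T"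
    and S: "line_perfect n S" and T: "line_perfect m T" and x: "x \<in> S"
  shows "pull_at M n S (\<lambda>x. g (\<phi> x)) \<omega> x vs = pull_at M m T g \<omega> (\<phi> x) (map (differential n S \<phi> x) vs)"
proof -
  define d where "d = chart_at M (g (\<phi> x))"
  have \<phi>x: "\<phi> x \<in> T" using \<phi> x by auto
  have d: "d \<in> atlas M" "g (\<phi> x) \<in> chart_dom d"
    using chart_at[OF M smooth_into_topspace[OF g \<phi>x]] by (simp_all add: d_def)
  have SR: "S \<subseteq> Rn n" using S by (simp add: line_perfect_def)
  have g\<phi>: "smooth_into n S M (\<lambda>x. g (\<phi> x))" by (rule smooth_into_compose[OF g \<phi> SR])
  obtain V where V: "openin (Euclidean_space n) V" "{y \<in> S. g (\<phi> y) \<in> chart_dom d} = S \<inter> V"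
    using smooth_into_preimage[OF g\<phi> chart_dom_openin[OF M d(1)]] by metis
  have xV: "x \<in> V" using V(2) x d by auto
  let ?T = "{y \<in> T. g y \<in> chart_dom d}"
  have "differential n (S \<inter> V) (\<lambda>y. chart_map d (g (\<phi> y))) x v =
    differential m ?T (\<lambda>y. chart_map d (g y)) (\<phi> x) (differential n (S \<inter> V) \<phi> x v)" for v
  proof (rule differential_compose[OF smooth_into_smooth_on[OF g d(1)]])
    show "smooth_on n m (S \<inter> V) \<phi>" by (rule smooth_on_subset[OF \<phi>(1)]) auto
    show "\<phi> ` (S \<inter> V) \<subseteq> ?T" using \<phi>(2) unfolding V(2)[symmetric] by auto
    show "line_perfect n (S \<inter> V)" by (rule line_perfect_Int[OF S V(1)])
    show "line_perfect m ?T" by (rule line_perfect_preimage[OF g chart_dom_openin[OF M d(1)] T])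
    show "x \<in> S \<inter> V" using x xV by simp
  qed
  then have "differential n (S \<inter> V) (\<lambda>y. chart_map d (g (\<phi> y))) x =
    (\<lambda>v. differential m ?T (\<lambda>y. chart_map d (g y)) (\<phi> x) (differential n S \<phi> x v))"
    by (simp add: differential_Int[OF V(1) xV] fun_eq_iff)
  then show ?thesis
    unfolding pull_at_eq d_def[symmetric] V(2) by (simp add: comp_def)
qed

lemma differential_linear:
  "differential n S F x (\<lambda>j. a * u j + w j) = (\<lambda>j. a * differential n S F x u j + differential n S F x w j)"
  by (simp add: differential_def fun_eq_iff algebra_simps sum.distrib sum_distrib_left)

text \<open>\<open>differential\<close> ignores the coordinates of a vector from n on, hence does
  not vanish outside R^n. The case distinction, which is the one in \<open>pull_form\<close>,
  restores the default value 0.\<close>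

lemma alternating_pull_at:
  assumes M: "smooth_manifold M" and \<omega>: "differential_form M k \<omega>" and g: "smooth_into n S M g"
    and S: "line_perfect n S" and x: "x \<in> S"
  shows "alternating n k (\<lambda>vs. if set vs \<subseteq> Rn n then pull_at M n S g \<omega> x vs else 0)"
proof -
  define d where "d = chart_at M (g x)"
  have d: "d \<in> atlas M" "g x \<in> chart_dom d"
    using chart_at[OF M smooth_into_topspace[OF g x]] by (simp_all add: d_def)
  let ?S = "{y \<in> S. g y \<in> chart_dom d}"
  define D where "D = differential n ?S (\<lambda>y. chart_map d (g y)) x"
  define \<alpha> where "\<alpha> = \<omega> d (chart_map d (g x))"
  have \<alpha>: "alternating (mdim M) k \<alpha>"
    unfolding \<alpha>_def by (rule form_alternating[OF \<omega> d(1)]) (use d in auto)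
  have pa: "pull_at M n S g \<omega> x vs = \<alpha> (map D vs)" for vs
    by (simp add: pull_at_eq \<alpha>_def D_def d_def)
  have D: "D v \<in> Rn (mdim M)" for v
    unfolding D_def
    by (rule differential_Rn[OF line_perfect_preimage[OF g chart_dom_openin[OF M d(1)] S]])
      (use smooth_into_smooth_on[OF g d(1)] d x in \<open>auto simp: smooth_on_def\<close>)
  show ?thesis
    unfolding alternating_def pa
  proof (intro conjI allI ballI impI)
    fix vs assume "\<not> (length vs = k \<and> set vs \<subseteq> Rn n)"
    then show "(if set vs \<subseteq> Rn n then \<alpha> (map D vs) else 0) = 0"
      using alternating_wrong[OF \<alpha>, of "map D vs"] by auto
  next
    fix vs i a u w
    assume u: "u \<in> Rn n" "w \<in> Rn n" and vs: "length vs = k \<and> set vs \<subseteq> Rn n \<and> i < k"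
    have R: "set (vs[i := v]) \<subseteq> Rn n" if "v \<in> Rn n" for v
      using vs that set_update_subset_insert[of vs i v] by auto
    have auw: "(\<lambda>j. a * u j + w j) \<in> Rn n" using u by (simp add: Rn_iff)
    have "\<alpha> ((map D vs)[i := (\<lambda>j. a * D u j + D w j)]) = a * \<alpha> ((map D vs)[i := D u]) + \<alpha> ((map D vs)[i := D w])"
    proof -
      have "\<forall>vs i a. \<forall>u\<in>Rn (mdim M). \<forall>w\<in>Rn (mdim M). length vs = k \<and> set vs \<subseteq> Rn (mdim M) \<and> i < k \<longrightarrow>
        \<alpha> (vs[i := (\<lambda>j. a * u j + w j)]) = a * \<alpha> (vs[i := u]) + \<alpha> (vs[i := w])"
        using \<alpha> unfolding alternating_def by (elim conjE)
      from this[rule_format, OF D D, of "map D vs" i] show ?thesis using D vs by auto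
    qed
    then have "\<alpha> (map D (vs[i := (\<lambda>j. a * u j + w j)])) = a * \<alpha> (map D (vs[i := u])) + \<alpha> (map D (vs[i := w]))"
      unfolding map_update using differential_linear[of n ?S "\<lambda>y. chart_map d (g y)" x a u w]
      by (simp add: D_def)
    then show "(if set (vs[i := \<lambda>j. a * u j + w j]) \<subseteq> Rn n then \<alpha> (map D (vs[i := \<lambda>j. a * u j + w j])) else 0) =
      a * (if set (vs[i := u]) \<subseteq> Rn n then \<alpha> (map D (vs[i := u])) else 0) +
      (if set (vs[i := w]) \<subseteq> Rn n then \<alpha> (map D (vs[i := w])) else 0)"
      using R[OF auw] R[OF u(1)] R[OF u(2)] by simp
  next
    fix vs :: "(nat \<Rightarrow> real) list" and i j
    assume ij: "i < j \<and> j < length vs \<and> vs ! i = vs ! j"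
    have "\<forall>vs i j. i < j \<and> j < length vs \<and> vs ! i = vs ! j \<longrightarrow> \<alpha> vs = 0"
      using \<alpha> unfolding alternating_def by (elim conjE)
    from this[rule_format, of i j "map D vs"]
    have "\<alpha> (map D vs) = 0" using ij by auto
    then show "(if set vs \<subseteq> Rn n then \<alpha> (map D vs) else 0) = 0" by simp
  qed
qed

text \<open>With the chart held fixed near a point, the expression is built from the coefficients of
  the form along g and the first partial derivatives of g in coordinates, which is the situation of
  \<open>alternating_closed_class\<close>.\<close>

lemma pull_at_smooth:
  assumes M: "smooth_manifold M" and \<omega>: "differential_form M k \<omega>" and g: "smooth_into n S M g"
    and S: "line_perfect n S" and js: "length js = k" "set js \<subseteq> {..<n}"
  shows "smooth_fun_on n S (\<lambda>x. pull_at M n S g \<omega> x (map unit_vec js))"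
proof (rule smooth_fun_on_local)
  fix x assume x: "x \<in> S"
  obtain d where d: "d \<in> atlas M" "g x \<in> chart_dom d"
    using chart_at[OF M smooth_into_topspace[OF g x]] by blast
  obtain V where V: "openin (Euclidean_space n) V" "{y \<in> S. g y \<in> chart_dom d} = S \<inter> V"
    using smooth_into_preimage[OF g chart_dom_openin[OF M d(1)]] by metis
  have SR: "S \<inter> V \<subseteq> Rn n" using S by (auto simp: line_perfect_def)
  have lp: "line_perfect n (S \<inter> V)" by (rule line_perfect_Int[OF S V(1)])
  have so: "smooth_on n (mdim M) (S \<inter> V) (\<lambda>y. chart_map d (g y))"
    using smooth_into_smooth_on[OF g d(1)] unfolding V(2) .
  have gd: "g y \<in> chart_dom d" if "y \<in> S \<inter> V" for y using that V(2) by blast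
  let ?D = "\<lambda>j y. differential n (S \<inter> V) (\<lambda>y. chart_map d (g y)) y (unit_vec j)"
  have "smooth_fun_on n (S \<inter> V)
    (\<lambda>y. \<omega> d (chart_map d (g y)) (map unit_vec [] @ map (\<lambda>v. v y) (map ?D js)))"
  proof (rule alternating_closed_class[where P="smooth_fun_on n (S \<inter> V)" and D="S \<inter> V"
        and \<alpha>="\<lambda>y. \<omega> d (chart_map d (g y))" and m="mdim M" and k=k])
    show "smooth_fun_on n (S \<inter> V) (\<lambda>_. 0)" by (rule smooth_fun_on_const[OF SR])
    show "alternating (mdim M) k (\<omega> d (chart_map d (g y)))" if "y \<in> S \<inter> V" for y
      by (rule form_alternating[OF \<omega> d(1)]) (use gd[OF that] in auto)
    show "smooth_fun_on n (S \<inter> V) (\<lambda>y. \<omega> d (chart_map d (g y)) (map unit_vec js'))"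
      if "length js' = k" "set js' \<subseteq> {..<mdim M}" for js'
      by (rule smooth_fun_on_compose[OF form_smooth[OF \<omega> d(1) that] so _ SR]) (use gd in blast)
    show "v y \<in> Rn (mdim M)" if v: "v \<in> set (map ?D js)" and y: "y \<in> S \<inter> V" for v y
    proof -
      obtain j where "v = ?D j" using v by auto
      then show ?thesis using differential_Rn[OF lp y] so by (simp add: smooth_on_def)
    qed
    show "smooth_fun_on n (S \<inter> V) (\<lambda>y. v y j)" if v: "v \<in> set (map ?D js)" and j: "j < mdim M" for v j
    proof -
      obtain i where i: "v = ?D i" "i < n" using v js by auto
      show ?thesis
        unfolding i(1) differential_unit_vec[OF i(2)]
        by (rule smooth_fun_on_partial[OF lp smooth_on_component[OF so j] i(2)])
    qed
  qed (use js in \<open>auto intro: smooth_fun_on_cong smooth_fun_on_add smooth_fun_on_mult\<close>)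
  then have "smooth_fun_on n (S \<inter> V) (\<lambda>x. pull_at M n S g \<omega> x (map unit_vec js))"
  proof (rule smooth_fun_on_cong)
    fix y assume y: "y \<in> S \<inter> V"
    then show "\<omega> d (chart_map d (g y)) (map unit_vec [] @ map (\<lambda>v. v y) (map ?D js)) =
      pull_at M n S g \<omega> y (map unit_vec js)"
      using pull_at_chart[OF M \<omega> g S _ d(1) gd[OF y]] y by (simp add: V(2) comp_def)
  qed
  then show "\<exists>V. openin (Euclidean_space n) V \<and> x \<in> V \<and>
      smooth_fun_on n (S \<inter> V) (\<lambda>x. pull_at M n S g \<omega> x (map unit_vec js))"
    using V d x by blast
qed

lemma chart_overlap:
  assumes A: "smooth_manifold A" and c: "c \<in> atlas A" "c' \<in> atlas A"
  obtains V where "openin (Euclidean_space (mdim A)) V"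
    "chart_map c ` (chart_dom c \<inter> chart_dom c') = chart_img c \<inter> V"
proof -
  have "openin (half_space (mdim A)) (chart_map c ` (chart_dom c \<inter> chart_dom c'))"
    by (rule chart_image_openin[OF A c(1)]) (intro openin_Int chart_dom_openin[OF A] c Int_lower1)+
  then obtain V where V: "openin (Euclidean_space (mdim A)) V"
    "chart_map c ` (chart_dom c \<inter> chart_dom c') = V \<inter> {x. 0 \<le> x 0}"
    unfolding openin_half_space_iff by blast
  moreover obtain V0 where "chart_img c = V0 \<inter> {x. 0 \<le> x 0}"
    using chart_img_openin[OF A c(1)] unfolding openin_half_space_iff by blast
  moreover have "chart_map c ` (chart_dom c \<inter> chart_dom c') \<subseteq> chart_img c" by auto
  ultimately show ?thesis by (intro that[of V]) auto
qed

context
  fixes A :: "'a mfd" and M :: "'m mfd" and \<rho> :: "'a \<Rightarrow> 'm"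
  assumes A: "smooth_manifold A" and M: "smooth_manifold M" and \<rho>: "smooth_map A M \<rho>"
begin

lemma smooth_into_map_chart_inv:
  "c \<in> atlas A \<Longrightarrow> smooth_into (mdim A) (chart_img c) M (\<lambda>x. \<rho> (chart_inv c x))"
  by (rule smooth_into_map[OF A M \<rho> smooth_into_chart_inv[OF A]])

lemma pull_form_eq:
  assumes "c \<in> atlas A" "x \<in> chart_img c"
  shows "pull_form A M \<rho> \<omega> c x vs =
    (if set vs \<subseteq> Rn (mdim A) then pull_at M (mdim A) (chart_img c) (\<lambda>x. \<rho> (chart_inv c x)) \<omega> x vs else 0)"
  using assms by (simp add: pull_form_def comp_def)

text \<open>The transition law is functoriality: on an overlap, \<open>\<rho>\<close> after the
  inverse of c equals \<open>\<rho>\<close> after the inverse of c' after the transition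
  map.\<close>

lemma differential_form_pull:
  assumes \<omega>: "differential_form M k \<omega>"
  shows "differential_form A k (pull_form A M \<rho> \<omega>)"
  unfolding differential_form_def
proof (intro conjI allI ballI impI)
  fix c x vs assume "\<not> (c \<in> atlas A \<and> x \<in> chart_img c)"
  then show "pull_form A M \<rho> \<omega> c x vs = 0" by (auto simp: pull_form_def)
next
  fix c x assume c: "c \<in> atlas A" "x \<in> chart_img c"
  have "pull_form A M \<rho> \<omega> c x = (\<lambda>vs. if set vs \<subseteq> Rn (mdim A) then
      pull_at M (mdim A) (chart_img c) (\<lambda>x. \<rho> (chart_inv c x)) \<omega> x vs else 0)"
    using pull_form_eq[OF c] by (simp add: fun_eq_iff)
  then show "alternating (mdim A) k (pull_form A M \<rho> \<omega> c x)"
    using alternating_pull_at[OF M \<omega> smooth_into_map_chart_inv[OF c(1)]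
        line_perfect_half_space[OF chart_img_openin[OF A c(1)]] c(2)] by simp
next
  fix c js assume c: "c \<in> atlas A" and js: "length js = k \<and> set js \<subseteq> {..<mdim A}"
  have "smooth_fun_on (mdim A) (chart_img c)
    (\<lambda>x. pull_at M (mdim A) (chart_img c) (\<lambda>x. \<rho> (chart_inv c x)) \<omega> x (map unit_vec js))"
    by (rule pull_at_smooth[OF M \<omega> smooth_into_map_chart_inv[OF c]
        line_perfect_half_space[OF chart_img_openin[OF A c]]]) (use js in auto)
  then show "smooth_fun_on (mdim A) (chart_img c) (\<lambda>x. pull_form A M \<rho> \<omega> c x (map unit_vec js))"
  proof (rule smooth_fun_on_cong)
    fix x assume x: "x \<in> chart_img c"
    have "set (map unit_vec js) \<subseteq> Rn (mdim A)" using js by (auto intro: unit_vec_Rn)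
    then show "pull_at M (mdim A) (chart_img c) (\<lambda>x. \<rho> (chart_inv c x)) \<omega> x (map unit_vec js) =
      pull_form A M \<rho> \<omega> c x (map unit_vec js)"
      using pull_form_eq[OF c x] by simp
  qed
next
  fix c c' p vs
  assume c: "c \<in> atlas A" "c' \<in> atlas A" and p: "p \<in> chart_dom c \<inter> chart_dom c'"
    and vs: "length vs = k \<and> set vs \<subseteq> Rn (mdim A)"
  let ?n = "mdim A" and ?T = "chart_map c ` (chart_dom c \<inter> chart_dom c')"
  let ?t = "\<lambda>x. chart_map c' (chart_inv c x)"
  obtain V where V: "openin (Euclidean_space ?n) V" "?T = chart_img c \<inter> V"
    using chart_overlap[OF A c] by metis
  have cp: "chart_map c p \<in> chart_img c" "chart_map c' p \<in> chart_img c'" "chart_map c p \<in> ?T"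
    using p by auto
  have lp: "line_perfect ?n (chart_img c)" "line_perfect ?n (chart_img c')"
    using line_perfect_half_space[OF chart_img_openin[OF A]] c by auto
  have lpT: "line_perfect ?n ?T" unfolding V(2) by (rule line_perfect_Int[OF lp(1) V(1)])
  have inv: "chart_inv c x \<in> chart_dom c'" if x: "x \<in> ?T" for x
  proof -
    obtain q where "q \<in> chart_dom c" "q \<in> chart_dom c'" "x = chart_map c q" using x by blast
    then show ?thesis by (simp add: chart_inv_map[OF A c(1)])
  qed
  have t: "?t (chart_map c p) = chart_map c' p" using p by (simp add: chart_inv_map[OF A c(1)])
  have "pull_form A M \<rho> \<omega> c (chart_map c p) vs =
     pull_at M ?n (chart_img c) (\<lambda>x. \<rho> (chart_inv c x)) \<omega> (chart_map c p) vs"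
    using pull_form_eq[OF c(1) cp(1)] vs by simp
  also have "\<dots> = pull_at M ?n ?T (\<lambda>x. \<rho> (chart_inv c x)) \<omega> (chart_map c p) vs"
    unfolding V(2) by (rule pull_at_Int[OF V(1), symmetric]) (use cp V(2) in auto)
  also have "\<dots> = pull_at M ?n ?T (\<lambda>x. \<rho> (chart_inv c' (?t x))) \<omega> (chart_map c p) vs"
  proof (rule pull_at_cong[OF M cp(3)])
    show "\<rho> (chart_inv c (chart_map c p)) \<in> topspace (mtop M)"
      using smooth_into_topspace[OF smooth_into_map_chart_inv[OF c(1)] cp(1)] .
    show "\<rho> (chart_inv c x) = \<rho> (chart_inv c' (?t x))" if "x \<in> ?T" for x
      by (simp add: chart_inv_map[OF A c(2) inv[OF that]])
  qed
  also have "\<dots> = pull_at M ?n (chart_img c') (\<lambda>x. \<rho> (chart_inv c' x)) \<omega> (?t (chart_map c p))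
      (map (differential ?n ?T ?t (chart_map c p)) vs)"
    by (rule pull_at_compose[OF M smooth_into_map_chart_inv[OF c(2)] transition_smooth[OF A c] _ lpT lp(2) cp(3)])
      (use inv in blast)
  also have "\<dots> = pull_form A M \<rho> \<omega> c' (chart_map c' p) (map (differential ?n ?T ?t (chart_map c p)) vs)"
  proof -
    have "differential ?n ?T ?t (chart_map c p) v \<in> Rn ?n" for v
      by (rule differential_Rn[OF lpT cp(3)]) (use transition_smooth[OF A c] in \<open>simp add: smooth_on_def\<close>)
    then have "set (map (differential ?n ?T ?t (chart_map c p)) vs) \<subseteq> Rn ?n" by auto
    then show ?thesis using pull_form_eq[OF c(2) cp(2)] t by simp
  qed
  finally show "pull_form A M \<rho> \<omega> c (chart_map c p) vs =
        pull_form A M \<rho> \<omega> c' (chart_map c' p)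
          (map (differential ?n ?T (chart_map c' \<circ> chart_inv c) (chart_map c p)) vs)"
    by (simp add: comp_def)
qed

text \<open>Functoriality at the level of integrands. It makes the integral of a pulled back form
  agree with the integral over the image simplex without any substitution rule.\<close>

lemma pull_at_pull_form:
  assumes g: "smooth_into n S A g" and S: "line_perfect n S" and x: "x \<in> S"
  shows "pull_at A n S g (pull_form A M \<rho> \<omega>) x vs = pull_at M n S (\<lambda>x. \<rho> (g x)) \<omega> x vs"
proof -
  define c where "c = chart_at A (g x)"
  have c: "c \<in> atlas A" "g x \<in> chart_dom c"
    using chart_at[OF A smooth_into_topspace[OF g x]] by (simp_all add: c_def)
  obtain V where V: "openin (Euclidean_space n) V" "{y \<in> S. g y \<in> chart_dom c} = S \<inter> V"
    using smooth_into_preimage[OF g chart_dom_openin[OF A c(1)]] by metis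
  have xV: "x \<in> S \<inter> V" using x c V(2) by blast
  have lp: "line_perfect n (S \<inter> V)" by (rule line_perfect_Int[OF S V(1)])
  have lpc: "line_perfect (mdim A) (chart_img c)"
    by (rule line_perfect_half_space[OF chart_img_openin[OF A c(1)]])
  have so: "smooth_on n (mdim A) (S \<inter> V) (\<lambda>y. chart_map c (g y))"
    using smooth_into_smooth_on[OF g c(1)] unfolding V(2) .
  have gc: "g y \<in> chart_dom c" if "y \<in> S \<inter> V" for y using that V(2) by blast
  let ?D = "differential n (S \<inter> V) (\<lambda>y. chart_map c (g y)) x"
  have D: "?D v \<in> Rn (mdim A)" for v
    by (rule differential_Rn[OF lp xV]) (use so in \<open>simp add: smooth_on_def\<close>)
  have "pull_at A n S g (pull_form A M \<rho> \<omega>) x vs = pull_form A M \<rho> \<omega> c (chart_map c (g x)) (map ?D vs)"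
    by (simp add: pull_at_eq c_def[symmetric] V(2))
  also have "\<dots> = pull_at M (mdim A) (chart_img c) (\<lambda>x. \<rho> (chart_inv c x)) \<omega> (chart_map c (g x)) (map ?D vs)"
    using pull_form_eq[OF c(1), of "chart_map c (g x)"] D c(2) by (simp add: image_subset_iff)
  also have "\<dots> = pull_at M n (S \<inter> V) (\<lambda>y. \<rho> (chart_inv c (chart_map c (g y)))) \<omega> x vs"
    by (rule pull_at_compose[OF M smooth_into_map_chart_inv[OF c(1)] so _ lp lpc xV, symmetric])
      (use gc in blast)
  also have "\<dots> = pull_at M n (S \<inter> V) (\<lambda>y. \<rho> (g y)) \<omega> x vs"
  proof (rule pull_at_cong[OF M xV])
    show "\<rho> (chart_inv c (chart_map c (g y))) = \<rho> (g y)" if "y \<in> S \<inter> V" for y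
      by (simp add: chart_inv_map[OF A c(1) gc[OF that]])
    show "\<rho> (chart_inv c (chart_map c (g x))) \<in> topspace (mtop M)"
      using smooth_into_topspace[OF smooth_into_map[OF A M \<rho> g] x] by (simp add: chart_inv_map[OF A c])
  qed
  also have "\<dots> = pull_at M n S (\<lambda>x. \<rho> (g x)) \<omega> x vs"
    by (rule pull_at_Int[OF V(1)]) (use xV in auto)
  finally show ?thesis .
qed

end

section \<open>Integration over the open simplex\<close>

definition Rn_emb :: "nat \<Rightarrow> (nat \<Rightarrow> real) \<Rightarrow> nat \<Rightarrow> real" where
  "Rn_emb k x = (\<lambda>i. if i < k then x i else 0)"

lemma integral_Rn_eq:
  "integral_Rn k S f = (LINT x|Pi\<^sub>M {..<k} (\<lambda>_. lborel). indicator S (Rn_emb k x) * f (Rn_emb k x))"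
  by (simp add: integral_Rn_def Rn_emb_def Let_def)

lemma Rn_emb_measurable [measurable]: "Rn_emb k \<in> borel_measurable (Pi\<^sub>M {..<k} (\<lambda>_. lborel))"
proof (rule measurable_coordinatewise_then_product)
  fix i
  show "(\<lambda>x. Rn_emb k x i) \<in> borel_measurable (Pi\<^sub>M {..<k} (\<lambda>_. lborel))"
  proof (cases "i < k")
    case True
    then have "(\<lambda>x. x i) \<in> measurable (Pi\<^sub>M {..<k} (\<lambda>_. lborel)) (lborel :: real measure)"
      by (intro measurable_component_singleton) auto
    then show ?thesis using True by (simp add: Rn_emb_def)
  qed (simp add: Rn_emb_def)
qed

lemma openin_open_simplex: "openin (Euclidean_space k) (open_simplex k)"
proof -
  have eq: "open_simplex k = {x \<in> {x \<in> Rn k. \<forall>i<k. x i \<in> {0<..}}. (\<Sum>i<k. x i) \<in> {..<1}}"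
    by (auto simp: open_simplex_def)
  show ?thesis
    unfolding eq
    by (intro openin_Rn_preimage openin_Rn_Collect_all continuous_intros)
       (auto intro: continuous_on_product_coordinates continuous_on_subset)
qed

lemma line_perfect_open_simplex: "line_perfect k (open_simplex k)"
  by (rule line_perfect_openin[OF openin_open_simplex])

lemma open_simplex_borel [measurable]: "open_simplex k \<in> sets borel"
proof -
  obtain T where T: "open T" "open_simplex k = T \<inter> Rn k"
    using openin_open_simplex unfolding openin_Rn_iff by blast
  have "closed (Rn k)"
    using closedin_Euclidean_imp_closed[of k "Rn k"] by (metis closedin_topspace)
  then show ?thesis using T by simp
qed

text \<open>The open simplex lies between the cubes of side 1 / (k + 1) and 1; for k = 0 all three
  are the one-point space of measure 1. Finiteness makes bounded densities integrable, positivity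
  makes the integral of a positive density positive.\<close>

lemma open_simplex_measure:
  defines "P k \<equiv> {x \<in> space (Pi\<^sub>M {..<k} (\<lambda>_. lborel :: real measure)). Rn_emb k x \<in> open_simplex k}"
  shows "P k \<in> sets (Pi\<^sub>M {..<k} (\<lambda>_. lborel))"
    and "emeasure (Pi\<^sub>M {..<k} (\<lambda>_. lborel)) (P k) < \<infinity>"
    and "emeasure (Pi\<^sub>M {..<k} (\<lambda>_. lborel)) (P k) > 0"
proof -
  interpret product_sigma_finite "\<lambda>_ :: nat. lborel :: real measure"
    by standard
  let ?L = "Pi\<^sub>M {..<k} (\<lambda>_. lborel :: real measure)"
  show m: "P k \<in> sets ?L" unfolding P_def by measurable
  have box: "emeasure ?L (Pi\<^sub>E {..<k} (\<lambda>_. {0..1})) = 1"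
    by (subst emeasure_PiM) auto
  have "P k \<subseteq> Pi\<^sub>E {..<k} (\<lambda>_. {0..1})"
  proof
    fix x assume x: "x \<in> P k"
    then have e: "x \<in> extensional {..<k}" by (auto simp: P_def space_PiM PiE_def)
    have pos: "0 < x i" if "i < k" for i
      using x that by (auto simp: P_def open_simplex_def Rn_emb_def)
    have "(\<Sum>i<k. Rn_emb k x i) = (\<Sum>i<k. x i)" by (rule sum.cong) (auto simp: Rn_emb_def)
    then have s: "(\<Sum>i<k. x i) < 1"
      using x by (simp add: P_def open_simplex_def)
    have "x i \<le> 1" if "i < k" for i
    proof -
      have "x i \<le> (\<Sum>i<k. x i)" using that pos by (intro member_le_sum) (auto simp: less_imp_le)
      then show ?thesis using s by simp
    qed
    then show "x \<in> Pi\<^sub>E {..<k} (\<lambda>_. {0..1})" using e pos by (auto simp: PiE_def less_imp_le)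
  qed
  then have "emeasure ?L (P k) \<le> 1"
    using emeasure_mono[of "P k" "Pi\<^sub>E {..<k} (\<lambda>_. {0..1})" ?L] box
    by (metis (no_types, lifting) atLeastAtMost_borel finite_lessThan sets_PiM_I_finite sets_lborel)
  then show "emeasure ?L (P k) < \<infinity>" by (metis ennreal_one_less_top infinity_ennreal_def order_le_less_trans)
  let ?\<epsilon> = "1 / (real k + 1)"
  have "emeasure ?L (Pi\<^sub>E {..<k} (\<lambda>_. {0<..<?\<epsilon>})) = ennreal ?\<epsilon> ^ k"
    by (subst emeasure_PiM) auto
  moreover have "ennreal ?\<epsilon> ^ k > 0" by (simp add: ennreal_power)
  moreover have "Pi\<^sub>E {..<k} (\<lambda>_. {0<..<?\<epsilon>}) \<subseteq> P k"
  proof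
    fix x assume x: "x \<in> Pi\<^sub>E {..<k} (\<lambda>_. {0<..<?\<epsilon>})"
    then have xi: "0 < x i" "x i < ?\<epsilon>" if "i < k" for i using that by (auto simp: PiE_def Pi_def)
    have "(\<Sum>i<k. x i) \<le> (\<Sum>i<k. ?\<epsilon>)"
      using xi by (intro sum_mono) (auto simp: less_imp_le)
    also have "\<dots> < 1" by simp
    finally have "(\<Sum>i<k. x i) < 1" .
    moreover have "(\<Sum>i<k. Rn_emb k x i) = (\<Sum>i<k. x i)" by (rule sum.cong) (auto simp: Rn_emb_def)
    ultimately have "(\<Sum>i<k. Rn_emb k x i) < 1" by simp
    moreover have "Rn_emb k x \<in> Rn k" "\<forall>i<k. 0 < Rn_emb k x i"
      using xi by (auto simp: Rn_emb_def Rn_iff)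
    moreover have "x \<in> space ?L" using x by (auto simp: space_PiM PiE_def)
    ultimately show "x \<in> P k"
      by (simp add: P_def open_simplex_def)
  qed
  ultimately show "emeasure ?L (P k) > 0"
    using emeasure_mono[OF _ m] by (metis order_less_le_trans)
qed

lemma open_simplex_indicator_measurable:
  assumes "continuous_on (open_simplex k) f"
  shows "(\<lambda>x. indicator (open_simplex k) (Rn_emb k x) * f (Rn_emb k x) :: real)
    \<in> borel_measurable (Pi\<^sub>M {..<k} (\<lambda>_. lborel))"
proof -
  have "(\<lambda>y. indicator (open_simplex k) y *\<^sub>R f y) \<in> borel_measurable borel"
    by (rule borel_measurable_continuous_on_indicator[OF open_simplex_borel assms])
  from measurable_compose[OF Rn_emb_measurable this] show ?thesis by simp
qed

lemma open_simplex_integrable: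
  fixes f :: "(nat \<Rightarrow> real) \<Rightarrow> real"
  assumes "continuous_on (open_simplex k) f" "\<And>y. y \<in> open_simplex k \<Longrightarrow> \<bar>f y\<bar> \<le> B"
  shows "integrable (Pi\<^sub>M {..<k} (\<lambda>_. lborel)) (\<lambda>x. indicator (open_simplex k) (Rn_emb k x) * f (Rn_emb k x))"
  by (rule integrableI_bounded_set[OF open_simplex_measure(1)[of k]
        open_simplex_indicator_measurable[OF assms(1)] open_simplex_measure(2)[of k]])
     (use assms(2) in \<open>auto intro!: AE_I2\<close>)

lemma integral_Rn_cong:
  assumes "\<And>y. y \<in> S \<Longrightarrow> f y = g y"
  shows "integral_Rn k S f = integral_Rn k S g"
proof -
  have "indicator S y * f y = indicator S y * g y" for y
    using assms by (cases "y \<in> S") auto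
  then show ?thesis by (simp only: integral_Rn_eq)
qed

lemma integral_Rn_0: "integral_Rn k S (\<lambda>_. 0) = 0"
  by (simp add: integral_Rn_eq)

lemma integral_Rn_pos:
  fixes f :: "(nat \<Rightarrow> real) \<Rightarrow> real"
  assumes f: "continuous_on (open_simplex k) f" "\<And>y. y \<in> open_simplex k \<Longrightarrow> \<bar>f y\<bar> \<le> B"
    and pos: "\<And>y. y \<in> open_simplex k \<Longrightarrow> f y > 0"
  shows "integral_Rn k (open_simplex k) f > 0"
proof -
  let ?L = "Pi\<^sub>M {..<k} (\<lambda>_. lborel :: real measure)"
  let ?f = "\<lambda>x. indicator (open_simplex k) (Rn_emb k x) * f (Rn_emb k x)"
  have nn: "?f x \<ge> 0" for x using pos[of "Rn_emb k x"] by (auto simp: indicator_def)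
  have "integral\<^sup>L ?L ?f \<ge> 0" using nn by (intro integral_nonneg_AE) auto
  moreover have "integral\<^sup>L ?L ?f \<noteq> 0"
  proof
    assume "integral\<^sup>L ?L ?f = 0"
    then have "AE x in ?L. ?f x = 0"
      using integral_nonneg_eq_0_iff_AE[OF open_simplex_integrable[OF f]] nn by auto
    then have "AE x in ?L. x \<notin> {x \<in> space ?L. Rn_emb k x \<in> open_simplex k}"
    proof eventually_elim
      case (elim x)
      then show ?case using pos[of "Rn_emb k x"] by (auto simp: indicator_def)
    qed
    then have "emeasure ?L {x \<in> space ?L. Rn_emb k x \<in> open_simplex k} = 0"
      using AE_iff_measurable[OF open_simplex_measure(1)[of k], of "\<lambda>x. x \<notin> {x \<in> space ?L. Rn_emb k x \<in> open_simplex k}"]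
      by auto
    then show False using open_simplex_measure(3)[of k] by simp
  qed
  ultimately show ?thesis unfolding integral_Rn_eq by linarith
qed

text \<open>Dominated convergence along sequences; the constant B is an integrable majorant because
  the simplex has finite measure.\<close>

lemma integral_Rn_continuous:
  fixes f :: "real \<Rightarrow> (nat \<Rightarrow> real) \<Rightarrow> real"
  assumes f: "\<And>t. t \<in> T \<Longrightarrow> continuous_on (open_simplex k) (f t)"
    and B: "\<And>t y. t \<in> T \<Longrightarrow> y \<in> open_simplex k \<Longrightarrow> \<bar>f t y\<bar> \<le> B"
    and c: "\<And>y. y \<in> open_simplex k \<Longrightarrow> continuous_on T (\<lambda>t. f t y)"
  shows "continuous_on T (\<lambda>t. integral_Rn k (open_simplex k) (f t))"
  unfolding continuous_on_sequentially
proof (intro allI ballI impI)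
  fix u a assume a: "a \<in> T" and u: "(\<forall>n. u n \<in> T) \<and> u \<longlonglongrightarrow> a"
  let ?L = "Pi\<^sub>M {..<k} (\<lambda>_. lborel :: real measure)"
  let ?I = "\<lambda>x. indicator (open_simplex k) (Rn_emb k x) :: real"
  have "(\<lambda>n. LINT x|?L. ?I x * f (u n) (Rn_emb k x)) \<longlonglongrightarrow> (LINT x|?L. ?I x * f a (Rn_emb k x))"
  proof (rule integral_dominated_convergence[where w="\<lambda>x. ?I x * B"])
    show "(\<lambda>x. ?I x * f a (Rn_emb k x)) \<in> borel_measurable ?L"
      by (rule open_simplex_indicator_measurable[OF f[OF a]])
    show "(\<lambda>x. ?I x * f (u n) (Rn_emb k x)) \<in> borel_measurable ?L" for n
      by (rule open_simplex_indicator_measurable[OF f]) (use u in auto)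
    show "integrable ?L (\<lambda>x. ?I x * B)"
      by (rule open_simplex_integrable[where f="\<lambda>_. B"]) auto
    show "AE x in ?L. (\<lambda>n. ?I x * f (u n) (Rn_emb k x)) \<longlonglongrightarrow> ?I x * f a (Rn_emb k x)"
    proof (rule AE_I2)
      fix x
      show "(\<lambda>n. ?I x * f (u n) (Rn_emb k x)) \<longlonglongrightarrow> ?I x * f a (Rn_emb k x)"
      proof (cases "Rn_emb k x \<in> open_simplex k")
        case True
        have "(\<lambda>n. f (u n) (Rn_emb k x)) \<longlonglongrightarrow> f a (Rn_emb k x)"
          using c[OF True] a u unfolding continuous_on_sequentially comp_def by blast
        then show ?thesis by (intro tendsto_intros)
      qed simp
    qed
    show "AE x in ?L. norm (?I x * f (u n) (Rn_emb k x)) \<le> ?I x * B" for n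
    proof (rule AE_I2)
      fix x
      show "norm (?I x * f (u n) (Rn_emb k x)) \<le> ?I x * B"
        using B[of "u n" "Rn_emb k x"] u by (cases "Rn_emb k x \<in> open_simplex k") auto
    qed
  qed
  then show "((\<lambda>t. integral_Rn k (open_simplex k) (f t)) \<circ> u) \<longlonglongrightarrow> integral_Rn k (open_simplex k) (f a)"
    by (simp add: integral_Rn_eq comp_def)
qed

subsection \<open>Families of maps on the closed simplex\<close>

text \<open>The closed simplex times the unit interval. Time is coordinate k, so the slice at time t
  is reached by \<open>y(k := t)\<close>. The factor [0, 1] and the closed simplex are both needed
  for compactness, from which uniform bounds are derived.\<close>

definition prism :: "nat \<Rightarrow> (nat \<Rightarrow> real) set" where
  "prism k = {y \<in> Rn (Suc k). (\<forall>i<k. 0 \<le> y i) \<and> (\<Sum>i<k. y i) \<le> 1 \<and> 0 \<le> y k \<and> y k \<le> 1}"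

lemma prism_Rn: "prism k \<subseteq> Rn (Suc k)" by (auto simp: prism_def)

lemma prism_slice:
  assumes "y \<in> open_simplex k" "t \<in> {0..1}" shows "y(k := t) \<in> prism k"
proof -
  have "(\<Sum>i<k. (y(k := t)) i) = (\<Sum>i<k. y i)" by (rule sum.cong) auto
  then have "(\<Sum>i<k. (y(k := t)) i) \<le> 1" using assms by (simp only: open_simplex_def) simp
  then show ?thesis using assms by (auto simp: prism_def open_simplex_def Rn_iff less_imp_le)
qed

lemma prism_le_1: "y \<in> prism k \<Longrightarrow> 0 \<le> y i \<and> y i \<le> 1"
proof -
  assume y: "y \<in> prism k"
  consider "i < k" | "i = k" | "i > k" by linarith
  then show ?thesis
  proof cases
    case 1
    have "y i \<le> (\<Sum>i<k. y i)" using 1 y by (intro member_le_sum) (auto simp: prism_def)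
    then show ?thesis using y 1 by (auto simp: prism_def)
  qed (use y in \<open>auto simp: prism_def Rn_iff\<close>)
qed

text \<open>A closed subset of the cube of all functions into [0, 1], which is compact by Tychonoff;
  \<open>prism_le_1\<close> bounds every coordinate, including the vanishing ones.\<close>

lemma compact_prism: "compact (prism k)"
proof -
  have "compactin (powertop_real UNIV) (UNIV \<rightarrow>\<^sub>E {0..1})" by (simp add: compactin_PiE)
  then have "compact (UNIV \<rightarrow>\<^sub>E {0..1} :: (nat \<Rightarrow> real) set)" by (simp add: euclidean_product_topology)
  moreover have "closed (prism k)"
  proof -
    have eq: "prism k = Rn (Suc k) \<inter> (\<Inter>i\<in>{..<k}. {y. 0 \<le> y i}) \<inter> {y. (\<Sum>i<k. y i) \<le> 1} \<inter>
      {y. 0 \<le> y k} \<inter> {y. y k \<le> 1}"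
      by (auto simp: prism_def)
    have "closed (Rn (Suc k))"
      using closedin_Euclidean_imp_closed[of "Suc k" "Rn (Suc k)"] by (metis closedin_topspace)
    then show ?thesis
      unfolding eq
      by (intro closed_Int closed_INT closed_Collect_le continuous_intros ballI) 
         (auto intro: continuous_on_product_coordinates)
  qed
  moreover have "prism k \<subseteq> UNIV \<rightarrow>\<^sub>E {0..1}" using prism_le_1 by auto
  ultimately show ?thesis using compact_Int_closed by (metis inf.absorb_iff2 inf_commute)
qed

lemma smooth_on_slice:
  assumes "t \<in> {0..1}"
  shows "smooth_on k (Suc k) (open_simplex k) (\<lambda>y. y(k := t))"
  unfolding smooth_on_def
proof (intro conjI allI impI)
  have U: "open_simplex k \<subseteq> Rn k" by (auto simp: open_simplex_def)
  show "(\<lambda>y. y(k := t)) ` open_simplex k \<subseteq> Rn (Suc k)" using U by (auto simp: Rn_iff)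
  show "smooth_fun_on k (open_simplex k) (\<lambda>y. (y(k := t)) j)" for j
    using smooth_fun_on_const[OF U] smooth_fun_on_proj[OF U] by (cases "j = k") auto
qed

context
  fixes M :: "'a mfd" and \<omega> :: "'a form" and k :: nat and G :: "(nat \<Rightarrow> real) \<Rightarrow> 'a"
  assumes M: "smooth_manifold M" and \<omega>: "differential_form M k \<omega>"
    and G: "smooth_into (Suc k) (prism k) M G"
begin

lemma smooth_into_slice:
  assumes "t \<in> {0..1}" shows "smooth_into k (open_simplex k) M (\<lambda>y. G (y(k := t)))"
  by (rule smooth_into_compose[OF G smooth_on_slice[OF assms]])
     (use assms prism_slice in \<open>auto simp: open_simplex_def\<close>)

abbreviation slice_density :: "real \<Rightarrow> (nat \<Rightarrow> real) \<Rightarrow> real" where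
  "slice_density t y \<equiv> pull_at M k (open_simplex k) (\<lambda>y. G (y(k := t))) \<omega> y (map unit_vec [0..<k])"

lemma slice_density_continuous: "t \<in> {0..1} \<Longrightarrow> continuous_on (open_simplex k) (slice_density t)"
  by (rule smooth_fun_on_continuous[OF pull_at_smooth[OF M \<omega> smooth_into_slice line_perfect_open_simplex]])
     auto

text \<open>\<open>prism k\<close> has corners, where partial derivatives within it are meaningless; the continuous
  extension of the density is computed from a local smooth extension of \<open>G\<close>.\<close>

lemma slice_density_extends:
  assumes z: "z \<in> prism k"
  obtains V H where "openin (Euclidean_space (Suc k)) V" "z \<in> V" "continuous_on (prism k \<inter> V) H"
    "\<And>t y. t \<in> {0..1} \<Longrightarrow> y \<in> open_simplex k \<Longrightarrow> y(k := t) \<in> V \<Longrightarrow> slice_density t y = H (y(k := t))"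
proof -
  obtain d where d: "d \<in> atlas M" "G z \<in> chart_dom d"
    using chart_at[OF M smooth_into_topspace[OF G z]] by blast
  obtain V1 where V1: "openin (Euclidean_space (Suc k)) V1" "{w \<in> prism k. G w \<in> chart_dom d} = prism k \<inter> V1"
    using smooth_into_preimage[OF G chart_dom_openin[OF M d(1)]] by metis
  have zV1: "z \<in> prism k \<inter> V1" using V1(2) z d by blast
  have so: "smooth_on (Suc k) (mdim M) (prism k \<inter> V1) (\<lambda>w. chart_map d (G w))"
    using smooth_into_smooth_on[OF G d(1)] unfolding V1(2) .
  have SR: "prism k \<inter> V1 \<subseteq> Rn (Suc k)" using prism_Rn by blast
  have gd: "G w \<in> chart_dom d" if "w \<in> prism k \<inter> V1" for w using that V1(2) by blast
  obtain V2 F where V2: "openin (Euclidean_space (Suc k)) V2" "z \<in> V2"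
    "\<And>r j. j < mdim M \<Longrightarrow> C_diff (Suc k) r V2 (\<lambda>y. F y j)" "F ` V2 \<subseteq> Rn (mdim M)"
    "\<And>y. y \<in> V2 \<Longrightarrow> y \<in> prism k \<inter> V1 \<Longrightarrow> F y = chart_map d (G y)"
    using smooth_on_extend[OF so zV1 _ _ SR, of "Rn (mdim M)"] smooth_on_Rn[OF so zV1]
    by (metis openin_topspace)
  define V where "V = V1 \<inter> V2"
  \<comment> \<open>The i-th column of the Jacobian of the extension F, padded with zeros so that it
    is a vector of R^m. It is continuous up to the boundary of the prism because F is smooth on an
    open set.\<close>
  define D where "D i w = (\<lambda>j. if j < mdim M then partial V2 i (\<lambda>y. F y j) w else 0)" for i w
  define H where "H w = \<omega> d (chart_map d (G w)) (map (\<lambda>v. v w) (map D [0..<k]))" for w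
  have "continuous_on (prism k \<inter> V) (\<lambda>w. \<omega> d (chart_map d (G w)) (map unit_vec [] @ map (\<lambda>v. v w) (map D [0..<k])))"
  proof (rule alternating_closed_class[where P="continuous_on (prism k \<inter> V)" and D="prism k \<inter> V"
        and \<alpha>="\<lambda>y. \<omega> d (chart_map d (G y))" and m="mdim M" and k=k])
    show "continuous_on (prism k \<inter> V) g" if "continuous_on (prism k \<inter> V) f" "\<And>x. x \<in> prism k \<inter> V \<Longrightarrow> f x = g x"
      for f g :: "(nat \<Rightarrow> real) \<Rightarrow> real"
      using continuous_on_cong[of "prism k \<inter> V" "prism k \<inter> V" f g] that by metis
    show "alternating (mdim M) k (\<omega> d (chart_map d (G y)))" if "y \<in> prism k \<inter> V" for y
      by (rule form_alternating[OF \<omega> d(1)]) (use gd that in \<open>auto simp: V_def\<close>)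
    show "continuous_on (prism k \<inter> V) (\<lambda>y. \<omega> d (chart_map d (G y)) (map unit_vec js'))"
      if "length js' = k" "set js' \<subseteq> {..<mdim M}" for js'
    proof -
      have "smooth_fun_on (Suc k) (prism k \<inter> V1) (\<lambda>y. \<omega> d (chart_map d (G y)) (map unit_vec js'))"
        by (rule smooth_fun_on_compose[OF form_smooth[OF \<omega> d(1) that] so _ SR]) (use gd in blast)
      then show ?thesis
        by (rule continuous_on_subset[OF smooth_fun_on_continuous]) (auto simp: V_def)
    qed
    show "v y \<in> Rn (mdim M)" if "v \<in> set (map D [0..<k])" for v y
      using that by (auto simp: D_def Rn_iff)
    show "continuous_on (prism k \<inter> V) (\<lambda>y. v y j)" if v: "v \<in> set (map D [0..<k])" and j: "j < mdim M" for v j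
    proof -
      obtain i where i: "v = D i" "i < k" using v by auto
      have "continuous_on V2 (partial V2 i (\<lambda>y. F y j))"
        using V2(3)[OF j, of "Suc 0"] i(2) by simp
      then have "continuous_on (prism k \<inter> V) (partial V2 i (\<lambda>y. F y j))"
        by (rule continuous_on_subset) (auto simp: V_def)
      then show ?thesis using j by (simp add: i(1) D_def)
    qed
  qed (auto intro: continuous_intros)
  then have cont: "continuous_on (prism k \<inter> V) H" by (simp add: H_def[abs_def])
  have eq: "slice_density t y = H (y(k := t))"
    if t: "t \<in> {0..1}" and y: "y \<in> open_simplex k" and w: "y(k := t) \<in> V" for t y
  proof -
    let ?w = "y(k := t)"
    let ?S = "{y \<in> open_simplex k. G (y(k := t)) \<in> chart_dom d}"
    have pw: "?w \<in> prism k \<inter> V1" using prism_slice[OF y t] w by (simp add: V_def)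
    have yS: "y \<in> ?S" using y gd[OF pw] by simp
    have lp: "line_perfect k ?S"
      by (rule line_perfect_preimage[OF smooth_into_slice[OF t] chart_dom_openin[OF M d(1)] line_perfect_open_simplex])
    have sos: "smooth_on k (mdim M) ?S (\<lambda>y. chart_map d (G (y(k := t))))"
      by (rule smooth_into_smooth_on[OF smooth_into_slice[OF t] d(1)])
    have "differential k ?S (\<lambda>y. chart_map d (G (y(k := t)))) y (unit_vec i) = D i ?w" if i: "i < k" for i
    proof
      fix j
      show "differential k ?S (\<lambda>y. chart_map d (G (y(k := t)))) y (unit_vec i) j = D i ?w j"
      proof (cases "j < mdim M")
        case False
        then have "differential k ?S (\<lambda>y. chart_map d (G (y(k := t)))) y (unit_vec i) j = 0"
          using differential_Rn[OF lp yS, of "\<lambda>y. chart_map d (G (y(k := t)))" "mdim M" "unit_vec i"] sos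
          by (simp add: smooth_on_def Rn_iff)
        then show ?thesis using False by (simp add: D_def)
      next
        case True
        \<comment> \<open>Along a line in direction i the slice of G stays inside the prism, where F
          agrees with the coordinate expression of G, so the two-sided derivative of F is also that
          of the slice.\<close>
        have "partial ?S i (\<lambda>y. chart_map d (G (y(k := t))) j) y = partial V2 i (\<lambda>y. F y j) ?w"
        proof (rule partial_eqI[OF lp yS i])
          have iS: "i < Suc k" using i by simp
          have w2: "?w \<in> V2" using w by (simp add: V_def)
          have com: "?w(i := s) = (y(i := s))(k := t)" for s using i by (auto simp: fun_upd_twist)
          have wi: "?w i = y i" using i by simp
          have "eventually (\<lambda>s. ?w(i := s) \<in> V2) (nhds (y i))"
            using eventually_upd_mem[OF V2(1) w2 iS] unfolding wi .
          then obtain e where e: "e > 0" "\<And>s. dist s (y i) < e \<Longrightarrow> ?w(i := s) \<in> V2"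
            unfolding eventually_nhds_metric by blast
          have "((\<lambda>s. F (?w(i := s)) j) has_real_derivative partial V2 i (\<lambda>y. F y j) ?w) (at (y i))"
            using C_diff_DERIV[OF V2(1) V2(3)[OF True] w2 iS] unfolding wi .
          then have "((\<lambda>s. F (?w(i := s)) j) has_real_derivative partial V2 i (\<lambda>y. F y j) ?w)
            (at (y i) within {s. y(i := s) \<in> ?S})"
            by (rule has_field_derivative_at_within)
          then show "((\<lambda>s. chart_map d (G ((y(i := s))(k := t))) j) has_real_derivative partial V2 i (\<lambda>y. F y j) ?w)
            (at (y i) within {s. y(i := s) \<in> ?S})"
          proof (rule has_field_derivative_transform_within[OF _ e(1)])
            show "y i \<in> {s. y(i := s) \<in> ?S}" using yS by simp
            fix s assume s: "s \<in> {s. y(i := s) \<in> ?S}" "dist s (y i) < e"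
            then have ys: "y(i := s) \<in> open_simplex k" "G ((y(i := s))(k := t)) \<in> chart_dom d" by auto
            have "(y(i := s))(k := t) \<in> {w \<in> prism k. G w \<in> chart_dom d}"
              using prism_slice[OF ys(1) t] ys(2) by simp
            then have "?w(i := s) \<in> prism k \<inter> V1" unfolding com V1(2) .
            from V2(5)[OF e(2)[OF s(2)] this]
            show "F (?w(i := s)) j = chart_map d (G ((y(i := s))(k := t))) j" unfolding com by simp
          qed
        qed
        then show ?thesis using True by (simp add: differential_unit_vec[OF i] D_def)
      qed
    qed
    then have "map (differential k ?S (\<lambda>y. chart_map d (G (y(k := t)))) y) (map unit_vec [0..<k]) =
      map (\<lambda>v. v ?w) (map D [0..<k])" by simp
    moreover have "slice_density t y = \<omega> d (chart_map d (G ?w))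
      (map (differential k ?S (\<lambda>y. chart_map d (G (y(k := t)))) y) (map unit_vec [0..<k]))"
      by (rule pull_at_chart[OF M \<omega> smooth_into_slice[OF t] line_perfect_open_simplex y d(1)])
        (use gd[OF pw] in simp)
    ultimately show ?thesis by (simp only: H_def)
  qed
  have V: "openin (Euclidean_space (Suc k)) V" "z \<in> V"
    using V1 V2 zV1 by (auto simp: V_def)
  show ?thesis by (rule that[OF V cont eq])
qed

text \<open>Continuity on the open simplex gives no bound. Near each point of the closed prism the
  density is bounded by the value of its continuous extension plus 1, and finitely many such
  neighbourhoods cover the prism.\<close>

lemma slice_density_bounded:
  "\<exists>B. \<forall>t\<in>{0..1}. \<forall>y\<in>open_simplex k. \<bar>slice_density t y\<bar> \<le> B"
proof -
  define bounded_near where "bounded_near z T B \<longleftrightarrow> open T \<and> z \<in> T \<and>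
    (\<forall>t\<in>{0..1}. \<forall>y\<in>open_simplex k. y(k := t) \<in> T \<longrightarrow> \<bar>slice_density t y\<bar> \<le> B)" for z T B
  have "\<exists>T B. bounded_near z T B" if z: "z \<in> prism k" for z
  proof -
    obtain V H where V: "openin (Euclidean_space (Suc k)) V" "z \<in> V" "continuous_on (prism k \<inter> V) H"
      "\<And>t y. t \<in> {0..1} \<Longrightarrow> y \<in> open_simplex k \<Longrightarrow> y(k := t) \<in> V \<Longrightarrow> slice_density t y = H (y(k := t))"
      using slice_density_extends[OF z] by blast
    obtain T1 where T1: "open T1" "V = T1 \<inter> Rn (Suc k)" using V(1) unfolding openin_Rn_iff by blast
    obtain T2 where T2: "open T2" "T2 \<inter> (prism k \<inter> V) = H -` ball (H z) 1 \<inter> (prism k \<inter> V)"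
      using V(3) unfolding continuous_on_open_invariant by (metis open_ball)
    have "z \<in> T1 \<inter> T2" using T1 T2(2) V(2) z by auto
    moreover have "\<bar>slice_density t y\<bar> \<le> \<bar>H z\<bar> + 1"
      if "t \<in> {0..1}" "y \<in> open_simplex k" "y(k := t) \<in> T1 \<inter> T2" for t y
    proof -
      have p: "y(k := t) \<in> prism k" using prism_slice that by blast
      then have v: "y(k := t) \<in> V" using that(3) T1(2) prism_Rn by blast
      then have "H (y(k := t)) \<in> ball (H z) 1" using T2(2) p that(3) by blast
      then show ?thesis using V(4)[OF that(1,2) v] by (simp add: dist_real_def)
    qed
    ultimately show ?thesis unfolding bounded_near_def
      using T1(1) T2(1) by (intro exI[of _ "T1 \<inter> T2"] exI[of _ "\<bar>H z\<bar> + 1"]) auto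
  qed
  then obtain T B where "\<And>z. z \<in> prism k \<Longrightarrow> bounded_near z (T z) (B z)" by metis
  note near = this[unfolded bounded_near_def]
  have TB: "open (T z)" "z \<in> T z" if "z \<in> prism k" for z
    using near[OF that] by simp_all
  have TB3: "\<bar>slice_density t y\<bar> \<le> B z"
    if "z \<in> prism k" "t \<in> {0..1}" "y \<in> open_simplex k" "y(k := t) \<in> T z" for z t y
    using conjunct2[OF conjunct2[OF near[OF that(1)]], rule_format, OF that(2-4)] .
  obtain Z where Z: "Z \<subseteq> prism k" "finite Z" "prism k \<subseteq> (\<Union>z\<in>Z. T z)"
  proof (rule compactE_image[OF compact_prism, of "prism k" T])
    show "prism k \<subseteq> (\<Union>z\<in>prism k. T z)" using TB(2) by (intro subsetI UN_I)
  qed (use TB(1) in auto)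
  show ?thesis
  proof (intro exI[of _ "\<Sum>z\<in>Z. \<bar>B z\<bar>"] ballI)
    fix t :: real and y assume ty: "t \<in> {0..1}" "y \<in> open_simplex k"
    then obtain z where z: "z \<in> Z" "y(k := t) \<in> T z" using prism_slice Z(3) by blast
    then have "\<bar>slice_density t y\<bar> \<le> B z" using TB3[of z t y] ty Z(1) by auto
    also have "\<dots> \<le> \<bar>B z\<bar>" by simp
    also have "\<dots> \<le> (\<Sum>z\<in>Z. \<bar>B z\<bar>)" using z Z(2) by (intro member_le_sum) auto
    finally show "\<bar>slice_density t y\<bar> \<le> (\<Sum>z\<in>Z. \<bar>B z\<bar>)" .
  qed
qed

text \<open>For fixed y the path \<open>y(k := t)\<close> runs inside the prism, and the local
  continuous extensions of the density can be restricted to it.\<close>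

lemma slice_density_continuous_param:
  assumes y: "y \<in> open_simplex k"
  shows "continuous_on {0..1} (\<lambda>t. slice_density t y)"
proof -
  have slice: "continuous_on UNIV (\<lambda>t. y(k := t))"
  proof (rule continuous_on_coordinatewise_then_product)
    show "continuous_on UNIV (\<lambda>t. (y(k := t)) i)" for i
      by (cases "i = k") (auto intro: continuous_intros)
  qed
  have "\<exists>S. open S \<and> s \<in> S \<and> continuous_on ({0..1} \<inter> S) (\<lambda>t. slice_density t y)" if s: "s \<in> {0..1}" for s
  proof -
    obtain V H where V: "openin (Euclidean_space (Suc k)) V" "y(k := s) \<in> V" "continuous_on (prism k \<inter> V) H"
      "\<And>t y. t \<in> {0..1} \<Longrightarrow> y \<in> open_simplex k \<Longrightarrow> y(k := t) \<in> V \<Longrightarrow> slice_density t y = H (y(k := t))"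
      using slice_density_extends[OF prism_slice[OF y s]] by blast
    obtain T where T: "open T" "V = T \<inter> Rn (Suc k)" using V(1) unfolding openin_Rn_iff by blast
    define S where "S = (\<lambda>t. y(k := t)) -` T"
    have "open S" unfolding S_def by (rule open_vimage[OF T(1) slice])
    moreover have "s \<in> S" using V(2) T(2) by (simp add: S_def)
    moreover have inV: "y(k := t) \<in> prism k \<inter> V" if "t \<in> {0..1} \<inter> S" for t
      using prism_slice[OF y, of t] that T(2) prism_Rn by (auto simp: S_def)
    have "continuous_on ({0..1} \<inter> S) (\<lambda>t. H (y(k := t)))"
      by (rule continuous_on_compose2[OF V(3) continuous_on_subset[OF slice]]) (use inV in auto)
    then have "continuous_on ({0..1} \<inter> S) (\<lambda>t. slice_density t y)"
      by (rule continuous_on_eq) (use V(4)[OF _ y] inV in auto)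
    ultimately show ?thesis by blast
  qed
  note local = this
  show ?thesis
    unfolding continuous_on_eq_continuous_within
  proof
    fix s :: real assume s: "s \<in> {0..1}"
    obtain S where S: "open S" "s \<in> S" "continuous_on ({0..1} \<inter> S) (\<lambda>t. slice_density t y)"
      using local[OF s] by blast
    have "at s within {0..1} \<inter> S = at s within {0..1}"
      by (rule at_within_nhd[OF S(2,1)]) auto
    then show "continuous (at s within {0..1}) (\<lambda>t. slice_density t y)"
      using S(2,3) s by (metis IntI continuous_on_eq_continuous_within)
  qed
qed

end

section \<open>Smooth chains\<close>

lemma standard_simplex_Rn: "standard_simplex k \<subseteq> Rn (Suc k)"
  by (auto simp: standard_simplex_def Rn_iff)

text \<open>Separates the analytic part of a smooth simplex, which is stable under composition, from
  the extensionality that the singular chains of the library require.\<close>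

lemma smooth_simplex_iff:
  "smooth_simplex k M \<sigma> \<longleftrightarrow>
    smooth_into (Suc k) (standard_simplex k) M \<sigma> \<and> \<sigma> \<in> extensional (standard_simplex k)"
  using standard_simplex_Rn[of k]
  by (auto simp: smooth_simplex_def smooth_into_def singular_simplex_def euclidean_product_topology comp_def)

lemma smooth_simplex_restrict:
  assumes "smooth_into (Suc k) (standard_simplex k) M g"
  shows "smooth_simplex k M (restrict g (standard_simplex k))"
  using smooth_into_cong[OF assms, of "restrict g (standard_simplex k)"] by (simp add: smooth_simplex_iff)

lemma smooth_on_simplical_face:
  assumes "S \<subseteq> Rn n"
  shows "smooth_on n (Suc n) S (simplical_face i)"
  unfolding smooth_on_def
proof (intro conjI allI impI)
  show "simplical_face i ` S \<subseteq> Rn (Suc n)"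
    using assms by (fastforce simp: Rn_iff simplical_face_def)
  show "smooth_fun_on n S (\<lambda>x. simplical_face i x j)" for j
    unfolding simplical_face_def
    by (cases "j < i"; cases "j = i") (simp_all add: smooth_fun_on_const[OF assms] smooth_fun_on_proj[OF assms])
qed

lemma smooth_simplex_face:
  assumes "smooth_simplex (Suc k) M \<sigma>" "i \<le> Suc k"
  shows "smooth_simplex k M (singular_face (Suc k) i \<sigma>)"
proof -
  have "smooth_into (Suc k) (standard_simplex k) M (\<lambda>x. \<sigma> (simplical_face i x))"
  proof (rule smooth_into_compose)
    show "smooth_into (Suc (Suc k)) (standard_simplex (Suc k)) M \<sigma>"
      using assms(1) by (simp add: smooth_simplex_iff)
    show "simplical_face i ` standard_simplex k \<subseteq> standard_simplex (Suc k)"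
      using simplical_face_in_standard_simplex[of "Suc k" i] assms(2) by auto
  qed (rule smooth_on_simplical_face standard_simplex_Rn)+
  from smooth_simplex_restrict[OF this] show ?thesis by (simp add: singular_face_def comp_def)
qed

lemma smooth_simplex_map:
  assumes "smooth_manifold A" "smooth_manifold M" "smooth_map A M \<rho>" "smooth_simplex k A \<sigma>"
  shows "smooth_simplex k M (simplex_map k \<rho> \<sigma>)"
proof -
  have "smooth_into (Suc k) (standard_simplex k) M (\<lambda>x. \<rho> (\<sigma> x))"
    by (rule smooth_into_map[OF assms(1-3)]) (use assms(4) in \<open>simp add: smooth_simplex_iff\<close>)
  from smooth_simplex_restrict[OF this] show ?thesis by (simp add: simplex_map_def comp_def)
qed

lemma smooth_chains_iff:
  "c \<in> carrier (smooth_chains M k) \<longleftrightarrow>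
    (\<forall>\<sigma>\<in>Poly_Mapping.keys c. 0 \<le> k \<and> smooth_simplex (nat k) M \<sigma>)"
  by (auto simp: smooth_chains_def)

lemma smooth_chains_neg: "k < 0 \<Longrightarrow> c \<in> carrier (smooth_chains M k) \<longleftrightarrow> c = 0"
  by (auto simp: smooth_chains_iff)

lemma smooth_chains_0 [simp]: "0 \<in> carrier (smooth_chains M k)"
  by (simp add: smooth_chains_iff)

lemma smooth_chains_add:
  "a \<in> carrier (smooth_chains M k) \<Longrightarrow> b \<in> carrier (smooth_chains M k) \<Longrightarrow> a + b \<in> carrier (smooth_chains M k)"
  unfolding smooth_chains_iff using keys_add[of a b] by blast

lemma smooth_chains_uminus [simp]:
  "- a \<in> carrier (smooth_chains M k) \<longleftrightarrow> a \<in> carrier (smooth_chains M k)"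
  by (simp add: smooth_chains_iff)

lemma smooth_chains_sum:
  "(\<And>i. i \<in> I \<Longrightarrow> f i \<in> carrier (smooth_chains M k)) \<Longrightarrow> (\<Sum>i\<in>I. f i) \<in> carrier (smooth_chains M k)"
  by (induct I rule: infinite_finite_induct) (auto intro: smooth_chains_add)

lemma smooth_chains_cmul:
  "a \<in> carrier (smooth_chains M k) \<Longrightarrow> frag_cmul n a \<in> carrier (smooth_chains M k)"
  by (auto simp: smooth_chains_iff)

lemma smooth_chains_of:
  "frag_of \<sigma> \<in> carrier (smooth_chains M k) \<longleftrightarrow> 0 \<le> k \<and> smooth_simplex (nat k) M \<sigma>"
  by (simp add: smooth_chains_iff)

lemma smooth_chains_singular:
  "c \<in> carrier (smooth_chains M k) \<Longrightarrow> singular_chain (nat k) (mtop M) c"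
  by (auto simp: smooth_chains_iff singular_chain_def smooth_simplex_def)

lemma smooth_chains_boundary:
  assumes "c \<in> carrier (smooth_chains M k)"
  shows "chain_boundary (nat k) c \<in> carrier (smooth_chains M (k - 1))"
proof (cases "k \<le> 0")
  case False
  then obtain n where n: "nat k = Suc n" "nat (k - 1) = n" by (cases "nat k") auto
  have "frag_of (singular_face (Suc n) i \<sigma>) \<in> carrier (smooth_chains M (k - 1))"
    if "\<sigma> \<in> Poly_Mapping.keys c" "i \<le> Suc n" for \<sigma> i
    using assms that False n smooth_simplex_face[of n M \<sigma> i] by (simp add: smooth_chains_of smooth_chains_iff[of c])
  then have "(\<Sum>\<sigma>\<in>Poly_Mapping.keys c. frag_cmul (Poly_Mapping.lookup c \<sigma>)
      (\<Sum>i\<le>Suc n. frag_cmul ((- 1) ^ i) (frag_of (singular_face (Suc n) i \<sigma>)))) \<in> carrier (smooth_chains M (k - 1))"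
    by (intro smooth_chains_sum smooth_chains_cmul) simp
  then show ?thesis by (simp only: chain_boundary_def n frag_extend_def) simp
qed (simp add: chain_boundary_def)

lemma smooth_chains_chain_map:
  assumes "smooth_manifold A" "smooth_manifold M" "smooth_map A M \<rho>" "c \<in> carrier (smooth_chains A k)"
  shows "chain_map (nat k) \<rho> c \<in> carrier (smooth_chains M k)"
  unfolding chain_map_def frag_extend_def
  using assms
  by (auto intro!: smooth_chains_sum smooth_chains_cmul smooth_simplex_map simp: smooth_chains_of smooth_chains_iff[of c])

lemma smooth_chain_boundary_boundary:
  assumes "c \<in> carrier (smooth_chains M k)"
  shows "chain_boundary (nat (k - 1)) (chain_boundary (nat k) c) = 0"
proof -
  have "nat (k - 1) = nat k - Suc 0" by arith
  then show ?thesis using chain_boundary_boundary[OF smooth_chains_singular[OF assms]] by simp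
qed

lemma smooth_chain_boundary_chain_map:
  assumes "c \<in> carrier (smooth_chains A k)"
  shows "chain_boundary (nat k) (chain_map (nat k) \<rho> c) = chain_map (nat (k - 1)) \<rho> (chain_boundary (nat k) c)"
proof -
  have "nat (k - 1) = nat k - Suc 0" by arith
  then show ?thesis using chain_boundary_chain_map[OF smooth_chains_singular[OF assms]] by simp
qed

lemma chain_integral_superset:
  assumes "finite F" "Poly_Mapping.keys z \<subseteq> F"
  shows "chain_integral M k z \<omega> =
    (\<Sum>\<sigma>\<in>F. of_int (Poly_Mapping.lookup z \<sigma>) * simplex_integral M (nat k) \<sigma> \<omega>)"
  unfolding chain_integral_def using assms
  by (intro sum.mono_neutral_left) (auto simp: in_keys_iff)

lemma chain_integral_add:
  "chain_integral M k (a + b) \<omega> = chain_integral M k a \<omega> + chain_integral M k b \<omega>"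
proof -
  let ?F = "Poly_Mapping.keys a \<union> Poly_Mapping.keys b"
  have "finite ?F" by simp
  then show ?thesis
    using keys_add[of a b]
    by (simp add: chain_integral_superset[of ?F] lookup_add algebra_simps sum.distrib)
qed

lemma chain_integral_0 [simp]: "chain_integral M k 0 \<omega> = 0"
  by (simp add: chain_integral_def)

lemma chain_integral_cmul: "chain_integral M k (frag_cmul n a) \<omega> = of_int n * chain_integral M k a \<omega>"
proof -
  have "Poly_Mapping.keys (frag_cmul n a) \<subseteq> Poly_Mapping.keys a" by auto
  then show ?thesis
    by (simp add: chain_integral_superset[of "Poly_Mapping.keys a"] sum_distrib_left mult.assoc)
qed

lemma chain_integral_uminus: "chain_integral M k (- a) \<omega> = - chain_integral M k a \<omega>"
  using chain_integral_cmul[of M k "- 1" a \<omega>] by simp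

lemma chain_integral_sum: "chain_integral M k (\<Sum>i\<in>I. f i) \<omega> = (\<Sum>i\<in>I. chain_integral M k (f i) \<omega>)"
  by (induct I rule: infinite_finite_induct) (simp_all add: chain_integral_add)

lemma chain_integral_of: "chain_integral M k (frag_of \<sigma>) \<omega> = simplex_integral M (nat k) \<sigma> \<omega>"
  by (simp add: chain_integral_def)

lemma chain_integral_frag_extend:
  "chain_integral M k (frag_extend \<phi> c) \<omega> =
    (\<Sum>\<sigma>\<in>Poly_Mapping.keys c. of_int (Poly_Mapping.lookup c \<sigma>) * chain_integral M k (\<phi> \<sigma>) \<omega>)"
  by (simp add: frag_extend_def chain_integral_sum chain_integral_cmul)

section \<open>Integration of forms over chains\<close>

lemma simplex_param_mem: "y \<in> open_simplex k \<Longrightarrow> simplex_param k y \<in> standard_simplex k"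
proof -
  assume y: "y \<in> open_simplex k"
  have pos: "0 < y i" if "i < k" for i using y that by (simp add: open_simplex_def)
  have le: "y i \<le> (\<Sum>j<k. y j)" if "i < k" for i
    using that pos by (intro member_le_sum) (auto simp: less_imp_le)
  have z: "y i = 0" if "i \<ge> k" for i using y that by (simp add: open_simplex_def Rn_iff)
  have s: "(\<Sum>j<k. y j) < 1" using y by (simp add: open_simplex_def)
  have "0 \<le> (\<Sum>j<k. y j)" using pos by (intro sum_nonneg) (simp add: less_imp_le)
  note s = s this
  have "(\<Sum>i\<le>k. simplex_param k y i) = 1"
    by (simp add: sum.atMost_shift simplex_param_def)
  moreover have "0 \<le> simplex_param k y i \<and> simplex_param k y i \<le> 1" for i
  proof (cases "0 < i \<and> i \<le> k")
    case True
    then have "i - 1 < k" by linarith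
    then show ?thesis using pos[of "i - 1"] le[of "i - 1"] s True by (auto simp: simplex_param_def)
  next
    case False
    then show ?thesis using s z[of "i - 1"] by (cases "i = 0") (auto simp: simplex_param_def)
  qed
  moreover have "simplex_param k y i = 0" if "i > k" for i
    using that z[of "i - 1"] by (simp add: simplex_param_def)
  ultimately show ?thesis by (simp add: standard_simplex_def)
qed

lemma smooth_on_simplex_param:
  assumes S: "S \<subseteq> Rn k" shows "smooth_on k (Suc k) S (simplex_param k)"
  unfolding smooth_on_def
proof (intro conjI allI impI)
  show "simplex_param k ` S \<subseteq> Rn (Suc k)"
    using S by (fastforce simp: simplex_param_def Rn_iff)
  have sub: "smooth_fun_on k S (\<lambda>x. 1 + (- 1) * (\<Sum>j<k. x j))"
    by (intro smooth_fun_on_add smooth_fun_on_mult smooth_fun_on_const smooth_fun_on_sum smooth_fun_on_proj S)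
  show "smooth_fun_on k S (\<lambda>x. simplex_param k x j)" for j
    using sub smooth_fun_on_proj[OF S] by (cases "j = 0") (simp_all add: simplex_param_def)
qed

text \<open>Forgets the time before parametrizing the simplex. The time has to be erased:
  \<open>simplex_param k\<close> would otherwise copy it to coordinate k + 1.\<close>

definition prism_param :: "nat \<Rightarrow> (nat \<Rightarrow> real) \<Rightarrow> nat \<Rightarrow> real" where
  "prism_param k w = simplex_param k (w(k := 0))"

lemma prism_param_slice: "y \<in> open_simplex k \<Longrightarrow> prism_param k (y(k := t)) = simplex_param k y"
proof -
  assume "y \<in> open_simplex k"
  then have "y(k := 0) = y" by (auto simp: open_simplex_def Rn_iff)
  then show ?thesis by (simp add: prism_param_def)
qed

lemma prism_param_mem: "w \<in> prism k \<Longrightarrow> prism_param k w \<in> standard_simplex k"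
proof -
  assume w: "w \<in> prism k"
  have s: "(\<Sum>j<k. (w(k := 0)) j) = (\<Sum>j<k. w j)" by (rule sum.cong) auto
  have z: "w i = 0" if "i > k" for i using w that by (simp add: prism_def Rn_iff)
  have nn: "0 \<le> w i \<and> w i \<le> 1" for i by (rule prism_le_1[OF w])
  have s2: "(\<Sum>j<k. w j) \<le> 1" "0 \<le> (\<Sum>j<k. w j)"
    using w by (auto simp: prism_def intro!: sum_nonneg)
  have "(\<Sum>i\<le>k. prism_param k w i) = 1"
    by (simp add: sum.atMost_shift prism_param_def simplex_param_def)
  moreover have "0 \<le> prism_param k w i \<and> prism_param k w i \<le> 1" for i
    using nn s s2 by (auto simp: prism_param_def simplex_param_def)
  moreover have "prism_param k w i = 0" if "i > k" for i
    using that z[of "i - 1"] by (auto simp: prism_param_def simplex_param_def)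
  ultimately show ?thesis by (simp add: standard_simplex_def)
qed

lemma smooth_on_prism_param: "smooth_on (Suc k) (Suc k) (prism k) (prism_param k)"
proof -
  have "smooth_on (Suc k) (Suc k) (prism k) (\<lambda>w. simplex_param k (w(k := 0)))"
  proof (rule smooth_on_compose[OF smooth_on_simplex_param])
    show "smooth_on (Suc k) k (prism k) (\<lambda>w. w(k := 0))"
      unfolding smooth_on_def
    proof (intro conjI allI impI)
      show "(\<lambda>w. w(k := 0)) ` prism k \<subseteq> Rn k" by (auto simp: prism_def Rn_iff)
      show "smooth_fun_on (Suc k) (prism k) (\<lambda>w. (w(k := 0)) j)" for j
        using smooth_fun_on_const[OF prism_Rn] smooth_fun_on_proj[OF prism_Rn] by (cases "j = k") auto
    qed
    show "(\<lambda>w. w(k := 0)) ` prism k \<subseteq> Rn k" by (auto simp: prism_def Rn_iff)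
  qed (auto simp: prism_Rn)
  then show ?thesis by (simp add: prism_param_def[abs_def])
qed

text \<open>Integrals see only interior points of the simplex, so \<open>\<tau>\<close> may be any
  family that matches the slices of G there. All analysis of the prism is used through this lemma:
  continuity in the parameter for contractions, bounds for integrability and positivity.\<close>

lemma simplex_integral_family:
  assumes M: "smooth_manifold M" and \<omega>: "differential_form M k \<omega>"
    and G: "smooth_into (Suc k) (prism k) M G"
    and \<tau>: "\<And>t y. t \<in> {0..1} \<Longrightarrow> y \<in> open_simplex k \<Longrightarrow> \<tau> t (simplex_param k y) = G (y(k := t))"
  defines "f t \<equiv> \<lambda>y. pull_at M k (open_simplex k) (\<tau> t \<circ> simplex_param k) \<omega> y (map unit_vec [0..<k])"
  shows "continuous_on {0..1} (\<lambda>t. simplex_integral M k (\<tau> t) \<omega>)"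
    and "\<exists>B. \<forall>t\<in>{0..1}. continuous_on (open_simplex k) (f t) \<and> (\<forall>y\<in>open_simplex k. \<bar>f t y\<bar> \<le> B)"
    and "\<And>t. t \<in> {0..1} \<Longrightarrow> simplex_integral M k (\<tau> t) \<omega> = integral_Rn k (open_simplex k) (f t)"
proof -
  let ?g = "\<lambda>t y. pull_at M k (open_simplex k) (\<lambda>y. G (y(k := t))) \<omega> y (map unit_vec [0..<k])"
  have eq: "f t y = ?g t y" if "t \<in> {0..1}" "y \<in> open_simplex k" for t y
    unfolding f_def
    by (rule pull_at_cong[OF M that(2)])
      (use \<tau>[OF that(1)] smooth_into_topspace[OF G prism_slice[OF that(2,1)]] that in auto)
  have cont: "continuous_on (open_simplex k) (f t)" if "t \<in> {0..1}" for t
    by (rule iffD2[OF continuous_on_cong[OF refl eq[OF that]] slice_density_continuous[OF M \<omega> G that]])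
  obtain B where "\<forall>t\<in>{0..1}. \<forall>y\<in>open_simplex k. \<bar>?g t y\<bar> \<le> B"
    using slice_density_bounded[OF M \<omega> G] by (elim exE)
  note B = this[rule_format]
  show "\<exists>B. \<forall>t\<in>{0..1}. continuous_on (open_simplex k) (f t) \<and> (\<forall>y\<in>open_simplex k. \<bar>f t y\<bar> \<le> B)"
    using cont B eq by (intro exI[of _ B]) simp
  have "continuous_on {0..1} (\<lambda>t. integral_Rn k (open_simplex k) (f t))"
  proof (rule integral_Rn_continuous[OF cont])
    show "\<bar>f t y\<bar> \<le> B" if "t \<in> {0..1}" "y \<in> open_simplex k" for t y
      using B[OF that] eq[OF that] by simp
    show "continuous_on {0..1} (\<lambda>t. f t y)" if "y \<in> open_simplex k" for y
      by (rule iffD2[OF continuous_on_cong[OF refl eq[OF _ that]] slice_density_continuous_param[OF M \<omega> G that]])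
  qed
  then show "continuous_on {0..1} (\<lambda>t. simplex_integral M k (\<tau> t) \<omega>)"
    by (simp add: simplex_integral_def f_def)
  show "simplex_integral M k (\<tau> t) \<omega> = integral_Rn k (open_simplex k) (f t)" for t
    by (simp add: simplex_integral_def f_def)
qed

text \<open>A single simplex is viewed as a family that is constant in time, so that its integrand
  inherits the uniform bound from the prism.\<close>

lemma simplex_integral_integrable:
  assumes M: "smooth_manifold M" and \<omega>: "differential_form M k \<omega>" and \<sigma>: "smooth_simplex k M \<sigma>"
  shows "integrable (Pi\<^sub>M {..<k} (\<lambda>_. lborel)) (\<lambda>x. indicator (open_simplex k) (Rn_emb k x) *
    pull_at M k (open_simplex k) (\<sigma> \<circ> simplex_param k) \<omega> (Rn_emb k x) (map unit_vec [0..<k]))"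
proof -
  have G: "smooth_into (Suc k) (prism k) M (\<lambda>w. \<sigma> (prism_param k w))"
    by (rule smooth_into_compose[OF _ smooth_on_prism_param _ prism_Rn])
      (use \<sigma> prism_param_mem in \<open>auto simp: smooth_simplex_iff\<close>)
  let ?f = "\<lambda>y. pull_at M k (open_simplex k) (\<sigma> \<circ> simplex_param k) \<omega> y (map unit_vec [0..<k])"
  have "\<exists>B. \<forall>t\<in>{0..1::real}. continuous_on (open_simplex k) ?f \<and> (\<forall>y\<in>open_simplex k. \<bar>?f y\<bar> \<le> B)"
    by (rule simplex_integral_family(2)[OF M \<omega> G, of "\<lambda>_. \<sigma>"]) (simp add: prism_param_slice)
  then obtain B where "\<forall>t\<in>{0..1::real}. continuous_on (open_simplex k) ?f \<and> (\<forall>y\<in>open_simplex k. \<bar>?f y\<bar> \<le> B)"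
    by (elim exE)
  then have "continuous_on (open_simplex k) ?f \<and> (\<forall>y\<in>open_simplex k. \<bar>?f y\<bar> \<le> B)"
    by (rule bspec[where x=0]) simp
  then have B: "continuous_on (open_simplex k) ?f" "\<And>y. y \<in> open_simplex k \<Longrightarrow> \<bar>?f y\<bar> \<le> B"
    by blast+
  show ?thesis by (rule open_simplex_integrable[OF B])
qed

lemma pull_at_add:
  "pull_at M n S g (\<lambda>c x vs. \<omega> c x vs + \<eta> c x vs) x vs = pull_at M n S g \<omega> x vs + pull_at M n S g \<eta> x vs"
  by (simp add: pull_at_eq)

lemma pull_at_zero_form [simp]: "pull_at M n S g zero_form x vs = 0"
  by (simp add: pull_at_eq zero_form_def)

lemma simplex_integral_add:
  assumes M: "smooth_manifold M" and \<omega>: "differential_form M k \<omega>" "differential_form M k \<eta>"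
    and \<sigma>: "smooth_simplex k M \<sigma>"
  shows "simplex_integral M k \<sigma> (\<lambda>c x vs. \<omega> c x vs + \<eta> c x vs) =
    simplex_integral M k \<sigma> \<omega> + simplex_integral M k \<sigma> \<eta>"
  unfolding simplex_integral_def integral_Rn_eq pull_at_add distrib_left
  by (rule Bochner_Integration.integral_add)
     (rule simplex_integral_integrable[OF M \<omega>(1) \<sigma>] simplex_integral_integrable[OF M \<omega>(2) \<sigma>])+

lemma simplex_integral_zero_form [simp]: "simplex_integral M k \<sigma> zero_form = 0"
  by (simp add: simplex_integral_def integral_Rn_0)

lemma chain_integral_zero_form [simp]: "chain_integral M k z zero_form = 0"
  by (simp add: chain_integral_def)

text \<open>The integrands agree at every point. \<open>simplex_map\<close> restricts to the closed
  simplex, which contains the image of \<open>simplex_param\<close>, so the restriction is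
  invisible.\<close>

lemma simplex_integral_pull_form:
  assumes A: "smooth_manifold A" and M: "smooth_manifold M" and \<rho>: "smooth_map A M \<rho>"
    and \<sigma>: "smooth_simplex k A \<sigma>"
  shows "simplex_integral A k \<sigma> (pull_form A M \<rho> \<omega>) = simplex_integral M k (simplex_map k \<rho> \<sigma>) \<omega>"
  unfolding simplex_integral_def
proof (rule integral_Rn_cong)
  fix y assume y: "y \<in> open_simplex k"
  have U: "open_simplex k \<subseteq> Rn k" by (auto simp: open_simplex_def)
  have g: "smooth_into k (open_simplex k) A (\<lambda>y. \<sigma> (simplex_param k y))"
    by (rule smooth_into_compose[OF _ smooth_on_simplex_param[OF U] _ U])
      (use \<sigma> simplex_param_mem in \<open>auto simp: smooth_simplex_iff\<close>)
  have "pull_at A k (open_simplex k) (\<lambda>y. \<sigma> (simplex_param k y)) (pull_form A M \<rho> \<omega>) y (map unit_vec [0..<k]) =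
    pull_at M k (open_simplex k) (\<lambda>y. \<rho> (\<sigma> (simplex_param k y))) \<omega> y (map unit_vec [0..<k])"
    by (rule pull_at_pull_form[OF A M \<rho> g line_perfect_open_simplex y])
  also have "\<dots> = pull_at M k (open_simplex k) (\<lambda>y. simplex_map k \<rho> \<sigma> (simplex_param k y)) \<omega> y (map unit_vec [0..<k])"
  proof (rule pull_at_cong[OF M y])
    show "\<rho> (\<sigma> (simplex_param k y)) \<in> topspace (mtop M)"
      by (rule smooth_into_topspace[OF smooth_into_map[OF A M \<rho> g] y])
  qed (simp add: simplex_map_def simplex_param_mem)
  finally show "pull_at A k (open_simplex k) (\<sigma> \<circ> simplex_param k) (pull_form A M \<rho> \<omega>) y (map unit_vec [0..<k]) =
    pull_at M k (open_simplex k) (simplex_map k \<rho> \<sigma> \<circ> simplex_param k) \<omega> y (map unit_vec [0..<k])"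
    by (simp add: comp_def)
qed

subsection \<open>Forms with periods in a proper subring\<close>

lemma real_subring:
  assumes "subring \<Lambda> real_ring"
  shows "0 \<in> \<Lambda>" "1 \<in> \<Lambda>" "x \<in> \<Lambda> \<Longrightarrow> y \<in> \<Lambda> \<Longrightarrow> x + y \<in> \<Lambda>" "x \<in> \<Lambda> \<Longrightarrow> - x \<in> \<Lambda>"
    "x \<in> \<Lambda> \<Longrightarrow> y \<in> \<Lambda> \<Longrightarrow> x - y \<in> \<Lambda>" "x \<in> \<Lambda> \<Longrightarrow> of_int n * x \<in> \<Lambda>"
proof -
  interpret R: ring real_ring by (rule ring_from_type_algebra)
  have real: "carrier real_ring = (UNIV :: real set)" "\<zero>\<^bsub>real_ring\<^esub> = (0 :: real)" "\<one>\<^bsub>real_ring\<^esub> = (1 :: real)"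
    "\<And>x y :: real. x \<oplus>\<^bsub>real_ring\<^esub> y = x + y" "\<And>x y :: real. x \<otimes>\<^bsub>real_ring\<^esub> y = x * y"
    by (simp_all add: ring_of_type_algebra_def)
  have minus: "\<ominus>\<^bsub>real_ring\<^esub> x = - x" for x :: real
    by (rule R.minus_equality) (simp_all add: real)
  note E = subringE[OF assms, unfolded real minus]
  show z: "0 \<in> \<Lambda>" "1 \<in> \<Lambda>" by (rule E)+
  show add: "x \<in> \<Lambda> \<Longrightarrow> y \<in> \<Lambda> \<Longrightarrow> x + y \<in> \<Lambda>" for x y by (rule E)
  show neg: "x \<in> \<Lambda> \<Longrightarrow> - x \<in> \<Lambda>" for x by (rule E)
  show "x \<in> \<Lambda> \<Longrightarrow> y \<in> \<Lambda> \<Longrightarrow> x - y \<in> \<Lambda>" using add[of x "- y"] neg[of y] by simp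
  assume x: "x \<in> \<Lambda>"
  have nat: "of_nat m * x \<in> \<Lambda>" for m
    by (induct m) (simp_all add: z x add algebra_simps)
  show "of_int n * x \<in> \<Lambda>"
    using nat[of "nat n"] neg[OF nat[of "nat (- n)"]] by (cases "0 \<le> n") auto
qed

text \<open>If the endpoints differed, the image would contain an interval [a, b] by connectedness.
  Differences then put [0, b - a] into \<open>\<Lambda>\<close>, integer multiples all nonnegative
  reals, and negation all reals.\<close>

lemma continuous_into_proper_subring:
  fixes F :: "real \<Rightarrow> real"
  assumes \<Lambda>: "subring \<Lambda> real_ring" "\<Lambda> \<noteq> UNIV"
    and F: "continuous_on {0..1} F" "\<And>t. t \<in> {0..1} \<Longrightarrow> F t \<in> \<Lambda>"
  shows "F 0 = F 1"
proof (rule ccontr)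
  assume ne: "F 0 \<noteq> F 1"
  define a where "a = min (F 0) (F 1)"
  define b where "b = max (F 0) (F 1)"
  have ab: "a < b" using ne by (auto simp: a_def b_def)
  have "connected (F ` {0..1})" by (rule connected_continuous_image[OF F(1)]) auto
  then have sub: "{a..b} \<subseteq> F ` {0..1}"
    by (rule connected_contains_Icc) (auto simp: a_def b_def min_def max_def)
  have small: "r \<in> \<Lambda>" if "0 \<le> r" "r \<le> b - a" for r
  proof -
    have "a + r \<in> {a..b}" "a \<in> {a..b}" using that ab by auto
    moreover have "{a..b} \<subseteq> \<Lambda>" using sub F(2) by (meson image_subset_iff order_trans)
    ultimately have "a + r \<in> \<Lambda>" "a \<in> \<Lambda>" by auto
    then show ?thesis using real_subring(5)[OF \<Lambda>(1), of "a + r" a] by simp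
  qed
  have nonneg: "r \<in> \<Lambda>" if r: "0 \<le> r" for r
  proof -
    obtain m :: nat where m: "r / (b - a) < real m" using reals_Archimedean2 by blast
    moreover have "0 \<le> r / (b - a)" using r ab by simp
    ultimately have "0 < real m" by linarith
    then have pos: "m > 0" by simp
    have "r < real m * (b - a)" using m ab by (simp add: pos_divide_less_eq)
    then have "r / real m \<le> b - a" using pos by (simp add: pos_divide_le_eq mult.commute)
    moreover have "0 \<le> r / real m" using r by simp
    ultimately have "r / real m \<in> \<Lambda>" by (rule small[rotated])
    from real_subring(6)[OF \<Lambda>(1) this, of "int m"] show ?thesis using pos by simp
  qed
  have "r \<in> \<Lambda>" for r
  proof (cases "0 \<le> r")
    case False
    then have "- (- r) \<in> \<Lambda>" by (intro real_subring(4)[OF \<Lambda>(1)] nonneg) simp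
    then show ?thesis by simp
  qed (rule nonneg)
  then show False using \<Lambda>(2) by blast
qed

text \<open>The differential of a constant map is 0, and a form of positive degree has at least one
  argument on which this shows.\<close>

lemma pull_at_constant:
  assumes M: "smooth_manifold M" and \<omega>: "differential_form M k \<omega>" and k: "k > 0" and S: "line_perfect n S"
    and x: "x \<in> S" and p: "p \<in> topspace (mtop M)" and g: "\<And>y. y \<in> S \<Longrightarrow> g y = p" and vs: "length vs = k"
  shows "pull_at M n S g \<omega> x vs = 0"
proof -
  define d where "d = chart_at M p"
  have d: "d \<in> atlas M" "p \<in> chart_dom d" using chart_at[OF M p] by (simp_all add: d_def)
  have eq: "{y \<in> S. g y \<in> chart_dom d} = S" using g d by auto
  have "differential n S (\<lambda>y. chart_map d (g y)) x v = (\<lambda>_. 0)" for v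
  proof
    fix j show "differential n S (\<lambda>y. chart_map d (g y)) x v j = 0"
      by (rule differential_eq_0[OF S x, where c="chart_map d p j"]) (simp add: g)
  qed
  then have "pull_at M n S g \<omega> x vs = \<omega> d (chart_map d p) (map (\<lambda>v _. 0) vs)"
    using g[OF x] by (simp add: pull_at_eq d_def[symmetric] eq fun_eq_iff[symmetric] cong: map_cong)
  also have "\<dots> = 0"
  proof -
    obtain v ws where "vs = v # ws" using vs k by (cases vs) auto
    then have "map (\<lambda>v (_ :: nat). 0 :: real) vs = [] @ (\<lambda>_. 0) # map (\<lambda>v _. 0) ws" by simp
    moreover have "\<omega> d (chart_map d p) ([] @ (\<lambda>_. 0) # map (\<lambda>v _. 0) ws) = 0"
      by (rule alternating_zero[OF form_alternating[OF \<omega> d(1)]])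
        (use d vs \<open>vs = v # ws\<close> in \<open>auto simp: Rn_iff\<close>)
    ultimately show ?thesis by simp
  qed
  finally show ?thesis .
qed

lemma simplex_integral_constant:
  assumes M: "smooth_manifold M" and \<omega>: "differential_form M k \<omega>" and k: "k > 0"
    and p: "p \<in> topspace (mtop M)" and \<sigma>: "\<And>y. y \<in> standard_simplex k \<Longrightarrow> \<sigma> y = p"
  shows "simplex_integral M k \<sigma> \<omega> = 0"
proof -
  have "simplex_integral M k \<sigma> \<omega> = integral_Rn k (open_simplex k) (\<lambda>_. 0)"
    unfolding simplex_integral_def
    by (rule integral_Rn_cong, rule pull_at_constant[OF M \<omega> k line_perfect_open_simplex _ p])
      (use \<sigma> simplex_param_mem in auto)
  then show ?thesis by (simp add: integral_Rn_0)
qed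

lemma chain_integral_boundary_of:
  "chain_integral M (int n) (chain_boundary (Suc n) (frag_of \<sigma>)) \<omega> =
    (\<Sum>i\<le>Suc n. (- 1) ^ i * simplex_integral M n (singular_face (Suc n) i \<sigma>) \<omega>)"
  by (simp add: chain_boundary_of chain_integral_sum chain_integral_cmul chain_integral_of del: sum.atMost_Suc)

text \<open>Contract the simplex to a vertex: the integrals over the boundaries depend continuously on the
  parameter and lie in \<open>\<Lambda>\<close>, so they all equal the integral over the boundary of a constant simplex.\<close>

lemma simplex_boundary_integral_zero:
  assumes M: "smooth_manifold M" and \<omega>: "differential_form M n \<omega>"
    and \<Lambda>: "subring \<Lambda> real_ring" "\<Lambda> \<noteq> UNIV"
    and per: "\<And>z. z \<in> smooth_cycles M (int n) \<Longrightarrow> chain_integral M (int n) z \<omega> \<in> \<Lambda>"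
    and \<sigma>: "smooth_simplex (Suc n) M \<sigma>"
  shows "chain_integral M (int n) (chain_boundary (Suc n) (frag_of \<sigma>)) \<omega> = 0"
proof -
  let ?\<Delta> = "standard_simplex (Suc n)"
  \<comment> \<open>Vertex 0 of the simplex. The homotopy h below is constant at v for t = 0 and the
    identity for t = 1.\<close>
  define v where "v = (\<lambda>j::nat. if j = 0 then 1 else 0 :: real)"
  have v: "v \<in> ?\<Delta>" by (simp add: v_def)
  define h where "h t p = (\<lambda>j. (1 - t) * v j + t * p j)" for t :: real and p :: "nat \<Rightarrow> real"
  have h: "h t p \<in> ?\<Delta>" if "p \<in> ?\<Delta>" "t \<in> {0..1}" for t p
    using convex_standard_simplex[OF v that(1), of t] that(2) by (simp add: h_def)
  define \<sigma>' where "\<sigma>' t = restrict (\<lambda>p. \<sigma> (h t p)) ?\<Delta>" for t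
  have vj: "v j = 0" if "j \<ge> Suc (Suc n)" for j using that by (simp add: v_def)
  have \<sigma>i: "smooth_into (Suc (Suc n)) ?\<Delta> M \<sigma>" using \<sigma> by (simp add: smooth_simplex_iff)
  have smooth: "smooth_simplex (Suc n) M (\<sigma>' t)" if t: "t \<in> {0..1}" for t
    unfolding \<sigma>'_def
  proof (rule smooth_simplex_restrict, rule smooth_into_compose[OF \<sigma>i])
    note R = standard_simplex_Rn[of "Suc n"]
    show "smooth_on (Suc (Suc n)) (Suc (Suc n)) ?\<Delta> (h t)"
      unfolding smooth_on_def
    proof (intro conjI allI impI)
      show "h t ` ?\<Delta> \<subseteq> Rn (Suc (Suc n))" using h[OF _ t] R by blast
      show "smooth_fun_on (Suc (Suc n)) ?\<Delta> (\<lambda>p. h t p j)" for j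
        unfolding h_def
        by (intro smooth_fun_on_add smooth_fun_on_mult smooth_fun_on_const smooth_fun_on_proj R)
    qed
    show "h t ` ?\<Delta> \<subseteq> ?\<Delta>" using h[OF _ t] by blast
  qed (rule standard_simplex_Rn)
  have bdry: "chain_integral M (int n) (chain_boundary (Suc n) (frag_of (\<sigma>' t))) \<omega> \<in> \<Lambda>" if t: "t \<in> {0..1}" for t
  proof (rule per)
    have c: "frag_of (\<sigma>' t) \<in> carrier (smooth_chains M (int (Suc n)))"
      using smooth[OF t] by (simp add: smooth_chains_of del: of_nat_Suc)
    have n: "nat (int (Suc n)) = Suc n" "int (Suc n) - 1 = int n" by simp_all
    show "chain_boundary (Suc n) (frag_of (\<sigma>' t)) \<in> smooth_cycles M (int n)"
      using smooth_chains_boundary[OF c] smooth_chain_boundary_boundary[OF c]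
      unfolding smooth_cycles_def n by simp
  qed
  have face: "singular_face (Suc n) i (\<sigma>' t) q = \<sigma> (h t (simplical_face i q))"
    if "i \<le> Suc n" "q \<in> standard_simplex n" for i t q
    using that simplical_face_in_standard_simplex[of "Suc n" i q]
    by (simp add: singular_face_def \<sigma>'_def)
  have cont: "continuous_on {0..1} (\<lambda>t. simplex_integral M n (singular_face (Suc n) i (\<sigma>' t)) \<omega>)"
    if i: "i \<le> Suc n" for i
  proof (rule simplex_integral_family(1)[OF M \<omega>])
    \<comment> \<open>Face inclusion and contraction as one map of the prism, with the time read off
      as \<open>w n\<close>; it has to be smooth jointly in point and time, not only at each
      time.\<close>
    let ?L = "\<lambda>w j. (1 - w n) * v j + w n * simplical_face i (prism_param n w) j"
    have L: "?L w = h (w n) (simplical_face i (prism_param n w))" for w by (simp add: h_def)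
    have f: "simplical_face i (prism_param n w) \<in> ?\<Delta>" if "w \<in> prism n" for w
      using simplical_face_in_standard_simplex[of "Suc n" i] prism_param_mem[OF that] i by simp
    have Lm: "?L w \<in> ?\<Delta>" if "w \<in> prism n" for w
      unfolding L by (rule h[OF f[OF that]]) (use prism_le_1[OF that] in auto)
    show "smooth_into (Suc n) (prism n) M (\<lambda>w. \<sigma> (?L w))"
    proof (rule smooth_into_compose[OF \<sigma>i _ _ prism_Rn])
      have Q: "smooth_on (Suc n) (Suc (Suc n)) (prism n) (\<lambda>w. simplical_face i (prism_param n w))"
        by (rule smooth_on_compose[OF smooth_on_simplical_face smooth_on_prism_param order_refl prism_Rn])
          (use smooth_on_prism_param in \<open>auto simp: smooth_on_def\<close>)
      show "smooth_on (Suc n) (Suc (Suc n)) (prism n) ?L"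
        unfolding smooth_on_def
      proof (intro conjI allI impI)
        show "?L ` prism n \<subseteq> Rn (Suc (Suc n))" using Lm standard_simplex_Rn by blast
        fix j assume j: "j < Suc (Suc n)"
        have "smooth_fun_on (Suc n) (prism n) (\<lambda>w. (1 + (- 1) * w n) * v j + w n * simplical_face i (prism_param n w) j)"
          by (intro smooth_fun_on_add smooth_fun_on_mult smooth_fun_on_const smooth_fun_on_proj prism_Rn
              smooth_on_component[OF Q j])
        then show "smooth_fun_on (Suc n) (prism n) (\<lambda>w. ?L w j)" by simp
      qed
      show "?L ` prism n \<subseteq> ?\<Delta>" using Lm by blast
    qed
    show "singular_face (Suc n) i (\<sigma>' t) (simplex_param n y) = \<sigma> (?L (y(n := t)))"
      if "y \<in> open_simplex n" for t y
      using face[OF i simplex_param_mem[OF that], of t] prism_param_slice[OF that] by (simp add: h_def)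
  qed
  have "chain_integral M (int n) (chain_boundary (Suc n) (frag_of (\<sigma>' 0))) \<omega> =
    chain_integral M (int n) (chain_boundary (Suc n) (frag_of (\<sigma>' 1))) \<omega>"
  proof (rule continuous_into_proper_subring[OF \<Lambda> _ bdry])
    show "continuous_on {0..1} (\<lambda>t. chain_integral M (int n) (chain_boundary (Suc n) (frag_of (\<sigma>' t))) \<omega>)"
      unfolding chain_integral_boundary_of using cont by (intro continuous_intros) auto
  qed
  moreover have "\<sigma>' 1 = \<sigma>"
  proof
    fix p show "\<sigma>' 1 p = \<sigma> p"
      using \<sigma> by (auto simp: \<sigma>'_def h_def smooth_simplex_iff extensional_def restrict_def)
  qed
  moreover have "chain_integral M (int n) (chain_boundary (Suc n) (frag_of (\<sigma>' 0))) \<omega> = 0"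
  proof -
    have const: "singular_face (Suc n) i (\<sigma>' 0) = restrict (\<lambda>_. \<sigma> v) (standard_simplex n)" if "i \<le> Suc n" for i
    proof
      fix q show "singular_face (Suc n) i (\<sigma>' 0) q = restrict (\<lambda>_. \<sigma> v) (standard_simplex n) q"
        using face[OF that, of q 0] by (cases "q \<in> standard_simplex n") (simp_all add: h_def singular_face_def)
    qed
    show ?thesis
    \<comment> \<open>In degree 0 the integral over a constant simplex is the value of the function
      and need not vanish. There the two faces have equal integrals and opposite signs.\<close>
    proof (cases "n = 0")
      case True
      have "{..Suc 0} = {0, Suc 0}" by auto
      then show ?thesis unfolding chain_integral_boundary_of using const True by simp
    next
      case False
      have "simplex_integral M n (restrict (\<lambda>_. \<sigma> v) (standard_simplex n)) \<omega> = 0"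
        by (rule simplex_integral_constant[OF M \<omega>, of "\<sigma> v"])
          (use False smooth_into_topspace[OF \<sigma>i v] in auto)
      then show ?thesis unfolding chain_integral_boundary_of using const by simp
    qed
  qed
  ultimately show ?thesis by simp
qed

lemma alternating_scale:
  assumes \<alpha>: "alternating m k \<alpha>" and len: "length us + length vs = k"
    and R: "set us \<subseteq> Rn m" "set vs \<subseteq> Rn m"
  shows "\<alpha> (us @ map (\<lambda>v j. a * v j) vs) = a ^ length vs * \<alpha> (us @ vs)"
  using len R
proof (induct vs arbitrary: us)
  case (Cons v vs)
  have R': "set us \<subseteq> Rn m" "v \<in> Rn m" "set (map (\<lambda>v j. a * v j) vs) \<subseteq> Rn m" "set vs \<subseteq> Rn m"
    using Cons.prems by (auto simp: Rn_iff)
  have z: "(\<lambda>_. 0) \<in> Rn m" by (simp add: Rn_iff)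
  have len: "length us + Suc (length (map (\<lambda>v j. a * v j) vs)) = k" using Cons.prems(1) by simp
  have "\<alpha> (us @ (\<lambda>j. a * v j + 0) # map (\<lambda>v j. a * v j) vs) = a * \<alpha> (us @ v # map (\<lambda>v j. a * v j) vs)"
    using alternating_linear[OF \<alpha> len R'(1,3,2) z, of a] alternating_zero[OF \<alpha> len R'(1,3)] by simp
  moreover have "\<alpha> ((us @ [v]) @ map (\<lambda>v j. a * v j) vs) = a ^ length vs * \<alpha> ((us @ [v]) @ vs)"
    by (rule Cons.hyps) (use Cons.prems in auto)
  ultimately show ?case by simp
qed simp

lemma integral_Rn_mult_right: "integral_Rn k S (\<lambda>x. f x * a) = integral_Rn k S f * (a :: real)"
  by (simp add: integral_Rn_eq mult.assoc[symmetric])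

text \<open>Integrate over the affine simplices spanned at \<open>x\<close> by small multiples of coordinate vectors:
  shrinking them to \<open>x\<close> shows that the integrals vanish, while the integrand has constant sign
  if it does not vanish at \<open>x\<close>.\<close>

lemma form_zero_if_simplex_integrals:
  assumes M: "smooth_manifold M" and \<omega>: "differential_form M k \<omega>" and k: "k > 0"
    and \<Lambda>: "subring \<Lambda> real_ring" "\<Lambda> \<noteq> UNIV"
    and per: "\<And>\<sigma>. smooth_simplex k M \<sigma> \<Longrightarrow> simplex_integral M k \<sigma> \<omega> \<in> \<Lambda>"
  shows "\<omega> = zero_form"
proof -
  have key: "\<omega> c x (map unit_vec js) = 0"
    if c: "c \<in> atlas M" "x \<in> chart_img c" and js: "length js = k" "set js \<subseteq> {..<mdim M}" for c x js
  proof (rule ccontr)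
    let ?m = "mdim M"
    define h where "h z = \<omega> c z (map unit_vec js)" for z
    assume "\<omega> c x (map unit_vec js) \<noteq> 0"
    \<comment> \<open>Multiplying by \<open>h x\<close> throughout replaces a case distinction on
      the sign of the coefficient.\<close>
    then have hx: "h x * h x > 0" using not_real_square_gt_zero[of "h x"] unfolding h_def by blast
    have xR: "x \<in> Rn ?m" using chart_img_Rn[OF M c(1)] c(2) by blast
    obtain V where V: "openin (Euclidean_space ?m) V" "chart_img c = V \<inter> {x. 0 \<le> x 0}"
      using chart_img_openin[OF M c(1)] unfolding openin_half_space_iff by blast
    have "continuous_on (chart_img c) (\<lambda>z. h z * h x)"
      using smooth_fun_on_continuous[OF form_smooth[OF \<omega> c(1) js]] unfolding h_def by (intro continuous_intros)
    from continuous_openin_preimage_gen[OF this, of "{0<..}"]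
    have "openin (top_of_set (chart_img c)) (chart_img c \<inter> (\<lambda>z. h z * h x) -` {0<..})" by simp
    then obtain W where W: "openin (Euclidean_space ?m) W"
      "chart_img c \<inter> (\<lambda>z. h z * h x) -` {0<..} = chart_img c \<inter> W"
      using openin_top_of_set_Rn[OF _ chart_img_Rn[OF M c(1)]] by metis
    have "x \<in> chart_img c \<inter> (\<lambda>z. h z * h x) -` {0<..}" using c(2) hx by simp
    then have "x \<in> V \<inter> W" using V(2) c(2) unfolding W(2) by blast
    \<comment> \<open>Within this cube h keeps the sign that it has at x, as far as the cube lies in
      the half-space; that part also stays inside the chart image.\<close>
    then obtain e where e: "e > 0" "\<And>y. y \<in> Rn ?m \<Longrightarrow> (\<forall>j<?m. \<bar>y j - x j\<bar> < e) \<Longrightarrow> y \<in> V \<inter> W"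
      using openin_Int[OF V(1) W(1)] unfolding openin_Rn_box by metis
    define \<delta> where "\<delta> = e / 2"
    have \<delta>: "0 < \<delta>" "\<delta> < e" using e(1) by (simp_all add: \<delta>_def)
    define s where "s j w = (\<Sum>i<k. (if js ! i = j then 1 else 0) * w i)" for j and w :: "nat \<Rightarrow> real"
    \<comment> \<open>At time \<open>w k\<close> this runs through the affine simplex with vertex x
      whose edges are \<open>\<delta> * w k\<close> times the unit vectors listed in
      \<open>js\<close>. No coordinate ever decreases, so the simplex stays in the half-space even
      when x is a boundary point.\<close>
    define B where "B w = (\<lambda>j. x j + \<delta> * (w k * s j w))" for w
    have s: "0 \<le> s j w \<and> s j w \<le> 1" if w: "w \<in> prism k" for j w
    proof -
      have "s j w \<le> (\<Sum>i<k. w i)"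
        unfolding s_def using w by (intro sum_mono) (auto simp: prism_def)
      moreover have "0 \<le> s j w"
        unfolding s_def using w by (intro sum_nonneg) (auto simp: prism_def)
      ultimately show ?thesis using w by (simp add: prism_def)
    qed
    have sw: "0 \<le> w k * s j w \<and> w k * s j w \<le> 1" if w: "w \<in> prism k" for j w
      using s[OF w, of j] prism_le_1[OF w, of k] by (simp add: mult_le_one)
    have BR: "B w \<in> Rn ?m" for w
      unfolding Rn_iff
    proof (intro allI impI)
      fix j assume j: "j \<ge> ?m"
      have "s j w = 0"
        unfolding s_def
      proof (rule sum.neutral, rule ballI)
        fix i assume "i \<in> {..<k}"
        then have "js ! i \<in> set js" using js(1) by simp
        then have "js ! i < ?m" using js(2) by blast
        then show "(if js ! i = j then 1 else 0) * w i = 0" using j by auto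
      qed
      then show "B w j = 0" using xR j by (simp add: B_def Rn_iff)
    qed
    have BV: "B w \<in> V \<inter> W" "B w \<in> chart_img c" if w: "w \<in> prism k" for w
    proof -
      have "\<bar>B w j - x j\<bar> < e" for j
      proof -
        have "\<bar>B w j - x j\<bar> = \<delta> * (w k * s j w)" using sw[OF w, of j] \<delta> by (simp add: B_def)
        also have "\<dots> \<le> \<delta> * 1" using sw[OF w, of j] \<delta> by (intro mult_left_mono) auto
        finally show ?thesis using \<delta> by simp
      qed
      then show "B w \<in> V \<inter> W" using e(2)[OF BR] by blast
      moreover have "0 \<le> B w 0" using sw[OF w, of 0] \<delta> c(2) V(2) by (auto simp: B_def)
      ultimately show "B w \<in> chart_img c" using V(2) by blast
    qed
    have Bs: "smooth_on (Suc k) ?m (prism k) B"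
      unfolding smooth_on_def
    proof (intro conjI allI impI)
      show "B ` prism k \<subseteq> Rn ?m" using BR by blast
      show "smooth_fun_on (Suc k) (prism k) (\<lambda>w. B w j)" for j
        unfolding B_def s_def
        by (intro smooth_fun_on_add smooth_fun_on_mult smooth_fun_on_const smooth_fun_on_proj
            smooth_fun_on_sum prism_Rn)
    qed
    define G where "G w = chart_inv c (B w)" for w
    have G: "smooth_into (Suc k) (prism k) M G"
      unfolding G_def
      by (rule smooth_into_compose[OF smooth_into_chart_inv[OF M c(1)] Bs _ prism_Rn]) (use BV in blast)
    \<comment> \<open>Inverse to \<open>simplex_param\<close> on the simplex, with the time t
      inserted: it drops barycentric coordinate 0 and shifts the others down by one.\<close>
    define L where "L t p = (\<lambda>i. if i < k then p (Suc i) else if i = k then t else 0)" for t :: real and p :: "nat \<Rightarrow> real"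
    define \<tau> where "\<tau> t = restrict (\<lambda>p. G (L t p)) (standard_simplex k)" for t
    have L: "L t p \<in> prism k" if t: "t \<in> {0..1}" and p: "p \<in> standard_simplex k" for t p
    proof -
      have "(\<Sum>i<k. L t p i) = (\<Sum>i<k. p (Suc i))" by (rule sum.cong) (auto simp: L_def)
      also have "\<dots> = (\<Sum>i\<le>k. p i) - p 0" by (simp add: sum.atMost_shift)
      finally have "(\<Sum>i<k. L t p i) \<le> 1" using p by (auto simp: standard_simplex_def)
      then show ?thesis using t p by (auto simp: prism_def L_def Rn_iff standard_simplex_def)
    qed
    have \<tau>: "smooth_simplex k M (\<tau> t)" if t: "t \<in> {0..1}" for t
      unfolding \<tau>_def
    proof (rule smooth_simplex_restrict, rule smooth_into_compose[OF G])
      show "smooth_on (Suc k) (Suc k) (standard_simplex k) (L t)"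
        unfolding smooth_on_def
      proof (intro conjI allI impI)
        show "L t ` standard_simplex k \<subseteq> Rn (Suc k)" using L[OF t] prism_Rn by blast
        show "smooth_fun_on (Suc k) (standard_simplex k) (\<lambda>p. L t p j)" for j
          using smooth_fun_on_const[OF standard_simplex_Rn] smooth_fun_on_proj[OF standard_simplex_Rn]
          by (cases "j < k"; cases "j = k") (simp_all add: L_def)
      qed
      show "L t ` standard_simplex k \<subseteq> prism k" using L[OF t] by blast
    qed (rule standard_simplex_Rn)
    have \<tau>G: "\<tau> t (simplex_param k y) = G (y(k := t))" if y: "y \<in> open_simplex k" for t y
    proof -
      have "L t (simplex_param k y) = y(k := t)"
        using y by (auto simp: L_def simplex_param_def open_simplex_def Rn_iff fun_eq_iff)
      then show ?thesis using simplex_param_mem[OF y] by (simp add: \<tau>_def)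
    qed
    have cont: "continuous_on {0..1} (\<lambda>t. simplex_integral M k (\<tau> t) \<omega>)"
      by (rule simplex_integral_family(1)[OF M \<omega> G]) (rule \<tau>G)
    have bounded: "\<exists>B. \<forall>t\<in>{0..1}. continuous_on (open_simplex k)
        (\<lambda>y. pull_at M k (open_simplex k) (\<tau> t \<circ> simplex_param k) \<omega> y (map unit_vec [0..<k])) \<and>
        (\<forall>y\<in>open_simplex k. \<bar>pull_at M k (open_simplex k) (\<tau> t \<circ> simplex_param k) \<omega> y (map unit_vec [0..<k])\<bar> \<le> B)"
      by (rule simplex_integral_family(2)[OF M \<omega> G]) (rule \<tau>G)
    have "simplex_integral M k (\<tau> 0) \<omega> = simplex_integral M k (\<tau> 1) \<omega>"
      by (rule continuous_into_proper_subring[OF \<Lambda> cont]) (use per \<tau> in auto)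
    moreover have "simplex_integral M k (\<tau> 0) \<omega> = 0"
    proof (rule simplex_integral_constant[OF M \<omega> k])
      show "chart_inv c x \<in> topspace (mtop M)"
        using smooth_into_topspace[OF smooth_into_chart_inv[OF M c(1)] c(2)] .
      show "\<tau> 0 p = chart_inv c x" if "p \<in> standard_simplex k" for p
        using that by (simp add: \<tau>_def G_def B_def L_def)
    qed
    moreover have "simplex_integral M k (\<tau> 1) \<omega> * h x > 0"
    proof -
      let ?f = "\<lambda>y. pull_at M k (open_simplex k) (\<tau> 1 \<circ> simplex_param k) \<omega> y (map unit_vec [0..<k])"
      have one: "(1 :: real) \<in> {0..1}" by simp
      \<comment> \<open>At time 1 the i-th edge direction is \<open>\<delta>\<close> times the unit
        vector \<open>js ! i\<close>, so the form is evaluated on k vectors scaled by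
        \<open>\<delta>\<close>, and homogeneity gives the factor
        \<open>\<delta> ^ k\<close>.\<close>
      have val: "?f y = \<delta> ^ k * h (B (y(k := 1)))" if y: "y \<in> open_simplex k" for y
      proof -
        have "?f y = pull_at M k (open_simplex k) (\<lambda>y. G (y(k := 1))) \<omega> y (map unit_vec [0..<k])"
          by (rule pull_at_cong[OF M y])
            (use \<tau>G smooth_into_topspace[OF G prism_slice[OF y one]] y in auto)
        also have "\<dots> = \<omega> c (chart_map c (G (y(k := 1))))
          (map (differential k {y \<in> open_simplex k. G (y(k := 1)) \<in> chart_dom c}
            (\<lambda>y. chart_map c (G (y(k := 1)))) y) (map unit_vec [0..<k]))"
        proof (rule pull_at_chart[OF M \<omega> smooth_into_slice[OF M \<omega> G one] line_perfect_open_simplex y c(1)])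
          show "G (y(k := 1)) \<in> chart_dom c"
            using chart_inv_mem[OF BV(2)[OF prism_slice[OF y one]]] by (simp add: G_def)
        qed
        also have "{y \<in> open_simplex k. G (y(k := 1)) \<in> chart_dom c} = open_simplex k"
          using chart_inv_mem[OF BV(2)[OF prism_slice[OF _ one]]] by (auto simp: G_def)
        also have "chart_map c (G (y(k := 1))) = B (y(k := 1))"
          using chart_map_inv[OF BV(2)[OF prism_slice[OF y one]]] by (simp add: G_def)
        also have "map (differential k (open_simplex k) (\<lambda>y. chart_map c (G (y(k := 1)))) y) (map unit_vec [0..<k]) =
          map (\<lambda>v j. \<delta> * v j) (map unit_vec js)"
        proof (rule nth_equalityI)
          fix i assume "i < length (map (differential k (open_simplex k) (\<lambda>y. chart_map c (G (y(k := 1)))) y) (map unit_vec [0..<k]))"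
          then have i: "i < k" by simp
          have "differential k (open_simplex k) (\<lambda>y. chart_map c (G (y(k := 1)))) y (unit_vec i) j = \<delta> * unit_vec (js ! i) j" for j
            unfolding differential_unit_vec[OF i]
          proof (subst partial_affine[OF line_perfect_open_simplex y i])
            fix y assume y: "y \<in> open_simplex k"
            have "s j (y(k := 1)) = (\<Sum>i<k. (if js ! i = j then 1 else 0) * y i)"
              unfolding s_def by (rule sum.cong) auto
            then have "B (y(k := 1)) j = x j + (\<Sum>i<k. (\<delta> * (if js ! i = j then 1 else 0)) * y i)"
              by (simp add: B_def sum_distrib_left mult.assoc)
            then show "chart_map c (G (y(k := 1))) j = x j + (\<Sum>i<k. (\<delta> * (if js ! i = j then 1 else 0)) * y i)"
              using chart_map_inv[OF BV(2)[OF prism_slice[OF y one]]] by (simp add: G_def)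
          qed (simp add: unit_vec_def eq_commute)
          then show "map (differential k (open_simplex k) (\<lambda>y. chart_map c (G (y(k := 1)))) y) (map unit_vec [0..<k]) ! i =
            map (\<lambda>v j. \<delta> * v j) (map unit_vec js) ! i"
            using i js by (simp add: fun_eq_iff)
        qed (simp add: js)
        also have "\<omega> c (B (y(k := 1))) (map (\<lambda>v j. \<delta> * v j) (map unit_vec js)) = \<delta> ^ k * h (B (y(k := 1)))"
        proof -
          have "set (map unit_vec js) \<subseteq> Rn ?m" using js by (auto intro: unit_vec_Rn)
          then show ?thesis
            using alternating_scale[OF form_alternating[OF \<omega> c(1) BV(2)[OF prism_slice[OF y one]]], of "[]" "map unit_vec js" \<delta>] js
            by (simp add: h_def)
        qed
        finally show ?thesis .
      qed
      have pos: "?f y * h x > 0" if y: "y \<in> open_simplex k" for y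
      proof -
        have "B (y(k := 1)) \<in> chart_img c \<inter> W" using BV[OF prism_slice[OF y one]] by blast
        then have "h (B (y(k := 1))) * h x > 0" unfolding W(2)[symmetric] by simp
        then have "\<delta> ^ k * (h (B (y(k := 1))) * h x) > 0" using \<delta> by simp
        then show ?thesis using val[OF y] by (simp only: mult.assoc)
      qed
      obtain C where C: "\<forall>t\<in>{0..1}. continuous_on (open_simplex k)
        (\<lambda>y. pull_at M k (open_simplex k) (\<tau> t \<circ> simplex_param k) \<omega> y (map unit_vec [0..<k])) \<and>
        (\<forall>y\<in>open_simplex k. \<bar>pull_at M k (open_simplex k) (\<tau> t \<circ> simplex_param k) \<omega> y (map unit_vec [0..<k])\<bar> \<le> C)"
        using bounded by (elim exE)
      from bspec[OF C one] have C1: "continuous_on (open_simplex k) ?f" "\<forall>y\<in>open_simplex k. \<bar>?f y\<bar> \<le> C"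
        by blast+
      have "integral_Rn k (open_simplex k) (\<lambda>y. ?f y * h x) > 0"
      proof (rule integral_Rn_pos[OF _ _ pos])
        show "continuous_on (open_simplex k) (\<lambda>y. ?f y * h x)"
          by (rule continuous_on_mult_right[OF C1(1)])
        show "\<bar>?f y * h x\<bar> \<le> C * \<bar>h x\<bar>" if "y \<in> open_simplex k" for y
          using C1(2) that by (simp only: abs_mult) (simp add: mult_right_mono)
      qed
      then show ?thesis by (simp add: integral_Rn_mult_right simplex_integral_def)
    qed
    ultimately show False by simp
  qed
  have "\<omega> c x vs = 0" for c x vs
  proof (cases "c \<in> atlas M \<and> x \<in> chart_img c")
    case True
    have "alternating (mdim M) k (\<lambda>_. 0)" by (simp add: alternating_def)
    from alternating_ext[OF form_alternating[OF \<omega>] this, of c x vs]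
    show ?thesis using key True by simp
  next
    case False
    have "\<forall>c x vs. \<not> (c \<in> atlas M \<and> x \<in> chart_img c) \<longrightarrow> \<omega> c x vs = 0"
      using \<omega> unfolding differential_form_def by (elim conjE)
    then show ?thesis using False by blast
  qed
  then show ?thesis by (simp add: zero_form_def fun_eq_iff)
qed

section \<open>Groups of forms\<close>

text \<open>The factor a lets one argument serve both sums (a = 1) and inverses (a = -1 with the
  zero form added).\<close>

lemma alternating_combine:
  assumes "alternating n k \<alpha>" "alternating n k \<beta>"
  shows "alternating n k (\<lambda>vs. a * \<alpha> vs + \<beta> vs)"
proof -
  note A = assms(1)[unfolded alternating_def] and B = assms(2)[unfolded alternating_def]
  show ?thesis
    unfolding alternating_def
  proof (intro conjI allI ballI impI)
    fix vs assume vs: "\<not> (length vs = k \<and> set vs \<subseteq> Rn n)"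
    show "a * \<alpha> vs + \<beta> vs = 0" using conjunct1[OF A] conjunct1[OF B] vs by simp
  next
    fix vs i b u w assume u: "u \<in> Rn n" "w \<in> Rn n" and vs: "length vs = k \<and> set vs \<subseteq> Rn n \<and> i < k"
    have "\<alpha> (vs[i := (\<lambda>j. b * u j + w j)]) = b * \<alpha> (vs[i := u]) + \<alpha> (vs[i := w])"
      by (rule conjunct1[OF conjunct2[OF A], rule_format, OF u vs])
    moreover have "\<beta> (vs[i := (\<lambda>j. b * u j + w j)]) = b * \<beta> (vs[i := u]) + \<beta> (vs[i := w])"
      by (rule conjunct1[OF conjunct2[OF B], rule_format, OF u vs])
    ultimately show "a * \<alpha> (vs[i := (\<lambda>j. b * u j + w j)]) + \<beta> (vs[i := (\<lambda>j. b * u j + w j)]) =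
      b * (a * \<alpha> (vs[i := u]) + \<beta> (vs[i := u])) + (a * \<alpha> (vs[i := w]) + \<beta> (vs[i := w]))"
      by (simp add: algebra_simps)
  next
    fix vs :: "(nat \<Rightarrow> real) list" and i j assume ij: "i < j \<and> j < length vs \<and> vs ! i = vs ! j"
    have "\<alpha> vs = 0" by (rule conjunct2[OF conjunct2[OF A], rule_format, OF ij])
    moreover have "\<beta> vs = 0" by (rule conjunct2[OF conjunct2[OF B], rule_format, OF ij])
    ultimately show "a * \<alpha> vs + \<beta> vs = 0" by simp
  qed
qed

lemma differential_form_zero: "smooth_manifold M \<Longrightarrow> differential_form M k zero_form"
  unfolding differential_form_def zero_form_def
  by (auto simp: alternating_def intro!: smooth_fun_on_const dest: chart_img_Rn)

lemma differential_form_combine: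
  assumes M: "smooth_manifold M" and \<omega>: "differential_form M k \<omega>" and \<eta>: "differential_form M k \<eta>"
  shows "differential_form M k (\<lambda>c x vs. a * \<omega> c x vs + \<eta> c x vs)"
proof -
  have z: "\<omega> c x vs = 0" if "differential_form M k \<omega>" "\<not> (c \<in> atlas M \<and> x \<in> chart_img c)" for \<omega> c x vs
    using conjunct1[OF that(1)[unfolded differential_form_def]] that(2) by blast
  show ?thesis
    unfolding differential_form_def
  proof (intro conjI allI ballI impI)
    fix c x vs assume "\<not> (c \<in> atlas M \<and> x \<in> chart_img c)"
    then show "a * \<omega> c x vs + \<eta> c x vs = 0" using z[OF \<omega>] z[OF \<eta>] by simp
  next
    fix c x assume "c \<in> atlas M" "x \<in> chart_img c"
    then show "alternating (mdim M) k (\<lambda>vs. a * \<omega> c x vs + \<eta> c x vs)"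
      by (intro alternating_combine form_alternating[OF \<omega>] form_alternating[OF \<eta>])
  next
    fix c js assume c: "c \<in> atlas M" and js: "length js = k \<and> set js \<subseteq> {..<mdim M}"
    show "smooth_fun_on (mdim M) (chart_img c) (\<lambda>x. a * \<omega> c x (map unit_vec js) + \<eta> c x (map unit_vec js))"
      using js by (intro smooth_fun_on_add smooth_fun_on_mult smooth_fun_on_const chart_img_Rn[OF M c]
          form_smooth[OF \<omega> c] form_smooth[OF \<eta> c]) auto
  next
    fix c d p vs assume c: "c \<in> atlas M" "d \<in> atlas M" and p: "p \<in> chart_dom c \<inter> chart_dom d"
      and vs: "length vs = k \<and> set vs \<subseteq> Rn (mdim M)"
    show "a * \<omega> c (chart_map c p) vs + \<eta> c (chart_map c p) vs =
      a * \<omega> d (chart_map d p) (map (differential (mdim M) (chart_map c ` (chart_dom c \<inter> chart_dom d))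
         (chart_map d \<circ> chart_inv c) (chart_map c p)) vs) +
      \<eta> d (chart_map d p) (map (differential (mdim M) (chart_map c ` (chart_dom c \<inter> chart_dom d))
         (chart_map d \<circ> chart_inv c) (chart_map c p)) vs)"
      using form_transition[OF \<omega> c, of p vs] form_transition[OF \<eta> c, of p vs] p vs by (simp add: comp_def)
  qed
qed

lemma form_group_carrier:
  "\<omega> \<in> carrier (form_group M k) \<longleftrightarrow> (if k < 0 then \<omega> = zero_form else differential_form M (nat k) \<omega>)"
  by (simp add: form_group_def)

lemma form_group_mult: "\<omega> \<otimes>\<^bsub>form_group M k\<^esub> \<eta> = (\<lambda>c x vs. \<omega> c x vs + \<eta> c x vs)"
  and form_group_one: "\<one>\<^bsub>form_group M k\<^esub> = zero_form"
  by (simp_all add: form_group_def)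

lemma form_group_comm_group:
  assumes M: "smooth_manifold M" shows "comm_group (form_group M k)"
proof (rule comm_groupI)
  fix \<omega> \<eta> assume w: "\<omega> \<in> carrier (form_group M k)" "\<eta> \<in> carrier (form_group M k)"
  then show "\<omega> \<otimes>\<^bsub>form_group M k\<^esub> \<eta> \<in> carrier (form_group M k)"
    using differential_form_combine[OF M, of "nat k" \<omega> \<eta> 1]
    by (auto simp: form_group_carrier form_group_mult zero_form_def split: if_splits)
  show "\<omega> \<otimes>\<^bsub>form_group M k\<^esub> \<eta> = \<eta> \<otimes>\<^bsub>form_group M k\<^esub> \<omega>"
    by (simp add: form_group_mult add.commute)
next
  show "\<one>\<^bsub>form_group M k\<^esub> \<in> carrier (form_group M k)"
    using differential_form_zero[OF M] by (simp add: form_group_carrier form_group_one)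
next
  fix \<omega> assume w: "\<omega> \<in> carrier (form_group M k)"
  show "\<one>\<^bsub>form_group M k\<^esub> \<otimes>\<^bsub>form_group M k\<^esub> \<omega> = \<omega>"
    by (simp add: form_group_mult form_group_one zero_form_def)
  have "(\<lambda>c x vs. - 1 * \<omega> c x vs + zero_form c x vs) \<in> carrier (form_group M k)"
    using w differential_form_combine[OF M _ differential_form_zero[OF M], of "nat k" \<omega> "- 1"]
    by (auto simp: form_group_carrier zero_form_def split: if_splits)
  moreover have "(\<lambda>c x vs. - 1 * \<omega> c x vs + zero_form c x vs) \<otimes>\<^bsub>form_group M k\<^esub> \<omega> = \<one>\<^bsub>form_group M k\<^esub>"
    by (simp add: form_group_mult form_group_one zero_form_def)
  ultimately show "\<exists>\<eta>\<in>carrier (form_group M k). \<eta> \<otimes>\<^bsub>form_group M k\<^esub> \<omega> = \<one>\<^bsub>form_group M k\<^esub>"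
    by blast
qed (simp add: form_group_mult add.assoc)

lemma chain_integral_mult_form:
  assumes M: "smooth_manifold M" and w: "\<omega> \<in> carrier (form_group M k)" "\<eta> \<in> carrier (form_group M k)"
    and z: "z \<in> carrier (smooth_chains M k)"
  shows "chain_integral M k z (\<omega> \<otimes>\<^bsub>form_group M k\<^esub> \<eta>) = chain_integral M k z \<omega> + chain_integral M k z \<eta>"
proof (cases "k < 0")
  case False
  then have w': "differential_form M (nat k) \<omega>" "differential_form M (nat k) \<eta>"
    using w by (simp_all add: form_group_carrier)
  have "simplex_integral M (nat k) \<sigma> (\<lambda>c x vs. \<omega> c x vs + \<eta> c x vs) =
    simplex_integral M (nat k) \<sigma> \<omega> + simplex_integral M (nat k) \<sigma> \<eta>" if "\<sigma> \<in> Poly_Mapping.keys z" for \<sigma>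
    using simplex_integral_add[OF M w'] z that by (simp add: smooth_chains_iff)
  then show ?thesis
    by (simp add: chain_integral_def form_group_mult distrib_left sum.distrib cong: sum.cong)
next
  case True
  then have "z = 0" using z smooth_chains_neg by blast
  then show ?thesis by simp
qed

lemma chain_integral_inv_form:
  assumes M: "smooth_manifold M" and w: "\<omega> \<in> carrier (form_group M k)"
    and z: "z \<in> carrier (smooth_chains M k)"
  shows "chain_integral M k z (inv\<^bsub>form_group M k\<^esub> \<omega>) = - chain_integral M k z \<omega>"
proof -
  interpret G: comm_group "form_group M k" by (rule form_group_comm_group[OF M])
  have "chain_integral M k z (inv\<^bsub>form_group M k\<^esub> \<omega> \<otimes>\<^bsub>form_group M k\<^esub> \<omega>) = 0"
    using w by (simp add: form_group_one)
  then show ?thesis using chain_integral_mult_form[OF M _ w z, of "inv\<^bsub>form_group M k\<^esub> \<omega>"] w by simp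
qed

lemma form_zero_if_integrals:
  assumes M: "smooth_manifold M" and \<Lambda>: "subring \<Lambda> real_ring" "\<Lambda> \<noteq> UNIV" and k: "0 < k"
    and w: "\<omega> \<in> carrier (form_group M k)"
    and per: "\<And>z. z \<in> carrier (smooth_chains M k) \<Longrightarrow> chain_integral M k z \<omega> \<in> \<Lambda>"
  shows "\<omega> = zero_form"
proof (rule form_zero_if_simplex_integrals[OF M _ _ \<Lambda>])
  show "differential_form M (nat k) \<omega>" "0 < nat k" using w k by (simp_all add: form_group_carrier)
  show "simplex_integral M (nat k) \<sigma> \<omega> \<in> \<Lambda>" if "smooth_simplex (nat k) M \<sigma>" for \<sigma>
    using per[of "frag_of \<sigma>"] that k by (simp add: smooth_chains_of chain_integral_of)
qed

lemma chain_boundary_integral_zero: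
  assumes M: "smooth_manifold M" and \<Lambda>: "subring \<Lambda> real_ring" "\<Lambda> \<noteq> UNIV"
    and w: "\<omega> \<in> carrier (period_forms \<Lambda> M k)" and z: "z \<in> carrier (smooth_chains M (k + 1))"
  shows "chain_integral M k (chain_boundary (nat (k + 1)) z) \<omega> = 0"
proof (cases "k < 0")
  case True
  then show ?thesis by (simp add: chain_boundary_def)
next
  case False
  define n where "n = nat k"
  have n: "k = int n" "nat (k + 1) = Suc n" using False by (simp_all add: n_def)
  have w': "differential_form M n \<omega>" "\<And>z. z \<in> smooth_cycles M (int n) \<Longrightarrow> chain_integral M (int n) z \<omega> \<in> \<Lambda>"
    using w False by (simp_all add: period_forms_def form_group_carrier n)
  have "chain_integral M (int n) (chain_boundary (Suc n) (frag_of \<sigma>)) \<omega> = 0" if "\<sigma> \<in> Poly_Mapping.keys z" for \<sigma>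
    by (rule simplex_boundary_integral_zero[OF M w'(1) \<Lambda> w'(2)])
      (use z that n in \<open>auto simp: smooth_chains_iff\<close>)
  moreover have "chain_boundary (Suc n) z = frag_extend (\<lambda>\<sigma>. chain_boundary (Suc n) (frag_of \<sigma>)) z"
    by (simp add: chain_boundary_def)
  ultimately have "chain_integral M (int n) (chain_boundary (Suc n) z) \<omega> = 0"
    by (simp add: chain_integral_frag_extend)
  then show ?thesis unfolding n(2) unfolding n(1) .
qed

context
  fixes A :: "'a mfd" and M :: "'m mfd" and \<rho> :: "'a \<Rightarrow> 'm"
  assumes A: "smooth_manifold A" and M: "smooth_manifold M" and \<rho>: "smooth_map A M \<rho>"
begin

lemma pull_form_zero: "pull_form A M \<rho> zero_form = zero_form"
  by (simp add: pull_form_def fun_eq_iff) (simp add: zero_form_def)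

lemma pull_form_mult:
  "pull_form A M \<rho> (\<omega> \<otimes>\<^bsub>form_group M k\<^esub> \<eta>) = pull_form A M \<rho> \<omega> \<otimes>\<^bsub>form_group A k\<^esub> pull_form A M \<rho> \<eta>"
  by (simp add: pull_form_def form_group_mult pull_at_add fun_eq_iff)

lemma pull_form_carrier:
  "\<omega> \<in> carrier (form_group M k) \<Longrightarrow> pull_form A M \<rho> \<omega> \<in> carrier (form_group A k)"
  using differential_form_pull[OF A M \<rho>] pull_form_zero by (simp add: form_group_carrier split: if_splits)

lemma chain_integral_pull_form:
  assumes "z \<in> carrier (smooth_chains A k)"
  shows "chain_integral A k z (pull_form A M \<rho> \<omega>) = chain_integral M k (chain_map (nat k) \<rho> z) \<omega>"
proof -
  have "simplex_integral A (nat k) \<sigma> (pull_form A M \<rho> \<omega>) = simplex_integral M (nat k) (simplex_map (nat k) \<rho> \<sigma>) \<omega>"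
    if "\<sigma> \<in> Poly_Mapping.keys z" for \<sigma>
    using simplex_integral_pull_form[OF A M \<rho>] assms that by (simp add: smooth_chains_iff)
  then show ?thesis
    unfolding chain_map_def chain_integral_frag_extend
    by (simp add: chain_integral_of chain_integral_def[of A] cong: sum.cong)
qed

end

section \<open>Extension of homomorphisms\<close>

context comm_group
begin

lemma additive_one:
  fixes F :: "'a \<Rightarrow> 'r :: ring_1"
  assumes "\<And>x y. x \<in> carrier G \<Longrightarrow> y \<in> carrier G \<Longrightarrow> F (x \<otimes> y) = F x + F y"
  shows "F \<one> = 0"
  using assms[of \<one> \<one>] by simp

lemma additive_int_pow:
  fixes F :: "'a \<Rightarrow> 'r :: ring_1"
  assumes F: "\<And>x y. x \<in> carrier G \<Longrightarrow> y \<in> carrier G \<Longrightarrow> F (x \<otimes> y) = F x + F y" and x: "x \<in> carrier G"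
  shows "F (x [^] (n :: int)) = of_int n * F x"
proof -
  have inv: "F (inv y) = - F y" if "y \<in> carrier G" for y
  proof -
    have "F y + F (inv y) = 0" using F[of y "inv y"] that additive_one[of F, OF F] by simp
    then show ?thesis by (rule minus_unique[symmetric])
  qed
  have nat: "F (x [^] m) = of_nat m * F x" for m :: nat
    using x additive_one[of F, OF F] by (induct m) (simp_all add: F algebra_simps)
  show ?thesis
  proof (cases n rule: int_cases2)
    case (nonneg m)
    then show ?thesis using nat by (simp add: int_pow_int)
  next
    case (nonpos m)
    then show ?thesis using nat inv x by (simp add: int_pow_neg int_pow_int)
  qed
qed

lemma int_pow_cancel:
  assumes "x \<in> carrier G" "a \<in> carrier G" "a \<otimes> x [^] (m :: int) = \<one>"
  shows "a = x [^] (- m)"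
  using assms by (metis int_pow_closed int_pow_neg inv_equality inv_inv)

text \<open>Zorn's lemma is applied to graphs of partial extensions.\<close>

lemma real_extension:
  fixes f :: "'a \<Rightarrow> real"
  assumes H: "subgroup H G" and f: "\<And>x y. x \<in> H \<Longrightarrow> y \<in> H \<Longrightarrow> f (x \<otimes> y) = f x + f y"
  shows "\<exists>F. (\<forall>x\<in>carrier G. \<forall>y\<in>carrier G. F (x \<otimes> y) = F x + F y) \<and> (\<forall>x\<in>H. F x = f x)"
proof -
  \<comment> \<open>For a set of pairs closed under differences, the last clause is equivalent to
    being single-valued.\<close>
  define graph where "graph R \<longleftrightarrow> R \<subseteq> carrier G \<times> UNIV \<and> (\<forall>x\<in>H. (x, f x) \<in> R) \<and>
    (\<forall>a b c d. (a, b) \<in> R \<longrightarrow> (c, d) \<in> R \<longrightarrow> (a \<otimes> inv c, b - d) \<in> R) \<and>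
    (\<forall>y. (\<one>, y) \<in> R \<longrightarrow> y = 0)" for R :: "('a \<times> real) set"
  have "\<exists>R\<in>Collect graph. \<forall>S\<in>Collect graph. R \<subseteq> S \<longrightarrow> S = R"
  proof (rule subset_Zorn_nonempty)
    have HG: "x \<in> carrier G" if "x \<in> H" for x using subgroup.mem_carrier[OF H that] .
    have f1: "f \<one> = 0" using f[of \<one> \<one>] subgroup.one_closed[OF H] by simp
    have finv: "f (x \<otimes> inv y) = f x - f y" if "x \<in> H" "y \<in> H" for x y
    proof -
      have "f (x \<otimes> inv y) = f x + f (inv y)" using f that subgroup.m_inv_closed[OF H] by blast
      moreover have "f y + f (inv y) = 0"
        using f[of y "inv y"] that subgroup.m_inv_closed[OF H] f1 HG by simp
      ultimately show ?thesis by simp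
    qed
    have "graph ((\<lambda>x. (x, f x)) ` H)"
      unfolding graph_def
      using HG finv f1 subgroup.m_closed[OF H] subgroup.m_inv_closed[OF H] by auto
    then show "Collect graph \<noteq> {}" by blast
    fix C assume C: "C \<noteq> {}" "subset.chain (Collect graph) C"
    have g: "graph R" if "R \<in> C" for R using C(2) that by (auto simp: subset.chain_def)
    have dir: "\<exists>R\<in>C. p \<in> R \<and> q \<in> R" if pq: "p \<in> \<Union>C" "q \<in> \<Union>C" for p q
    proof -
      obtain P Q where PQ: "P \<in> C" "p \<in> P" "Q \<in> C" "q \<in> Q" using pq by blast
      then have "P \<subseteq> Q \<or> Q \<subseteq> P" using C(2) unfolding subset.chain_def by blast
      then show ?thesis using PQ by blast
    qed
    have "graph (\<Union>C)"
      unfolding graph_def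
    proof (intro conjI allI impI ballI)
      show "\<Union>C \<subseteq> carrier G \<times> UNIV" using g unfolding graph_def by blast
      show "(x, f x) \<in> \<Union>C" if "x \<in> H" for x
        using C(1) g that unfolding graph_def by blast
      show "(a \<otimes> inv c, b - d) \<in> \<Union>C" if ab: "(a, b) \<in> \<Union>C" "(c, d) \<in> \<Union>C" for a b c d
      proof -
        obtain R where R: "R \<in> C" "(a, b) \<in> R" "(c, d) \<in> R" using dir[OF ab] by blast
        have "\<forall>a b c d. (a, b) \<in> R \<longrightarrow> (c, d) \<in> R \<longrightarrow> (a \<otimes> inv c, b - d) \<in> R"
          using g[OF R(1)] unfolding graph_def by (elim conjE)
        then show ?thesis using R by blast
      qed
      show "y = 0" if "(\<one>, y) \<in> \<Union>C" for y
        using that g unfolding graph_def by blast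
    qed
    then show "\<Union>C \<in> Collect graph" by simp
  qed
  then obtain R where R: "graph R" and max: "\<And>S. graph S \<Longrightarrow> R \<subseteq> S \<Longrightarrow> S = R" by auto
  have RG: "a \<in> carrier G" if "(a, b) \<in> R" for a b using R that unfolding graph_def by auto
  have RH: "(x, f x) \<in> R" if "x \<in> H" for x using R that unfolding graph_def by auto
  have Rdiff: "(a \<otimes> inv c, b - d) \<in> R" if "(a, b) \<in> R" "(c, d) \<in> R" for a b c d
    using conjunct1[OF conjunct2[OF conjunct2[OF R[unfolded graph_def]]]] that by blast
  have R1: "y = 0" if "(\<one>, y) \<in> R" for y
    using conjunct2[OF conjunct2[OF conjunct2[OF R[unfolded graph_def]]]] that by blast
  have R0: "(\<one>, 0) \<in> R"
    using Rdiff[OF RH RH, OF subgroup.one_closed[OF H] subgroup.one_closed[OF H]] by simp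
  have Rinv: "(inv a, - b) \<in> R" if "(a, b) \<in> R" for a b
    using Rdiff[OF R0 that] RG[OF that] by simp
  have Radd: "(a \<otimes> c, b + d) \<in> R" if "(a, b) \<in> R" "(c, d) \<in> R" for a b c d
    using Rdiff[OF that(1) Rinv[OF that(2)]] RG[OF that(2)] by simp
  have Rnat: "(a [^] m, of_nat m * b) \<in> R" if "(a, b) \<in> R" for a b and m :: nat
  proof (induct m)
    case (Suc m)
    from Radd[OF this that] show ?case by (simp add: algebra_simps)
  qed (use R0 in simp)
  have Rpow: "(a [^] n, of_int n * b) \<in> R" if "(a, b) \<in> R" for a b and n :: int
  proof (cases n rule: int_cases2)
    case (nonneg m)
    then show ?thesis using Rnat[OF that, of m] by (simp add: int_pow_int)
  next
    case (nonpos m)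
    then show ?thesis using Rinv[OF Rnat[OF that, of m]] RG[OF that] by (simp add: int_pow_neg int_pow_int)
  qed
  have total: "\<exists>y. (x, y) \<in> R" if x: "x \<in> carrier G" for x
  proof -
    \<comment> \<open>c is the value to be given to x. If a nonzero power \<open>n0\<close> of x
      already has a value, c is that value divided by \<open>n0\<close>, and this is where
      divisibility of the reals is used; if no such power has a value, any c is consistent.\<close>
    obtain c where c: "\<And>n y. (x [^] (n :: int), y) \<in> R \<Longrightarrow> y = of_int n * c"
    proof (cases "\<exists>n y. n \<noteq> 0 \<and> (x [^] (n :: int), y) \<in> R")
      case True
      then obtain n0 y0 where n0: "n0 \<noteq> 0" "(x [^] (n0 :: int), y0) \<in> R" by blast
      show ?thesis
      proof (rule that[of "y0 / of_int n0"])
        fix n :: int and y assume y: "(x [^] n, y) \<in> R"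
        have "((x [^] n) [^] n0 \<otimes> inv ((x [^] n0) [^] n), of_int n0 * y - of_int n * y0) \<in> R"
          by (rule Rdiff[OF Rpow[OF y] Rpow[OF n0(2)]])
        moreover have "(x [^] n) [^] n0 \<otimes> inv ((x [^] n0) [^] n) = \<one>"
          using x by (simp add: int_pow_pow mult.commute[of n n0])
        ultimately have "(\<one>, of_int n0 * y - of_int n * y0) \<in> R" by (simp only:)
        then have "of_int n0 * y - of_int n * y0 = 0" by (rule R1)
        then show "y = of_int n * (y0 / of_int n0)" using n0(1) by (simp add: field_simps)
      qed
    next
      case False
      show ?thesis
      proof (rule that[of 0])
        fix n :: int and y assume y: "(x [^] n, y) \<in> R"
        then have "n = 0" using False by blast
        then show "y = of_int n * 0" using y R1 by simp
      qed
    qed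
    \<comment> \<open>The graph generated by R and the pair (x, c). By maximality it equals R, so x
      was in the domain all along.\<close>
    define S where "S = {(a \<otimes> x [^] n, b + of_int n * c) | a b n. (a, b) \<in> R \<and> n \<in> (UNIV :: int set)}"
    have SI: "(a \<otimes> x [^] n, b + of_int n * c) \<in> S" if "(a, b) \<in> R" for a b and n :: int
      using that unfolding S_def by blast
    have sub: "R \<subseteq> S"
    proof
      fix p assume "p \<in> R"
      then have "(fst p, snd p) \<in> R" by simp
      from SI[OF this, of 0] show "p \<in> S" using RG[of "fst p" "snd p"] \<open>p \<in> R\<close> by simp
    qed
    have "graph S"
      unfolding graph_def
    proof (intro conjI allI impI ballI)
      show "S \<subseteq> carrier G \<times> UNIV" unfolding S_def using RG x by auto
      show "(y, f y) \<in> S" if "y \<in> H" for y using RH[OF that] sub by blast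
      fix p q r s assume "(p, q) \<in> S" "(r, s) \<in> S"
      then obtain a b a' b' and n n' :: int where ab: "(a, b) \<in> R" "p = a \<otimes> x [^] n" "q = b + of_int n * c"
        "(a', b') \<in> R" "r = a' \<otimes> x [^] n'" "s = b' + of_int n' * c"
        unfolding S_def by blast
      have "((a \<otimes> inv a') \<otimes> x [^] (n - n'), (b - b') + of_int (n - n') * c) \<in> S"
        by (rule SI[OF Rdiff[OF ab(1,4)]])
      moreover have "(a \<otimes> inv a') \<otimes> x [^] (n - n') = p \<otimes> inv r"
        using x RG[OF ab(1)] RG[OF ab(4)] by (simp add: ab int_pow_diff inv_mult_group m_ac)
      ultimately show "(p \<otimes> inv r, q - s) \<in> S" by (simp add: ab algebra_simps)
    next
      fix y assume "(\<one>, y) \<in> S"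
      then obtain a b and n :: int where ab: "(a, b) \<in> R" "\<one> = a \<otimes> x [^] n" "y = b + of_int n * c"
        unfolding S_def by blast
      have "a = x [^] (- n)" using int_pow_cancel[OF x RG[OF ab(1)] ab(2)[symmetric]] .
      then have "(x [^] (- n), b) \<in> R" using ab(1) by (simp only:)
      from c[OF this] have "b = of_int (- n) * c" .
      then show "y = 0" using ab(3) by simp
    qed
    from max[OF this sub] have "S = R" .
    moreover have "(x, c) \<in> S" using SI[OF R0, of 1] x by simp
    ultimately show ?thesis by blast
  qed
  have uniq: "b = d" if "(a, b) \<in> R" "(a, d) \<in> R" for a b d
    using R1[of "b - d"] Rdiff[OF that] RG[OF that(1)] by simp
  define F where "F x = (SOME y. (x, y) \<in> R)" for x
  have F: "(x, F x) \<in> R" if "x \<in> carrier G" for x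
    unfolding F_def by (rule someI_ex[OF total[OF that]])
  show ?thesis
  proof (intro exI[of _ F] conjI ballI)
    show "F (x \<otimes> y) = F x + F y" if "x \<in> carrier G" "y \<in> carrier G" for x y
      by (rule uniq[OF F Radd[OF F F]]) (use that in auto)
    show "F x = f x" if "x \<in> H" for x
      by (rule uniq[OF F RH[OF that]]) (rule subgroup.mem_carrier[OF H that])
  qed
qed

text \<open>The joint kernel of finitely supported integral functionals is a direct summand: a retraction is
  built up by admitting one coordinate after the other, where for each new coordinate \<open>s\<close> one element
  generating the values of \<open>coord s\<close> is sent to \<open>\<one>\<close>.\<close>

lemma kernel_retraction:
  fixes coord :: "'i \<Rightarrow> 'a \<Rightarrow> int"
  assumes coord: "\<And>i x y. x \<in> carrier G \<Longrightarrow> y \<in> carrier G \<Longrightarrow> coord i (x \<otimes> y) = coord i x + coord i y"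
    and fin: "\<And>x. x \<in> carrier G \<Longrightarrow> finite {i. coord i x \<noteq> 0}"
  defines "Z \<equiv> {x \<in> carrier G. \<forall>i. coord i x = 0}"
  shows "\<exists>r. r \<in> hom G G \<and> r ` carrier G \<subseteq> Z \<and> (\<forall>x\<in>Z. r x = x)"
proof -
  have cpow: "coord i (x [^] (n :: int)) = n * coord i x" if "x \<in> carrier G" for i x n
    using additive_int_pow[of "coord i", OF coord that, of n] by simp
  have cone: "coord i \<one> = 0" for i using additive_one[of "coord i", OF coord] .
  have cinv: "coord i (inv x) = - coord i x" if "x \<in> carrier G" for i x
    using coord[of x "inv x" i] that cone by simp
  have Z: "\<one> \<in> Z" "\<And>x y. x \<in> Z \<Longrightarrow> y \<in> Z \<Longrightarrow> x \<otimes> inv y \<in> Z"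
    using coord cone cinv by (simp_all add: Z_def)
  define Cn where "Cn T = {x \<in> carrier G. \<forall>i. i \<notin> T \<longrightarrow> coord i x = 0}" for T
  have Cn1: "\<one> \<in> Cn T" "x \<in> Cn T \<Longrightarrow> x \<in> carrier G" for T x by (auto simp: Cn_def cone)
  define graph where "graph T R \<longleftrightarrow> fst ` R = Cn T \<and> snd ` R \<subseteq> Z \<and> (\<forall>x\<in>Z. (x, x) \<in> R) \<and>
    (\<forall>a b c d. (a, b) \<in> R \<longrightarrow> (c, d) \<in> R \<longrightarrow> (a \<otimes> inv c, b \<otimes> inv d) \<in> R) \<and>
    (\<forall>y. (\<one>, y) \<in> R \<longrightarrow> y = \<one>)" for T and R :: "('a \<times> 'a) set"
  \<comment> \<open>A coordinate set and a graph are packed into one subset of a sum type, so that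
    Zorn's lemma for inclusion applies to such pairs.\<close>
  define T where "T E = {i :: 'i. Inr i \<in> E}" for E :: "('a \<times> 'a + 'i) set"
  define R where "R E = {p. Inl p \<in> E}" for E :: "('a \<times> 'a + 'i) set"
  define good where "good = {E. graph (T E) (R E)}"
  have gd: "R E \<subseteq> carrier G \<times> Z" "fst ` R E = Cn (T E)" "\<And>x. x \<in> Z \<Longrightarrow> (x, x) \<in> R E"
    "\<And>a b c d. (a, b) \<in> R E \<Longrightarrow> (c, d) \<in> R E \<Longrightarrow> (a \<otimes> inv c, b \<otimes> inv d) \<in> R E"
    "\<And>y. (\<one>, y) \<in> R E \<Longrightarrow> y = \<one>" if "E \<in> good" for E
  proof -
    have g: "fst ` R E = Cn (T E)" "snd ` R E \<subseteq> Z" "\<forall>x\<in>Z. (x, x) \<in> R E"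
      "\<forall>a b c d. (a, b) \<in> R E \<longrightarrow> (c, d) \<in> R E \<longrightarrow> (a \<otimes> inv c, b \<otimes> inv d) \<in> R E"
      "\<forall>y. (\<one>, y) \<in> R E \<longrightarrow> y = \<one>"
      using that by (simp_all add: good_def graph_def)
    show "R E \<subseteq> carrier G \<times> Z"
    proof
      fix p assume p: "p \<in> R E"
      then have "fst p \<in> Cn (T E)" "snd p \<in> Z" using g(1,2) by auto
      then show "p \<in> carrier G \<times> Z" using Cn1(2) by (simp add: mem_Times_iff)
    qed
    show "fst ` R E = Cn (T E)" "\<And>x. x \<in> Z \<Longrightarrow> (x, x) \<in> R E" using g(1,3) by auto
    show "(a \<otimes> inv c, b \<otimes> inv d) \<in> R E" if "(a, b) \<in> R E" "(c, d) \<in> R E" for a b c d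
      using g(4) that by blast
    show "y = \<one>" if "(\<one>, y) \<in> R E" for y using g(5) that by blast
  qed
  have "\<exists>E\<in>good. \<forall>E'\<in>good. E \<subseteq> E' \<longrightarrow> E' = E"
  proof (rule subset_Zorn_nonempty)
    have "Inl ` ((\<lambda>x. (x, x)) ` Z) \<in> good"
    proof -
      have "R (Inl ` P) = P" "T (Inl ` P) = {}" for P by (auto simp: R_def T_def)
      moreover have "Cn {} = Z" by (simp add: Cn_def Z_def)
      moreover have "graph {} ((\<lambda>x. (x, x)) ` Z)"
        unfolding graph_def
      proof (intro conjI ballI allI impI)
        show "fst ` (\<lambda>x. (x, x)) ` Z = Cn {}" by (simp add: image_image \<open>Cn {} = Z\<close>)
        fix a b c d assume "(a, b) \<in> (\<lambda>x. (x, x)) ` Z" "(c, d) \<in> (\<lambda>x. (x, x)) ` Z"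
        then have "a \<in> Z" "c \<in> Z" "b = a" "d = c" by auto
        then show "(a \<otimes> inv c, b \<otimes> inv d) \<in> (\<lambda>x. (x, x)) ` Z" using Z(2) by simp
      qed auto
      ultimately show ?thesis by (simp add: good_def)
    qed
    then show "good \<noteq> {}" by blast
    fix C assume C: "C \<noteq> {}" "subset.chain good C"
    have g: "E \<in> good" if "E \<in> C" for E using C(2) that by (auto simp: subset.chain_def)
    have RU: "R (\<Union>C) = (\<Union>E\<in>C. R E)" "T (\<Union>C) = (\<Union>E\<in>C. T E)" by (auto simp: R_def T_def)
    have mono: "R E \<subseteq> R E'" "T E \<subseteq> T E'" if "E \<subseteq> E'" for E E' using that by (auto simp: R_def T_def)
    have dir: "\<exists>E\<in>C. P \<subseteq> E \<and> Q \<subseteq> E" if "P \<in> C" "Q \<in> C" for P Q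
    proof -
      have "\<forall>P\<in>C. \<forall>Q\<in>C. P \<subseteq> Q \<or> Q \<subseteq> P" using C(2) unfolding subset_chain_def by (elim conjE)
      then have "P \<subseteq> Q \<or> Q \<subseteq> P" using that by simp
      then show ?thesis
      proof
        assume "P \<subseteq> Q"
        then show ?thesis using that by (intro bexI[of _ Q]) simp_all
      next
        assume "Q \<subseteq> P"
        then show ?thesis using that by (intro bexI[of _ P]) simp_all
      qed
    qed
    \<comment> \<open>An element has only finitely many nonzero coordinates, so one member of the
      chain already contains it in its domain. This is the use of \<open>fin\<close>.\<close>
    have dirT: "finite F \<Longrightarrow> F \<subseteq> T (\<Union>C) \<Longrightarrow> \<exists>E\<in>C. F \<subseteq> T E" for F
    proof (induct F rule: finite_induct)
      case empty
      then show ?case using C(1) by blast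
    next
      case (insert i F)
      then obtain E where E: "E \<in> C" "F \<subseteq> T E" by blast
      obtain E' where E': "E' \<in> C" "i \<in> T E'" using insert.prems RU(2) by blast
      obtain E'' where "E'' \<in> C" "E \<subseteq> E''" "E' \<subseteq> E''" using dir[OF E(1) E'(1)] by blast
      then show ?case using mono(2)[of E E''] mono(2)[of E' E''] E E' by blast
    qed
    have "graph (T (\<Union>C)) (R (\<Union>C))"
      unfolding graph_def
    proof (intro conjI ballI allI impI)
      show "fst ` R (\<Union>C) = Cn (T (\<Union>C))"
      proof (intro equalityI subsetI)
        fix x assume "x \<in> fst ` R (\<Union>C)"
        then obtain E where E: "E \<in> C" "x \<in> fst ` R E" unfolding RU by blast
        then have "x \<in> Cn (T E)" using gd(2)[OF g] by blast
        then show "x \<in> Cn (T (\<Union>C))" using E(1) unfolding RU Cn_def by blast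
      next
        fix x assume x: "x \<in> Cn (T (\<Union>C))"
        then have "{i. coord i x \<noteq> 0} \<subseteq> T (\<Union>C)" by (auto simp: Cn_def)
        then obtain E where E: "E \<in> C" "{i. coord i x \<noteq> 0} \<subseteq> T E"
          using dirT fin[OF Cn1(2)[OF x]] by blast
        then have "x \<in> Cn (T E)" using x by (auto simp: Cn_def)
        then have "x \<in> fst ` R E" using gd(2)[OF g[OF E(1)]] by simp
        then show "x \<in> fst ` R (\<Union>C)" using E(1) unfolding RU by blast
      qed
      show "snd ` R (\<Union>C) \<subseteq> Z" using gd(1)[OF g] unfolding RU by fastforce
      show "(x, x) \<in> R (\<Union>C)" if "x \<in> Z" for x using gd(3)[OF g that] C(1) unfolding RU by blast
      show "y = \<one>" if "(\<one>, y) \<in> R (\<Union>C)" for y using that gd(5)[OF g] unfolding RU by blast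
      fix a b c d assume "(a, b) \<in> R (\<Union>C)" "(c, d) \<in> R (\<Union>C)"
      then obtain E E' where E: "E \<in> C" "(a, b) \<in> R E" "E' \<in> C" "(c, d) \<in> R E'" unfolding RU by blast
      obtain E'' where E'': "E'' \<in> C" "E \<subseteq> E''" "E' \<subseteq> E''" using dir[OF E(1,3)] by blast
      then have "(a, b) \<in> R E''" "(c, d) \<in> R E''" using E mono(1) by blast+
      from gd(4)[OF g[OF E''(1)] this] show "(a \<otimes> inv c, b \<otimes> inv d) \<in> R (\<Union>C)"
        using E''(1) unfolding RU by blast
    qed
    then show "\<Union>C \<in> good" by (simp add: good_def)
  qed
  then obtain E where E: "E \<in> good" and max: "\<And>E'. E' \<in> good \<Longrightarrow> E \<subseteq> E' \<Longrightarrow> E' = E" by blast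
  note RG = gd(1)[OF E] and Rfst = gd(2)[OF E] and RZ = gd(3)[OF E] and Rdiff = gd(4)[OF E] and R1 = gd(5)[OF E]
  have RG1: "a \<in> carrier G" "b \<in> Z" "b \<in> carrier G" if "(a, b) \<in> R E" for a b
    using RG that by (auto simp: Z_def)
  have RC: "a \<in> Cn (T E)" if "(a, b) \<in> R E" for a b using Rfst that by force
  have CR: "\<exists>b. (a, b) \<in> R E" if "a \<in> Cn (T E)" for a using Rfst that by force
  have all: "s \<in> T E" for s
  proof (rule ccontr)
    assume s: "s \<notin> T E"
    have extend: False if "graph (insert s (T E)) R'" "R E \<subseteq> R'" for R'
    proof -
      let ?E = "Inl ` R' \<union> Inr ` insert s (T E)"
      have "R ?E = R'" "T ?E = insert s (T E)" by (auto simp: R_def T_def)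
      then have "?E \<in> good" using that(1) by (simp add: good_def)
      moreover have "E \<subseteq> ?E"
      proof
        fix p assume "p \<in> E"
        then show "p \<in> ?E" using that(2) by (cases p) (auto simp: R_def T_def)
      qed
      ultimately have "?E = E" by (rule max)
      then show False using s unfolding T_def by blast
    qed
    have CnI: "Cn (T E) \<subseteq> Cn (insert s (T E))" by (auto simp: Cn_def)
    show False
    proof (cases "\<forall>x\<in>Cn (insert s (T E)). coord s x = 0")
      case True
      then have "Cn (insert s (T E)) = Cn (T E)" by (auto simp: Cn_def)
      then have "graph (insert s (T E)) (R E)" using E by (simp add: good_def graph_def)
      then show False using extend by blast
    next
      case False
      then obtain x1 where x1: "x1 \<in> Cn (insert s (T E))" "coord s x1 \<noteq> 0" by blast
      define pos where "pos m \<longleftrightarrow> m > 0 \<and> (\<exists>x\<in>Cn (insert s (T E)). coord s x = int m)" for m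
      have "pos (nat \<bar>coord s x1\<bar>)"
      proof (cases "coord s x1 > 0")
        case False
        have "inv x1 \<in> Cn (insert s (T E))" using x1 cinv by (simp add: Cn_def)
        moreover have "coord s (inv x1) = int (nat \<bar>coord s x1\<bar>)" using False cinv Cn1(2)[OF x1(1)] by simp
        ultimately show ?thesis unfolding pos_def using x1(2) by force
      qed (use x1 in \<open>auto simp: pos_def\<close>)
      \<comment> \<open>The least positive value of \<open>coord s\<close> on the enlarged domain;
        it divides all the others, so \<open>x0\<close> becomes the generator of the new direction.
        Positive values exist because inversion changes the sign.\<close>
      define n where "n = (LEAST m. pos m)"
      have n: "pos n" "\<And>m. pos m \<Longrightarrow> n \<le> m" unfolding n_def by (rule LeastI, fact) (rule Least_le)
      obtain x0 where x0: "x0 \<in> Cn (insert s (T E))" "coord s x0 = int n" "n > 0"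
        using n(1) unfolding pos_def by blast
      have x0G: "x0 \<in> carrier G" using Cn1(2)[OF x0(1)] .
      \<comment> \<open>Division with remainder: after subtracting the right multiple of
        \<open>x0\<close>, the remainder in coordinate s is smaller than n and hence 0 by
        minimality.\<close>
      have red: "x \<otimes> x0 [^] (- (coord s x div int n)) \<in> Cn (T E)" if x: "x \<in> Cn (insert s (T E))" for x
      proof -
        let ?q = "coord s x div int n" and ?y = "x \<otimes> x0 [^] (- (coord s x div int n))"
        have xG: "x \<in> carrier G" using Cn1(2)[OF x] .
        have cy: "coord i ?y = coord i x - ?q * coord i x0" for i
          using coord[of x "x0 [^] (- ?q)" i] cpow[OF x0G, of i "- ?q"] xG x0G by simp
        have yC: "?y \<in> Cn (insert s (T E))"
          using x x0(1) cy xG x0G by (simp add: Cn_def)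
        have ys: "coord s ?y = coord s x mod int n"
          unfolding cy x0(2) by (simp add: minus_div_mult_eq_mod)
        have "coord s ?y = 0"
        proof (rule ccontr)
          assume "coord s ?y \<noteq> 0"
          moreover have "0 \<le> coord s ?y" unfolding ys using x0(3) by simp
          ultimately have "0 < coord s ?y" by linarith
          then have "pos (nat (coord s ?y))"
            unfolding pos_def using yC by (intro conjI bexI[of _ ?y]) auto
          from n(2)[OF this] show False
            using ys pos_mod_bound[of "int n" "coord s x"] x0(3) by linarith
        qed
        then show ?thesis using yC by (auto simp: Cn_def)
      qed
      define R' where "R' = {(a \<otimes> x0 [^] m, b) | a b m. (a, b) \<in> R E \<and> m \<in> (UNIV :: int set)}"
      have R'I: "(a \<otimes> x0 [^] m, b) \<in> R'" if "(a, b) \<in> R E" for a b and m :: int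
        using that unfolding R'_def by blast
      have sub: "R E \<subseteq> R'"
      proof
        fix p assume p: "p \<in> R E"
        then have "(fst p, snd p) \<in> R E" by simp
        from R'I[OF this, of 0] RG1(1)[OF this] show "p \<in> R'" by simp
      qed
      have "graph (insert s (T E)) R'"
        unfolding graph_def
      proof (intro conjI ballI allI impI)
        show "fst ` R' = Cn (insert s (T E))"
        proof (intro equalityI subsetI)
          fix y assume "y \<in> fst ` R'"
          then obtain a b and m :: int where ab: "(a, b) \<in> R E" "y = a \<otimes> x0 [^] m"
            unfolding R'_def by force
          have "a \<in> Cn (insert s (T E))" using RC[OF ab(1)] CnI by blast
          then show "y \<in> Cn (insert s (T E))"
            unfolding ab(2) using x0 coord[of a "x0 [^] m"] cpow[OF x0G] by (simp add: Cn_def)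
        next
          fix x assume x: "x \<in> Cn (insert s (T E))"
          let ?q = "coord s x div int n"
          obtain b where "(x \<otimes> x0 [^] (- ?q), b) \<in> R E" using CR[OF red[OF x]] by blast
          from R'I[OF this, of ?q] have "(x \<otimes> x0 [^] (- ?q) \<otimes> x0 [^] ?q, b) \<in> R'" .
          moreover have "x \<otimes> x0 [^] (- ?q) \<otimes> x0 [^] ?q = x"
            using Cn1(2)[OF x] x0G by (simp add: m_assoc int_pow_mult[symmetric] del: int_pow_neg)
          ultimately have "(x, b) \<in> R'" by simp
          then show "x \<in> fst ` R'" by force
        qed
        show "snd ` R' \<subseteq> Z" unfolding R'_def using RG1(2) by auto
        show "(z, z) \<in> R'" if "z \<in> Z" for z using RZ[OF that] sub by blast
        fix p q r t assume "(p, q) \<in> R'" "(r, t) \<in> R'"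
        then obtain a b a' b' and m m' :: int where ab: "(a, b) \<in> R E" "p = a \<otimes> x0 [^] m" "q = b"
          "(a', b') \<in> R E" "r = a' \<otimes> x0 [^] m'" "t = b'"
          unfolding R'_def by blast
        have "((a \<otimes> inv a') \<otimes> x0 [^] (m - m'), b \<otimes> inv b') \<in> R'"
          by (rule R'I[OF Rdiff[OF ab(1,4)]])
        moreover have "(a \<otimes> inv a') \<otimes> x0 [^] (m - m') = p \<otimes> inv r"
          using x0G RG1(1)[OF ab(1)] RG1(1)[OF ab(4)] by (simp add: ab int_pow_diff inv_mult_group m_ac)
        ultimately show "(p \<otimes> inv r, q \<otimes> inv t) \<in> R'" by (simp add: ab)
      next
        fix y assume "(\<one>, y) \<in> R'"
        then obtain a and m :: int where ab: "(a, y) \<in> R E" "\<one> = a \<otimes> x0 [^] m"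
          unfolding R'_def by blast
        \<comment> \<open>The old domain has no component in coordinate s, so the exponent of
          \<open>x0\<close> in a representation of \<open>\<one>\<close> is 0; the extension
          therefore remains single-valued.\<close>
        have "coord s a = 0" using RC[OF ab(1)] s by (simp add: Cn_def)
        then have "m * int n = 0"
          using coord[of a "x0 [^] m" s] ab(2) cpow[OF x0G, of s m] x0(2) RG1(1)[OF ab(1)] x0G cone[of s] by simp
        then have "m = 0" using x0(3) by simp
        then have "(\<one>, y) \<in> R E" using ab RG1(1)[OF ab(1)] by simp
        then show "y = \<one>" by (rule R1)
      qed
      then show False using extend sub by blast
    qed
  qed
  have total: "\<exists>b. (x, b) \<in> R E" if "x \<in> carrier G" for x
    by (rule CR) (use that all in \<open>auto simp: Cn_def\<close>)
  have uniq: "b = d" if "(a, b) \<in> R E" "(a, d) \<in> R E" for a b d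
  proof -
    have "b \<otimes> inv d = \<one>" using R1[of "b \<otimes> inv d"] Rdiff[OF that] RG1(1)[OF that(1)] by simp
    then show ?thesis using RG1(3)[OF that(1)] RG1(3)[OF that(2)] by (metis inv_closed inv_equality inv_inv)
  qed
  have R11: "(\<one>, \<one>) \<in> R E" by (rule RZ[OF Z(1)])
  have Rmult: "(a \<otimes> c, b \<otimes> d) \<in> R E" if "(a, b) \<in> R E" "(c, d) \<in> R E" for a b c d
    using Rdiff[OF that(1) Rdiff[OF R11 that(2)]] RG1[OF that(1)] RG1[OF that(2)] by simp
  define r where "r x = (SOME b. (x, b) \<in> R E)" for x
  have r: "(x, r x) \<in> R E" if "x \<in> carrier G" for x
    unfolding r_def by (rule someI_ex[OF total[OF that]])
  show ?thesis
  proof (intro exI[of _ r] conjI ballI)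
    show "r \<in> hom G G"
    proof (rule homI)
      show "r x \<in> carrier G" if "x \<in> carrier G" for x using RG1(3)[OF r[OF that]] .
      show "r (x \<otimes> y) = r x \<otimes> r y" if "x \<in> carrier G" "y \<in> carrier G" for x y
        by (rule uniq[OF r Rmult[OF r r]]) (use that in auto)
    qed
    show "r ` carrier G \<subseteq> Z" using RG1(2)[OF r] by blast
    show "r x = x" if "x \<in> Z" for x
      by (rule uniq[OF r RZ[OF that]]) (use that in \<open>simp add: Z_def\<close>)
  qed
qed

end

section \<open>Coefficient groups and groups of homomorphisms\<close>

lemma comm_group_DirProd:
  assumes "comm_group G" "comm_group H" shows "comm_group (G \<times>\<times> H)"
proof -
  interpret G: comm_group G by fact
  interpret H: comm_group H by fact
  interpret P: group "G \<times>\<times> H" by (rule DirProd_group) unfold_locales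
  show ?thesis
    by (rule P.group_comm_groupI) (auto simp: G.m_comm H.m_comm)
qed

text \<open>Record simplification would take \<^term>\<open>real_group\<close> apart; a constant protects it.\<close>

definition real_add :: "real monoid" where
  "real_add = real_group"

lemma real_add_simps [simp]:
  "carrier real_add = UNIV" "x \<otimes>\<^bsub>real_add\<^esub> y = x + y" "\<one>\<^bsub>real_add\<^esub> = 0"
  by (simp_all add: real_add_def ring_of_type_algebra_def)

lemma real_add_comm_group: "comm_group real_add"
proof (rule comm_groupI)
  fix x
  show "\<exists>y\<in>carrier real_add. y \<otimes>\<^bsub>real_add\<^esub> x = \<one>\<^bsub>real_add\<^esub>"
    by (rule bexI[of _ "- x"]) simp_all
qed simp_all

lemma real_add_inv [simp]: "inv\<^bsub>real_add\<^esub> x = - x"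
proof -
  interpret comm_group real_add by (rule real_add_comm_group)
  show ?thesis by (rule inv_equality) simp_all
qed

lemma coeff_group_simps [simp]:
  "carrier (coeff_group \<Lambda>) = \<Lambda>" "x \<otimes>\<^bsub>coeff_group \<Lambda>\<^esub> y = x + y" "\<one>\<^bsub>coeff_group \<Lambda>\<^esub> = 0"
  by (simp_all add: coeff_group_def ring_of_type_algebra_def)

lemma coeff_group_comm_group:
  assumes "subring \<Lambda> real_ring" shows "comm_group (coeff_group \<Lambda>)"
proof (rule comm_groupI)
  note L = real_subring[OF assms]
  fix x assume "x \<in> carrier (coeff_group \<Lambda>)"
  then show "\<exists>y\<in>carrier (coeff_group \<Lambda>). y \<otimes>\<^bsub>coeff_group \<Lambda>\<^esub> x = \<one>\<^bsub>coeff_group \<Lambda>\<^esub>"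
    using L(4) by (intro bexI[of _ "- x"]) simp_all
qed (simp_all add: real_subring[OF assms])

context
  fixes \<Lambda> :: "real set"
  assumes \<Lambda>: "subring \<Lambda> real_ring"
begin

lemma subgroup_real: "subgroup \<Lambda> real_add"
  by (rule subgroup.intro) (simp_all add: real_subring[OF \<Lambda>])

lemma normal_real: "\<Lambda> \<lhd> real_add"
  using comm_group.normal_iff_subgroup[OF real_add_comm_group] subgroup_real by blast

lemma RmodL_eq: "RmodL \<Lambda> = real_add Mod \<Lambda>"
  and reduce_eq: "reduce \<Lambda> x = \<Lambda> #>\<^bsub>real_add\<^esub> x"
  by (simp_all only: RmodL_def reduce_def real_add_def)

lemma RmodL_comm_group: "comm_group (RmodL \<Lambda>)"
  unfolding RmodL_eq by (rule comm_group.abelian_FactGroup[OF real_add_comm_group subgroup_real])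

lemma reduce_carrier [simp]: "reduce \<Lambda> x \<in> carrier (RmodL \<Lambda>)"
  by (auto simp: RmodL_eq FactGroup_def RCOSETS_def reduce_eq)

lemma carrier_RmodL: "carrier (RmodL \<Lambda>) = range (reduce \<Lambda>)"
  by (auto simp: RmodL_eq FactGroup_def RCOSETS_def reduce_eq)

lemma reduce_add: "reduce \<Lambda> (x + y) = reduce \<Lambda> x \<otimes>\<^bsub>RmodL \<Lambda>\<^esub> reduce \<Lambda> y"
  using normal.rcos_sum[OF normal_real, of x y] by (simp add: RmodL_eq FactGroup_def reduce_eq)

lemma RmodL_one: "\<one>\<^bsub>RmodL \<Lambda>\<^esub> = reduce \<Lambda> 0"
proof -
  interpret comm_group real_add by (rule real_add_comm_group)
  have "\<Lambda> #>\<^bsub>real_add\<^esub> \<one>\<^bsub>real_add\<^esub> = \<Lambda>" by (rule coset_mult_one) simp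
  then show ?thesis by (simp add: RmodL_eq FactGroup_def reduce_eq)
qed

lemma reduce_uminus: "reduce \<Lambda> (- x) = inv\<^bsub>RmodL \<Lambda>\<^esub> reduce \<Lambda> x"
proof -
  interpret R: comm_group "RmodL \<Lambda>" by (rule RmodL_comm_group)
  have "reduce \<Lambda> (- x) \<otimes>\<^bsub>RmodL \<Lambda>\<^esub> reduce \<Lambda> x = \<one>\<^bsub>RmodL \<Lambda>\<^esub>"
    using reduce_add[of "- x" x] RmodL_one by simp
  then show ?thesis
    by (rule R.inv_equality[symmetric]) simp_all
qed

lemma reduce_eq_one: "reduce \<Lambda> x = \<one>\<^bsub>RmodL \<Lambda>\<^esub> \<longleftrightarrow> x \<in> \<Lambda>"
proof -
  interpret comm_group real_add by (rule real_add_comm_group)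
  have "\<Lambda> #>\<^bsub>real_add\<^esub> x = \<Lambda> \<longleftrightarrow> x \<in> \<Lambda>"
  proof
    assume "\<Lambda> #>\<^bsub>real_add\<^esub> x = \<Lambda>"
    moreover have "x \<in> \<Lambda> #>\<^bsub>real_add\<^esub> x" by (rule rcos_self[OF _ subgroup_real]) simp
    ultimately show "x \<in> \<Lambda>" by simp
  next
    assume "x \<in> \<Lambda>"
    then show "\<Lambda> #>\<^bsub>real_add\<^esub> x = \<Lambda>" by (intro coset_join2 subgroup_real) simp_all
  qed
  then show ?thesis by (simp add: RmodL_eq FactGroup_def reduce_eq)
qed

lemma reduce_eq_iff: "reduce \<Lambda> x = reduce \<Lambda> y \<longleftrightarrow> x - y \<in> \<Lambda>"
proof -
  interpret R: comm_group "RmodL \<Lambda>" by (rule RmodL_comm_group)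
  have "reduce \<Lambda> x = reduce \<Lambda> (x - y) \<otimes>\<^bsub>RmodL \<Lambda>\<^esub> reduce \<Lambda> y"
    using reduce_add[of "x - y" y] by simp
  then show ?thesis
    using reduce_eq_one[of "x - y"] R.r_cancel_one[of "reduce \<Lambda> y" "reduce \<Lambda> (x - y)"] by auto
qed

text \<open>On a free group it suffices to lift the value at each generator. The lift h is additive
  on all finitely supported functions, whatever the unspecified values of t outside S, so it needs
  no restriction to a carrier.\<close>

lemma free_lift:
  assumes F: "F \<in> hom (free_Abelian_group S) (RmodL \<Lambda>)"
  shows "\<exists>h. (\<forall>x y. h (x + y) = h x + h y) \<and> (\<forall>x\<in>carrier (free_Abelian_group S). F x = reduce \<Lambda> (h x))"
proof -
  interpret R: comm_group "RmodL \<Lambda>" by (rule RmodL_comm_group)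
  have "\<exists>t. F (frag_of s) = reduce \<Lambda> t" if "s \<in> S" for s
    using hom_in_carrier[OF F, of "frag_of s"] that carrier_RmodL by auto
  then obtain t where t: "\<And>s. s \<in> S \<Longrightarrow> F (frag_of s) = reduce \<Lambda> (t s)" by metis
  define h where "h x = (\<Sum>s\<in>Poly_Mapping.keys x. of_int (Poly_Mapping.lookup x s) * t s)" for x
  have h: "h x = (\<Sum>s\<in>U. of_int (Poly_Mapping.lookup x s) * t s)" if "finite U" "Poly_Mapping.keys x \<subseteq> U" for x U
    unfolding h_def using that by (intro sum.mono_neutral_left) (auto simp: in_keys_iff)
  have add: "h (x + y) = h x + h y" for x y
    using keys_add[of x y]
    by (simp add: h[of "Poly_Mapping.keys x \<union> Poly_Mapping.keys y"] lookup_add algebra_simps sum.distrib)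
  have min: "h (- x) = - h x" for x using add[of x "- x"] by (simp add: h_def)
  have "Poly_Mapping.keys x \<subseteq> S \<Longrightarrow> F x = reduce \<Lambda> (h x)" for x
  proof (rule frag_induction[of x S "\<lambda>x. x \<in> carrier (free_Abelian_group S) \<and> F x = reduce \<Lambda> (h x)", THEN conjunct2])
    have F1: "F 0 = \<one>\<^bsub>RmodL \<Lambda>\<^esub>"
      using hom_one[OF F group_free_Abelian_group R.is_group] by simp
    show "0 \<in> carrier (free_Abelian_group S) \<and> F 0 = reduce \<Lambda> (h 0)"
      using F1 by (simp add: RmodL_one h_def)
    show "frag_of s \<in> carrier (free_Abelian_group S) \<and> F (frag_of s) = reduce \<Lambda> (h (frag_of s))" if "s \<in> S" for s
      using t[OF that] that by (simp add: h_def)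
    fix a b assume ab: "a \<in> carrier (free_Abelian_group S) \<and> F a = reduce \<Lambda> (h a)"
      "b \<in> carrier (free_Abelian_group S) \<and> F b = reduce \<Lambda> (h b)"
    interpret G: comm_group "free_Abelian_group S" by (rule abelian_free_Abelian_group)
    have mb: "- b \<in> carrier (free_Abelian_group S)" using ab by simp
    have d: "a - b \<in> carrier (free_Abelian_group S)"
      using G.m_closed[of a "- b"] ab mb by simp
    have "F (a - b + b) = F (a - b) \<otimes>\<^bsub>RmodL \<Lambda>\<^esub> F b"
      using hom_mult[OF F d, of b] ab by simp
    then have "reduce \<Lambda> (h a) = F (a - b) \<otimes>\<^bsub>RmodL \<Lambda>\<^esub> reduce \<Lambda> (h b)" using ab by simp
    moreover have "reduce \<Lambda> (h a) = reduce \<Lambda> (h (a - b)) \<otimes>\<^bsub>RmodL \<Lambda>\<^esub> reduce \<Lambda> (h b)"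
      using reduce_add[of "h (a - b)" "h b"] add[of "a - b" b] by simp
    ultimately have "F (a - b) = reduce \<Lambda> (h (a - b))"
      using hom_in_carrier[OF F d] by (metis R.r_cancel reduce_carrier)
    then show "a - b \<in> carrier (free_Abelian_group S) \<and> F (a - b) = reduce \<Lambda> (h (a - b))" using d by simp
  qed
  then show ?thesis using add by (intro exI[of _ h]) simp
qed

end

lemma hom_group_simps:
  "carrier (hom_group G H) = hom G H \<inter> extensional (carrier G)"
  "f \<otimes>\<^bsub>hom_group G H\<^esub> g = (\<lambda>x\<in>carrier G. f x \<otimes>\<^bsub>H\<^esub> g x)"
  "\<one>\<^bsub>hom_group G H\<^esub> = (\<lambda>x\<in>carrier G. \<one>\<^bsub>H\<^esub>)"
  by (simp_all add: hom_group_def)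

lemma
  assumes G: "group G" and H: "comm_group H"
  shows hom_group_comm_group: "comm_group (hom_group G H)"
    and hom_group_inv: "f \<in> carrier (hom_group G H) \<Longrightarrow>
      inv\<^bsub>hom_group G H\<^esub> f = (\<lambda>x\<in>carrier G. inv\<^bsub>H\<^esub> f x)"
proof -
  interpret G: group G by fact
  interpret H: comm_group H by fact
  have inv: "(\<lambda>x\<in>carrier G. inv\<^bsub>H\<^esub> f x) \<in> carrier (hom_group G H)"
    "(\<lambda>x\<in>carrier G. inv\<^bsub>H\<^esub> f x) \<otimes>\<^bsub>hom_group G H\<^esub> f = \<one>\<^bsub>hom_group G H\<^esub>"
    if f: "f \<in> carrier (hom_group G H)" for f
  proof -
    have fh: "f \<in> hom G H" using f by (simp add: hom_group_simps)
    have fc: "f x \<in> carrier H" if "x \<in> carrier G" for x using hom_in_carrier[OF fh that] .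
    show "(\<lambda>x\<in>carrier G. inv\<^bsub>H\<^esub> f x) \<in> carrier (hom_group G H)"
      unfolding hom_group_simps
      by (auto intro!: homI simp: fc hom_mult[OF fh] H.inv_mult H.m_comm)
    show "(\<lambda>x\<in>carrier G. inv\<^bsub>H\<^esub> f x) \<otimes>\<^bsub>hom_group G H\<^esub> f = \<one>\<^bsub>hom_group G H\<^esub>"
      unfolding hom_group_simps by (rule restrict_ext) (simp add: fc)
  qed
  show cg: "comm_group (hom_group G H)"
  proof (rule comm_groupI)
    fix f g assume fg: "f \<in> carrier (hom_group G H)" "g \<in> carrier (hom_group G H)"
    then have h: "f \<in> hom G H" "g \<in> hom G H" by (simp_all add: hom_group_simps)
    have c: "f x \<in> carrier H" "g x \<in> carrier H" if "x \<in> carrier G" for x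
      using hom_in_carrier[OF h(1) that] hom_in_carrier[OF h(2) that] .
    show "f \<otimes>\<^bsub>hom_group G H\<^esub> g \<in> carrier (hom_group G H)"
      unfolding hom_group_simps
      by (auto intro!: homI simp: c hom_mult[OF h(1)] hom_mult[OF h(2)] H.m_ac)
    show "f \<otimes>\<^bsub>hom_group G H\<^esub> g = g \<otimes>\<^bsub>hom_group G H\<^esub> f"
      unfolding hom_group_simps by (rule restrict_ext) (simp add: c H.m_comm)
    fix e assume e: "e \<in> carrier (hom_group G H)"
    then have eh: "e \<in> hom G H" by (simp add: hom_group_simps)
    show "f \<otimes>\<^bsub>hom_group G H\<^esub> g \<otimes>\<^bsub>hom_group G H\<^esub> e = f \<otimes>\<^bsub>hom_group G H\<^esub> (g \<otimes>\<^bsub>hom_group G H\<^esub> e)"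
      unfolding hom_group_simps by (rule restrict_ext) (simp add: c hom_in_carrier[OF eh] H.m_assoc)
  next
    show "\<one>\<^bsub>hom_group G H\<^esub> \<in> carrier (hom_group G H)"
      unfolding hom_group_simps by (auto intro!: homI)
    fix f assume f: "f \<in> carrier (hom_group G H)"
    then have h: "f \<in> hom G H" "f \<in> extensional (carrier G)" by (simp_all add: hom_group_simps)
    show "\<one>\<^bsub>hom_group G H\<^esub> \<otimes>\<^bsub>hom_group G H\<^esub> f = f"
      unfolding hom_group_simps
      by (rule extensionalityI[OF restrict_extensional h(2)]) (simp add: hom_in_carrier[OF h(1)])
    show "\<exists>g\<in>carrier (hom_group G H). g \<otimes>\<^bsub>hom_group G H\<^esub> f = \<one>\<^bsub>hom_group G H\<^esub>"
      using inv[OF f] by blast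
  qed
  show "inv\<^bsub>hom_group G H\<^esub> f = (\<lambda>x\<in>carrier G. inv\<^bsub>H\<^esub> f x)" if f: "f \<in> carrier (hom_group G H)"
  proof -
    interpret K: comm_group "hom_group G H" by (rule cg)
    show ?thesis by (rule K.inv_equality[OF inv(2)[OF f] f inv(1)[OF f]])
  qed
qed

text \<open>For a multiplicative relation it is enough to know what is related to the identity: if
  that lies in B, then the elements related to a fixed f form part of one coset, and
  \<open>the_elem\<close> is applied to a singleton. No choice compatible with products has to be
  constructed.\<close>

lemma quotient_map_from_relation:
  assumes H: "comm_group H" and Z: "comm_group Z" and B: "subgroup B Z"
    and R: "\<And>f z. R f z \<Longrightarrow> f \<in> carrier H \<and> z \<in> carrier Z"
    and mult: "\<And>f z g y. R f z \<Longrightarrow> R g y \<Longrightarrow> R (f \<otimes>\<^bsub>H\<^esub> g) (z \<otimes>\<^bsub>Z\<^esub> y)"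
    and total: "\<And>f. f \<in> carrier H \<Longrightarrow> \<exists>z. R f z"
    and one: "\<And>z. R \<one>\<^bsub>H\<^esub> z \<Longrightarrow> z \<in> B"
    and surj: "\<And>z. z \<in> carrier Z \<Longrightarrow> \<exists>f. R f z"
    and J_eq: "\<And>f. f \<in> carrier H \<Longrightarrow> J f = the_elem {B #>\<^bsub>Z\<^esub> z | z. R f z}"
  shows "J \<in> epi H (Z Mod B)"
    and "kernel H (Z Mod B) J = {f. \<exists>z\<in>B. R f z}"
proof -
  interpret H: comm_group H by fact
  interpret Z: comm_group Z by fact
  interpret B: subgroup B Z by fact
  interpret N: normal B Z using Z.normal_iff_subgroup B by blast
  have coset: "B #>\<^bsub>Z\<^esub> z = B #>\<^bsub>Z\<^esub> y" if zy: "R f z" "R f y" for f z y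
  proof -
    have f: "f \<in> carrier H" and z: "z \<in> carrier Z" and y: "y \<in> carrier Z" using R zy by auto
    \<comment> \<open>An element related to the inverse of f: multiplied by it, both z and y become
      related to the identity, so their quotient lies in B.\<close>
    obtain x where x: "R (inv\<^bsub>H\<^esub> f) x" using total[OF H.inv_closed[OF f]] by blast
    have xc: "x \<in> carrier Z" using R[OF x] by simp
    have b: "z \<otimes>\<^bsub>Z\<^esub> x \<in> B" "y \<otimes>\<^bsub>Z\<^esub> x \<in> B"
      using one mult[OF zy(1) x] mult[OF zy(2) x] f by simp_all
    have "(z \<otimes>\<^bsub>Z\<^esub> x) \<otimes>\<^bsub>Z\<^esub> inv\<^bsub>Z\<^esub> (y \<otimes>\<^bsub>Z\<^esub> x) \<in> B" by (intro B.m_closed B.m_inv_closed b)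
    moreover have "(z \<otimes>\<^bsub>Z\<^esub> x) \<otimes>\<^bsub>Z\<^esub> inv\<^bsub>Z\<^esub> (y \<otimes>\<^bsub>Z\<^esub> x) = z \<otimes>\<^bsub>Z\<^esub> inv\<^bsub>Z\<^esub> y"
      using z y xc by (simp add: Z.inv_mult_group Z.m_assoc[symmetric]) (simp add: Z.m_assoc)
    ultimately have "z \<otimes>\<^bsub>Z\<^esub> inv\<^bsub>Z\<^esub> y \<in> B" by simp
    then have "z \<in> B #>\<^bsub>Z\<^esub> y" using B.rcos_module_rev[OF Z.is_group y z] by simp
    then show ?thesis using Z.repr_independence[OF _ y B] by simp
  qed
  have J: "J f = B #>\<^bsub>Z\<^esub> z" if "R f z" for f z
  proof -
    have "{B #>\<^bsub>Z\<^esub> z | z. R f z} = {B #>\<^bsub>Z\<^esub> z}" using coset that by blast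
    then show ?thesis using J_eq R[OF that] by simp
  qed
  have Jh: "J \<in> hom H (Z Mod B)"
  proof (rule homI)
    fix f assume "f \<in> carrier H"
    then obtain z where z: "R f z" using total by blast
    then show "J f \<in> carrier (Z Mod B)"
      using R[OF z] by (auto simp: J[OF z] FactGroup_def RCOSETS_def)
    fix g assume "g \<in> carrier H"
    then obtain y where y: "R g y" using total by blast
    show "J (f \<otimes>\<^bsub>H\<^esub> g) = J f \<otimes>\<^bsub>Z Mod B\<^esub> J g"
      using N.rcos_sum R[OF z] R[OF y] by (simp add: J[OF z] J[OF y] J[OF mult[OF z y]] FactGroup_def)
  qed
  moreover have "J ` carrier H = carrier (Z Mod B)"
  proof (intro equalityI subsetI)
    fix c assume "c \<in> carrier (Z Mod B)"
    then obtain z where z: "z \<in> carrier Z" "c = B #>\<^bsub>Z\<^esub> z" by (auto simp: FactGroup_def RCOSETS_def)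
    then obtain f where f: "R f z" using surj by blast
    then have "c = J f" "f \<in> carrier H" using J[OF f] R[OF f] z by simp_all
    then show "c \<in> J ` carrier H" by blast
  qed (use Jh in \<open>auto simp: hom_def\<close>)
  ultimately show "J \<in> epi H (Z Mod B)" by (simp add: epi_def)
  show "kernel H (Z Mod B) J = {f. \<exists>z\<in>B. R f z}"
  proof (intro equalityI subsetI)
    fix f assume "f \<in> kernel H (Z Mod B) J"
    then have f: "f \<in> carrier H" "J f = B" by (simp_all add: kernel_def FactGroup_def)
    then obtain z where z: "R f z" using total by blast
    have "z \<in> B #>\<^bsub>Z\<^esub> z" by (rule Z.rcos_self[OF _ B]) (use R[OF z] in simp)
    then have "z \<in> B" using J[OF z] f(2) by simp
    then show "f \<in> {f. \<exists>z\<in>B. R f z}" using z by blast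
  next
    fix f assume "f \<in> {f. \<exists>z\<in>B. R f z}"
    then obtain z where z: "z \<in> B" "R f z" by blast
    have "B #>\<^bsub>Z\<^esub> z = B" by (rule Z.coset_join2[OF _ B z(1)]) (use R[OF z(2)] in simp)
    then show "f \<in> kernel H (Z Mod B) J" using J[OF z(2)] R[OF z(2)] by (simp add: kernel_def FactGroup_def)
  qed
qed

section \<open>The relative complexes\<close>

lemma comm_group_restrict:
  assumes "comm_group G" "subgroup H G" shows "comm_group (G\<lparr>carrier := H\<rparr>)"
proof -
  interpret G: comm_group G by fact
  interpret K: group "G\<lparr>carrier := H\<rparr>" by (rule G.subgroup_imp_group[OF assms(2)])
  show ?thesis
    by (rule K.group_comm_groupI) (use subgroup.mem_carrier[OF assms(2)] G.m_comm in simp)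
qed

lemma smooth_chains_simps [simp]:
  "x \<otimes>\<^bsub>smooth_chains N n\<^esub> y = x + y" "\<one>\<^bsub>smooth_chains N n\<^esub> = 0"
  by (simp_all add: smooth_chains_def)

lemma smooth_chains_comm_group: "comm_group (smooth_chains N n)"
  by (simp add: smooth_chains_def abelian_free_Abelian_group)

lemma rel_chains_carrier:
  "carrier (rel_chains A M n) = carrier (smooth_chains M n) \<times> carrier (smooth_chains A (n - 1))"
  by (simp add: rel_chains_def)

lemma rel_chains_simps [simp]:
  "x \<otimes>\<^bsub>rel_chains A M n\<^esub> y = x + y" "\<one>\<^bsub>rel_chains A M n\<^esub> = 0"
  by (simp_all add: rel_chains_def mult_DirProd' plus_prod_def zero_prod_def)

lemma rel_chains_comm_group: "comm_group (rel_chains A M n)"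
  unfolding rel_chains_def by (intro comm_group_DirProd smooth_chains_comm_group)

lemma rel_boundary_add: "rel_boundary \<rho> n (x + y) = rel_boundary \<rho> n x + rel_boundary \<rho> n y"
  by (cases x; cases y) (simp add: rel_boundary_def chain_boundary_add chain_map_add)

lemma rel_boundary_Pair:
  "rel_boundary \<rho> n (\<sigma>, \<tau>) = (chain_boundary (nat n) \<sigma> + chain_map (nat (n - 1)) \<rho> \<tau>, - chain_boundary (nat (n - 1)) \<tau>)"
  by (simp add: rel_boundary_def)

lemma rel_boundary_closed:
  assumes A: "smooth_manifold A" and M: "smooth_manifold M" and \<rho>: "smooth_map A M \<rho>"
    and z: "z \<in> carrier (rel_chains A M n)"
  shows "rel_boundary \<rho> n z \<in> carrier (rel_chains A M (n - 1))"
  using z smooth_chains_boundary[of _ M n] smooth_chains_boundary[of _ A "n - 1"]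
    smooth_chains_chain_map[OF A M \<rho>, of _ "n - 1"]
  by (auto simp: rel_chains_carrier rel_boundary_def intro!: smooth_chains_add)

lemma rel_boundary_boundary:
  assumes "z \<in> carrier (rel_chains A M n)" shows "rel_boundary \<rho> (n - 1) (rel_boundary \<rho> n z) = 0"
proof -
  obtain \<sigma> \<tau> where z: "z = (\<sigma>, \<tau>)" "\<sigma> \<in> carrier (smooth_chains M n)" "\<tau> \<in> carrier (smooth_chains A (n - 1))"
    using assms by (auto simp: rel_chains_carrier)
  show ?thesis
    using smooth_chain_boundary_boundary[OF z(2)] smooth_chain_boundary_boundary[OF z(3)]
      smooth_chain_boundary_chain_map[OF z(3), of \<rho>]
    by (simp add: z(1) rel_boundary_Pair chain_boundary_add chain_boundary_minus chain_map_minus zero_prod_def)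
qed

lemma rel_cycles_iff:
  "z \<in> carrier (rel_cycles A M \<rho> n) \<longleftrightarrow> z \<in> carrier (rel_chains A M n) \<and> rel_boundary \<rho> n z = 0"
  by (simp add: rel_cycles_def zero_prod_def)

lemma rel_cycles_simps [simp]:
  "x \<otimes>\<^bsub>rel_cycles A M \<rho> n\<^esub> y = x + y" "\<one>\<^bsub>rel_cycles A M \<rho> n\<^esub> = 0"
  using rel_chains_simps[of A M n] by (simp_all add: rel_cycles_def)

lemma rel_integral_add:
  "rel_integral A M n w (x + y) = rel_integral A M n w x + rel_integral A M n w y"
  by (cases w; cases x; cases y) (simp add: rel_integral_def chain_integral_add)

lemma rel_integral_Pair:
  "rel_integral A M n (\<omega>, \<theta>) (\<sigma>, \<tau>) = chain_integral M n \<sigma> \<omega> + chain_integral A (n - 1) \<tau> \<theta>"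
  by (simp add: rel_integral_def)

lemma smooth_cycles_iff:
  "z \<in> smooth_cycles N n \<longleftrightarrow> z \<in> carrier (smooth_chains N n) \<and> chain_boundary (nat n) z = 0"
  by (simp add: smooth_cycles_def)

lemma hom_real_iff:
  "f \<in> carrier (hom_group G real_add) \<longleftrightarrow> f \<in> extensional (carrier G) \<and>
     (\<forall>x\<in>carrier G. \<forall>y\<in>carrier G. f (x \<otimes>\<^bsub>G\<^esub> y) = f x + f y)"
  by (auto simp: hom_group_simps hom_def)

lemma hom_coeff_iff:
  "f \<in> carrier (hom_group G (coeff_group \<Lambda>)) \<longleftrightarrow> f \<in> extensional (carrier G) \<and>
     (\<forall>x\<in>carrier G. \<forall>y\<in>carrier G. f (x \<otimes>\<^bsub>G\<^esub> y) = f x + f y) \<and> (\<forall>x\<in>carrier G. f x \<in> \<Lambda>)"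
  by (auto simp: hom_group_simps hom_def)

lemma additive_on_0:
  fixes f :: "'g :: group_add \<Rightarrow> real"
  assumes "0 \<in> C" "\<And>x y. x \<in> C \<Longrightarrow> y \<in> C \<Longrightarrow> f (x + y) = f x + f y"
  shows "f 0 = 0"
  using assms(2)[of 0 0] assms(1) by simp

lemma additive_on_uminus:
  fixes f :: "'g :: group_add \<Rightarrow> real"
  assumes "0 \<in> C" "\<And>x y. x \<in> C \<Longrightarrow> y \<in> C \<Longrightarrow> f (x + y) = f x + f y" "x \<in> C" "- x \<in> C"
  shows "f (- x) = - f x"
  using assms(2)[of x "- x"] additive_on_0[of C f] assms by simp

lemma hom_chains_add:
  assumes "f \<in> carrier (hom_group (smooth_chains N n) real_add) \<or> f \<in> carrier (hom_group (smooth_chains N n) (coeff_group \<Lambda>))"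
    "x \<in> carrier (smooth_chains N n)" "y \<in> carrier (smooth_chains N n)"
  shows "f (x + y) = f x + f y"
  using assms by (auto simp: hom_real_iff hom_coeff_iff)

lemma hom_chains_0:
  assumes "f \<in> carrier (hom_group (smooth_chains N n) real_add) \<or> f \<in> carrier (hom_group (smooth_chains N n) (coeff_group \<Lambda>))"
  shows "f 0 = 0"
  by (rule additive_on_0[of "carrier (smooth_chains N n)"]) (use hom_chains_add[OF assms] in simp_all)

lemma hom_chains_uminus:
  assumes "f \<in> carrier (hom_group (smooth_chains N n) real_add) \<or> f \<in> carrier (hom_group (smooth_chains N n) (coeff_group \<Lambda>))"
    "x \<in> carrier (smooth_chains N n)"
  shows "f (- x) = - f x"
  by (rule additive_on_uminus[of "carrier (smooth_chains N n)"]) (use hom_chains_add[OF assms(1)] assms(2) in simp_all)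

lemma period_forms_iff:
  "\<omega> \<in> carrier (period_forms \<Lambda> N n) \<longleftrightarrow>
    \<omega> \<in> carrier (form_group N n) \<and> (\<forall>z\<in>smooth_cycles N n. chain_integral N n z \<omega> \<in> \<Lambda>)"
  by (simp add: period_forms_def)

lemma period_forms_simps:
  "\<omega> \<otimes>\<^bsub>period_forms \<Lambda> N n\<^esub> \<eta> = \<omega> \<otimes>\<^bsub>form_group N n\<^esub> \<eta>" "\<one>\<^bsub>period_forms \<Lambda> N n\<^esub> = zero_form"
  by (simp_all add: period_forms_def form_group_one)

lemma form_mult_zero [simp]: "\<omega> \<otimes>\<^bsub>form_group N n\<^esub> zero_form = \<omega>" "zero_form \<otimes>\<^bsub>form_group N n\<^esub> \<omega> = \<omega>"
  by (simp_all add: form_group_mult zero_form_def)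

lemma zero_form_carrier: "smooth_manifold N \<Longrightarrow> zero_form \<in> carrier (form_group N n)"
  by (simp add: form_group_carrier differential_form_zero)

section \<open>The relative Hopkins-Singer complex\<close>

context
  fixes \<Lambda> :: "real set"
  assumes \<Lambda>: "subring \<Lambda> real_ring" "\<Lambda> \<noteq> UNIV"
begin

lemma period_forms_subgroup:
  assumes N: "smooth_manifold N"
  shows "subgroup (carrier (period_forms \<Lambda> N n)) (form_group N n)"
proof -
  interpret F: comm_group "form_group N n" by (rule form_group_comm_group[OF N])
  note L = real_subring[OF \<Lambda>(1)]
  have cyc: "z \<in> carrier (smooth_chains N n)" if "z \<in> smooth_cycles N n" for z
    using that by (simp add: smooth_cycles_iff)
  show ?thesis
  proof (rule subgroup.intro)
    show "carrier (period_forms \<Lambda> N n) \<subseteq> carrier (form_group N n)" by (auto simp: period_forms_iff)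
    show "\<one>\<^bsub>form_group N n\<^esub> \<in> carrier (period_forms \<Lambda> N n)"
      using L(1) by (simp add: period_forms_iff form_group_one zero_form_carrier[OF N])
    show "\<omega> \<otimes>\<^bsub>form_group N n\<^esub> \<eta> \<in> carrier (period_forms \<Lambda> N n)"
      if "\<omega> \<in> carrier (period_forms \<Lambda> N n)" "\<eta> \<in> carrier (period_forms \<Lambda> N n)" for \<omega> \<eta>
      using that L(3) chain_integral_mult_form[OF N _ _ cyc] by (simp add: period_forms_iff)
    show "inv\<^bsub>form_group N n\<^esub> \<omega> \<in> carrier (period_forms \<Lambda> N n)" if "\<omega> \<in> carrier (period_forms \<Lambda> N n)" for \<omega>
      using that L(4) chain_integral_inv_form[OF N _ cyc] by (simp add: period_forms_iff)
  qed
qed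

lemma period_forms_comm_group:
  assumes N: "smooth_manifold N" shows "comm_group (period_forms \<Lambda> N n)"
proof -
  have "period_forms \<Lambda> N n = (form_group N n)\<lparr>carrier := carrier (period_forms \<Lambda> N n)\<rparr>"
    by (simp add: period_forms_def)
  then show ?thesis
    by (rule ssubst) (rule comm_group_restrict[OF form_group_comm_group[OF N] period_forms_subgroup[OF N]])
qed

lemma zero_form_period: "smooth_manifold N \<Longrightarrow> zero_form \<in> carrier (period_forms \<Lambda> N n)"
  by (simp add: period_forms_iff zero_form_carrier real_subring(1)[OF \<Lambda>(1)])

lemma hs_group_eq:
  "hs_group \<Lambda> N n = hom_group (smooth_chains N n) (coeff_group \<Lambda>) \<times>\<times>
     (hom_group (smooth_chains N (n - 1)) real_add \<times>\<times> period_forms \<Lambda> N n)"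
  by (simp only: hs_group_def real_add_def)

lemma hs_group_iff:
  "(c, h, \<omega>) \<in> carrier (hs_group \<Lambda> N n) \<longleftrightarrow>
    c \<in> carrier (hom_group (smooth_chains N n) (coeff_group \<Lambda>)) \<and>
    h \<in> carrier (hom_group (smooth_chains N (n - 1)) real_add) \<and> \<omega> \<in> carrier (period_forms \<Lambda> N n)"
  by (simp add: hs_group_eq)

lemma hs_group_mult:
  "(c, h, \<omega>) \<otimes>\<^bsub>hs_group \<Lambda> N n\<^esub> (c', h', \<omega>') =
    (\<lambda>z\<in>carrier (smooth_chains N n). c z + c' z, \<lambda>z\<in>carrier (smooth_chains N (n - 1)). h z + h' z,
     \<omega> \<otimes>\<^bsub>form_group N n\<^esub> \<omega>')"
  by (simp add: hs_group_eq hom_group_simps period_forms_simps)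

lemma hs_group_one:
  "\<one>\<^bsub>hs_group \<Lambda> N n\<^esub> =
    (\<lambda>z\<in>carrier (smooth_chains N n). 0, \<lambda>z\<in>carrier (smooth_chains N (n - 1)). 0, zero_form)"
  by (simp add: hs_group_eq hom_group_simps period_forms_simps)

lemma hs_group_comm_group:
  assumes N: "smooth_manifold N" shows "comm_group (hs_group \<Lambda> N n)"
  unfolding hs_group_eq
  by (intro comm_group_DirProd hom_group_comm_group coeff_group_comm_group[OF \<Lambda>(1)] real_add_comm_group
      period_forms_comm_group[OF N] comm_group.axioms(2)[OF smooth_chains_comm_group])

lemma hs_group_inv:
  assumes N: "smooth_manifold N" and x: "(c, h, zero_form) \<in> carrier (hs_group \<Lambda> N n)"
  shows "inv\<^bsub>hs_group \<Lambda> N n\<^esub> (c, h, zero_form) =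
    (\<lambda>z\<in>carrier (smooth_chains N n). - c z, \<lambda>z\<in>carrier (smooth_chains N (n - 1)). - h z, zero_form)"
proof -
  interpret H: comm_group "hs_group \<Lambda> N n" by (rule hs_group_comm_group[OF N])
  show ?thesis
  proof (rule H.inv_equality[OF _ x])
    have c: "c \<in> carrier (hom_group (smooth_chains N n) (coeff_group \<Lambda>))"
      and h: "h \<in> carrier (hom_group (smooth_chains N (n - 1)) real_add)"
      using x by (simp_all add: hs_group_iff)
    show "(\<lambda>z\<in>carrier (smooth_chains N n). - c z, \<lambda>z\<in>carrier (smooth_chains N (n - 1)). - h z, zero_form)
      \<in> carrier (hs_group \<Lambda> N n)"
      using c h real_subring(4)[OF \<Lambda>(1)] zero_form_period[OF N]
      by (simp add: hs_group_iff hom_real_iff hom_coeff_iff smooth_chains_add)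
    show "(\<lambda>z\<in>carrier (smooth_chains N n). - c z, \<lambda>z\<in>carrier (smooth_chains N (n - 1)). - h z, zero_form)
      \<otimes>\<^bsub>hs_group \<Lambda> N n\<^esub> (c, h, zero_form) = \<one>\<^bsub>hs_group \<Lambda> N n\<^esub>"
      by (simp add: hs_group_mult hs_group_one cong: restrict_cong)
  qed
qed

lemma hs_diff_closed:
  assumes N: "smooth_manifold N" and x: "(c, h, \<omega>) \<in> carrier (hs_group \<Lambda> N n)"
  shows "hs_diff N n (c, h, \<omega>) \<in> carrier (hs_group \<Lambda> N (n + 1))"
proof -
  have c: "c \<in> carrier (hom_group (smooth_chains N n) (coeff_group \<Lambda>))"
    and h: "h \<in> carrier (hom_group (smooth_chains N (n - 1)) real_add)"
    using x by (simp_all add: hs_group_iff)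
  have b: "chain_boundary (nat (n + 1)) z \<in> carrier (smooth_chains N n)" if "z \<in> carrier (smooth_chains N (n + 1))" for z
    using smooth_chains_boundary[OF that] by simp
  note b' = smooth_chains_boundary[of _ N n]
  show ?thesis
    using c hom_chains_add[OF disjI1[OF h]] hom_chains_add[OF disjI2[OF c]] b b' zero_form_period[OF N]
    by (simp add: hs_diff_def hs_group_iff hom_real_iff hom_coeff_iff smooth_chains_add chain_boundary_add
        chain_integral_add)
qed

lemma rel_hs_group_iff:
  "(S, T) \<in> carrier (rel_hs_group \<Lambda> A M n) \<longleftrightarrow> S \<in> carrier (hs_group \<Lambda> M n) \<and> T \<in> carrier (hs_group \<Lambda> A (n - 1))"
  by (simp add: rel_hs_group_def)

lemma rel_hs_group_comm_group:
  assumes "smooth_manifold A" "smooth_manifold M" shows "comm_group (rel_hs_group \<Lambda> A M n)"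
  unfolding rel_hs_group_def by (intro comm_group_DirProd hs_group_comm_group assms)

context
  fixes A :: "'a mfd" and M :: "'m mfd" and \<rho> :: "'a \<Rightarrow> 'm"
  assumes A: "smooth_manifold A" and M: "smooth_manifold M" and \<rho>: "smooth_map A M \<rho>"
begin

lemma pull_form_period:
  assumes "\<omega> \<in> carrier (period_forms \<Lambda> M n)" shows "pull_form A M \<rho> \<omega> \<in> carrier (period_forms \<Lambda> A n)"
  unfolding period_forms_iff
proof (intro conjI ballI)
  show "pull_form A M \<rho> \<omega> \<in> carrier (form_group A n)"
    using pull_form_carrier[OF A M \<rho>] assms by (simp add: period_forms_iff)
  fix z assume z: "z \<in> smooth_cycles A n"
  then have zc: "z \<in> carrier (smooth_chains A n)" by (simp add: smooth_cycles_iff)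
  have "chain_map (nat n) \<rho> z \<in> smooth_cycles M n"
    using z smooth_chains_chain_map[OF A M \<rho> zc] smooth_chain_boundary_chain_map[OF zc, of \<rho>]
    by (simp add: smooth_cycles_iff)
  then show "chain_integral A n z (pull_form A M \<rho> \<omega>) \<in> \<Lambda>"
    using assms chain_integral_pull_form[OF A M \<rho> zc] by (simp add: period_forms_iff)
qed

text \<open>The abstract inverse in the definition becomes pointwise negation. Inverses are known
  only for elements of the group, whence the assumption on the component over A.\<close>

lemma rel_hs_diff_eq:
  assumes T: "(b, e, \<theta>) \<in> carrier (hs_group \<Lambda> A (n - 1))"
  shows "rel_hs_diff \<Lambda> A M \<rho> n ((c, h, \<omega>), (b, e, \<theta>)) =
    ((\<lambda>z\<in>carrier (smooth_chains M (n + 1)). c (chain_boundary (nat (n + 1)) z),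
      \<lambda>z\<in>carrier (smooth_chains M n). chain_integral M n z \<omega> - c z - h (chain_boundary (nat n) z), zero_form),
     (\<lambda>z\<in>carrier (smooth_chains A n). c (chain_map (nat n) \<rho> z) - b (chain_boundary (nat n) z),
      \<lambda>z\<in>carrier (smooth_chains A (n - 1)). h (chain_map (nat (n - 1)) \<rho> z) -
        (chain_integral A (n - 1) z \<theta> - b z - e (chain_boundary (nat (n - 1)) z)), pull_form A M \<rho> \<omega>))"
proof -
  have d: "hs_diff A (n - 1) (b, e, \<theta>) =
    (\<lambda>z\<in>carrier (smooth_chains A n). b (chain_boundary (nat n) z),
     \<lambda>z\<in>carrier (smooth_chains A (n - 1)). chain_integral A (n - 1) z \<theta> - b z - e (chain_boundary (nat (n - 1)) z), zero_form)"
    by (simp add: hs_diff_def)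
  have "hs_diff A (n - 1) (b, e, \<theta>) \<in> carrier (hs_group \<Lambda> A n)"
    using hs_diff_closed[OF A T] by simp
  note inv = hs_group_inv[OF A this[unfolded d]]
  show ?thesis
    unfolding rel_hs_diff_def prod.case d inv
    by (simp add: hs_diff_def hs_pull_def hs_group_mult algebra_simps cong: restrict_cong)
qed

lemma rel_hs_diff_hom: "rel_hs_diff \<Lambda> A M \<rho> n \<in> hom (rel_hs_group \<Lambda> A M n) (rel_hs_group \<Lambda> A M (n + 1))"
proof (rule homI)
  note add = smooth_chains_add
  have bM1: "chain_boundary (nat (n + 1)) z \<in> carrier (smooth_chains M n)" if "z \<in> carrier (smooth_chains M (n + 1))" for z
    using smooth_chains_boundary[OF that] by simp
  note bM = smooth_chains_boundary[of _ M n] and bA = smooth_chains_boundary[of _ A n]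
    and bA1 = smooth_chains_boundary[of _ A "n - 1"]
    and pA = smooth_chains_chain_map[OF A M \<rho>, of _ n] and pA1 = smooth_chains_chain_map[OF A M \<rho>, of _ "n - 1"]
  fix x assume x: "x \<in> carrier (rel_hs_group \<Lambda> A M n)"
  obtain c h \<omega> b e \<theta> where xe: "x = ((c, h, \<omega>), (b, e, \<theta>))" by (metis prod.exhaust)
  have S: "(c, h, \<omega>) \<in> carrier (hs_group \<Lambda> M n)" and T: "(b, e, \<theta>) \<in> carrier (hs_group \<Lambda> A (n - 1))"
    using x by (simp_all add: xe rel_hs_group_iff)
  have c: "c \<in> carrier (hom_group (smooth_chains M n) (coeff_group \<Lambda>))"
    and h: "h \<in> carrier (hom_group (smooth_chains M (n - 1)) real_add)"
    and w: "\<omega> \<in> carrier (period_forms \<Lambda> M n)"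
    using S by (simp_all add: hs_group_iff)
  have b: "b \<in> carrier (hom_group (smooth_chains A (n - 1)) (coeff_group \<Lambda>))"
    and e: "e \<in> carrier (hom_group (smooth_chains A (n - 1 - 1)) real_add)"
    and th: "\<theta> \<in> carrier (period_forms \<Lambda> A (n - 1))"
    using T unfolding hs_group_iff by simp_all
  note ca = hom_chains_add[OF disjI2[OF c]] and ha = hom_chains_add[OF disjI1[OF h]]
    and ba = hom_chains_add[OF disjI2[OF b]] and ea = hom_chains_add[OF disjI1[OF e]]
  show "rel_hs_diff \<Lambda> A M \<rho> n x \<in> carrier (rel_hs_group \<Lambda> A M (n + 1))"
    unfolding xe rel_hs_diff_eq[OF T] rel_hs_group_iff
  proof (intro conjI)
    show "(\<lambda>z\<in>carrier (smooth_chains M (n + 1)). c (chain_boundary (nat (n + 1)) z),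
      \<lambda>z\<in>carrier (smooth_chains M n). chain_integral M n z \<omega> - c z - h (chain_boundary (nat n) z), zero_form)
      \<in> carrier (hs_group \<Lambda> M (n + 1))"
      using hs_diff_closed[OF M S] by (simp add: hs_diff_def)
    have cL: "c z \<in> \<Lambda>" if "z \<in> carrier (smooth_chains M n)" for z using c that by (simp add: hom_coeff_iff)
    have bL: "b z \<in> \<Lambda>" if "z \<in> carrier (smooth_chains A (n - 1))" for z using b that by (simp add: hom_coeff_iff)
    show "(\<lambda>z\<in>carrier (smooth_chains A n). c (chain_map (nat n) \<rho> z) - b (chain_boundary (nat n) z),
      \<lambda>z\<in>carrier (smooth_chains A (n - 1)). h (chain_map (nat (n - 1)) \<rho> z) -
        (chain_integral A (n - 1) z \<theta> - b z - e (chain_boundary (nat (n - 1)) z)), pull_form A M \<rho> \<omega>)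
      \<in> carrier (hs_group \<Lambda> A (n + 1 - 1))"
      unfolding add_diff_cancel_right' hs_group_iff
    proof (intro conjI pull_form_period w)
      show "(\<lambda>z\<in>carrier (smooth_chains A n). c (chain_map (nat n) \<rho> z) - b (chain_boundary (nat n) z))
        \<in> carrier (hom_group (smooth_chains A n) (coeff_group \<Lambda>))"
        unfolding hom_coeff_iff
        using cL bL real_subring(5)[OF \<Lambda>(1)]
        by (simp add: add pA bA ca ba chain_boundary_add chain_map_add)
      show "(\<lambda>z\<in>carrier (smooth_chains A (n - 1)). h (chain_map (nat (n - 1)) \<rho> z) -
        (chain_integral A (n - 1) z \<theta> - b z - e (chain_boundary (nat (n - 1)) z)))
        \<in> carrier (hom_group (smooth_chains A (n - 1)) real_add)"
        unfolding hom_real_iff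
        using bA1 by (simp add: add pA1 ha ba ea chain_boundary_add chain_map_add chain_integral_add)
    qed
  qed
  fix y assume y: "y \<in> carrier (rel_hs_group \<Lambda> A M n)"
  obtain c' h' \<omega>' b' e' \<theta>' where ye: "y = ((c', h', \<omega>'), (b', e', \<theta>'))" by (metis prod.exhaust)
  have S': "(c', h', \<omega>') \<in> carrier (hs_group \<Lambda> M n)" and T': "(b', e', \<theta>') \<in> carrier (hs_group \<Lambda> A (n - 1))"
    using y by (simp_all add: ye rel_hs_group_iff)
  have w': "\<omega>' \<in> carrier (period_forms \<Lambda> M n)" and th': "\<theta>' \<in> carrier (period_forms \<Lambda> A (n - 1))"
    using S' T' unfolding hs_group_iff by simp_all
  have iM: "chain_integral M n z (\<omega> \<otimes>\<^bsub>form_group M n\<^esub> \<omega>') = chain_integral M n z \<omega> + chain_integral M n z \<omega>'"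
    if "z \<in> carrier (smooth_chains M n)" for z
    using chain_integral_mult_form[OF M _ _ that] w w' by (simp add: period_forms_iff)
  have iA: "chain_integral A (n - 1) z (\<theta> \<otimes>\<^bsub>form_group A (n - 1)\<^esub> \<theta>') = chain_integral A (n - 1) z \<theta> + chain_integral A (n - 1) z \<theta>'"
    if "z \<in> carrier (smooth_chains A (n - 1))" for z
    using chain_integral_mult_form[OF A _ _ that] th th' by (simp add: period_forms_iff)
  interpret HA: comm_group "hs_group \<Lambda> A (n - 1)" by (rule hs_group_comm_group[OF A])
  have TT: "(b, e, \<theta>) \<otimes>\<^bsub>hs_group \<Lambda> A (n - 1)\<^esub> (b', e', \<theta>') \<in> carrier (hs_group \<Lambda> A (n - 1))"
    by (rule HA.m_closed[OF T T'])
  have xy: "x \<otimes>\<^bsub>rel_hs_group \<Lambda> A M n\<^esub> y =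
    ((c, h, \<omega>) \<otimes>\<^bsub>hs_group \<Lambda> M n\<^esub> (c', h', \<omega>'), (b, e, \<theta>) \<otimes>\<^bsub>hs_group \<Lambda> A (n - 1)\<^esub> (b', e', \<theta>'))"
    by (simp add: xe ye rel_hs_group_def)
  show "rel_hs_diff \<Lambda> A M \<rho> n (x \<otimes>\<^bsub>rel_hs_group \<Lambda> A M n\<^esub> y) =
    rel_hs_diff \<Lambda> A M \<rho> n x \<otimes>\<^bsub>rel_hs_group \<Lambda> A M (n + 1)\<^esub> rel_hs_diff \<Lambda> A M \<rho> n y"
    unfolding xy
    unfolding hs_group_mult rel_hs_diff_eq[OF TT[unfolded hs_group_mult]] xe ye rel_hs_diff_eq[OF T] rel_hs_diff_eq[OF T']
      rel_hs_group_def mult_DirProd add_diff_cancel_right' hs_group_mult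
    unfolding prod.inject
    by (intro conjI restrict_ext)
      (simp_all add: iM iA bM1 bM bA bA1[simplified] pA pA1 pull_form_mult[OF A M \<rho>])
qed

text \<open>Apart from the vanishing of the square of the boundary, two facts about forms enter:
  integrals of forms with \<open>\<Lambda>\<close>-periods over boundaries are 0, which plays the
  role of closedness, and the integral of a pull-back is the integral over the image chain.\<close>

lemma rel_hs_diff_diff:
  assumes x: "x \<in> carrier (rel_hs_group \<Lambda> A M n)"
  shows "rel_hs_diff \<Lambda> A M \<rho> (n + 1) (rel_hs_diff \<Lambda> A M \<rho> n x) = \<one>\<^bsub>rel_hs_group \<Lambda> A M (n + 1 + 1)\<^esub>"
proof -
  obtain c h \<omega> b e \<theta> where xe: "x = ((c, h, \<omega>), (b, e, \<theta>))" by (metis prod.exhaust)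
  have S: "(c, h, \<omega>) \<in> carrier (hs_group \<Lambda> M n)" and T: "(b, e, \<theta>) \<in> carrier (hs_group \<Lambda> A (n - 1))"
    using x by (simp_all add: xe rel_hs_group_iff)
  have c: "c \<in> carrier (hom_group (smooth_chains M n) (coeff_group \<Lambda>))"
    and h: "h \<in> carrier (hom_group (smooth_chains M (n - 1)) real_add)"
    and w: "\<omega> \<in> carrier (period_forms \<Lambda> M n)"
    using S by (simp_all add: hs_group_iff)
  have b: "b \<in> carrier (hom_group (smooth_chains A (n - 1)) (coeff_group \<Lambda>))"
    and e: "e \<in> carrier (hom_group (smooth_chains A (n - 1 - 1)) real_add)"
    and th: "\<theta> \<in> carrier (period_forms \<Lambda> A (n - 1))"
    using T unfolding hs_group_iff by simp_all
  note z0 = hom_chains_0[OF disjI2[OF c]] hom_chains_0[OF disjI1[OF h]]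
    hom_chains_0[OF disjI2[OF b]] hom_chains_0[OF disjI1[OF e]]
  have Dx: "rel_hs_diff \<Lambda> A M \<rho> n x \<in> carrier (rel_hs_group \<Lambda> A M (n + 1))"
    by (rule hom_in_carrier[OF rel_hs_diff_hom x])
  note Dx' = Dx[unfolded xe rel_hs_diff_eq[OF T] rel_hs_group_iff, THEN conjunct2]
  have bM2: "chain_boundary (nat (n + 1 + 1)) z \<in> carrier (smooth_chains M (n + 1))"
    "chain_boundary (nat (n + 1)) (chain_boundary (nat (n + 1 + 1)) z) = 0" if "z \<in> carrier (smooth_chains M (n + 1 + 1))" for z
    using smooth_chains_boundary[OF that] smooth_chain_boundary_boundary[OF that]
    by (simp_all only: add_diff_cancel_right')
  have bM1: "chain_boundary (nat (n + 1)) z \<in> carrier (smooth_chains M n)"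
    "chain_boundary (nat n) (chain_boundary (nat (n + 1)) z) = 0"
    "chain_integral M n (chain_boundary (nat (n + 1)) z) \<omega> = 0"
    if "z \<in> carrier (smooth_chains M (n + 1))" for z
    using smooth_chains_boundary[OF that] smooth_chain_boundary_boundary[OF that]
      chain_boundary_integral_zero[OF M \<Lambda> w that] by simp_all
  have bA1: "chain_boundary (nat (n + 1)) z \<in> carrier (smooth_chains A n)"
    "chain_boundary (nat n) (chain_boundary (nat (n + 1)) z) = 0"
    "chain_map (nat (n + 1)) \<rho> z \<in> carrier (smooth_chains M (n + 1))"
    "chain_boundary (nat (n + 1)) (chain_map (nat (n + 1)) \<rho> z) = chain_map (nat n) \<rho> (chain_boundary (nat (n + 1)) z)"
    if "z \<in> carrier (smooth_chains A (n + 1))" for z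
    using smooth_chains_boundary[OF that] smooth_chain_boundary_boundary[OF that]
      smooth_chains_chain_map[OF A M \<rho> that] smooth_chain_boundary_chain_map[OF that, of \<rho>] by simp_all
  have bA: "chain_boundary (nat n) z \<in> carrier (smooth_chains A (n - 1))"
    "chain_boundary (nat (n - 1)) (chain_boundary (nat n) z) = 0"
    "chain_map (nat n) \<rho> z \<in> carrier (smooth_chains M n)"
    "chain_boundary (nat n) (chain_map (nat n) \<rho> z) = chain_map (nat (n - 1)) \<rho> (chain_boundary (nat n) z)"
    "chain_integral A (n - 1) (chain_boundary (nat n) z) \<theta> = 0"
    "chain_integral A n z (pull_form A M \<rho> \<omega>) = chain_integral M n (chain_map (nat n) \<rho> z) \<omega>"
    if "z \<in> carrier (smooth_chains A n)" for z
    using smooth_chains_boundary[OF that] smooth_chain_boundary_boundary[OF that]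
      smooth_chains_chain_map[OF A M \<rho> that] smooth_chain_boundary_chain_map[OF that, of \<rho>]
      chain_boundary_integral_zero[OF A \<Lambda> th, of z] that chain_integral_pull_form[OF A M \<rho> that, of \<omega>] by simp_all
  show ?thesis
    unfolding xe rel_hs_diff_eq[OF T] rel_hs_diff_eq[OF Dx'] rel_hs_group_def one_DirProd hs_group_one
      add_diff_cancel_right' prod.inject
    by (intro conjI restrict_ext)
      (simp_all add: bM2[simplified] bM1 bA1 bA z0 pull_form_zero[OF A M \<rho>])
qed

end

end

section \<open>Characters and the maps of the sequence\<close>

lemma rel_forms_iff:
  "(\<omega>, \<theta>) \<in> carrier (rel_forms A M n) \<longleftrightarrow> \<omega> \<in> carrier (form_group M n) \<and> \<theta> \<in> carrier (form_group A (n - 1))"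
  by (simp add: rel_forms_def)

lemma rel_forms_mult:
  "(\<omega>, \<theta>) \<otimes>\<^bsub>rel_forms A M n\<^esub> (\<omega>', \<theta>') = (\<omega> \<otimes>\<^bsub>form_group M n\<^esub> \<omega>', \<theta> \<otimes>\<^bsub>form_group A (n - 1)\<^esub> \<theta>')"
  by (simp add: rel_forms_def)

lemma rel_forms_comm_group:
  "smooth_manifold A \<Longrightarrow> smooth_manifold M \<Longrightarrow> comm_group (rel_forms A M n)"
  unfolding rel_forms_def by (intro comm_group_DirProd form_group_comm_group)

lemma rel_integral_mult:
  assumes A: "smooth_manifold A" and M: "smooth_manifold M"
    and w: "w \<in> carrier (rel_forms A M n)" "w' \<in> carrier (rel_forms A M n)" and z: "z \<in> carrier (rel_chains A M n)"
  shows "rel_integral A M n (w \<otimes>\<^bsub>rel_forms A M n\<^esub> w') z = rel_integral A M n w z + rel_integral A M n w' z"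
proof -
  obtain \<omega> \<theta> \<omega>' \<theta>' \<sigma> \<tau> where e: "w = (\<omega>, \<theta>)" "w' = (\<omega>', \<theta>')" "z = (\<sigma>, \<tau>)" by (metis prod.exhaust)
  show ?thesis
    using w z chain_integral_mult_form[OF M] chain_integral_mult_form[OF A]
    by (simp add: e rel_forms_iff rel_forms_mult rel_integral_Pair rel_chains_carrier)
qed

lemma J_choice_iff:
  "J_choice \<Lambda> A M \<rho> k f u v w \<longleftrightarrow>
     v \<in> carrier (hom_group (rel_chains A M (k - 1)) real_add) \<and>
     (\<forall>z\<in>carrier (rel_cycles A M \<rho> (k - 1)). f z = reduce \<Lambda> (v z)) \<and>
     w \<in> rel_period_forms \<Lambda> A M \<rho> k \<and>
     u \<in> carrier (hom_group (rel_chains A M k) (coeff_group \<Lambda>)) \<and>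
     (\<forall>z\<in>carrier (rel_chains A M k). v (rel_boundary \<rho> k z) = rel_integral A M k w z - u z) \<and>
     (\<forall>z\<in>carrier (rel_chains A M (k + 1)). u (rel_boundary \<rho> (k + 1) z) = 0)"
  by (simp only: J_choice_def real_add_def)

lemma rel_chains_uminus: "- z \<in> carrier (rel_chains A M n) \<longleftrightarrow> z \<in> carrier (rel_chains A M n)"
  by (cases z) (simp add: rel_chains_carrier)

lemma rel_boundary_0 [simp]: "rel_boundary \<rho> n 0 = 0"
  using rel_boundary_add[of \<rho> n 0 0] by simp

lemma rel_boundary_uminus: "rel_boundary \<rho> n (- z) = - rel_boundary \<rho> n z"
  using rel_boundary_add[of \<rho> n z "- z"] by (simp add: eq_neg_iff_add_eq_0 add.commute)

lemma rel_chains_0 [simp]: "0 \<in> carrier (rel_chains A M n)"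
  by (simp add: rel_chains_carrier zero_prod_def)

lemma rel_chains_inv: "z \<in> carrier (rel_chains A M n) \<Longrightarrow> inv\<^bsub>rel_chains A M n\<^esub> z = - z"
proof -
  interpret comm_group "rel_chains A M n" by (rule rel_chains_comm_group)
  show "z \<in> carrier (rel_chains A M n) \<Longrightarrow> inv\<^bsub>rel_chains A M n\<^esub> z = - z"
    by (rule inv_equality) (simp_all add: rel_chains_uminus)
qed

lemma rel_cycles_subgroup: "subgroup (carrier (rel_cycles A M \<rho> n)) (rel_chains A M n)"
proof -
  interpret comm_group "rel_chains A M n" by (rule rel_chains_comm_group)
  show ?thesis
  proof (rule subgroup.intro)
    show "x \<otimes>\<^bsub>rel_chains A M n\<^esub> y \<in> carrier (rel_cycles A M \<rho> n)"
      if "x \<in> carrier (rel_cycles A M \<rho> n)" "y \<in> carrier (rel_cycles A M \<rho> n)" for x y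
      using that m_closed[of x y] by (simp add: rel_cycles_iff rel_boundary_add)
  qed (auto simp: rel_cycles_iff rel_chains_inv rel_chains_uminus rel_boundary_uminus)
qed

lemma rel_cycles_comm_group: "comm_group (rel_cycles A M \<rho> n)"
proof -
  have "rel_cycles A M \<rho> n = (rel_chains A M n)\<lparr>carrier := carrier (rel_cycles A M \<rho> n)\<rparr>"
    by (simp add: rel_cycles_def)
  then show ?thesis
    by (rule ssubst) (rule comm_group_restrict[OF rel_chains_comm_group rel_cycles_subgroup])
qed

text \<open>The coefficients of the boundary of a chain are integral functionals, finitely many of
  them nonzero on each chain, and their joint kernel is the group of relative cycles.\<close>

lemma rel_retraction:
  "\<exists>r. (\<forall>x\<in>carrier (rel_chains A M n). \<forall>y\<in>carrier (rel_chains A M n). r (x + y) = r x + r y) \<and>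
    (\<forall>x\<in>carrier (rel_chains A M n). r x \<in> carrier (rel_cycles A M \<rho> n)) \<and>
    (\<forall>x\<in>carrier (rel_cycles A M \<rho> n). r x = x)"
proof -
  interpret comm_group "rel_chains A M n" by (rule rel_chains_comm_group)
  define coord where "coord i z = (case i of Inl s \<Rightarrow> Poly_Mapping.lookup (fst (rel_boundary \<rho> n z)) s
    | Inr s \<Rightarrow> Poly_Mapping.lookup (snd (rel_boundary \<rho> n z)) s)" for i z
  have add: "coord i (x \<otimes>\<^bsub>rel_chains A M n\<^esub> y) = coord i x + coord i y" for i x y
    by (cases i) (simp_all add: coord_def rel_boundary_add lookup_add)
  have fin: "finite {i. coord i z \<noteq> 0}" for z
  proof (rule finite_subset)
    show "{i. coord i z \<noteq> 0} \<subseteq> Inl ` Poly_Mapping.keys (fst (rel_boundary \<rho> n z)) \<union>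
      Inr ` Poly_Mapping.keys (snd (rel_boundary \<rho> n z))"
    proof
      fix i assume "i \<in> {i. coord i z \<noteq> 0}"
      then show "i \<in> Inl ` Poly_Mapping.keys (fst (rel_boundary \<rho> n z)) \<union> Inr ` Poly_Mapping.keys (snd (rel_boundary \<rho> n z))"
        by (cases i) (auto simp: coord_def in_keys_iff)
    qed
  qed simp
  have Z: "{x \<in> carrier (rel_chains A M n). \<forall>i. coord i x = 0} = carrier (rel_cycles A M \<rho> n)"
  proof -
    have "(\<forall>i. coord i x = 0) \<longleftrightarrow> rel_boundary \<rho> n x = 0" for x
    proof
      assume *: "\<forall>i. coord i x = 0"
      have "Poly_Mapping.lookup (fst (rel_boundary \<rho> n x)) s = 0" for s using spec[OF *, of "Inl s"] by (simp add: coord_def)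
      moreover have "Poly_Mapping.lookup (snd (rel_boundary \<rho> n x)) s = 0" for s using spec[OF *, of "Inr s"] by (simp add: coord_def)
      ultimately show "rel_boundary \<rho> n x = 0"
        by (intro prod_eqI poly_mapping_eqI) simp_all
    qed (auto simp: coord_def split: sum.split)
    then show ?thesis by (auto simp: rel_cycles_iff)
  qed
  obtain r where r: "r \<in> hom (rel_chains A M n) (rel_chains A M n)"
    "r ` carrier (rel_chains A M n) \<subseteq> carrier (rel_cycles A M \<rho> n)" "\<forall>x\<in>carrier (rel_cycles A M \<rho> n). r x = x"
    using kernel_retraction[of coord, OF add fin, unfolded Z] by blast
  show ?thesis
  proof (intro exI[of _ r] conjI ballI)
    show "r (x + y) = r x + r y" if "x \<in> carrier (rel_chains A M n)" "y \<in> carrier (rel_chains A M n)" for x y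
      using hom_mult[OF r(1) that] by simp
  qed (use r in auto)
qed

text \<open>Translates between a cochain on relative chains and its restrictions to the two factors;
  the second formula matches the minus sign in \<open>rel_boundary\<close>.\<close>

lemma pair_additive_split:
  fixes f :: "'a::ab_group_add \<times> 'b::ab_group_add \<Rightarrow> real"
  assumes add: "\<And>x y. x \<in> P \<times> Q \<Longrightarrow> y \<in> P \<times> Q \<Longrightarrow> f (x + y) = f x + f y"
    and z: "0 \<in> P" "0 \<in> Q" and x: "a \<in> P" "b \<in> Q" "- b \<in> Q"
  shows "f (a, b) = f (a, 0) + f (0, b)" "f (a, - b) = f (a, 0) - f (0, b)"
proof -
  show *: "f (a, b) = f (a, 0) + f (0, b)" using add[of "(a, 0)" "(0, b)"] z x by simp
  have "f (0, 0) = 0" using add[of "(0, 0)" "(0, 0)"] z by simp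
  then have "f (0, - b) = - f (0, b)" using add[of "(0, b)" "(0, - b)"] z x by simp
  then show "f (a, - b) = f (a, 0) - f (0, b)" using add[of "(a, 0)" "(0, - b)"] z x by simp
qed

section \<open>The groups of characters, cocycles and coboundaries\<close>

context
  fixes \<Lambda> :: "real set" and A :: "'a mfd" and M :: "'m mfd" and \<rho> :: "'a \<Rightarrow> 'm" and k :: int
  assumes \<Lambda>: "subring \<Lambda> real_ring" "\<Lambda> \<noteq> UNIV"
    and A: "smooth_manifold A" and M: "smooth_manifold M" and \<rho>: "smooth_map A M \<rho>" and k: "1 \<le> k"
begin

lemma characters0_iff:
  "f \<in> carrier (rel_characters0 \<Lambda> A M \<rho> k) \<longleftrightarrow>
    f \<in> carrier (hom_group (rel_cycles A M \<rho> (k - 1)) (RmodL \<Lambda>)) \<and>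
    (\<exists>w\<in>carrier (rel_forms A M k). \<forall>z\<in>carrier (rel_chains A M k).
      f (rel_boundary \<rho> k z) = reduce \<Lambda> (rel_integral A M k w z)) \<and>
    (\<forall>\<tau>\<in>smooth_cycles A (k - 1). f (chain_map (nat (k - 1)) \<rho> \<tau>, 0) = \<one>\<^bsub>RmodL \<Lambda>\<^esub>)"
  by (simp add: rel_characters0_def rel_characters_def)

lemma boundary_cycle:
  assumes "z \<in> carrier (rel_chains A M k)"
  shows "rel_boundary \<rho> k z \<in> carrier (rel_cycles A M \<rho> (k - 1))"
  using rel_boundary_closed[OF A M \<rho> assms] rel_boundary_boundary[OF assms] by (simp add: rel_cycles_iff)

lemma image_cycle:
  assumes "\<tau> \<in> smooth_cycles A n"
  shows "(chain_map (nat n) \<rho> \<tau>, 0) \<in> carrier (rel_cycles A M \<rho> n)" "chain_map (nat n) \<rho> \<tau> \<in> smooth_cycles M n"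
proof -
  have \<tau>: "\<tau> \<in> carrier (smooth_chains A n)" "chain_boundary (nat n) \<tau> = 0"
    using assms by (simp_all add: smooth_cycles_iff)
  show "(chain_map (nat n) \<rho> \<tau>, 0) \<in> carrier (rel_cycles A M \<rho> n)" "chain_map (nat n) \<rho> \<tau> \<in> smooth_cycles M n"
    using smooth_chains_chain_map[OF A M \<rho> \<tau>(1)] smooth_chain_boundary_chain_map[OF \<tau>(1), of \<rho>] \<tau>(2)
    by (simp_all add: rel_cycles_iff rel_chains_carrier rel_boundary_Pair smooth_cycles_iff zero_prod_def)
qed

lemma characters_mult:
  assumes "f \<in> carrier (hom_group (rel_cycles A M \<rho> (k - 1)) (RmodL \<Lambda>))" "x \<in> carrier (rel_cycles A M \<rho> (k - 1))"
    "y \<in> carrier (rel_cycles A M \<rho> (k - 1))"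
  shows "f (x + y) = f x \<otimes>\<^bsub>RmodL \<Lambda>\<^esub> f y"
  using hom_mult[of f "rel_cycles A M \<rho> (k - 1)" "RmodL \<Lambda>" x y] assms by (simp add: hom_group_simps)

lemma characters_comm_group: "comm_group (hom_group (rel_cycles A M \<rho> (k - 1)) (RmodL \<Lambda>))"
  by (rule hom_group_comm_group[OF comm_group.axioms(2)[OF rel_cycles_comm_group] RmodL_comm_group[OF \<Lambda>(1)]])

lemma characters0_subgroup:
  "subgroup (carrier (rel_characters0 \<Lambda> A M \<rho> k)) (hom_group (rel_cycles A M \<rho> (k - 1)) (RmodL \<Lambda>))"
proof -
  let ?H = "hom_group (rel_cycles A M \<rho> (k - 1)) (RmodL \<Lambda>)"
  interpret H: comm_group ?H by (rule characters_comm_group)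
  interpret R: comm_group "RmodL \<Lambda>" by (rule RmodL_comm_group[OF \<Lambda>(1)])
  interpret W: comm_group "rel_forms A M k" by (rule rel_forms_comm_group[OF A M])
  note bc = boundary_cycle and ic = image_cycle(1)[of _ "k - 1"]
  have r0: "rel_integral A M k \<one>\<^bsub>rel_forms A M k\<^esub> z = 0" if "z \<in> carrier (rel_chains A M k)" for z
    using rel_integral_mult[OF A M W.one_closed W.one_closed that] by simp
  show ?thesis
  proof (rule subgroup.intro)
    show "carrier (rel_characters0 \<Lambda> A M \<rho> k) \<subseteq> carrier ?H" by (auto simp: characters0_iff)
    show "\<one>\<^bsub>?H\<^esub> \<in> carrier (rel_characters0 \<Lambda> A M \<rho> k)"
      unfolding characters0_iff
    proof (intro conjI bexI[of _ "\<one>\<^bsub>rel_forms A M k\<^esub>"] ballI)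
      show "\<one>\<^bsub>?H\<^esub> (rel_boundary \<rho> k z) = reduce \<Lambda> (rel_integral A M k \<one>\<^bsub>rel_forms A M k\<^esub> z)"
        if "z \<in> carrier (rel_chains A M k)" for z
        using bc[OF that] r0[OF that] by (simp add: hom_group_simps RmodL_one[OF \<Lambda>(1)])
      show "\<one>\<^bsub>?H\<^esub> (chain_map (nat (k - 1)) \<rho> \<tau>, 0) = \<one>\<^bsub>RmodL \<Lambda>\<^esub>" if "\<tau> \<in> smooth_cycles A (k - 1)" for \<tau>
        using ic[OF that] by (simp add: hom_group_simps)
    qed simp_all
    fix f assume f: "f \<in> carrier (rel_characters0 \<Lambda> A M \<rho> k)"
    then obtain w where w: "w \<in> carrier (rel_forms A M k)"
      "\<And>z. z \<in> carrier (rel_chains A M k) \<Longrightarrow> f (rel_boundary \<rho> k z) = reduce \<Lambda> (rel_integral A M k w z)"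
      by (auto simp: characters0_iff)
    have fH: "f \<in> carrier ?H" and f1: "\<And>\<tau>. \<tau> \<in> smooth_cycles A (k - 1) \<Longrightarrow> f (chain_map (nat (k - 1)) \<rho> \<tau>, 0) = \<one>\<^bsub>RmodL \<Lambda>\<^esub>"
      using f by (simp_all add: characters0_iff)
    note inv = hom_group_inv[OF comm_group.axioms(2)[OF rel_cycles_comm_group] RmodL_comm_group[OF \<Lambda>(1)] fH]
    have rinv: "rel_integral A M k (inv\<^bsub>rel_forms A M k\<^esub> w) z = - rel_integral A M k w z"
      if "z \<in> carrier (rel_chains A M k)" for z
      using rel_integral_mult[OF A M W.inv_closed[OF w(1)] w(1) that] r0[OF that] w(1) by simp
    show "inv\<^bsub>?H\<^esub> f \<in> carrier (rel_characters0 \<Lambda> A M \<rho> k)"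
      unfolding characters0_iff
    proof (intro conjI bexI[of _ "inv\<^bsub>rel_forms A M k\<^esub> w"] ballI)
      show "(inv\<^bsub>?H\<^esub> f) (rel_boundary \<rho> k z) = reduce \<Lambda> (rel_integral A M k (inv\<^bsub>rel_forms A M k\<^esub> w) z)"
        if z: "z \<in> carrier (rel_chains A M k)" for z
        using bc[OF z] w(2)[OF z] rinv[OF z] by (simp add: inv reduce_uminus[OF \<Lambda>(1)])
      show "(inv\<^bsub>?H\<^esub> f) (chain_map (nat (k - 1)) \<rho> \<tau>, 0) = \<one>\<^bsub>RmodL \<Lambda>\<^esub>" if "\<tau> \<in> smooth_cycles A (k - 1)" for \<tau>
        using ic[OF that] f1[OF that] by (simp add: inv)
    qed (use fH w in simp_all)
    fix g assume g: "g \<in> carrier (rel_characters0 \<Lambda> A M \<rho> k)"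
    then obtain w' where w': "w' \<in> carrier (rel_forms A M k)"
      "\<And>z. z \<in> carrier (rel_chains A M k) \<Longrightarrow> g (rel_boundary \<rho> k z) = reduce \<Lambda> (rel_integral A M k w' z)"
      by (auto simp: characters0_iff)
    have gH: "g \<in> carrier ?H" and g1: "\<And>\<tau>. \<tau> \<in> smooth_cycles A (k - 1) \<Longrightarrow> g (chain_map (nat (k - 1)) \<rho> \<tau>, 0) = \<one>\<^bsub>RmodL \<Lambda>\<^esub>"
      using g by (simp_all add: characters0_iff)
    show "f \<otimes>\<^bsub>?H\<^esub> g \<in> carrier (rel_characters0 \<Lambda> A M \<rho> k)"
      unfolding characters0_iff
    proof (intro conjI bexI[of _ "w \<otimes>\<^bsub>rel_forms A M k\<^esub> w'"] ballI)
      show "(f \<otimes>\<^bsub>?H\<^esub> g) (rel_boundary \<rho> k z) = reduce \<Lambda> (rel_integral A M k (w \<otimes>\<^bsub>rel_forms A M k\<^esub> w') z)"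
        if z: "z \<in> carrier (rel_chains A M k)" for z
        using bc[OF z] by (simp add: hom_group_simps w(2)[OF z] w'(2)[OF z]
            rel_integral_mult[OF A M w(1) w'(1) z] reduce_add[OF \<Lambda>(1)])
      show "(f \<otimes>\<^bsub>?H\<^esub> g) (chain_map (nat (k - 1)) \<rho> \<tau>, 0) = \<one>\<^bsub>RmodL \<Lambda>\<^esub>" if "\<tau> \<in> smooth_cycles A (k - 1)" for \<tau>
        using ic[OF that] by (simp add: hom_group_simps f1[OF that] g1[OF that])
    qed (use fH gH w w' in simp_all)
  qed
qed

lemma characters0_eq:
  "rel_characters0 \<Lambda> A M \<rho> k =
    (hom_group (rel_cycles A M \<rho> (k - 1)) (RmodL \<Lambda>))\<lparr>carrier := carrier (rel_characters0 \<Lambda> A M \<rho> k)\<rparr>"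
  by (simp add: rel_characters0_def rel_characters_def)

lemma characters0_simps:
  "f \<otimes>\<^bsub>rel_characters0 \<Lambda> A M \<rho> k\<^esub> g = (\<lambda>z\<in>carrier (rel_cycles A M \<rho> (k - 1)). f z \<otimes>\<^bsub>RmodL \<Lambda>\<^esub> g z)"
  "\<one>\<^bsub>rel_characters0 \<Lambda> A M \<rho> k\<^esub> = (\<lambda>z\<in>carrier (rel_cycles A M \<rho> (k - 1)). \<one>\<^bsub>RmodL \<Lambda>\<^esub>)"
  by (simp_all add: rel_characters0_def rel_characters_def hom_group_simps)

lemma characters0_comm_group: "comm_group (rel_characters0 \<Lambda> A M \<rho> k)"
  by (subst characters0_eq) (rule comm_group_restrict[OF characters_comm_group characters0_subgroup])

lemma rel_hs_group_hom: "group_hom (rel_hs_group \<Lambda> A M n) (rel_hs_group \<Lambda> A M (n + 1)) (rel_hs_diff \<Lambda> A M \<rho> n)"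
  using rel_hs_diff_hom[OF \<Lambda> A M \<rho>] comm_group.axioms(2)[OF rel_hs_group_comm_group[OF \<Lambda> A M]]
  by (simp add: group_hom_def group_hom_axioms_def)

lemma cocycles_iff:
  "z \<in> carrier (rel_hs_cocycles \<Lambda> A M \<rho> k) \<longleftrightarrow> z \<in> carrier (rel_hs_group \<Lambda> A M k) \<and>
    rel_hs_diff \<Lambda> A M \<rho> k z = \<one>\<^bsub>rel_hs_group \<Lambda> A M (k + 1)\<^esub>"
  by (simp add: rel_hs_cocycles_def kernel_def)

lemma cocycles_subgroup: "subgroup (carrier (rel_hs_cocycles \<Lambda> A M \<rho> k)) (rel_hs_group \<Lambda> A M k)"
  using group_hom.subgroup_kernel[OF rel_hs_group_hom[of k]] by (simp add: rel_hs_cocycles_def)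

lemma cocycles_eq:
  "rel_hs_cocycles \<Lambda> A M \<rho> k = (rel_hs_group \<Lambda> A M k)\<lparr>carrier := carrier (rel_hs_cocycles \<Lambda> A M \<rho> k)\<rparr>"
  by (simp add: rel_hs_cocycles_def)

lemma cocycles_comm_group: "comm_group (rel_hs_cocycles \<Lambda> A M \<rho> k)"
  by (subst cocycles_eq) (rule comm_group_restrict[OF rel_hs_group_comm_group[OF \<Lambda> A M] cocycles_subgroup])

lemma coboundaries_subgroup:
  "subgroup (rel_hs_coboundaries \<Lambda> A M \<rho> k) (rel_hs_cocycles \<Lambda> A M \<rho> k)"
proof -
  interpret G: comm_group "rel_hs_group \<Lambda> A M k" by (rule rel_hs_group_comm_group[OF \<Lambda> A M])
  have B: "subgroup (rel_hs_coboundaries \<Lambda> A M \<rho> k) (rel_hs_group \<Lambda> A M k)"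
    using group_hom.img_is_subgroup[OF rel_hs_group_hom[of "k - 1"]] by (simp add: rel_hs_coboundaries_def)
  have "rel_hs_coboundaries \<Lambda> A M \<rho> k \<subseteq> carrier (rel_hs_cocycles \<Lambda> A M \<rho> k)"
  proof
    fix z assume z: "z \<in> rel_hs_coboundaries \<Lambda> A M \<rho> k"
    then obtain x where x: "x \<in> carrier (rel_hs_group \<Lambda> A M (k - 1))" "z = rel_hs_diff \<Lambda> A M \<rho> (k - 1) x"
      by (auto simp: rel_hs_coboundaries_def)
    show "z \<in> carrier (rel_hs_cocycles \<Lambda> A M \<rho> k)"
      using subgroup.mem_carrier[OF B z] rel_hs_diff_diff[OF \<Lambda> A M \<rho> x(1)] x(2) by (simp add: cocycles_iff)
  qed
  then show ?thesis
    by (subst cocycles_eq) (rule G.subgroup_incl[OF B cocycles_subgroup])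
qed

lemma J_choiceD:
  assumes J: "J_choice \<Lambda> A M \<rho> k f u v (\<omega>, \<theta>)"
  shows "x \<in> carrier (rel_chains A M (k - 1)) \<Longrightarrow> y \<in> carrier (rel_chains A M (k - 1)) \<Longrightarrow> v (x + y) = v x + v y"
    and "x' \<in> carrier (rel_chains A M k) \<Longrightarrow> y' \<in> carrier (rel_chains A M k) \<Longrightarrow> u (x' + y') = u x' + u y'"
    and "x' \<in> carrier (rel_chains A M k) \<Longrightarrow> u x' \<in> \<Lambda>"
    and "z \<in> carrier (rel_cycles A M \<rho> (k - 1)) \<Longrightarrow> f z = reduce \<Lambda> (v z)"
    and "\<omega> \<in> carrier (form_group M k)" "\<theta> \<in> carrier (form_group A (k - 1))"
    and "x' \<in> carrier (rel_cycles A M \<rho> k) \<Longrightarrow> rel_integral A M k (\<omega>, \<theta>) x' \<in> \<Lambda>"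
    and "x' \<in> carrier (rel_chains A M k) \<Longrightarrow> v (rel_boundary \<rho> k x') = rel_integral A M k (\<omega>, \<theta>) x' - u x'"
    and "s \<in> carrier (rel_chains A M (k + 1)) \<Longrightarrow> u (rel_boundary \<rho> (k + 1) s) = 0"
  using J by (simp_all add: J_choice_iff hom_real_iff hom_coeff_iff rel_period_forms_def rel_forms_iff)

text \<open>Stated without u, so that it can already be used while u is being constructed. If
  \<open>\<tau>\<close> is a cycle, the boundary of (0, \<open>\<tau>\<close>) is
  (\<open>\<rho>\<close> applied to \<open>\<tau>\<close>, 0), where f is trivial; this gives the
  periods of \<open>\<theta>\<close>. If \<open>\<tau>\<close> is any k-chain of A, the period over
  the boundary of (0, \<open>\<tau>\<close>) shows that the integral of the pull-back of
  \<open>\<omega>\<close> over \<open>\<tau>\<close> lies in \<open>\<Lambda>\<close>, so the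
  pull-back vanishes.\<close>

lemma J_choice_periods:
  assumes f: "f \<in> carrier (rel_characters0 \<Lambda> A M \<rho> k)"
    and v: "\<And>z. z \<in> carrier (rel_cycles A M \<rho> (k - 1)) \<Longrightarrow> f z = reduce \<Lambda> (v z)"
    and w: "\<omega> \<in> carrier (form_group M k)" "\<theta> \<in> carrier (form_group A (k - 1))"
    and per: "\<And>z. z \<in> carrier (rel_cycles A M \<rho> k) \<Longrightarrow> rel_integral A M k (\<omega>, \<theta>) z \<in> \<Lambda>"
    and d: "\<And>z. z \<in> carrier (rel_chains A M k) \<Longrightarrow> rel_integral A M k (\<omega>, \<theta>) z - v (rel_boundary \<rho> k z) \<in> \<Lambda>"
  shows "\<omega> \<in> carrier (period_forms \<Lambda> M k)" "\<theta> \<in> carrier (period_forms \<Lambda> A (k - 1))"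
    "pull_form A M \<rho> \<omega> = zero_form"
proof -
  note L = real_subring[OF \<Lambda>(1)]
  show \<omega>: "\<omega> \<in> carrier (period_forms \<Lambda> M k)"
    unfolding period_forms_iff
  proof (intro conjI ballI w)
    fix \<sigma> assume "\<sigma> \<in> smooth_cycles M k"
    then have "(\<sigma>, 0) \<in> carrier (rel_cycles A M \<rho> k)"
      by (simp add: smooth_cycles_iff rel_cycles_iff rel_chains_carrier rel_boundary_Pair zero_prod_def)
    from per[OF this] show "chain_integral M k \<sigma> \<omega> \<in> \<Lambda>" by (simp add: rel_integral_Pair)
  qed
  show \<theta>: "\<theta> \<in> carrier (period_forms \<Lambda> A (k - 1))"
    unfolding period_forms_iff
  proof (intro conjI ballI w)
    fix \<tau> assume \<tau>: "\<tau> \<in> smooth_cycles A (k - 1)"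
    let ?p = "(chain_map (nat (k - 1)) \<rho> \<tau>, 0)"
    have "reduce \<Lambda> (v ?p) = \<one>\<^bsub>RmodL \<Lambda>\<^esub>"
      using f \<tau> v[OF image_cycle(1)[OF \<tau>]] by (simp add: characters0_iff)
    then have "v ?p \<in> \<Lambda>" using reduce_eq_one[OF \<Lambda>(1)] by blast
    moreover have "rel_boundary \<rho> k (0, \<tau>) = ?p" using \<tau> by (simp add: rel_boundary_Pair smooth_cycles_iff)
    moreover have "(0, \<tau>) \<in> carrier (rel_chains A M k)" using \<tau> by (simp add: smooth_cycles_iff rel_chains_carrier)
    ultimately have "rel_integral A M k (\<omega>, \<theta>) (0, \<tau>) - v ?p \<in> \<Lambda>" using d by metis
    from L(3)[OF this \<open>v ?p \<in> \<Lambda>\<close>] show "chain_integral A (k - 1) \<tau> \<theta> \<in> \<Lambda>" by (simp add: rel_integral_Pair)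
  qed
  show "pull_form A M \<rho> \<omega> = zero_form"
  proof (rule form_zero_if_integrals[OF A \<Lambda>])
    show "0 < k" using k by simp
    show "pull_form A M \<rho> \<omega> \<in> carrier (form_group A k)" by (rule pull_form_carrier[OF A M \<rho> w(1)])
    fix \<tau> assume \<tau>: "\<tau> \<in> carrier (smooth_chains A k)"
    have p: "(0, \<tau>) \<in> carrier (rel_chains A M (k + 1))" using \<tau> by (simp add: rel_chains_carrier)
    have "rel_boundary \<rho> (k + 1) (0, \<tau>) \<in> carrier (rel_cycles A M \<rho> k)"
      using rel_boundary_closed[OF A M \<rho> p] rel_boundary_boundary[OF p] by (simp add: rel_cycles_iff)
    from per[OF this] have "chain_integral M k (chain_map (nat k) \<rho> \<tau>) \<omega> - chain_integral A (k - 1) (chain_boundary (nat k) \<tau>) \<theta> \<in> \<Lambda>"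
      by (simp add: rel_boundary_Pair rel_integral_Pair chain_integral_uminus)
    moreover have "chain_boundary (nat k) \<tau> \<in> smooth_cycles A (k - 1)"
      using smooth_chains_boundary[OF \<tau>] smooth_chain_boundary_boundary[OF \<tau>] by (simp add: smooth_cycles_iff)
    then have "chain_integral A (k - 1) (chain_boundary (nat k) \<tau>) \<theta> \<in> \<Lambda>" using \<theta> by (simp add: period_forms_iff)
    ultimately have "chain_integral M k (chain_map (nat k) \<rho> \<tau>) \<omega> \<in> \<Lambda>" using L(3) by fastforce
    then show "chain_integral A k \<tau> (pull_form A M \<rho> \<omega>) \<in> \<Lambda>" using chain_integral_pull_form[OF A M \<rho> \<tau>] by simp
  qed
qed

end

section \<open>Existence and properties of the choices that define J\<close>

context
  fixes \<Lambda> :: "real set" and A :: "'a mfd" and M :: "'m mfd" and \<rho> :: "'a \<Rightarrow> 'm" and k :: int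
  assumes \<Lambda>: "subring \<Lambda> real_ring" "\<Lambda> \<noteq> UNIV"
    and A: "smooth_manifold A" and M: "smooth_manifold M" and \<rho>: "smooth_map A M \<rho>" and k: "1 \<le> k"
begin

lemma rel_chains_mem1:
  "(\<sigma>, \<tau>) \<in> carrier (rel_chains A M (k - 1)) \<longleftrightarrow> \<sigma> \<in> carrier (smooth_chains M (k - 1)) \<and> \<tau> \<in> carrier (smooth_chains A (k - 2))"
  by (simp add: rel_chains_carrier)

lemma J_choice_closed:
  assumes f: "f \<in> carrier (rel_characters0 \<Lambda> A M \<rho> k)" and J: "J_choice \<Lambda> A M \<rho> k f u v (\<omega>, \<theta>)"
  shows "\<omega> \<in> carrier (period_forms \<Lambda> M k)" "\<theta> \<in> carrier (period_forms \<Lambda> A (k - 1))"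
    "pull_form A M \<rho> \<omega> = zero_form"
proof -
  note D = J_choiceD[OF \<Lambda> A M \<rho> k J]
  have d: "rel_integral A M k (\<omega>, \<theta>) z - v (rel_boundary \<rho> k z) \<in> \<Lambda>" if "z \<in> carrier (rel_chains A M k)" for z
    using D(3)[OF that] D(8)[OF that] by simp
  show "\<omega> \<in> carrier (period_forms \<Lambda> M k)" "\<theta> \<in> carrier (period_forms \<Lambda> A (k - 1))"
    "pull_form A M \<rho> \<omega> = zero_form"
    using J_choice_periods[OF \<Lambda> A M \<rho> k f D(4) D(5,6) D(7) d] by blast+
qed

text \<open>Evaluating the conditions of \<open>J_choice\<close> on (\<open>\<sigma>\<close>, 0) and
  (0, \<open>\<tau>\<close>) yields the four cochain equations, where the sign of e in
  \<open>hs_element\<close> absorbs the sign in \<open>rel_boundary\<close>. The remaining form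
  equation is the vanishing of the pull-back of \<open>\<omega>\<close>.\<close>

lemma J_choice_cocycle:
  assumes f: "f \<in> carrier (rel_characters0 \<Lambda> A M \<rho> k)" and J: "J_choice \<Lambda> A M \<rho> k f u v (\<omega>, \<theta>)"
  shows "hs_element A M k u v (\<omega>, \<theta>) \<in> carrier (rel_hs_cocycles \<Lambda> A M \<rho> k)"
proof -
  note D = J_choiceD[OF \<Lambda> A M \<rho> k J]
  note w = J_choice_closed[OF f J]
  have uM: "u (x + y, 0) = u (x, 0) + u (y, 0)" "u (x, 0) \<in> \<Lambda>"
    if "x \<in> carrier (smooth_chains M k)" "y \<in> carrier (smooth_chains M k)" for x y
    using D(2)[of "(x, 0)" "(y, 0)"] D(3)[of "(x, 0)"] that by (simp_all add: rel_chains_carrier)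
  have uA: "u (0, x + y) = u (0, x) + u (0, y)" "u (0, x) \<in> \<Lambda>"
    if "x \<in> carrier (smooth_chains A (k - 1))" "y \<in> carrier (smooth_chains A (k - 1))" for x y
    using D(2)[of "(0, x)" "(0, y)"] D(3)[of "(0, x)"] that by (simp_all add: rel_chains_carrier)
  have vM: "v (x + y, 0) = v (x, 0) + v (y, 0)"
    if "x \<in> carrier (smooth_chains M (k - 1))" "y \<in> carrier (smooth_chains M (k - 1))" for x y
    using D(1)[of "(x, 0)" "(y, 0)"] that by (simp add: rel_chains_mem1)
  have vA: "v (0, x + y) = v (0, x) + v (0, y)"
    if "x \<in> carrier (smooth_chains A (k - 2))" "y \<in> carrier (smooth_chains A (k - 2))" for x y
    using D(1)[of "(0, x)" "(0, y)"] that by (simp add: rel_chains_mem1)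
  have us: "u (a, - b) = u (a, 0) - u (0, b)"
    if "a \<in> carrier (smooth_chains M k)" "b \<in> carrier (smooth_chains A (k - 1))" for a b
    using pair_additive_split(2)[of "carrier (smooth_chains M k)" "carrier (smooth_chains A (k - 1))" u a b]
      D(2) that by (simp add: rel_chains_carrier)
  have vs: "v (a, - b) = v (a, 0) - v (0, b)"
    if "a \<in> carrier (smooth_chains M (k - 1))" "b \<in> carrier (smooth_chains A (k - 2))" for a b
    using pair_additive_split(2)[of "carrier (smooth_chains M (k - 1))" "carrier (smooth_chains A (k - 2))" v a b]
      D(1) that by (simp add: rel_chains_carrier)
  define c where "c = (\<lambda>\<sigma>\<in>carrier (smooth_chains M k). u (\<sigma>, 0))"
  define h where "h = (\<lambda>\<sigma>\<in>carrier (smooth_chains M (k - 1)). v (\<sigma>, 0))"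
  define b where "b = (\<lambda>\<tau>\<in>carrier (smooth_chains A (k - 1)). u (0, \<tau>))"
  define e where "e = (\<lambda>\<tau>\<in>carrier (smooth_chains A (k - 2)). - v (0, \<tau>))"
  have E: "hs_element A M k u v (\<omega>, \<theta>) = ((c, h, \<omega>), (b, e, \<theta>))"
    by (simp add: hs_element_def c_def h_def b_def e_def)
  have S: "(c, h, \<omega>) \<in> carrier (hs_group \<Lambda> M k)"
    unfolding hs_group_iff[OF \<Lambda>] hom_coeff_iff hom_real_iff c_def h_def
    using w(1) uM vM by (simp add: smooth_chains_add)
  have T: "(b, e, \<theta>) \<in> carrier (hs_group \<Lambda> A (k - 1))"
    unfolding hs_group_iff[OF \<Lambda>] hom_coeff_iff hom_real_iff b_def e_def
    using w(2) uA vA by (simp add: smooth_chains_add)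
  have M1: "c (chain_boundary (nat (k + 1)) z) = 0" if z: "z \<in> carrier (smooth_chains M (k + 1))" for z
    using D(9)[of "(z, 0)"] z smooth_chains_boundary[OF z] by (simp add: c_def rel_chains_carrier rel_boundary_Pair)
  have M2: "chain_integral M k z \<omega> - c z - h (chain_boundary (nat k) z) = 0" if z: "z \<in> carrier (smooth_chains M k)" for z
    using D(8)[of "(z, 0)"] z smooth_chains_boundary[OF z]
    by (simp add: c_def h_def rel_chains_carrier rel_boundary_Pair rel_integral_Pair)
  have A1: "c (chain_map (nat k) \<rho> z) - b (chain_boundary (nat k) z) = 0" if z: "z \<in> carrier (smooth_chains A k)" for z
    using D(9)[of "(0, z)"] z smooth_chains_boundary[OF z] smooth_chains_chain_map[OF A M \<rho> z]
    by (simp add: c_def b_def rel_chains_carrier rel_boundary_Pair us)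
  have A2: "h (chain_map (nat (k - 1)) \<rho> z) - (chain_integral A (k - 1) z \<theta> - b z - e (chain_boundary (nat (k - 1)) z)) = 0"
    if z: "z \<in> carrier (smooth_chains A (k - 1))" for z
    using D(8)[of "(0, z)"] z smooth_chains_boundary[OF z] smooth_chains_chain_map[OF A M \<rho> z]
    by (simp add: h_def b_def e_def rel_chains_carrier rel_boundary_Pair rel_integral_Pair vs)
  show ?thesis
    unfolding cocycles_iff[OF \<Lambda> A M \<rho> k] E
  proof (intro conjI)
    show "((c, h, \<omega>), (b, e, \<theta>)) \<in> carrier (rel_hs_group \<Lambda> A M k)"
      using S T by (simp add: rel_hs_group_iff[OF \<Lambda>])
    show "rel_hs_diff \<Lambda> A M \<rho> k ((c, h, \<omega>), (b, e, \<theta>)) = \<one>\<^bsub>rel_hs_group \<Lambda> A M (k + 1)\<^esub>"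
      unfolding rel_hs_diff_eq[OF \<Lambda> A M \<rho> T] rel_hs_group_def one_DirProd hs_group_one[OF \<Lambda>]
        add_diff_cancel_right' prod.inject
      by (intro conjI restrict_ext) (simp_all only: M1 M2 A1 A2 w(3))
  qed
qed

text \<open>The lift v is assembled from separate lifts of \<open>f \<circ> r\<close> on the two
  free factors. On cycles r is the identity, so v lifts f there, in particular on
  boundaries.\<close>

lemma J_choice_exists:
  assumes f: "f \<in> carrier (rel_characters0 \<Lambda> A M \<rho> k)"
  shows "\<exists>u v \<omega> \<theta>. J_choice \<Lambda> A M \<rho> k f u v (\<omega>, \<theta>)"
proof -
  let ?C = "carrier (rel_chains A M (k - 1))" and ?Z = "carrier (rel_cycles A M \<rho> (k - 1))"
  have fH: "f \<in> carrier (hom_group (rel_cycles A M \<rho> (k - 1)) (RmodL \<Lambda>))"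
    using f by (simp add: characters0_iff[OF \<Lambda> A M \<rho> k])
  note fm = characters_mult[OF \<Lambda> A M \<rho> k fH]
  have fc: "f x \<in> carrier (RmodL \<Lambda>)" if "x \<in> ?Z" for x
    using fH that by (auto simp: hom_group_simps hom_def)
  obtain w where w: "w \<in> carrier (rel_forms A M k)"
    "\<And>z. z \<in> carrier (rel_chains A M k) \<Longrightarrow> f (rel_boundary \<rho> k z) = reduce \<Lambda> (rel_integral A M k w z)"
    using f by (auto simp: characters0_iff[OF \<Lambda> A M \<rho> k])
  obtain \<omega> \<theta> where we: "w = (\<omega>, \<theta>)" by (metis prod.exhaust)
  obtain r where r: "\<And>x y. x \<in> ?C \<Longrightarrow> y \<in> ?C \<Longrightarrow> r (x + y) = r x + r y" "\<And>x. x \<in> ?C \<Longrightarrow> r x \<in> ?Z"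
    "\<And>x. x \<in> ?Z \<Longrightarrow> r x = x"
    using rel_retraction[of A M "k - 1" \<rho>] by blast
  have memM: "(\<sigma>, 0) \<in> ?C" if "\<sigma> \<in> carrier (smooth_chains M (k - 1))" for \<sigma>
    using that by (simp add: rel_chains_mem1)
  have memA: "(0, \<tau>) \<in> ?C" if "\<tau> \<in> carrier (smooth_chains A (k - 2))" for \<tau>
    using that by (simp add: rel_chains_mem1)
  have frm: "f (r (x + y)) = f (r x) \<otimes>\<^bsub>RmodL \<Lambda>\<^esub> f (r y)" if "x \<in> ?C" "y \<in> ?C" for x y
    using fm[OF r(2) r(2)] r(1) that by simp
  have "(\<lambda>\<sigma>. f (r (\<sigma>, 0))) \<in> hom (smooth_chains M (k - 1)) (RmodL \<Lambda>)"
  proof (rule homI)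
    fix x y assume x: "x \<in> carrier (smooth_chains M (k - 1))" and y: "y \<in> carrier (smooth_chains M (k - 1))"
    show "f (r (x, 0)) \<in> carrier (RmodL \<Lambda>)" by (rule fc[OF r(2)[OF memM[OF x]]])
    show "f (r (x \<otimes>\<^bsub>smooth_chains M (k - 1)\<^esub> y, 0)) = f (r (x, 0)) \<otimes>\<^bsub>RmodL \<Lambda>\<^esub> f (r (y, 0))"
      using frm[OF memM[OF x] memM[OF y]] by simp
  qed
  then obtain h where h: "\<And>x y. h (x + y) = h x + h y"
    "\<And>x. x \<in> carrier (smooth_chains M (k - 1)) \<Longrightarrow> f (r (x, 0)) = reduce \<Lambda> (h x)"
    using free_lift[OF \<Lambda>(1), of "\<lambda>\<sigma>. f (r (\<sigma>, 0))"] unfolding smooth_chains_def by blast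
  have "(\<lambda>\<tau>. f (r (0, \<tau>))) \<in> hom (smooth_chains A (k - 2)) (RmodL \<Lambda>)"
  proof (rule homI)
    fix x y assume x: "x \<in> carrier (smooth_chains A (k - 2))" and y: "y \<in> carrier (smooth_chains A (k - 2))"
    show "f (r (0, x)) \<in> carrier (RmodL \<Lambda>)" by (rule fc[OF r(2)[OF memA[OF x]]])
    show "f (r (0, x \<otimes>\<^bsub>smooth_chains A (k - 2)\<^esub> y)) = f (r (0, x)) \<otimes>\<^bsub>RmodL \<Lambda>\<^esub> f (r (0, y))"
      using frm[OF memA[OF x] memA[OF y]] by simp
  qed
  then obtain e where e: "\<And>x y. e (x + y) = e x + e y"
    "\<And>x. x \<in> carrier (smooth_chains A (k - 2)) \<Longrightarrow> f (r (0, x)) = reduce \<Lambda> (e x)"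
    using free_lift[OF \<Lambda>(1), of "\<lambda>\<tau>. f (r (0, \<tau>))"] unfolding smooth_chains_def by blast
  define v where "v = (\<lambda>z\<in>?C. h (fst z) + e (snd z))"
  have v: "v \<in> carrier (hom_group (rel_chains A M (k - 1)) real_add)"
    using comm_group.axioms(2)[OF rel_chains_comm_group, of A M "k - 1"] group.subgroup_self subgroup.m_closed
    by (fastforce simp: hom_real_iff v_def h(1) e(1) rel_chains_carrier smooth_chains_add)
  have va: "v (x + y) = v x + v y" if "x \<in> ?C" "y \<in> ?C" for x y
    using v that by (simp add: hom_real_iff)
  have v0: "v 0 = 0" using va[of 0 0] by simp
  have ZC: "z \<in> ?C" if "z \<in> ?Z" for z using that by (simp add: rel_cycles_iff)
  have fv: "f z = reduce \<Lambda> (v z)" if z: "z \<in> ?Z" for z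
  proof -
    obtain \<sigma> \<tau> where ze: "z = (\<sigma>, \<tau>)" "\<sigma> \<in> carrier (smooth_chains M (k - 1))" "\<tau> \<in> carrier (smooth_chains A (k - 2))"
      using ZC[OF z] by (cases z) (simp add: rel_chains_mem1)
    have "f z = f (r ((\<sigma>, 0) + (0, \<tau>)))" using r(3)[OF z] by (simp add: ze)
    also have "\<dots> = reduce \<Lambda> (h \<sigma>) \<otimes>\<^bsub>RmodL \<Lambda>\<^esub> reduce \<Lambda> (e \<tau>)"
      using frm[OF memM[OF ze(2)] memA[OF ze(3)]] h(2)[OF ze(2)] e(2)[OF ze(3)] by simp
    also have "\<dots> = reduce \<Lambda> (v z)"
      using ZC[OF z] by (simp add: v_def ze(1) reduce_add[OF \<Lambda>(1)])
    finally show ?thesis .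
  qed
  \<comment> \<open>The defect between integration and the coboundary of v. Both reduce to
    \<open>f \<circ> \<partial>\<close>, so it takes values in \<open>\<Lambda>\<close>.\<close>
  define u where "u = (\<lambda>z\<in>carrier (rel_chains A M k). rel_integral A M k w z - v (rel_boundary \<rho> k z))"
  have ud: "rel_integral A M k w z - v (rel_boundary \<rho> k z) \<in> \<Lambda>" if "z \<in> carrier (rel_chains A M k)" for z
  proof -
    have "reduce \<Lambda> (rel_integral A M k w z) = reduce \<Lambda> (v (rel_boundary \<rho> k z))"
      using w(2)[OF that] fv[OF boundary_cycle[OF \<Lambda> A M \<rho> k that]] by (simp only:)
    then show ?thesis by (rule iffD1[OF reduce_eq_iff[OF \<Lambda>(1)]])
  qed
  have bC: "rel_boundary \<rho> k z \<in> ?C" if "z \<in> carrier (rel_chains A M k)" for z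
    by (rule rel_boundary_closed[OF A M \<rho> that])
  have per: "rel_integral A M k w z \<in> \<Lambda>" if "z \<in> carrier (rel_cycles A M \<rho> k)" for z
    using ud[of z] that v0 by (simp add: rel_cycles_iff)
  have wf: "\<omega> \<in> carrier (form_group M k)" "\<theta> \<in> carrier (form_group A (k - 1))"
    using w(1) by (simp_all add: we rel_forms_iff)
  note P = J_choice_periods[OF \<Lambda> A M \<rho> k f fv wf per[unfolded we] ud[unfolded we]]
  have add: "x + y \<in> carrier (rel_chains A M k)" if "x \<in> carrier (rel_chains A M k)" "y \<in> carrier (rel_chains A M k)" for x y
    using that by (cases x; cases y) (simp add: rel_chains_carrier smooth_chains_add)
  have u: "u \<in> carrier (hom_group (rel_chains A M k) (coeff_group \<Lambda>))"
    using ud by (simp add: hom_coeff_iff u_def add rel_boundary_add rel_integral_add va bC)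
  \<comment> \<open>The v term drops out because the boundary of a boundary is 0. The integral of w
    over a relative boundary vanishes because both forms integrate to 0 over boundaries and the
    pull-back of \<open>\<omega>\<close> is 0.\<close>
  have u0: "u (rel_boundary \<rho> (k + 1) z) = 0" if z: "z \<in> carrier (rel_chains A M (k + 1))" for z
  proof -
    obtain \<sigma> \<tau> where ze: "z = (\<sigma>, \<tau>)" "\<sigma> \<in> carrier (smooth_chains M (k + 1))" "\<tau> \<in> carrier (smooth_chains A k)"
      using z by (cases z) (simp add: rel_chains_carrier)
    have b: "rel_boundary \<rho> (k + 1) z \<in> carrier (rel_chains A M k)" "rel_boundary \<rho> k (rel_boundary \<rho> (k + 1) z) = 0"
      using rel_boundary_closed[OF A M \<rho> z] rel_boundary_boundary[OF z] by simp_all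
    have "chain_integral M k (chain_boundary (nat (k + 1)) \<sigma>) \<omega> = 0"
      by (rule chain_boundary_integral_zero[OF M \<Lambda> P(1) ze(2)])
    moreover have "chain_integral A (k - 1) (chain_boundary (nat k) \<tau>) \<theta> = 0"
      using chain_boundary_integral_zero[OF A \<Lambda> P(2), of \<tau>] ze(3) by simp
    moreover have "chain_integral M k (chain_map (nat k) \<rho> \<tau>) \<omega> = 0"
      using chain_integral_pull_form[OF A M \<rho> ze(3), of \<omega>] P(3) by simp
    ultimately have "rel_integral A M k w (rel_boundary \<rho> (k + 1) z) = 0"
      by (simp add: ze(1) we rel_boundary_Pair rel_integral_Pair chain_integral_add chain_integral_uminus)
    then show ?thesis using b v0 by (simp add: u_def)
  qed
  have "J_choice \<Lambda> A M \<rho> k f u v w"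
    unfolding J_choice_iff
    using v fv u u0 w(1) per by (simp add: rel_period_forms_def u_def)
  then show ?thesis by (auto simp: we)
qed

text \<open>Supplies the multiplicativity of the relation in \<open>J_map_epi\<close>. The sums are
  restricted because cochains are extensional functions.\<close>

lemma J_choice_mult:
  assumes J: "J_choice \<Lambda> A M \<rho> k f u v (\<omega>, \<theta>)" and J': "J_choice \<Lambda> A M \<rho> k g u' v' (\<omega>', \<theta>')"
  defines "u'' \<equiv> \<lambda>z\<in>carrier (rel_chains A M k). u z + u' z"
    and "v'' \<equiv> \<lambda>z\<in>carrier (rel_chains A M (k - 1)). v z + v' z"
    and "\<omega>'' \<equiv> \<omega> \<otimes>\<^bsub>form_group M k\<^esub> \<omega>'" and "\<theta>'' \<equiv> \<theta> \<otimes>\<^bsub>form_group A (k - 1)\<^esub> \<theta>'"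
  shows "J_choice \<Lambda> A M \<rho> k (f \<otimes>\<^bsub>rel_characters0 \<Lambda> A M \<rho> k\<^esub> g) u'' v'' (\<omega>'', \<theta>'')"
    and "hs_element A M k u'' v'' (\<omega>'', \<theta>'') =
      hs_element A M k u v (\<omega>, \<theta>) \<otimes>\<^bsub>rel_hs_cocycles \<Lambda> A M \<rho> k\<^esub> hs_element A M k u' v' (\<omega>', \<theta>')"
proof -
  note D = J_choiceD[OF \<Lambda> A M \<rho> k J] and D' = J_choiceD[OF \<Lambda> A M \<rho> k J']
  note L = real_subring[OF \<Lambda>(1)]
  interpret W: comm_group "rel_forms A M k" by (rule rel_forms_comm_group[OF A M])
  have w: "(\<omega>, \<theta>) \<in> carrier (rel_forms A M k)" "(\<omega>', \<theta>') \<in> carrier (rel_forms A M k)"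
    using D(5,6) D'(5,6) by (simp_all add: rel_forms_iff)
  have ww: "(\<omega>'', \<theta>'') = (\<omega>, \<theta>) \<otimes>\<^bsub>rel_forms A M k\<^esub> (\<omega>', \<theta>')"
    by (simp add: rel_forms_mult \<omega>''_def \<theta>''_def)
  note int = rel_integral_mult[OF A M w]
  have add: "x + y \<in> carrier (rel_chains A M n)" if "x \<in> carrier (rel_chains A M n)" "y \<in> carrier (rel_chains A M n)" for x y n
    using that by (cases x; cases y) (simp add: rel_chains_carrier smooth_chains_add)
  have bC: "rel_boundary \<rho> k z \<in> carrier (rel_chains A M (k - 1))" if "z \<in> carrier (rel_chains A M k)" for z
    by (rule rel_boundary_closed[OF A M \<rho> that])
  have bC1: "rel_boundary \<rho> (k + 1) z \<in> carrier (rel_chains A M k)" if "z \<in> carrier (rel_chains A M (k + 1))" for z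
    using rel_boundary_closed[OF A M \<rho> that] by simp
  have cyc: "z \<in> carrier (rel_chains A M n)" if "z \<in> carrier (rel_cycles A M \<rho> n)" for z n
    using that by (simp add: rel_cycles_iff)
  show "J_choice \<Lambda> A M \<rho> k (f \<otimes>\<^bsub>rel_characters0 \<Lambda> A M \<rho> k\<^esub> g) u'' v'' (\<omega>'', \<theta>'')"
    unfolding J_choice_iff
  proof (intro conjI ballI)
    show "v'' \<in> carrier (hom_group (rel_chains A M (k - 1)) real_add)"
      by (simp add: hom_real_iff v''_def add D(1) D'(1))
    show "u'' \<in> carrier (hom_group (rel_chains A M k) (coeff_group \<Lambda>))"
      by (simp add: hom_coeff_iff u''_def add D(2) D'(2) L(3) D(3) D'(3))
    show "(f \<otimes>\<^bsub>rel_characters0 \<Lambda> A M \<rho> k\<^esub> g) z = reduce \<Lambda> (v'' z)" if "z \<in> carrier (rel_cycles A M \<rho> (k - 1))" for z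
      using that cyc[OF that] D(4)[OF that] D'(4)[OF that]
      by (simp add: characters0_simps[OF \<Lambda> A M \<rho> k] v''_def reduce_add[OF \<Lambda>(1)])
    show "(\<omega>'', \<theta>'') \<in> rel_period_forms \<Lambda> A M \<rho> k"
      using W.m_closed[OF w] int[OF cyc] D(7) D'(7) L(3) by (simp add: rel_period_forms_def ww)
    show "v'' (rel_boundary \<rho> k z) = rel_integral A M k (\<omega>'', \<theta>'') z - u'' z" if "z \<in> carrier (rel_chains A M k)" for z
      using that bC[OF that] D(8)[OF that] D'(8)[OF that] int[OF that] by (simp add: v''_def u''_def ww)
    show "u'' (rel_boundary \<rho> (k + 1) z) = 0" if "z \<in> carrier (rel_chains A M (k + 1))" for z
      using bC1[OF that] D(9)[OF that] D'(9)[OF that] by (simp add: u''_def)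
  qed
  have "x \<otimes>\<^bsub>rel_hs_cocycles \<Lambda> A M \<rho> k\<^esub> y = x \<otimes>\<^bsub>rel_hs_group \<Lambda> A M k\<^esub> y" for x y
    by (simp add: rel_hs_cocycles_def)
  then show "hs_element A M k u'' v'' (\<omega>'', \<theta>'') =
      hs_element A M k u v (\<omega>, \<theta>) \<otimes>\<^bsub>rel_hs_cocycles \<Lambda> A M \<rho> k\<^esub> hs_element A M k u' v' (\<omega>', \<theta>')"
    by (simp add: hs_element_def rel_hs_group_def hs_group_mult[OF \<Lambda>] u''_def v''_def \<omega>''_def \<theta>''_def
        rel_chains_carrier cong: restrict_cong)
qed

end

text \<open>Two chains with the same boundary differ by a cycle, so g induces an additive function
  on boundaries. Boundaries need not be a direct summand of the chains, so the extension to all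
  chains uses the divisibility of the reals in \<open>real_extension\<close>, not a
  retraction.\<close>

lemma rel_cochain_through_boundary:
  fixes g :: "'m chain \<times> 'a chain \<Rightarrow> real"
  assumes A: "smooth_manifold A" and M: "smooth_manifold M" and \<rho>: "smooth_map A M \<rho>"
    and g: "\<And>x y. x \<in> carrier (rel_chains A M n) \<Longrightarrow> y \<in> carrier (rel_chains A M n) \<Longrightarrow> g (x + y) = g x + g y"
    and g0: "\<And>x. x \<in> carrier (rel_cycles A M \<rho> n) \<Longrightarrow> g x = 0"
  shows "\<exists>F. (\<forall>x\<in>carrier (rel_chains A M (n - 1)). \<forall>y\<in>carrier (rel_chains A M (n - 1)). F (x + y) = F x + F y) \<and>
    (\<forall>x\<in>carrier (rel_chains A M n). F (rel_boundary \<rho> n x) = g x)"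
proof -
  interpret C: comm_group "rel_chains A M n" by (rule rel_chains_comm_group)
  interpret B: comm_group "rel_chains A M (n - 1)" by (rule rel_chains_comm_group)
  let ?C = "carrier (rel_chains A M n)"
  have add: "x + y \<in> ?C" if "x \<in> ?C" "y \<in> ?C" for x y using C.m_closed[OF that] by simp
  have gm: "g (- x) = - g x" if "x \<in> ?C" for x
    by (rule additive_on_uminus[of ?C]) (use that g in \<open>simp_all add: rel_chains_uminus\<close>)
  have same: "g x = g y" if x: "x \<in> ?C" and y: "y \<in> ?C" and e: "rel_boundary \<rho> n x = rel_boundary \<rho> n y" for x y
  proof -
    have my: "- y \<in> ?C" using y by (simp add: rel_chains_uminus)
    have "x + - y \<in> carrier (rel_cycles A M \<rho> n)"
      using add[OF x my] e by (simp only: rel_cycles_iff rel_boundary_add rel_boundary_uminus) simp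
    then have "g (x + - y) = 0" by (rule g0)
    then show ?thesis using g[OF x my] gm[OF y] by simp
  qed
  let ?H = "rel_boundary \<rho> n ` ?C"
  have "rel_boundary \<rho> n \<in> hom (rel_chains A M n) (rel_chains A M (n - 1))"
    by (rule homI) (simp_all add: rel_boundary_closed[OF A M \<rho>] rel_boundary_add)
  then interpret d: group_hom "rel_chains A M n" "rel_chains A M (n - 1)" "rel_boundary \<rho> n"
    by unfold_locales
  have H: "subgroup ?H (rel_chains A M (n - 1))" by (rule d.img_is_subgroup)
  define p where "p y = g (SOME x. x \<in> ?C \<and> rel_boundary \<rho> n x = y)" for y
  have p: "p (rel_boundary \<rho> n x) = g x" if x: "x \<in> ?C" for x
  proof -
    have "(SOME x'. x' \<in> ?C \<and> rel_boundary \<rho> n x' = rel_boundary \<rho> n x) \<in> ?C \<and>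
      rel_boundary \<rho> n (SOME x'. x' \<in> ?C \<and> rel_boundary \<rho> n x' = rel_boundary \<rho> n x) = rel_boundary \<rho> n x"
      by (rule someI[of _ x]) (simp add: x)
    then show ?thesis unfolding p_def by (intro same x) simp_all
  qed
  have pa: "p (x \<otimes>\<^bsub>rel_chains A M (n - 1)\<^esub> y) = p x + p y" if xy: "x \<in> ?H" "y \<in> ?H" for x y
  proof -
    obtain a b where ab: "a \<in> ?C" "b \<in> ?C" "x = rel_boundary \<rho> n a" "y = rel_boundary \<rho> n b"
      using xy by (elim imageE) simp
    have "p (rel_boundary \<rho> n (a + b)) = g a + g b" using p[OF add[OF ab(1,2)]] g[OF ab(1,2)] by simp
    then show ?thesis using p[OF ab(1)] p[OF ab(2)] by (simp add: ab(3,4) rel_boundary_add)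
  qed
  obtain F where F: "\<And>x y. x \<in> carrier (rel_chains A M (n - 1)) \<Longrightarrow> y \<in> carrier (rel_chains A M (n - 1)) \<Longrightarrow>
      F (x \<otimes>\<^bsub>rel_chains A M (n - 1)\<^esub> y) = F x + F y" "\<And>x. x \<in> ?H \<Longrightarrow> F x = p x"
    using B.real_extension[OF H, of p] pa by blast
  show ?thesis
  proof (intro exI[of _ F] conjI ballI)
    show "F (x + y) = F x + F y" if "x \<in> carrier (rel_chains A M (n - 1))" "y \<in> carrier (rel_chains A M (n - 1))" for x y
      using F(1)[OF that] by simp
    show "F (rel_boundary \<rho> n x) = g x" if "x \<in> ?C" for x
      using F(2)[OF imageI[OF that]] p[OF that] by simp
  qed
qed

lemma restrict_eq_iff: "restrict f B = restrict g B \<longleftrightarrow> (\<forall>x\<in>B. f x = g x)"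
proof
  assume *: "restrict f B = restrict g B"
  show "\<forall>x\<in>B. f x = g x"
  proof
    fix x assume "x \<in> B"
    then show "f x = g x" using fun_cong[OF *, of x] by simp
  qed
qed (intro restrict_ext, simp)

section \<open>The map phi and exactness at the group of characters\<close>

context
  fixes \<Lambda> :: "real set" and A :: "'a mfd" and M :: "'m mfd" and \<rho> :: "'a \<Rightarrow> 'm" and k :: int
  assumes \<Lambda>: "subring \<Lambda> real_ring" "\<Lambda> \<noteq> UNIV"
    and A: "smooth_manifold A" and M: "smooth_manifold M" and \<rho>: "smooth_map A M \<rho>" and k: "1 \<le> k"
begin

text \<open>The normal form of a coboundary in which the degree k - 1 - 1 reads k - 2, so that it
  can be compared with \<open>hs_element\<close> componentwise.\<close>

lemma coboundary_eq:
  assumes "(b, e, \<theta>) \<in> carrier (hs_group \<Lambda> A (k - 2))"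
  shows "rel_hs_diff \<Lambda> A M \<rho> (k - 1) ((c, h, \<omega>), (b, e, \<theta>)) =
    ((\<lambda>z\<in>carrier (smooth_chains M k). c (chain_boundary (nat k) z),
      \<lambda>z\<in>carrier (smooth_chains M (k - 1)). chain_integral M (k - 1) z \<omega> - c z - h (chain_boundary (nat (k - 1)) z), zero_form),
     (\<lambda>z\<in>carrier (smooth_chains A (k - 1)). c (chain_map (nat (k - 1)) \<rho> z) - b (chain_boundary (nat (k - 1)) z),
      \<lambda>z\<in>carrier (smooth_chains A (k - 2)). h (chain_map (nat (k - 2)) \<rho> z) -
        (chain_integral A (k - 2) z \<theta> - b z - e (chain_boundary (nat (k - 2)) z)), pull_form A M \<rho> \<omega>))"
proof -
  have e: "k - 1 - 1 = k - 2" "k - 1 + 1 = k" by simp_all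
  show ?thesis
    using rel_hs_diff_eq[OF \<Lambda> A M \<rho>, of b e \<theta> "k - 1" c h \<omega>] assms by (simp only: e)
qed

text \<open>Shows that \<open>phi0\<close> produces characters, with the pair (0, pull-back of
  \<open>\<nu>\<close>) as their forms: the boundary of \<open>\<sigma>\<close> contributes nothing
  because \<open>\<nu>\<close> has \<open>\<Lambda>\<close>-periods, and the image of
  \<open>\<tau>\<close> contributes the integral of the pull-back.\<close>

lemma boundary_period_zero:
  assumes \<nu>: "\<nu> \<in> carrier (period_forms \<Lambda> M (k - 1))" and z: "z \<in> carrier (rel_chains A M k)"
  shows "chain_integral M (k - 1) (fst (rel_boundary \<rho> k z)) \<nu> =
    rel_integral A M k (zero_form, pull_form A M \<rho> \<nu>) z"
proof -
  obtain \<sigma> \<tau> where ze: "z = (\<sigma>, \<tau>)" "\<sigma> \<in> carrier (smooth_chains M k)" "\<tau> \<in> carrier (smooth_chains A (k - 1))"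
    using z by (cases z) (simp add: rel_chains_carrier)
  have "chain_integral M (k - 1) (chain_boundary (nat k) \<sigma>) \<nu> = 0"
    using chain_boundary_integral_zero[OF M \<Lambda> \<nu>, of \<sigma>] ze(2) by simp
  then show ?thesis
    using chain_integral_pull_form[OF A M \<rho> ze(3), of \<nu>]
    by (simp add: ze(1) rel_boundary_Pair rel_integral_Pair chain_integral_add)
qed

lemma phi0_carrier:
  assumes \<nu>: "\<nu> \<in> carrier (period_forms \<Lambda> M (k - 1))"
  shows "phi0 \<Lambda> A M \<rho> k \<nu> \<in> carrier (rel_characters0 \<Lambda> A M \<rho> k)"
proof -
  interpret Z: comm_group "rel_cycles A M \<rho> (k - 1)" by (rule rel_cycles_comm_group)
  have \<nu>f: "\<nu> \<in> carrier (form_group M (k - 1))" using \<nu> by (simp add: period_forms_iff)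
  show ?thesis
    unfolding characters0_iff[OF \<Lambda> A M \<rho> k]
  proof (intro conjI bexI[of _ "(zero_form, pull_form A M \<rho> \<nu>)"] ballI)
    have "phi0 \<Lambda> A M \<rho> k \<nu> \<in> hom (rel_cycles A M \<rho> (k - 1)) (RmodL \<Lambda>)"
    proof (rule homI)
      fix x y assume xy: "x \<in> carrier (rel_cycles A M \<rho> (k - 1))" "y \<in> carrier (rel_cycles A M \<rho> (k - 1))"
      show "phi0 \<Lambda> A M \<rho> k \<nu> x \<in> carrier (RmodL \<Lambda>)" using xy by (simp add: phi0_def reduce_carrier[OF \<Lambda>(1)])
      show "phi0 \<Lambda> A M \<rho> k \<nu> (x \<otimes>\<^bsub>rel_cycles A M \<rho> (k - 1)\<^esub> y) =
        phi0 \<Lambda> A M \<rho> k \<nu> x \<otimes>\<^bsub>RmodL \<Lambda>\<^esub> phi0 \<Lambda> A M \<rho> k \<nu> y"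
        using xy Z.m_closed[OF xy] by (simp add: phi0_def chain_integral_add reduce_add[OF \<Lambda>(1)])
    qed
    then show "phi0 \<Lambda> A M \<rho> k \<nu> \<in> carrier (hom_group (rel_cycles A M \<rho> (k - 1)) (RmodL \<Lambda>))"
      by (simp add: hom_group_simps phi0_def)
    show "(zero_form, pull_form A M \<rho> \<nu>) \<in> carrier (rel_forms A M k)"
      by (simp add: rel_forms_iff zero_form_carrier[OF M] pull_form_carrier[OF A M \<rho> \<nu>f])
    show "phi0 \<Lambda> A M \<rho> k \<nu> (rel_boundary \<rho> k z) =
      reduce \<Lambda> (rel_integral A M k (zero_form, pull_form A M \<rho> \<nu>) z)" if "z \<in> carrier (rel_chains A M k)" for z
      using boundary_cycle[OF \<Lambda> A M \<rho> k that] boundary_period_zero[OF \<nu> that] by (simp add: phi0_def)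
    show "phi0 \<Lambda> A M \<rho> k \<nu> (chain_map (nat (k - 1)) \<rho> \<tau>, 0) = \<one>\<^bsub>RmodL \<Lambda>\<^esub>" if "\<tau> \<in> smooth_cycles A (k - 1)" for \<tau>
      using image_cycle[OF \<Lambda> A M \<rho> k that] \<nu> by (simp add: phi0_def period_forms_iff reduce_eq_one[OF \<Lambda>(1)])
  qed
qed

lemma phi0_hom: "phi0 \<Lambda> A M \<rho> k \<in> hom (period_forms \<Lambda> M (k - 1)) (rel_characters0 \<Lambda> A M \<rho> k)"
proof (rule homI)
  fix \<nu> \<eta> assume w: "\<nu> \<in> carrier (period_forms \<Lambda> M (k - 1))" "\<eta> \<in> carrier (period_forms \<Lambda> M (k - 1))"
  have c: "fst z \<in> carrier (smooth_chains M (k - 1))" if "z \<in> carrier (rel_cycles A M \<rho> (k - 1))" for z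
    using that by (cases z) (simp add: rel_cycles_iff rel_chains_carrier)
  have wf: "\<nu> \<in> carrier (form_group M (k - 1))" "\<eta> \<in> carrier (form_group M (k - 1))"
    using w by (simp_all add: period_forms_iff)
  show "phi0 \<Lambda> A M \<rho> k (\<nu> \<otimes>\<^bsub>period_forms \<Lambda> M (k - 1)\<^esub> \<eta>) =
      phi0 \<Lambda> A M \<rho> k \<nu> \<otimes>\<^bsub>rel_characters0 \<Lambda> A M \<rho> k\<^esub> phi0 \<Lambda> A M \<rho> k \<eta>"
    unfolding characters0_simps[OF \<Lambda> A M \<rho> k]
    by (simp add: phi0_def period_forms_simps chain_integral_mult_form[OF M wf c] reduce_add[OF \<Lambda>(1)]
        cong: restrict_cong)
qed (rule phi0_carrier)

text \<open>An ordinary cycle \<open>\<sigma>\<close> of M gives the relative cycle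
  (\<open>\<sigma>\<close>, 0), so forms in \<open>tilde_forms\<close> automatically lie in
  \<open>period_forms\<close>, the domain of \<open>phi0\<close>.\<close>

lemma phi0_kernel:
  "kernel (period_forms \<Lambda> M (k - 1)) (rel_characters0 \<Lambda> A M \<rho> k) (phi0 \<Lambda> A M \<rho> k) = tilde_forms \<Lambda> A M \<rho> (k - 1)"
proof -
  have one: "phi0 \<Lambda> A M \<rho> k \<nu> = \<one>\<^bsub>rel_characters0 \<Lambda> A M \<rho> k\<^esub> \<longleftrightarrow>
    (\<forall>z\<in>carrier (rel_cycles A M \<rho> (k - 1)). chain_integral M (k - 1) (fst z) \<nu> \<in> \<Lambda>)" for \<nu>
  proof -
    have "phi0 \<Lambda> A M \<rho> k \<nu> = \<one>\<^bsub>rel_characters0 \<Lambda> A M \<rho> k\<^esub> \<longleftrightarrow> (\<forall>z\<in>carrier (rel_cycles A M \<rho> (k - 1)).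
      reduce \<Lambda> (chain_integral M (k - 1) (fst z) \<nu>) = \<one>\<^bsub>RmodL \<Lambda>\<^esub>)"
      unfolding characters0_simps[OF \<Lambda> A M \<rho> k] phi0_def by (rule restrict_eq_iff)
    then show ?thesis by (simp only: reduce_eq_one[OF \<Lambda>(1)])
  qed
  have int: "rel_integral A M (k - 1) (\<nu>, zero_form) z = chain_integral M (k - 1) (fst z) \<nu>" for \<nu> z
    by (cases z) (simp add: rel_integral_Pair)
  have per: "\<nu> \<in> carrier (period_forms \<Lambda> M (k - 1))"
    if n: "\<nu> \<in> carrier (form_group M (k - 1))" "\<forall>z\<in>carrier (rel_cycles A M \<rho> (k - 1)). chain_integral M (k - 1) (fst z) \<nu> \<in> \<Lambda>" for \<nu>
    unfolding period_forms_iff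
  proof (intro conjI ballI n)
    fix \<sigma> assume "\<sigma> \<in> smooth_cycles M (k - 1)"
    then have "(\<sigma>, 0) \<in> carrier (rel_cycles A M \<rho> (k - 1))"
      by (simp add: smooth_cycles_iff rel_cycles_iff rel_chains_carrier rel_boundary_Pair zero_prod_def)
    from bspec[OF n(2) this] show "chain_integral M (k - 1) \<sigma> \<nu> \<in> \<Lambda>" by simp
  qed
  show ?thesis
  proof (intro equalityI subsetI)
    fix \<nu> assume "\<nu> \<in> kernel (period_forms \<Lambda> M (k - 1)) (rel_characters0 \<Lambda> A M \<rho> k) (phi0 \<Lambda> A M \<rho> k)"
    then show "\<nu> \<in> tilde_forms \<Lambda> A M \<rho> (k - 1)"
      using zero_form_carrier[OF A]
      by (simp add: kernel_def one tilde_forms_def rel_period_forms_def int rel_forms_iff period_forms_iff)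
  next
    fix \<nu> assume "\<nu> \<in> tilde_forms \<Lambda> A M \<rho> (k - 1)"
    then have n: "\<nu> \<in> carrier (form_group M (k - 1))" "\<forall>z\<in>carrier (rel_cycles A M \<rho> (k - 1)). chain_integral M (k - 1) (fst z) \<nu> \<in> \<Lambda>"
      by (simp_all add: tilde_forms_def rel_period_forms_def int)
    show "\<nu> \<in> kernel (period_forms \<Lambda> M (k - 1)) (rel_characters0 \<Lambda> A M \<rho> k) (phi0 \<Lambda> A M \<rho> k)"
      using per[OF n] n(2) by (simp add: kernel_def one)
  qed
qed

text \<open>The form on M in an element whose differential is the given cocycle is the
  \<open>\<nu>\<close> sought: comparing the real cochain components shows that v differs on cycles
  from integration of \<open>\<nu>\<close> only by values in \<open>\<Lambda>\<close>.\<close>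

lemma coboundary_choice:
  assumes J: "J_choice \<Lambda> A M \<rho> k f u v (\<omega>, \<theta>)" and f: "f \<in> carrier (rel_characters0 \<Lambda> A M \<rho> k)"
    and z: "hs_element A M k u v (\<omega>, \<theta>) \<in> rel_hs_coboundaries \<Lambda> A M \<rho> k"
  shows "\<exists>\<nu>\<in>carrier (period_forms \<Lambda> M (k - 1)). f = phi0 \<Lambda> A M \<rho> k \<nu>"
proof -
  note D = J_choiceD[OF \<Lambda> A M \<rho> k J] and L = real_subring[OF \<Lambda>(1)]
  obtain c h \<nu> b e \<eta> where ST: "((c, h, \<nu>), (b, e, \<eta>)) \<in> carrier (rel_hs_group \<Lambda> A M (k - 1))"
    "hs_element A M k u v (\<omega>, \<theta>) = rel_hs_diff \<Lambda> A M \<rho> (k - 1) ((c, h, \<nu>), (b, e, \<eta>))"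
    using z unfolding rel_hs_coboundaries_def by (elim imageE) (metis prod.exhaust)
  have kk: "k - 1 - 1 = k - 2" by simp
  have S: "(c, h, \<nu>) \<in> carrier (hs_group \<Lambda> M (k - 1))" and T: "(b, e, \<eta>) \<in> carrier (hs_group \<Lambda> A (k - 2))"
    using ST(1) unfolding rel_hs_group_iff[OF \<Lambda>] kk by blast+
  have c: "c \<in> carrier (hom_group (smooth_chains M (k - 1)) (coeff_group \<Lambda>))"
    and h: "h \<in> carrier (hom_group (smooth_chains M (k - 2)) real_add)"
    and n: "\<nu> \<in> carrier (period_forms \<Lambda> M (k - 1))"
    using S unfolding hs_group_iff[OF \<Lambda>] kk by blast+
  have b: "b \<in> carrier (hom_group (smooth_chains A (k - 2)) (coeff_group \<Lambda>))"
    and e: "e \<in> carrier (hom_group (smooth_chains A (k - 2 - 1)) real_add)"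
    and et: "\<eta> \<in> carrier (period_forms \<Lambda> A (k - 2))"
    using T unfolding hs_group_iff[OF \<Lambda>] by blast+
  have e0: "e 0 = 0" by (rule hom_chains_0[OF disjI1[OF e]])
  note E = ST(2)[unfolded coboundary_eq[OF T] hs_element_def prod.case prod.inject]
  have vM: "v (\<sigma>, 0) = chain_integral M (k - 1) \<sigma> \<nu> - c \<sigma> - h (chain_boundary (nat (k - 1)) \<sigma>)"
    if "\<sigma> \<in> carrier (smooth_chains M (k - 1))" for \<sigma>
    using fun_cong[OF conjunct1[OF conjunct2[OF conjunct1[OF E]]], of \<sigma>] that by simp
  have vA: "- v (0, \<tau>) = h (chain_map (nat (k - 2)) \<rho> \<tau>) -
        (chain_integral A (k - 2) \<tau> \<eta> - b \<tau> - e (chain_boundary (nat (k - 2)) \<tau>))"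
    if "\<tau> \<in> carrier (smooth_chains A (k - 2))" for \<tau>
    using fun_cong[OF conjunct1[OF conjunct2[OF conjunct2[OF E]]], of \<tau>] that by simp
  have key: "f z = reduce \<Lambda> (chain_integral M (k - 1) (fst z) \<nu>)" if z: "z \<in> carrier (rel_cycles A M \<rho> (k - 1))" for z
  proof -
    obtain \<sigma> \<tau> where ze: "z = (\<sigma>, \<tau>)" by (cases z)
    have st: "\<sigma> \<in> carrier (smooth_chains M (k - 1))" "\<tau> \<in> carrier (smooth_chains A (k - 2))"
      "chain_boundary (nat (k - 1)) \<sigma> + chain_map (nat (k - 2)) \<rho> \<tau> = 0" "chain_boundary (nat (k - 2)) \<tau> = 0"
      using z unfolding ze rel_cycles_iff rel_chains_carrier rel_boundary_Pair kk by (simp_all add: zero_prod_def)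
    have "v z = v ((\<sigma>, 0) + (0, \<tau>))" by (simp add: ze)
    also have "\<dots> = v (\<sigma>, 0) + v (0, \<tau>)"
      by (rule D(1)) (use st(1,2) in \<open>simp_all add: rel_chains_mem1[OF \<Lambda> A M \<rho> k]\<close>)
    finally have vz: "v z = v (\<sigma>, 0) + v (0, \<tau>)" .
    have r: "chain_map (nat (k - 2)) \<rho> \<tau> \<in> carrier (smooth_chains M (k - 2))"
      by (rule smooth_chains_chain_map[OF A M \<rho> st(2)])
    have d: "chain_boundary (nat (k - 1)) \<sigma> = - chain_map (nat (k - 2)) \<rho> \<tau>"
      using st(3) by (simp add: eq_neg_iff_add_eq_0)
    have hd: "h (chain_boundary (nat (k - 1)) \<sigma>) = - h (chain_map (nat (k - 2)) \<rho> \<tau>)"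
      unfolding d by (rule hom_chains_uminus[OF disjI1[OF h] r])
    have "chain_integral A (k - 2) \<tau> \<eta> \<in> \<Lambda>" using et st by (simp add: period_forms_iff smooth_cycles_iff)
    moreover have "c \<sigma> \<in> \<Lambda>" "b \<tau> \<in> \<Lambda>" using c b st by (simp_all add: hom_coeff_iff)
    ultimately have "chain_integral A (k - 2) \<tau> \<eta> - b \<tau> - c \<sigma> \<in> \<Lambda>" by (intro L(5))
    \<comment> \<open>For a relative cycle, the boundary of \<open>\<sigma>\<close> is minus the
      image of \<open>\<tau>\<close>, so the h terms cancel; \<open>\<tau>\<close> is itself a
      cycle, so the e term is 0 and the integral of \<open>\<eta>\<close> lies in
      \<open>\<Lambda>\<close>.\<close>
    moreover have "v z - chain_integral M (k - 1) (fst z) \<nu> = chain_integral A (k - 2) \<tau> \<eta> - b \<tau> - c \<sigma>"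
      using vz vM[OF st(1)] vA[OF st(2)] hd e0 st(4) ze by simp
    ultimately have "v z - chain_integral M (k - 1) (fst z) \<nu> \<in> \<Lambda>" by (simp only:)
    then have "reduce \<Lambda> (v z) = reduce \<Lambda> (chain_integral M (k - 1) (fst z) \<nu>)" by (rule iffD2[OF reduce_eq_iff[OF \<Lambda>(1)]])
    then show ?thesis using D(4)[OF z] by simp
  qed
  have "f \<in> extensional (carrier (rel_cycles A M \<rho> (k - 1)))"
    using f by (simp add: characters0_iff[OF \<Lambda> A M \<rho> k] hom_group_simps)
  then have "f = phi0 \<Lambda> A M \<rho> k \<nu>"
    by (rule extensionalityI[where A = "carrier (rel_cycles A M \<rho> (k - 1))"]) (simp_all add: phi0_def key)
  then show ?thesis using n by blast
qed

text \<open>Integration of \<open>\<nu>\<close> is itself a real lift of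
  \<open>phi0 \<Lambda> A M \<rho> k \<nu>\<close>, so u can be 0. The resulting cocycle is the
  differential of the element with \<open>\<nu>\<close> as form on M and zero in all other
  places.\<close>

lemma phi0_choice:
  assumes \<nu>: "\<nu> \<in> carrier (period_forms \<Lambda> M (k - 1))"
  shows "\<exists>u v w. J_choice \<Lambda> A M \<rho> k (phi0 \<Lambda> A M \<rho> k \<nu>) u v w \<and> hs_element A M k u v w \<in> rel_hs_coboundaries \<Lambda> A M \<rho> k"
proof -
  define u where "u = (\<lambda>z\<in>carrier (rel_chains A M k). 0 :: real)"
  define v where "v = (\<lambda>z\<in>carrier (rel_chains A M (k - 1)). chain_integral M (k - 1) (fst z) \<nu>)"
  let ?w = "(zero_form, pull_form A M \<rho> \<nu>)"
  note L = real_subring[OF \<Lambda>(1)]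
  have \<nu>f: "\<nu> \<in> carrier (form_group M (k - 1))" using \<nu> by (simp add: period_forms_iff)
  interpret C: comm_group "rel_chains A M (k - 1)" by (rule rel_chains_comm_group)
  interpret C': comm_group "rel_chains A M k" by (rule rel_chains_comm_group)
  have add: "x + y \<in> carrier (rel_chains A M (k - 1))"
    if "x \<in> carrier (rel_chains A M (k - 1))" "y \<in> carrier (rel_chains A M (k - 1))" for x y
    using C.m_closed[OF that] by simp
  have add': "x + y \<in> carrier (rel_chains A M k)"
    if "x \<in> carrier (rel_chains A M k)" "y \<in> carrier (rel_chains A M k)" for x y
    using C'.m_closed[OF that] by simp
  have vd: "v (rel_boundary \<rho> k z) = rel_integral A M k ?w z" if "z \<in> carrier (rel_chains A M k)" for z
    using boundary_period_zero[OF \<nu> that] rel_boundary_closed[OF A M \<rho> that] by (simp add: v_def)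
  have "J_choice \<Lambda> A M \<rho> k (phi0 \<Lambda> A M \<rho> k \<nu>) u v ?w"
    unfolding J_choice_iff
  proof (intro conjI ballI)
    show "v \<in> carrier (hom_group (rel_chains A M (k - 1)) real_add)"
      by (simp add: hom_real_iff v_def add chain_integral_add)
    show "phi0 \<Lambda> A M \<rho> k \<nu> z = reduce \<Lambda> (v z)" if "z \<in> carrier (rel_cycles A M \<rho> (k - 1))" for z
      using that by (simp add: phi0_def v_def rel_cycles_iff)
    show "u \<in> carrier (hom_group (rel_chains A M k) (coeff_group \<Lambda>))"
      by (simp add: hom_coeff_iff u_def add' L(1))
    show "v (rel_boundary \<rho> k z) = rel_integral A M k ?w z - u z" if "z \<in> carrier (rel_chains A M k)" for z
      using vd[OF that] that by (simp add: u_def)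
    show "u (rel_boundary \<rho> (k + 1) z) = 0" if "z \<in> carrier (rel_chains A M (k + 1))" for z
      using rel_boundary_closed[OF A M \<rho> that] by (simp add: u_def)
    have "rel_integral A M k ?w z \<in> \<Lambda>" if "z \<in> carrier (rel_cycles A M \<rho> k)" for z
      using vd[of z] that L(1) by (simp add: rel_cycles_iff v_def)
    then show "?w \<in> rel_period_forms \<Lambda> A M \<rho> k"
      using zero_form_carrier[OF M] pull_form_carrier[OF A M \<rho> \<nu>f] by (simp add: rel_period_forms_def rel_forms_iff)
  qed
  moreover have "hs_element A M k u v ?w \<in> rel_hs_coboundaries \<Lambda> A M \<rho> k"
  proof -
    have kk: "k - 1 - 1 = k - 2" by simp
    define c where "c = (\<lambda>z\<in>carrier (smooth_chains M (k - 1)). 0 :: real)"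
    define h where "h = (\<lambda>z\<in>carrier (smooth_chains M (k - 2)). 0 :: real)"
    define b where "b = (\<lambda>z\<in>carrier (smooth_chains A (k - 2)). 0 :: real)"
    define e where "e = (\<lambda>z\<in>carrier (smooth_chains A (k - 2 - 1)). 0 :: real)"
    have S: "(c, h, \<nu>) \<in> carrier (hs_group \<Lambda> M (k - 1))"
      unfolding hs_group_iff[OF \<Lambda>] kk hom_coeff_iff hom_real_iff using \<nu> L(1) by (simp add: c_def h_def smooth_chains_add)
    have T: "(b, e, zero_form) \<in> carrier (hs_group \<Lambda> A (k - 2))"
      unfolding hs_group_iff[OF \<Lambda>] hom_coeff_iff hom_real_iff b_def e_def
      using zero_form_period[OF \<Lambda> A] L(1) by (simp add: smooth_chains_add)
    have bM: "chain_boundary (nat k) z \<in> carrier (smooth_chains M (k - 1))" if "z \<in> carrier (smooth_chains M k)" for z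
      by (rule smooth_chains_boundary[OF that])
    have bM': "chain_boundary (nat (k - 1)) z \<in> carrier (smooth_chains M (k - 2))" if "z \<in> carrier (smooth_chains M (k - 1))" for z
      using smooth_chains_boundary[OF that] by (simp only: kk)
    have bA: "chain_boundary (nat (k - 1)) z \<in> carrier (smooth_chains A (k - 2))" if "z \<in> carrier (smooth_chains A (k - 1))" for z
      using smooth_chains_boundary[OF that] by (simp only: kk)
    have bA': "chain_boundary (nat (k - 2)) z \<in> carrier (smooth_chains A (k - 2 - 1))" if "z \<in> carrier (smooth_chains A (k - 2))" for z
      by (rule smooth_chains_boundary[OF that])
    have cc: "c z = 0" if "z \<in> carrier (smooth_chains M (k - 1))" for z using that by (simp add: c_def)
    have hh: "h z = 0" if "z \<in> carrier (smooth_chains M (k - 2))" for z using that by (simp add: h_def)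
    have bb: "b z = 0" if "z \<in> carrier (smooth_chains A (k - 2))" for z using that by (simp add: b_def)
    have ee: "e z = 0" if "z \<in> carrier (smooth_chains A (k - 2 - 1))" for z using that unfolding e_def by simp
    note rho = smooth_chains_chain_map[OF A M \<rho>]
    have "hs_element A M k u v ?w = rel_hs_diff \<Lambda> A M \<rho> (k - 1) ((c, h, \<nu>), (b, e, zero_form))"
      unfolding coboundary_eq[OF T] hs_element_def prod.case prod.inject
    proof (intro conjI restrict_ext refl)
      show "u (z, 0) = c (chain_boundary (nat k) z)" if "z \<in> carrier (smooth_chains M k)" for z
        using that cc[OF bM[OF that]] by (simp add: u_def rel_chains_carrier)
      show "v (z, 0) = chain_integral M (k - 1) z \<nu> - c z - h (chain_boundary (nat (k - 1)) z)"
        if "z \<in> carrier (smooth_chains M (k - 1))" for z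
        using that cc[OF that] hh[OF bM'[OF that]] by (simp add: v_def rel_chains_carrier)
      show "u (0, z) = c (chain_map (nat (k - 1)) \<rho> z) - b (chain_boundary (nat (k - 1)) z)"
        if "z \<in> carrier (smooth_chains A (k - 1))" for z
        using that cc[OF rho[OF that]] bb[OF bA[OF that]] by (simp add: u_def rel_chains_carrier)
      show "- v (0, z) = h (chain_map (nat (k - 2)) \<rho> z) -
          (chain_integral A (k - 2) z zero_form - b z - e (chain_boundary (nat (k - 2)) z))"
        if "z \<in> carrier (smooth_chains A (k - 2))" for z
        using that hh[OF rho[OF that]] bb[OF that] ee[OF bA'[OF that]] by (simp add: v_def rel_chains_carrier)
    qed
    moreover have "((c, h, \<nu>), (b, e, zero_form)) \<in> carrier (rel_hs_group \<Lambda> A M (k - 1))"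
      unfolding rel_hs_group_iff[OF \<Lambda>] kk by (intro conjI S T)
    ultimately show ?thesis unfolding rel_hs_coboundaries_def by (rule image_eqI)
  qed
  ultimately show ?thesis by blast
qed

end

section \<open>Surjectivity of J and the lifts of the trivial character\<close>

context
  fixes \<Lambda> :: "real set" and A :: "'a mfd" and M :: "'m mfd" and \<rho> :: "'a \<Rightarrow> 'm" and k :: int
  assumes \<Lambda>: "subring \<Lambda> real_ring" "\<Lambda> \<noteq> UNIV"
    and A: "smooth_manifold A" and M: "smooth_manifold M" and \<rho>: "smooth_map A M \<rho>" and k: "1 \<le> k"
begin

text \<open>Inverts \<open>hs_element\<close>: u joins c and b, v joins h and -e, and f is the
  reduction of v on cycles. The cocycle equations turn back into the conditions of
  \<open>J_choice\<close>.\<close>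

lemma J_choice_surj:
  assumes x: "x \<in> carrier (rel_hs_cocycles \<Lambda> A M \<rho> k)"
  shows "\<exists>f\<in>carrier (rel_characters0 \<Lambda> A M \<rho> k). \<exists>u v w. J_choice \<Lambda> A M \<rho> k f u v w \<and> x = hs_element A M k u v w"
proof -
  note L = real_subring[OF \<Lambda>(1)]
  obtain c h \<omega> b e \<theta> where xe: "x = ((c, h, \<omega>), (b, e, \<theta>))" by (metis prod.exhaust)
  have kk: "k - 1 - 1 = k - 2" "k + 1 - 1 = k" by simp_all
  have S: "(c, h, \<omega>) \<in> carrier (hs_group \<Lambda> M k)" and T: "(b, e, \<theta>) \<in> carrier (hs_group \<Lambda> A (k - 1))"
    using x unfolding xe cocycles_iff[OF \<Lambda> A M \<rho> k] rel_hs_group_iff[OF \<Lambda>] by blast+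
  have c: "c \<in> carrier (hom_group (smooth_chains M k) (coeff_group \<Lambda>))"
    and h: "h \<in> carrier (hom_group (smooth_chains M (k - 1)) real_add)"
    and w: "\<omega> \<in> carrier (period_forms \<Lambda> M k)"
    using S unfolding hs_group_iff[OF \<Lambda>] by blast+
  have b: "b \<in> carrier (hom_group (smooth_chains A (k - 1)) (coeff_group \<Lambda>))"
    and e: "e \<in> carrier (hom_group (smooth_chains A (k - 2)) real_add)"
    and th: "\<theta> \<in> carrier (period_forms \<Lambda> A (k - 1))"
    using T unfolding hs_group_iff[OF \<Lambda>] kk by blast+
  note ca = hom_chains_add[OF disjI2[OF c]] and ha = hom_chains_add[OF disjI1[OF h]]
    and ba = hom_chains_add[OF disjI2[OF b]] and ea = hom_chains_add[OF disjI1[OF e]]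
    and bn = hom_chains_uminus[OF disjI2[OF b]] and en = hom_chains_uminus[OF disjI1[OF e]]
  have z0: "c 0 = 0" "h 0 = 0" "b 0 = 0" "e 0 = 0"
    using hom_chains_0[OF disjI2[OF c]] hom_chains_0[OF disjI1[OF h]] hom_chains_0[OF disjI2[OF b]]
      hom_chains_0[OF disjI1[OF e]] .
  have cL: "c z \<in> \<Lambda>" if "z \<in> carrier (smooth_chains M k)" for z using c that by (simp add: hom_coeff_iff)
  have bL: "b z \<in> \<Lambda>" if "z \<in> carrier (smooth_chains A (k - 1))" for z using b that by (simp add: hom_coeff_iff)
  have "rel_hs_diff \<Lambda> A M \<rho> k x = \<one>\<^bsub>rel_hs_group \<Lambda> A M (k + 1)\<^esub>"
    using x unfolding cocycles_iff[OF \<Lambda> A M \<rho> k] by blast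
  note E = this[unfolded xe rel_hs_diff_eq[OF \<Lambda> A M \<rho> T] rel_hs_group_def one_DirProd hs_group_one[OF \<Lambda>] kk prod.inject restrict_eq_iff]
  have M1: "c (chain_boundary (nat (k + 1)) z) = 0" if "z \<in> carrier (smooth_chains M (k + 1))" for z
    using bspec[OF conjunct1[OF conjunct1[OF E]] that] .
  have M2: "chain_integral M k z \<omega> - c z - h (chain_boundary (nat k) z) = 0" if "z \<in> carrier (smooth_chains M k)" for z
    using bspec[OF conjunct1[OF conjunct2[OF conjunct1[OF E]]] that] .
  have A1: "c (chain_map (nat k) \<rho> z) - b (chain_boundary (nat k) z) = 0" if "z \<in> carrier (smooth_chains A k)" for z
    using bspec[OF conjunct1[OF conjunct2[OF E]] that] .
  have A2: "h (chain_map (nat (k - 1)) \<rho> z) -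
      (chain_integral A (k - 1) z \<theta> - b z - e (chain_boundary (nat (k - 1)) z)) = 0"
    if "z \<in> carrier (smooth_chains A (k - 1))" for z
    using bspec[OF conjunct1[OF conjunct2[OF conjunct2[OF E]]] that] .
  have bA: "chain_boundary (nat (k - 1)) z \<in> carrier (smooth_chains A (k - 2))" if "z \<in> carrier (smooth_chains A (k - 1))" for z
    using smooth_chains_boundary[OF that] by (simp only: kk)
  have bM1: "chain_boundary (nat (k + 1)) z \<in> carrier (smooth_chains M k)" if "z \<in> carrier (smooth_chains M (k + 1))" for z
    using smooth_chains_boundary[OF that] by (simp only: kk)
  note rho = smooth_chains_chain_map[OF A M \<rho>] and bd = smooth_chains_boundary
  note add = smooth_chains_add
  define u where "u = (\<lambda>z\<in>carrier (rel_chains A M k). c (fst z) + b (snd z))"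
  define v where "v = (\<lambda>z\<in>carrier (rel_chains A M (k - 1)). h (fst z) - e (snd z))"
  have u: "u \<in> carrier (hom_group (rel_chains A M k) (coeff_group \<Lambda>))"
    unfolding hom_coeff_iff u_def rel_chains_carrier using L(3) cL bL by (simp add: add ca ba)
  have mem1: "z \<in> carrier (rel_chains A M (k - 1)) \<longleftrightarrow> fst z \<in> carrier (smooth_chains M (k - 1)) \<and> snd z \<in> carrier (smooth_chains A (k - 2))" for z
    by (cases z) (simp add: rel_chains_mem1[OF \<Lambda> A M \<rho> k])
  have v: "v \<in> carrier (hom_group (rel_chains A M (k - 1)) real_add)"
    unfolding hom_real_iff v_def by (simp add: mem1 add ha ea)
  have va: "v (y + z) = v y + v z" if "y \<in> carrier (rel_chains A M (k - 1))" "z \<in> carrier (rel_chains A M (k - 1))" for y z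
    using v that by (simp add: hom_real_iff)
  have v0: "v 0 = 0" by (simp add: v_def z0)
  have vd: "v (rel_boundary \<rho> k z) = rel_integral A M k (\<omega>, \<theta>) z - u z" if z: "z \<in> carrier (rel_chains A M k)" for z
  proof -
    obtain \<sigma> \<tau> where ze: "z = (\<sigma>, \<tau>)" "\<sigma> \<in> carrier (smooth_chains M k)" "\<tau> \<in> carrier (smooth_chains A (k - 1))"
      using z by (cases z) (simp add: rel_chains_carrier)
    have "v (rel_boundary \<rho> k z) = h (chain_boundary (nat k) \<sigma>) + h (chain_map (nat (k - 1)) \<rho> \<tau>) + e (chain_boundary (nat (k - 1)) \<tau>)"
      using rel_boundary_closed[OF A M \<rho> z] by (simp add: v_def ze(1) rel_boundary_Pair ha[OF bd[OF ze(2)] rho[OF ze(3)]] en[OF bA[OF ze(3)]])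
    then show ?thesis
      using M2[OF ze(2)] A2[OF ze(3)] z by (simp add: u_def ze(1) rel_integral_Pair)
  qed
  have ud: "u (rel_boundary \<rho> (k + 1) z) = 0" if z: "z \<in> carrier (rel_chains A M (k + 1))" for z
  proof -
    obtain \<sigma> \<tau> where ze: "z = (\<sigma>, \<tau>)" "\<sigma> \<in> carrier (smooth_chains M (k + 1))" "\<tau> \<in> carrier (smooth_chains A k)"
      using z by (cases z) (simp add: rel_chains_carrier)
    show ?thesis
      using rel_boundary_closed[OF A M \<rho> z] M1[OF ze(2)] A1[OF ze(3)]
      by (simp add: u_def ze(1) rel_boundary_Pair ca[OF bM1[OF ze(2)] rho[OF ze(3)]] bn[OF bd[OF ze(3)]])
  qed
  have wf: "(\<omega>, \<theta>) \<in> carrier (rel_forms A M k)" using w th by (simp add: rel_forms_iff period_forms_iff)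
  have uL: "u z \<in> \<Lambda>" if "z \<in> carrier (rel_chains A M k)" for z using u that by (simp add: hom_coeff_iff)
  define f where "f = (\<lambda>z\<in>carrier (rel_cycles A M \<rho> (k - 1)). reduce \<Lambda> (v z))"
  interpret Z: comm_group "rel_cycles A M \<rho> (k - 1)" by (rule rel_cycles_comm_group)
  have cyc: "z \<in> carrier (rel_chains A M (k - 1))" if "z \<in> carrier (rel_cycles A M \<rho> (k - 1))" for z
    using that by (simp add: rel_cycles_iff)
  have "f \<in> carrier (rel_characters0 \<Lambda> A M \<rho> k)"
    unfolding characters0_iff[OF \<Lambda> A M \<rho> k]
  proof (intro conjI bexI[of _ "(\<omega>, \<theta>)"] ballI wf)
    have "f \<in> hom (rel_cycles A M \<rho> (k - 1)) (RmodL \<Lambda>)"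
    proof (rule homI)
      fix y z assume yz: "y \<in> carrier (rel_cycles A M \<rho> (k - 1))" "z \<in> carrier (rel_cycles A M \<rho> (k - 1))"
      show "f y \<in> carrier (RmodL \<Lambda>)" using yz by (simp add: f_def reduce_carrier[OF \<Lambda>(1)])
      show "f (y \<otimes>\<^bsub>rel_cycles A M \<rho> (k - 1)\<^esub> z) = f y \<otimes>\<^bsub>RmodL \<Lambda>\<^esub> f z"
        using yz Z.m_closed[OF yz] by (simp add: f_def va[OF cyc cyc] reduce_add[OF \<Lambda>(1)])
    qed
    then show "f \<in> carrier (hom_group (rel_cycles A M \<rho> (k - 1)) (RmodL \<Lambda>))"
      by (simp add: hom_group_simps f_def)
    show "f (rel_boundary \<rho> k z) = reduce \<Lambda> (rel_integral A M k (\<omega>, \<theta>) z)" if z: "z \<in> carrier (rel_chains A M k)" for z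
    proof -
      have "v (rel_boundary \<rho> k z) - rel_integral A M k (\<omega>, \<theta>) z \<in> \<Lambda>" using vd[OF z] L(4)[OF uL[OF z]] by simp
      then have "reduce \<Lambda> (v (rel_boundary \<rho> k z)) = reduce \<Lambda> (rel_integral A M k (\<omega>, \<theta>) z)"
        by (rule iffD2[OF reduce_eq_iff[OF \<Lambda>(1)]])
      then show ?thesis using boundary_cycle[OF \<Lambda> A M \<rho> k z] by (simp add: f_def)
    qed
    show "f (chain_map (nat (k - 1)) \<rho> \<tau>, 0) = \<one>\<^bsub>RmodL \<Lambda>\<^esub>" if t: "\<tau> \<in> smooth_cycles A (k - 1)" for \<tau>
    proof -
      have tc: "\<tau> \<in> carrier (smooth_chains A (k - 1))" "chain_boundary (nat (k - 1)) \<tau> = 0"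
        using t by (simp_all add: smooth_cycles_iff)
      \<comment> \<open>f is trivial on cycles from A because the cochain equation over A expresses
        h there by a period of \<open>\<theta>\<close> and a value of b, both in
        \<open>\<Lambda>\<close>.\<close>
      have "v (chain_map (nat (k - 1)) \<rho> \<tau>, 0) = chain_integral A (k - 1) \<tau> \<theta> - b \<tau>"
        using A2[OF tc(1)] rho[OF tc(1)] by (simp add: v_def mem1 tc(2) z0)
      moreover have "chain_integral A (k - 1) \<tau> \<theta> - b \<tau> \<in> \<Lambda>"
        using th t bL[OF tc(1)] by (intro L(5)) (simp_all add: period_forms_iff)
      ultimately have "reduce \<Lambda> (v (chain_map (nat (k - 1)) \<rho> \<tau>, 0)) = \<one>\<^bsub>RmodL \<Lambda>\<^esub>"
        using reduce_eq_one[OF \<Lambda>(1)] by simp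
      then show ?thesis using image_cycle(1)[OF \<Lambda> A M \<rho> k t] by (simp add: f_def)
    qed
  qed
  moreover have "J_choice \<Lambda> A M \<rho> k f u v (\<omega>, \<theta>)"
    unfolding J_choice_iff
  proof (intro conjI ballI u v vd ud)
    show "f z = reduce \<Lambda> (v z)" if "z \<in> carrier (rel_cycles A M \<rho> (k - 1))" for z using that by (simp add: f_def)
    have "rel_integral A M k (\<omega>, \<theta>) z \<in> \<Lambda>" if "z \<in> carrier (rel_cycles A M \<rho> k)" for z
      using vd[of z] uL[of z] that v0 by (simp add: rel_cycles_iff)
    then show "(\<omega>, \<theta>) \<in> rel_period_forms \<Lambda> A M \<rho> k" using wf by (simp add: rel_period_forms_def)
  qed
  moreover have "x = hs_element A M k u v (\<omega>, \<theta>)"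
    unfolding xe hs_element_def prod.case prod.inject
  proof (intro conjI refl; rule extensionalityI[OF _ restrict_extensional])
    show "c \<in> extensional (carrier (smooth_chains M k))" "h \<in> extensional (carrier (smooth_chains M (k - 1)))"
      "b \<in> extensional (carrier (smooth_chains A (k - 1)))" "e \<in> extensional (carrier (smooth_chains A (k - 2)))"
      using c h b e by (simp_all add: hom_coeff_iff hom_real_iff)
  qed (simp_all add: u_def v_def rel_chains_carrier mem1 z0)
  ultimately show ?thesis by blast
qed

text \<open>This is what makes J single-valued. The cocycle is the differential of ((c, h,
  \<open>\<nu>\<close>), (b, e, 0)), where \<open>\<nu>\<close> accounts for
  \<open>\<theta>\<close>, c and b come from the \<open>\<Lambda>\<close>-valued part of what then
  remains of v, and h and e from the part that vanishes on cycles.\<close>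

lemma J_choice_one:
  assumes hyp: "k = 1 \<Longrightarrow> pull_form A M \<rho> ` carrier (period_forms \<Lambda> M 0) = carrier (period_forms \<Lambda> A 0)"
    and J: "J_choice \<Lambda> A M \<rho> k \<one>\<^bsub>rel_characters0 \<Lambda> A M \<rho> k\<^esub> u v (\<omega>, \<theta>)"
  shows "hs_element A M k u v (\<omega>, \<theta>) \<in> rel_hs_coboundaries \<Lambda> A M \<rho> k"
proof -
  note D = J_choiceD[OF \<Lambda> A M \<rho> k J] and L = real_subring[OF \<Lambda>(1)]
  interpret H: comm_group "rel_characters0 \<Lambda> A M \<rho> k" by (rule characters0_comm_group[OF \<Lambda> A M \<rho> k])
  note per = J_choice_closed[OF \<Lambda> A M \<rho> k H.one_closed J]
  have kk: "k - 1 - 1 = k - 2" by simp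
  let ?C = "carrier (rel_chains A M (k - 1))" and ?Z = "carrier (rel_cycles A M \<rho> (k - 1))"
  have vL: "v z \<in> \<Lambda>" if "z \<in> ?Z" for z
  proof -
    have "reduce \<Lambda> (v z) = \<one>\<^bsub>RmodL \<Lambda>\<^esub>" using D(4)[OF that] that by (simp add: characters0_simps[OF \<Lambda> A M \<rho> k])
    then show ?thesis by (rule iffD1[OF reduce_eq_one[OF \<Lambda>(1)]])
  qed
  \<comment> \<open>Because the character is trivial, v is \<open>\<Lambda>\<close>-valued on
    boundaries, and u is \<open>\<Lambda>\<close>-valued everywhere. So the forms have
    \<open>\<Lambda>\<close>-valued integrals over all chains, not only over cycles, and vanish in
    positive degree.\<close>
  have wL: "rel_integral A M k (\<omega>, \<theta>) z \<in> \<Lambda>" if z: "z \<in> carrier (rel_chains A M k)" for z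
    using L(3)[OF vL[OF boundary_cycle[OF \<Lambda> A M \<rho> k z]] D(3)[OF z]] D(8)[OF z] by simp
  have \<omega>0: "\<omega> = zero_form"
  proof (rule form_zero_if_integrals[OF M \<Lambda> _ D(5)])
    show "0 < k" using k by simp
    show "chain_integral M k \<sigma> \<omega> \<in> \<Lambda>" if "\<sigma> \<in> carrier (smooth_chains M k)" for \<sigma>
      using wL[of "(\<sigma>, 0)"] that by (simp add: rel_chains_carrier rel_integral_Pair)
  qed
  \<comment> \<open>For k > 1 the form \<open>\<theta>\<close> has positive degree and vanishes, so
    \<open>\<nu>\<close> can be 0. For k = 1 it is a function, and \<open>hyp\<close> provides
    \<open>\<nu>\<close>.\<close>
  obtain \<nu> where \<nu>: "\<nu> \<in> carrier (period_forms \<Lambda> M (k - 1))" "pull_form A M \<rho> \<nu> = \<theta>"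
    "\<And>\<sigma>. \<sigma> \<in> carrier (smooth_chains M (k - 1)) \<Longrightarrow> chain_integral M (k - 1) \<sigma> \<nu> \<in> \<Lambda>"
  proof (cases "k = 1")
    case True
    have "\<theta> \<in> pull_form A M \<rho> ` carrier (period_forms \<Lambda> M 0)" using per(2) hyp[OF True] True by simp
    then obtain \<nu> where n: "\<nu> \<in> carrier (period_forms \<Lambda> M 0)" "\<theta> = pull_form A M \<rho> \<nu>" by (elim imageE)
    \<comment> \<open>Every 0-chain is a cycle, so for a function the period condition already
      covers all chains.\<close>
    have "chain_integral M 0 \<sigma> \<nu> \<in> \<Lambda>" if "\<sigma> \<in> carrier (smooth_chains M 0)" for \<sigma>
      using n(1) that by (simp add: period_forms_iff smooth_cycles_iff chain_boundary_def)
    then show thesis using that[of \<nu>] n True by simp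
  next
    case False
    have "\<theta> = zero_form"
    proof (rule form_zero_if_integrals[OF A \<Lambda> _ D(6)])
      show "0 < k - 1" using k False by simp
      show "chain_integral A (k - 1) \<tau> \<theta> \<in> \<Lambda>" if "\<tau> \<in> carrier (smooth_chains A (k - 1))" for \<tau>
        using wL[of "(0, \<tau>)"] that by (simp add: rel_chains_carrier rel_integral_Pair)
    qed
    then show thesis
      using that[of zero_form] zero_form_period[OF \<Lambda> M] pull_form_zero[OF A M \<rho>] L(1) by simp
  qed
  \<comment> \<open>Subtracting the integral of \<open>\<nu>\<close> removes \<open>\<theta>\<close>
    from the coboundary of v: g takes the value \<open>- u z\<close> on the boundary of z.\<close>
  define g where "g z = v z - chain_integral M (k - 1) (fst z) \<nu>" for z
  have ga: "g (x + y) = g x + g y" if "x \<in> ?C" "y \<in> ?C" for x y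
    using D(1)[OF that] by (simp add: g_def chain_integral_add)
  have ZC: "z \<in> ?C" if "z \<in> ?Z" for z using that by (simp add: rel_cycles_iff)
  have fstC: "fst z \<in> carrier (smooth_chains M (k - 1))" if "z \<in> ?C" for z
    using that by (cases z) (simp add: rel_chains_carrier)
  have gL: "g z \<in> \<Lambda>" if "z \<in> ?Z" for z
    unfolding g_def by (intro L(5) vL \<nu>(3) fstC ZC that)
  obtain r where r: "\<And>x y. x \<in> ?C \<Longrightarrow> y \<in> ?C \<Longrightarrow> r (x + y) = r x + r y" "\<And>x. x \<in> ?C \<Longrightarrow> r x \<in> ?Z"
    "\<And>x. x \<in> ?Z \<Longrightarrow> r x = x"
    using rel_retraction[of A M "k - 1" \<rho>] by blast
  \<comment> \<open>Values of r are cycles, where g lies in \<open>\<Lambda>\<close>; so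
    \<open>c0\<close> is \<open>\<Lambda>\<close>-valued on all chains. It agrees with g on cycles,
    which makes g minus \<open>c0\<close> a coboundary.\<close>
  define c0 where "c0 z = g (r z)" for z
  have c0a: "c0 (x + y) = c0 x + c0 y" if "x \<in> ?C" "y \<in> ?C" for x y
    using ga[OF ZC[OF r(2)[OF that(1)]] ZC[OF r(2)[OF that(2)]]] r(1)[OF that] by (simp add: c0_def)
  have c0L: "c0 z \<in> \<Lambda>" if "z \<in> ?C" for z using gL[OF r(2)[OF that]] by (simp add: c0_def)
  have c0Z: "c0 z = g z" if "z \<in> ?Z" for z using r(3)[OF that] by (simp add: c0_def)
  let ?B = "carrier (rel_chains A M (k - 1 - 1))"
  obtain F where "(\<forall>x\<in>?B. \<forall>y\<in>?B. F (x + y) = F x + F y) \<and> (\<forall>z\<in>?C. F (rel_boundary \<rho> (k - 1) z) = g z - c0 z)"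
  proof (rule exE[OF rel_cochain_through_boundary[OF A M \<rho>, of "k - 1" "\<lambda>z. g z - c0 z"]])
    show "g (x + y) - c0 (x + y) = g x - c0 x + (g y - c0 y)" if "x \<in> ?C" "y \<in> ?C" for x y
      using ga[OF that] c0a[OF that] by simp
    show "g x - c0 x = 0" if "x \<in> ?Z" for x using c0Z[OF that] by simp
  qed
  then have F: "\<And>x y. x \<in> ?B \<Longrightarrow> y \<in> ?B \<Longrightarrow> F (x + y) = F x + F y"
    "\<And>z. z \<in> ?C \<Longrightarrow> F (rel_boundary \<rho> (k - 1) z) = g z - c0 z"
    by (simp_all only: Ball_def)
  have memB: "(\<sigma>, \<tau>) \<in> ?B \<longleftrightarrow> \<sigma> \<in> carrier (smooth_chains M (k - 2)) \<and> \<tau> \<in> carrier (smooth_chains A (k - 2 - 1))" for \<sigma> \<tau>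
    by (simp add: rel_chains_carrier)
  have memC: "(\<sigma>, \<tau>) \<in> ?C \<longleftrightarrow> \<sigma> \<in> carrier (smooth_chains M (k - 1)) \<and> \<tau> \<in> carrier (smooth_chains A (k - 2))" for \<sigma> \<tau>
    by (simp add: rel_chains_carrier)
  have Fs: "F (\<sigma>, - \<tau>) = F (\<sigma>, 0) - F (0, \<tau>)"
    if "\<sigma> \<in> carrier (smooth_chains M (k - 2))" "\<tau> \<in> carrier (smooth_chains A (k - 2 - 1))" for \<sigma> \<tau>
    by (rule pair_additive_split(2)[where P = "carrier (smooth_chains M (k - 2))" and Q = "carrier (smooth_chains A (k - 2 - 1))"])
      (use that F(1) in \<open>simp_all add: rel_chains_carrier\<close>)
  have cs: "c0 (\<sigma>, - \<tau>) = c0 (\<sigma>, 0) - c0 (0, \<tau>)"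
    if "\<sigma> \<in> carrier (smooth_chains M (k - 1))" "\<tau> \<in> carrier (smooth_chains A (k - 2))" for \<sigma> \<tau>
    by (rule pair_additive_split(2)[where P = "carrier (smooth_chains M (k - 1))" and Q = "carrier (smooth_chains A (k - 2))"])
      (use that c0a in \<open>simp_all add: rel_chains_carrier\<close>)
  \<comment> \<open>The signs are dictated by the differential: it subtracts c and the coboundary of
    h, while v is the integral of \<open>\<nu>\<close> plus \<open>c0\<close> plus F of the
    boundary. The component e keeps the sign of F because \<open>hs_element\<close> already negates
    the part of v over A.\<close>
  define c where "c = (\<lambda>\<sigma>\<in>carrier (smooth_chains M (k - 1)). - c0 (\<sigma>, 0))"
  define h where "h = (\<lambda>\<sigma>\<in>carrier (smooth_chains M (k - 2)). - F (\<sigma>, 0))"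
  define b where "b = (\<lambda>\<tau>\<in>carrier (smooth_chains A (k - 2)). - c0 (0, \<tau>))"
  define e where "e = (\<lambda>\<tau>\<in>carrier (smooth_chains A (k - 2 - 1)). F (0, \<tau>))"
  have cc: "c z = - c0 (z, 0)" if "z \<in> carrier (smooth_chains M (k - 1))" for z using that by (simp add: c_def)
  have hh: "h z = - F (z, 0)" if "z \<in> carrier (smooth_chains M (k - 2))" for z using that by (simp add: h_def)
  have bb: "b z = - c0 (0, z)" if "z \<in> carrier (smooth_chains A (k - 2))" for z using that by (simp add: b_def)
  have ee: "e z = F (0, z)" if "z \<in> carrier (smooth_chains A (k - 2 - 1))" for z using that unfolding e_def by simp
  have c01: "c0 (x + y, 0) = c0 (x, 0) + c0 (y, 0)" "c0 (x, 0) \<in> \<Lambda>"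
    if "x \<in> carrier (smooth_chains M (k - 1))" "y \<in> carrier (smooth_chains M (k - 1))" for x y
    using c0a[of "(x, 0)" "(y, 0)"] c0L[of "(x, 0)"] that by (simp_all add: memC)
  have c02: "c0 (0, x + y) = c0 (0, x) + c0 (0, y)" "c0 (0, x) \<in> \<Lambda>"
    if "x \<in> carrier (smooth_chains A (k - 2))" "y \<in> carrier (smooth_chains A (k - 2))" for x y
    using c0a[of "(0, x)" "(0, y)"] c0L[of "(0, x)"] that by (simp_all add: memC)
  have F1: "F (x + y, 0) = F (x, 0) + F (y, 0)"
    if "x \<in> carrier (smooth_chains M (k - 2))" "y \<in> carrier (smooth_chains M (k - 2))" for x y
    using F(1)[of "(x, 0)" "(y, 0)"] that unfolding memB by simp
  have F2: "F (0, x + y) = F (0, x) + F (0, y)"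
    if "x \<in> carrier (smooth_chains A (k - 2 - 1))" "y \<in> carrier (smooth_chains A (k - 2 - 1))" for x y
    using F(1)[of "(0, x)" "(0, y)"] that unfolding memB by simp
  have S: "(c, h, \<nu>) \<in> carrier (hs_group \<Lambda> M (k - 1))"
    unfolding hs_group_iff[OF \<Lambda>] kk hom_coeff_iff hom_real_iff
    using \<nu>(1) L(4) c01 F1 by (simp add: c_def h_def smooth_chains_add)
  have T: "(b, e, zero_form) \<in> carrier (hs_group \<Lambda> A (k - 2))"
    unfolding hs_group_iff[OF \<Lambda>] hom_coeff_iff hom_real_iff
    using zero_form_period[OF \<Lambda> A] L(4) c02 F2 by (simp add: b_def e_def smooth_chains_add)
  note bM = smooth_chains_boundary[of _ M k] and rho = smooth_chains_chain_map[OF A M \<rho>]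
  have bM': "chain_boundary (nat (k - 1)) z \<in> carrier (smooth_chains M (k - 2))" if "z \<in> carrier (smooth_chains M (k - 1))" for z
    using smooth_chains_boundary[OF that] by (simp only: kk)
  have bA: "chain_boundary (nat (k - 1)) z \<in> carrier (smooth_chains A (k - 2))" if "z \<in> carrier (smooth_chains A (k - 1))" for z
    using smooth_chains_boundary[OF that] by (simp only: kk)
  have bA': "chain_boundary (nat (k - 2)) z \<in> carrier (smooth_chains A (k - 2 - 1))" if "z \<in> carrier (smooth_chains A (k - 2))" for z
    by (rule smooth_chains_boundary[OF that])
  have c0d: "c0 (rel_boundary \<rho> k z) = - u z" if z: "z \<in> carrier (rel_chains A M k)" for z
    using c0Z[OF boundary_cycle[OF \<Lambda> A M \<rho> k z]] boundary_period_zero[OF \<Lambda> A M \<rho> k \<nu>(1) z] D(8)[OF z]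
    by (cases z) (simp add: g_def \<omega>0 \<nu>(2) rel_integral_Pair)
  have "hs_element A M k u v (\<omega>, \<theta>) = rel_hs_diff \<Lambda> A M \<rho> (k - 1) ((c, h, \<nu>), (b, e, zero_form))"
    unfolding coboundary_eq[OF \<Lambda> A M \<rho> k T] hs_element_def prod.case prod.inject
  proof (intro conjI restrict_ext \<omega>0 \<nu>(2)[symmetric])
    show "u (z, 0) = c (chain_boundary (nat k) z)" if z: "z \<in> carrier (smooth_chains M k)" for z
      using c0d[of "(z, 0)"] cc[OF bM[OF z]] z by (simp add: rel_boundary_Pair rel_chains_carrier)
    show "v (z, 0) = chain_integral M (k - 1) z \<nu> - c z - h (chain_boundary (nat (k - 1)) z)"
      if z: "z \<in> carrier (smooth_chains M (k - 1))" for z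
      using F(2)[of "(z, 0)"] cc[OF z] hh[OF bM'[OF z]] z by (simp add: memC g_def rel_boundary_Pair)
    show "u (0, z) = c (chain_map (nat (k - 1)) \<rho> z) - b (chain_boundary (nat (k - 1)) z)"
      if z: "z \<in> carrier (smooth_chains A (k - 1))" for z
      using c0d[of "(0, z)"] cs[OF rho[OF z] bA[OF z]] cc[OF rho[OF z]] bb[OF bA[OF z]] z
      by (simp add: rel_boundary_Pair rel_chains_carrier)
    show "- v (0, z) = h (chain_map (nat (k - 2)) \<rho> z) -
        (chain_integral A (k - 2) z zero_form - b z - e (chain_boundary (nat (k - 2)) z))"
      if z: "z \<in> carrier (smooth_chains A (k - 2))" for z
      using F(2)[of "(0, z)"] Fs[OF rho[OF z] bA'[OF z]] hh[OF rho[OF z]] bb[OF z] ee[OF bA'[OF z]] z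
      by (simp add: memC g_def rel_boundary_Pair)
  qed
  moreover have "((c, h, \<nu>), (b, e, zero_form)) \<in> carrier (rel_hs_group \<Lambda> A M (k - 1))"
    unfolding rel_hs_group_iff[OF \<Lambda>] kk by (intro conjI S T)
  ultimately show ?thesis unfolding rel_hs_coboundaries_def by (rule image_eqI)
qed

text \<open>The hypotheses of \<open>quotient_map_from_relation\<close> are the preceding lemmas:
  existence of choices is totality, products of choices are choices, lifts of the trivial character
  bound, and every cocycle arises. The kernel then consists of the characters that admit a choice
  with coboundary value, and these are the images of \<open>phi0\<close>.\<close>

lemma J_map_epi:
  assumes hyp: "k = 1 \<Longrightarrow> pull_form A M \<rho> ` carrier (period_forms \<Lambda> M 0) = carrier (period_forms \<Lambda> A 0)"
  shows "J_map \<Lambda> A M \<rho> k \<in> epi (rel_characters0 \<Lambda> A M \<rho> k) (rel_hopkins_singer \<Lambda> A M \<rho> k)"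
    and "kernel (rel_characters0 \<Lambda> A M \<rho> k) (rel_hopkins_singer \<Lambda> A M \<rho> k) (J_map \<Lambda> A M \<rho> k) =
      phi0 \<Lambda> A M \<rho> k ` carrier (period_forms \<Lambda> M (k - 1))"
proof -
  \<comment> \<open>R relates f to every cocycle arising from some choice for f; the graph of J
    modulo coboundaries.\<close>
  define R where "R f z \<longleftrightarrow> f \<in> carrier (rel_characters0 \<Lambda> A M \<rho> k) \<and>
    (\<exists>u v \<omega> \<theta>. J_choice \<Lambda> A M \<rho> k f u v (\<omega>, \<theta>) \<and> z = hs_element A M k u v (\<omega>, \<theta>))" for f z
  have RI: "R f (hs_element A M k u v w)" if "f \<in> carrier (rel_characters0 \<Lambda> A M \<rho> k)" "J_choice \<Lambda> A M \<rho> k f u v w" for f u v w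
  proof -
    obtain \<omega> \<theta> where w: "w = (\<omega>, \<theta>)" by (cases w)
    show ?thesis unfolding R_def w by (rule conjI[OF that(1)]) (use that(2) w in blast)
  qed
  interpret H: comm_group "rel_characters0 \<Lambda> A M \<rho> k" by (rule characters0_comm_group[OF \<Lambda> A M \<rho> k])
  note q = quotient_map_from_relation[where R = R and J = "J_map \<Lambda> A M \<rho> k",
      OF H.comm_group_axioms cocycles_comm_group[OF \<Lambda> A M \<rho> k] coboundaries_subgroup[OF \<Lambda> A M \<rho> k]]
  have R: "f \<in> carrier (rel_characters0 \<Lambda> A M \<rho> k) \<and> z \<in> carrier (rel_hs_cocycles \<Lambda> A M \<rho> k)" if fz: "R f z" for f z
  proof -
    obtain u v \<omega> \<theta> where f: "f \<in> carrier (rel_characters0 \<Lambda> A M \<rho> k)"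
      and J: "J_choice \<Lambda> A M \<rho> k f u v (\<omega>, \<theta>)" and z: "z = hs_element A M k u v (\<omega>, \<theta>)"
      using fz unfolding R_def by (elim exE conjE)
    show ?thesis unfolding z by (rule conjI[OF f J_choice_cocycle[OF \<Lambda> A M \<rho> k f J]])
  qed
  have mult: "R (f \<otimes>\<^bsub>rel_characters0 \<Lambda> A M \<rho> k\<^esub> g) (z \<otimes>\<^bsub>rel_hs_cocycles \<Lambda> A M \<rho> k\<^esub> y)" if fz: "R f z" and gy: "R g y" for f z g y
  proof -
    obtain u v \<omega> \<theta> where f: "f \<in> carrier (rel_characters0 \<Lambda> A M \<rho> k)"
      and J: "J_choice \<Lambda> A M \<rho> k f u v (\<omega>, \<theta>)" and z: "z = hs_element A M k u v (\<omega>, \<theta>)"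
      using fz unfolding R_def by (elim exE conjE)
    obtain u' v' \<omega>' \<theta>' where g: "g \<in> carrier (rel_characters0 \<Lambda> A M \<rho> k)"
      and J': "J_choice \<Lambda> A M \<rho> k g u' v' (\<omega>', \<theta>')" and y: "y = hs_element A M k u' v' (\<omega>', \<theta>')"
      using gy unfolding R_def by (elim exE conjE)
    note m = J_choice_mult[OF \<Lambda> A M \<rho> k J J']
    show ?thesis unfolding z y m(2)[symmetric] by (rule RI[OF H.m_closed[OF f g] m(1)])
  qed
  have total: "\<exists>z. R f z" if f: "f \<in> carrier (rel_characters0 \<Lambda> A M \<rho> k)" for f
  proof -
    obtain u v \<omega> \<theta> where J: "J_choice \<Lambda> A M \<rho> k f u v (\<omega>, \<theta>)"
      using J_choice_exists[OF \<Lambda> A M \<rho> k f] by (elim exE)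
    show ?thesis by (rule exI, rule RI[OF f J])
  qed
  have one: "z \<in> rel_hs_coboundaries \<Lambda> A M \<rho> k" if z1: "R \<one>\<^bsub>rel_characters0 \<Lambda> A M \<rho> k\<^esub> z" for z
  proof -
    obtain u v \<omega> \<theta> where J: "J_choice \<Lambda> A M \<rho> k \<one>\<^bsub>rel_characters0 \<Lambda> A M \<rho> k\<^esub> u v (\<omega>, \<theta>)"
      and z: "z = hs_element A M k u v (\<omega>, \<theta>)"
      using z1 unfolding R_def by (elim exE conjE)
    show ?thesis unfolding z by (rule J_choice_one[OF hyp J])
  qed
  have surj: "\<exists>f. R f z" if z: "z \<in> carrier (rel_hs_cocycles \<Lambda> A M \<rho> k)" for z
  proof -
    obtain f u v w where f: "f \<in> carrier (rel_characters0 \<Lambda> A M \<rho> k)" and J: "J_choice \<Lambda> A M \<rho> k f u v w"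
      and ze: "z = hs_element A M k u v w"
      using J_choice_surj[OF z] by (elim bexE exE conjE)
    show ?thesis unfolding ze by (rule exI, rule RI[OF f J])
  qed
  have eq: "J_map \<Lambda> A M \<rho> k f =
      the_elem {rel_hs_coboundaries \<Lambda> A M \<rho> k #>\<^bsub>rel_hs_cocycles \<Lambda> A M \<rho> k\<^esub> z | z. R f z}"
    if f: "f \<in> carrier (rel_characters0 \<Lambda> A M \<rho> k)" for f
  proof -
    have "{rel_hs_coboundaries \<Lambda> A M \<rho> k #>\<^bsub>rel_hs_cocycles \<Lambda> A M \<rho> k\<^esub> hs_element A M k u v w | u v w. J_choice \<Lambda> A M \<rho> k f u v w}
      = {rel_hs_coboundaries \<Lambda> A M \<rho> k #>\<^bsub>rel_hs_cocycles \<Lambda> A M \<rho> k\<^esub> z | z. R f z}" (is "?X = ?Y")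
    proof (intro equalityI subsetI)
      fix x assume "x \<in> ?X"
      then obtain u v w where J: "J_choice \<Lambda> A M \<rho> k f u v w"
        and x: "x = rel_hs_coboundaries \<Lambda> A M \<rho> k #>\<^bsub>rel_hs_cocycles \<Lambda> A M \<rho> k\<^esub> hs_element A M k u v w"
        unfolding mem_Collect_eq by (elim exE conjE)
      show "x \<in> ?Y" unfolding mem_Collect_eq by (intro exI conjI, rule x, rule RI[OF f J])
    next
      fix x assume "x \<in> ?Y"
      then obtain u v \<omega> \<theta> where "J_choice \<Lambda> A M \<rho> k f u v (\<omega>, \<theta>)"
        and "x = rel_hs_coboundaries \<Lambda> A M \<rho> k #>\<^bsub>rel_hs_cocycles \<Lambda> A M \<rho> k\<^esub> hs_element A M k u v (\<omega>, \<theta>)"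
        unfolding mem_Collect_eq R_def by (elim exE conjE) (simp only:)
      then show "x \<in> ?X" unfolding mem_Collect_eq by (intro exI conjI)
    qed
    then show ?thesis unfolding J_map_def by (rule arg_cong)
  qed
  note Q = q[OF R mult total one surj eq]
  show "J_map \<Lambda> A M \<rho> k \<in> epi (rel_characters0 \<Lambda> A M \<rho> k) (rel_hopkins_singer \<Lambda> A M \<rho> k)"
    unfolding rel_hopkins_singer_def by (rule Q(1))
  have "{f. \<exists>z\<in>rel_hs_coboundaries \<Lambda> A M \<rho> k. R f z} = phi0 \<Lambda> A M \<rho> k ` carrier (period_forms \<Lambda> M (k - 1))"
  proof (intro equalityI subsetI)
    fix f assume "f \<in> {f. \<exists>z\<in>rel_hs_coboundaries \<Lambda> A M \<rho> k. R f z}"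
    then obtain z u v \<omega> \<theta> where zB: "z \<in> rel_hs_coboundaries \<Lambda> A M \<rho> k" and f: "f \<in> carrier (rel_characters0 \<Lambda> A M \<rho> k)"
      and J: "J_choice \<Lambda> A M \<rho> k f u v (\<omega>, \<theta>)" and z: "z = hs_element A M k u v (\<omega>, \<theta>)"
      unfolding mem_Collect_eq R_def by (elim bexE exE conjE)
    obtain \<nu> where "\<nu> \<in> carrier (period_forms \<Lambda> M (k - 1))" "f = phi0 \<Lambda> A M \<rho> k \<nu>"
      using coboundary_choice[OF \<Lambda> A M \<rho> k J f zB[unfolded z]] by (elim bexE)
    then show "f \<in> phi0 \<Lambda> A M \<rho> k ` carrier (period_forms \<Lambda> M (k - 1))" by simp
  next
    fix f assume "f \<in> phi0 \<Lambda> A M \<rho> k ` carrier (period_forms \<Lambda> M (k - 1))"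
    then obtain \<nu> where n: "\<nu> \<in> carrier (period_forms \<Lambda> M (k - 1))" and f: "f = phi0 \<Lambda> A M \<rho> k \<nu>" by (elim imageE)
    obtain u v w where J: "J_choice \<Lambda> A M \<rho> k (phi0 \<Lambda> A M \<rho> k \<nu>) u v w" and B: "hs_element A M k u v w \<in> rel_hs_coboundaries \<Lambda> A M \<rho> k"
      using phi0_choice[OF \<Lambda> A M \<rho> k n] by (elim exE conjE)
    show "f \<in> {f. \<exists>z\<in>rel_hs_coboundaries \<Lambda> A M \<rho> k. R f z}"
      unfolding f mem_Collect_eq by (rule bexI, rule RI[OF phi0_carrier[OF \<Lambda> A M \<rho> k n] J], rule B)
  qed
  then show "kernel (rel_characters0 \<Lambda> A M \<rho> k) (rel_hopkins_singer \<Lambda> A M \<rho> k) (J_map \<Lambda> A M \<rho> k) =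
      phi0 \<Lambda> A M \<rho> k ` carrier (period_forms \<Lambda> M (k - 1))"
    unfolding rel_hopkins_singer_def using Q(2) by (simp only:)
qed

end

section \<open>Exactness of the sequence\<close>

theorem theorem4p2:
  fixes A :: "'a mfd" and M :: "'m mfd" and \<rho> :: "'a \<Rightarrow> 'm" and \<Lambda> :: "real set" and k :: int
  assumes "compact_manifold A" and "compact_manifold M" and "smooth_map A M \<rho>"
    and "subring \<Lambda> real_ring" and "\<Lambda> \<noteq> UNIV"
    and "1 \<le> k"
    and "k = 1 \<Longrightarrow> pull_form A M \<rho> ` carrier (period_forms \<Lambda> M 0) = carrier (period_forms \<Lambda> A 0)"
  shows "short_exact
           (period_forms \<Lambda> M (k - 1) Mod tilde_forms \<Lambda> A M \<rho> (k - 1)) (phi \<Lambda> A M \<rho> k)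
           (rel_characters0 \<Lambda> A M \<rho> k) (J_map \<Lambda> A M \<rho> k)
           (rel_hopkins_singer \<Lambda> A M \<rho> k)"
proof -
  have A: "smooth_manifold A" and M: "smooth_manifold M"
    using assms(1,2) by (simp_all add: compact_manifold_def)
  note \<Lambda> = assms(4,5) and \<rho> = assms(3) and k = assms(6)
  let ?P = "period_forms \<Lambda> M (k - 1)" and ?H = "rel_characters0 \<Lambda> A M \<rho> k" and ?p = "phi0 \<Lambda> A M \<rho> k"
  interpret P: comm_group ?P by (rule period_forms_comm_group[OF \<Lambda> M])
  interpret H: comm_group ?H by (rule characters0_comm_group[OF \<Lambda> A M \<rho> k])
  interpret Z: comm_group "rel_hs_cocycles \<Lambda> A M \<rho> k" by (rule cocycles_comm_group[OF \<Lambda> A M \<rho> k])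
  have "group_hom_axioms ?P ?H ?p" by (rule group_hom_axioms.intro[OF phi0_hom[OF \<Lambda> A M \<rho> k]])
  then interpret p: group_hom ?P ?H ?p by (rule group_hom.intro[OF P.is_group H.is_group])
  note ker = phi0_kernel[OF \<Lambda> A M \<rho> k]
  have phi: "phi \<Lambda> A M \<rho> k = (\<lambda>N. the_elem (?p ` N))" by (rule ext) (simp add: phi_def)
  \<comment> \<open>The first isomorphism theorem for \<open>phi0\<close>, whose kernel is
    \<open>tilde_forms\<close>; it gives exactness on the left.\<close>
  have "phi \<Lambda> A M \<rho> k \<in> mon (?P Mod tilde_forms \<Lambda> A M \<rho> (k - 1)) ?H"
    unfolding phi mon_def using p.FactGroup_hom p.FactGroup_inj_on by (simp only: ker mem_Collect_eq)
  moreover have "phi \<Lambda> A M \<rho> k ` carrier (?P Mod tilde_forms \<Lambda> A M \<rho> (k - 1)) = ?p ` carrier ?P"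
  proof -
    have c: "phi \<Lambda> A M \<rho> k (tilde_forms \<Lambda> A M \<rho> (k - 1) #>\<^bsub>?P\<^esub> \<nu>) = ?p \<nu>" if n: "\<nu> \<in> carrier ?P" for \<nu>
    proof -
      have sub: "subgroup (tilde_forms \<Lambda> A M \<rho> (k - 1)) ?P" using p.subgroup_kernel by (simp only: ker)
      have "?p \<eta> = ?p \<nu>" if e: "\<eta> \<in> tilde_forms \<Lambda> A M \<rho> (k - 1) #>\<^bsub>?P\<^esub> \<nu>" for \<eta>
      proof -
        obtain t where t: "t \<in> kernel ?P ?H ?p" "\<eta> = t \<otimes>\<^bsub>?P\<^esub> \<nu>"
          using e unfolding r_coset_def ker[symmetric] by blast
        then have "t \<in> carrier ?P" "?p t = \<one>\<^bsub>?H\<^esub>" unfolding kernel_def by blast+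
        then show ?thesis using p.hom_mult[OF _ n] p.hom_closed[OF n] unfolding t(2) by simp
      qed
      then have "?p ` (tilde_forms \<Lambda> A M \<rho> (k - 1) #>\<^bsub>?P\<^esub> \<nu>) = {?p \<nu>}"
        using P.rcos_self[OF n sub] by blast
      then show ?thesis by (simp add: phi)
    qed
    have "carrier (?P Mod tilde_forms \<Lambda> A M \<rho> (k - 1)) = (\<lambda>\<nu>. tilde_forms \<Lambda> A M \<rho> (k - 1) #>\<^bsub>?P\<^esub> \<nu>) ` carrier ?P"
      by (auto simp: FactGroup_def RCOSETS_def)
    then show ?thesis using c by (simp add: image_image cong: image_cong_simp)
  qed
  moreover have "comm_group (?P Mod tilde_forms \<Lambda> A M \<rho> (k - 1))"
    using P.abelian_FactGroup[OF p.subgroup_kernel] by (simp only: ker)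
  moreover have "comm_group (rel_hopkins_singer \<Lambda> A M \<rho> k)"
    unfolding rel_hopkins_singer_def by (rule Z.abelian_FactGroup[OF coboundaries_subgroup[OF \<Lambda> A M \<rho> k]])
  ultimately show ?thesis
    unfolding short_exact_def
    using J_map_epi[OF \<Lambda> A M \<rho> k assms(7)] H.comm_group_axioms by simp
qed

end
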